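(* If $n_-(T_{\min})\le n_+(T_{\min})$, then there exist a finite-dimensional Hilbert space $\widetilde{\mathcal H}_b$, a subspace $\mathcal H_b\subset\widetilde{\mathcal H}_b$ and a surjective linear mapping $$\Gamma_b=\begin{pmatrix}\Gamma_{0b}\\ \hat\Gamma_b\\ \Gamma_{1b}\end{pmatrix}:\operatorname{dom}\mathcal T_{\max}\to\widetilde{\mathcal H}_b\oplus\hat H\oplus\mathcal H_b$$ such that for all $y,z\in\operatorname{dom}\mathcal T_{\max}$ $$[y,z]_b=(\Gamma_{0b}y,\Gamma_{1b}z)_{\widetilde{\mathcal H}_b}-(\Gamma_{1b}y,\Gamma_{0b}z)_{\widetilde{\mathcal H}_b}+i(P_{\mathcal H_b^\perp}\Gamma_{0b}y,P_{\mathcal H_b^\perp}\Gamma_{0b}z)_{\widetilde{\mathcal H}_b}+i(\hat\Gamma_by,\hat\Gamma_bz)_{\hat H},$$ where $\mathcal H_b^\perp=\widetilde{\mathcal H}_b\ominus\mathcal H_b$. Moreover, for each such mapping $\Gamma_b$ one has $$\dim\mathcal H_b=\nu_{b-},\qquad\dim\widetilde{\mathcal H}_b=\nu_{b+}-\hat\nu,$$ and $n_+(T_{\min})=n_-(T_{\min})$ if and only if $\widetilde{\mathcal H}_b=\mathcal H_b$. Therefore, in the case $n_+(T_{\min})=n_-(T_{\min})$ the identity takes the form $[y,z]_b=(\Gamma_{0b}y,\Gamma_{1b}z)_{\mathcal H_b}-(\Gamma_{1b}y,\Gamma_{0b}z)_{\mathcal H_b}+i(\hat\Gamma_by,\hat\Gamma_bz)_{\hat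 H}$.
   Context: Setting. $[X]$ denotes the bounded linear operators on $X$. $H,\hat H$ are finite-dimensional complex Hilbert spaces, $\mathbb H=H\oplus\hat H\oplus H$. $\mathcal I=[a,b\rangle$ is an interval, $-\infty<a<b\le\infty$ (if finite, $b$ may or may not belong to $\mathcal I$). $B,\Delta:\mathcal I\to[\mathbb H]$ are Borel, norm-integrable over every $[a,\beta]\subset\mathcal I$, with $B(t)=B(t)^*$, $\Delta(t)\ge0$ a.e., and $J=\begin{pmatrix}0&0&-I_H\\ 0&iI_{\hat H}&0\\ I_H&0&0\end{pmatrix}$. $AC(\mathcal I;\mathbb H)$ is the set of functions absolutely continuous on each $[a,\beta]\subset\mathcal I$. The system $Jy'-By=\Delta f$ is assumed definite: for every $\lambda\in\mathbb C$, a solution $y$ of $Jy'-By=\lambda\Delta y$ with $\Delta y=0$ a.e. is identically zero. $\mathcal L^2_\Delta(\mathcal I)$ is the space of Borel $f:\mathcal I\to\mathbb H$ with $\|f\|^2_\Delta=\int_{\mathcal I}(\Delta f,f)\,dt<\infty$; $L^2_\Delta(\mathcal I)$ is the quotient Hilbert space by $\{\|f\|_\Delta=0\}$, $\pi$ the quotient map. $\mathcal T_{\max}=\{\{y,f\}\in\mathcal L^2_\Delta(\mathcal I)^2: y\in AC(\mathcal I;\mathbb H),\ Jy'-By=\Delta f\text{ a.e.}\}$, $T_{\max}=\{\{\pi y,\pi f\}:\{y,f\}\in\mathcal T_{\max}\}$; $[y,z]_b=\lim_{t\uparrow b}(Jy(t),z(t))$ for $y,z\in\operatorname{dom}\mathcal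 T_{\max}$ (the limit exists); $T_{\min}=\{\{\pi y,\pi f\}:\{y,f\}\in\mathcal T_{\max},\ y(a)=0,\ [y,z]_b=0\ \forall z\in\operatorname{dom}\mathcal T_{\max}\}$ is closed symmetric with $T_{\min}^*=T_{\max}$; $n_\pm(T_{\min})=\dim\ker(T_{\max}-\lambda)$, $\lambda\in\mathbb C_\pm$. $\hat\nu=\dim\hat H$. $\nu_{b+}$ and $\nu_{b-}$ are the (finite) inertia indices of the skew-Hermitian form $[\cdot,\cdot]_b$ on $\operatorname{dom}\mathcal T_{\max}$, i.e. the numbers of positive and negative squares of the Hermitian form $-i[y,z]_b$; with $\nu_+=\dim\ker(iJ-I)=\dim H$ and $\nu_-=\dim\ker(iJ+I)=\dim H+\dim\hat H$ one has the known formulas $n_+(T_{\min})=\nu_++\nu_{b+}$, $n_-(T_{\min})=\nu_-+\nu_{b-}$. *)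

theory Defs
  imports "HOL-Analysis.Analysis"
begin

section \<open>Complex inner product spaces\<close>

class scaleC =
  fixes scaleC :: "complex \<Rightarrow> 'a \<Rightarrow> 'a"  (infixr "*\<^sub>C" 75)

text \<open>The inner product is linear in its first argument. The law \<open>cinner_self\<close> together with
  polarization makes the inherited real inner product the real part of \<open>cinner\<close>.\<close>

class complex_inner = real_inner + scaleC +
  fixes cinner :: "'a \<Rightarrow> 'a \<Rightarrow> complex"
  assumes scaleC_of_real: "complex_of_real r *\<^sub>C x = r *\<^sub>R x"
    and scaleC_add_left: "(c + d) *\<^sub>C x = c *\<^sub>C x + d *\<^sub>C x"
    and scaleC_add_right: "c *\<^sub>C (x + y) = c *\<^sub>C x + c *\<^sub>C y"
    and scaleC_scaleC: "c *\<^sub>C d *\<^sub>C x = (c * d) *\<^sub>C x"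
    and cinner_add_left: "cinner (x + y) z = cinner x z + cinner y z"
    and cinner_scaleC_left: "cinner (c *\<^sub>C x) y = c * cinner x y"
    and cinner_commute: "cinner x y = cnj (cinner y x)"
    and cinner_self: "cinner x x = complex_of_real ((norm x)\<^sup>2)"

lemma vector_space_scaleC: "vector_space (scaleC :: complex \<Rightarrow> 'a::complex_inner \<Rightarrow> 'a)"
proof
  fix c d :: complex and x y :: 'a
  show "1 *\<^sub>C x = x"
    using scaleC_of_real[of 1 x] by simp
qed (simp_all add: scaleC_add_left scaleC_add_right scaleC_scaleC)

abbreviation csubspace :: "'a::complex_inner set \<Rightarrow> bool"
  where "csubspace \<equiv> module.subspace scaleC"

abbreviation cspan :: "'a::complex_inner set \<Rightarrow> 'a set"
  where "cspan \<equiv> module.span scaleC"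

abbreviation cdim :: "'a::complex_inner set \<Rightarrow> nat"
  where "cdim \<equiv> vector_space.dim scaleC"

definition fin_dim :: "'a::complex_inner set \<Rightarrow> bool"
  where "fin_dim M \<longleftrightarrow> (\<exists>S. finite S \<and> M \<subseteq> cspan S)"

text \<open>Finite-dimensional complex Hilbert spaces; the zero space is not excluded. Completeness is
  automatic.\<close>

class fd_complex_hilbert = complex_inner +
  assumes finite_spanning_set: "\<exists>S. finite S \<and> (\<forall>x. \<exists>c. x = (\<Sum>v\<in>S. c v *\<^sub>C v))"

definition orth_compl_in :: "'a::complex_inner set \<Rightarrow> 'a set \<Rightarrow> 'a set"
  where "orth_compl_in W M = {x \<in> W. \<forall>m\<in>M. cinner x m = 0}"

definition orth_proj :: "'a::complex_inner set \<Rightarrow> 'a \<Rightarrow> 'a"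
  where "orth_proj M x = (THE p. p \<in> M \<and> (\<forall>m\<in>M. cinner (x - p) m = 0))"

instantiation prod :: (complex_inner, complex_inner) complex_inner
begin

definition scaleC_prod :: "complex \<Rightarrow> 'a \<times> 'b \<Rightarrow> 'a \<times> 'b"
  where "scaleC_prod c x = (c *\<^sub>C fst x, c *\<^sub>C snd x)"

definition cinner_prod :: "'a \<times> 'b \<Rightarrow> 'a \<times> 'b \<Rightarrow> complex"
  where "cinner_prod x y = cinner (fst x) (fst y) + cinner (snd x) (snd y)"

instance
proof
  fix x y :: "'a \<times> 'b"
  show "cinner x y = cnj (cinner y x)"
    unfolding cinner_prod_def complex_cnj_add
    by (simp add: cinner_commute[of "fst x"] cinner_commute[of "snd x"])
  show "cinner x x = complex_of_real ((norm x)\<^sup>2)"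
    unfolding cinner_prod_def norm_prod_def by (simp add: cinner_self)
qed (simp_all add: scaleC_prod_def cinner_prod_def prod_eq_iff scaleC_of_real scaleC_add_left
      scaleC_add_right scaleC_scaleC cinner_add_left cinner_scaleC_left algebra_simps)

end

instantiation complex :: fd_complex_hilbert
begin

definition scaleC_complex :: "complex \<Rightarrow> complex \<Rightarrow> complex"
  where "scaleC_complex c x = c * x"

definition cinner_complex :: "complex \<Rightarrow> complex \<Rightarrow> complex"
  where "cinner_complex x y = x * cnj y"

instance
proof
  fix x :: complex
  show "cinner x x = complex_of_real ((norm x)\<^sup>2)"
    unfolding cinner_complex_def by (metis complex_norm_square)
  have "\<forall>x. \<exists>c. x = (\<Sum>v\<in>{1::complex}. c v *\<^sub>C v)"
  proof
    fix x :: complex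
    show "\<exists>c. x = (\<Sum>v\<in>{1::complex}. c v *\<^sub>C v)"
      by (rule exI[of _ "\<lambda>_. x"]) (simp add: scaleC_complex_def)
  qed
  then show "\<exists>S. finite S \<and> (\<forall>x::complex. \<exists>c. x = (\<Sum>v\<in>S. c v *\<^sub>C v))"
    by (intro exI[of _ "{1}"]) simp
qed (simp_all add: scaleC_complex_def cinner_complex_def scaleR_conv_of_real algebra_simps)

end


subsection \<open>Finitely supported complex sequences\<close>

text \<open>Every finite-dimensional complex Hilbert space is isometric to a subspace of this inner
  product space, so an existential quantifier over finite-dimensional Hilbert spaces can be
  expressed as one over its finite-dimensional subspaces.\<close>

typedef fin_seq = "{x :: nat \<Rightarrow> complex. finite {n. x n \<noteq> 0}}"
  morphisms seq_nth Abs_fin_seq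
  by (intro exI[of _ "\<lambda>_. 0"]) simp

setup_lifting type_definition_fin_seq

lemma finite_support [simp]: "finite {n. seq_nth x n \<noteq> 0}"
  using seq_nth[of x] by simp

instantiation fin_seq :: complex_inner
begin

lift_definition zero_fin_seq :: fin_seq is "\<lambda>_. 0" by simp

lift_definition plus_fin_seq :: "fin_seq \<Rightarrow> fin_seq \<Rightarrow> fin_seq" is "\<lambda>x y n. x n + y n"
proof -
  fix x y :: "nat \<Rightarrow> complex"
  assume "finite {n. x n \<noteq> 0}" "finite {n. y n \<noteq> 0}"
  then have "finite ({n. x n \<noteq> 0} \<union> {n. y n \<noteq> 0})" by simp
  then show "finite {n. x n + y n \<noteq> 0}" by (rule rev_finite_subset) auto
qed

lift_definition uminus_fin_seq :: "fin_seq \<Rightarrow> fin_seq" is "\<lambda>x n. - x n" by simp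

lift_definition scaleC_fin_seq :: "complex \<Rightarrow> fin_seq \<Rightarrow> fin_seq" is "\<lambda>c x n. c * x n"
  by (rule rev_finite_subset) auto

definition minus_fin_seq :: "fin_seq \<Rightarrow> fin_seq \<Rightarrow> fin_seq"
  where "minus_fin_seq x y = x + - y"

definition scaleR_fin_seq :: "real \<Rightarrow> fin_seq \<Rightarrow> fin_seq"
  where "scaleR_fin_seq r x = complex_of_real r *\<^sub>C x"

definition cinner_fin_seq :: "fin_seq \<Rightarrow> fin_seq \<Rightarrow> complex"
  where "cinner_fin_seq x y = (\<Sum>n | seq_nth x n \<noteq> 0. seq_nth x n * cnj (seq_nth y n))"

definition inner_fin_seq :: "fin_seq \<Rightarrow> fin_seq \<Rightarrow> real"
  where "inner_fin_seq x y = Re (cinner x y)"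

definition norm_fin_seq :: "fin_seq \<Rightarrow> real"
  where "norm_fin_seq x = sqrt (inner x x)"

definition sgn_fin_seq :: "fin_seq \<Rightarrow> fin_seq"
  where "sgn_fin_seq x = inverse (norm x) *\<^sub>R x"

definition dist_fin_seq :: "fin_seq \<Rightarrow> fin_seq \<Rightarrow> real"
  where "dist_fin_seq x y = norm (x - y)"

definition uniformity_fin_seq :: "(fin_seq \<times> fin_seq) filter"
  where "uniformity_fin_seq = (INF e\<in>{0 <..}. principal {(x, y). dist x y < e})"

definition open_fin_seq :: "fin_seq set \<Rightarrow> bool"
  where "open_fin_seq U = (\<forall>x\<in>U. \<forall>\<^sub>F (x', y) in uniformity. x' = x \<longrightarrow> y \<in> U)"

lemma cinner_fin_seq_on:
  assumes "finite A" "{n. seq_nth x n \<noteq> 0} \<subseteq> A"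
  shows "cinner x y = (\<Sum>n\<in>A. seq_nth x n * cnj (seq_nth y n))"
  unfolding cinner_fin_seq_def using assms by (intro sum.mono_neutral_left) auto

instance
proof
  fix x y z :: fin_seq and c d :: complex and r s :: real
  define A where "A = {n. seq_nth x n \<noteq> 0} \<union> {n. seq_nth y n \<noteq> 0} \<union> {n. seq_nth z n \<noteq> 0}"
  have fin: "finite A" by (simp add: A_def)
  show "x + y + z = x + (y + z)" by transfer (simp add: algebra_simps)
  show "x + y = y + x" by transfer (simp add: algebra_simps)
  show "0 + x = x" by transfer simp
  show "- x + x = 0" by transfer simp
  show "x - y = x + - y" by (simp add: minus_fin_seq_def)
  show scl: "c *\<^sub>C (x + y) = c *\<^sub>C x + c *\<^sub>C y" for c and x y :: fin_seq
    by transfer (simp add: algebra_simps)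
  show scr: "(c + d) *\<^sub>C x = c *\<^sub>C x + d *\<^sub>C x" for c d and x :: fin_seq
    by transfer (simp add: algebra_simps)
  show scc: "c *\<^sub>C d *\<^sub>C x = (c * d) *\<^sub>C x" for c d and x :: fin_seq
    by transfer (simp add: algebra_simps)
  have sc1: "1 *\<^sub>C x = x" for x :: fin_seq
    by transfer simp
  show "r *\<^sub>R (x + y) = r *\<^sub>R x + r *\<^sub>R y" by (simp add: scaleR_fin_seq_def scl)
  show "(r + s) *\<^sub>R x = r *\<^sub>R x + s *\<^sub>R x" by (simp add: scaleR_fin_seq_def scr)
  show "r *\<^sub>R s *\<^sub>R x = (r * s) *\<^sub>R x" by (simp add: scaleR_fin_seq_def scc)
  show "1 *\<^sub>R x = x" by (simp add: scaleR_fin_seq_def sc1)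
  show "complex_of_real r *\<^sub>C x = r *\<^sub>R x" by (simp add: scaleR_fin_seq_def)
  have plus_nth: "seq_nth (x + y) n = seq_nth x n + seq_nth y n" for x y n
    by transfer simp
  have scale_nth: "seq_nth (c *\<^sub>C x) n = c * seq_nth x n" for c x n
    by transfer simp
  have on_x: "cinner x w = (\<Sum>n\<in>A. seq_nth x n * cnj (seq_nth w n))" for w
    by (rule cinner_fin_seq_on[OF fin]) (auto simp: A_def)
  have on_y: "cinner y w = (\<Sum>n\<in>A. seq_nth y n * cnj (seq_nth w n))" for w
    by (rule cinner_fin_seq_on[OF fin]) (auto simp: A_def)
  have "cinner (x + y) z = (\<Sum>n\<in>A. seq_nth (x + y) n * cnj (seq_nth z n))"
    by (rule cinner_fin_seq_on[OF fin]) (auto simp: A_def plus_nth)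
  then show add: "cinner (x + y) z = cinner x z + cinner y z"
    by (simp add: on_x on_y plus_nth algebra_simps sum.distrib)
  have "cinner (c *\<^sub>C x) y = (\<Sum>n\<in>A. seq_nth (c *\<^sub>C x) n * cnj (seq_nth y n))" for c
    by (rule cinner_fin_seq_on[OF fin]) (auto simp: A_def scale_nth)
  then show scale: "cinner (c *\<^sub>C x) y = c * cinner x y" for c
    by (simp add: on_x scale_nth algebra_simps sum_distrib_left)
  show comm: "cinner x y = cnj (cinner y x)"
    by (simp add: on_x on_y mult.commute)
  have self: "cinner x x = complex_of_real (\<Sum>n | seq_nth x n \<noteq> 0. (norm (seq_nth x n))\<^sup>2)"
    unfolding cinner_fin_seq_def of_real_sum by (intro sum.cong refl) (metis complex_norm_square)
  then have inner_self: "inner x x = (\<Sum>n | seq_nth x n \<noteq> 0. (norm (seq_nth x n))\<^sup>2)"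
    by (simp add: inner_fin_seq_def)
  show nonneg: "0 \<le> inner x x"
    unfolding inner_self by (intro sum_nonneg) simp
  show "cinner x x = complex_of_real ((norm x)\<^sup>2)"
    using nonneg unfolding norm_fin_seq_def by (simp add: self inner_self)
  show "inner x x = 0 \<longleftrightarrow> x = 0"
  proof
    assume "inner x x = 0"
    then have "seq_nth x n = 0" for n
      unfolding inner_self by (subst (asm) sum_nonneg_eq_0_iff) auto
    then show "x = 0" by transfer auto
  next
    assume "x = 0"
    then have "seq_nth x n = 0" for n by (simp add: zero_fin_seq.rep_eq)
    then show "inner x x = 0" by (simp add: inner_self)
  qed
  show "inner x y = inner y x" using comm by (simp add: inner_fin_seq_def)
  show "inner (x + y) z = inner x z + inner y z" using add by (simp add: inner_fin_seq_def)
  show "inner (r *\<^sub>R x) y = r * inner x y"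
    by (simp add: inner_fin_seq_def scaleR_fin_seq_def scale)
  show "norm x = sqrt (inner x x)" by (rule norm_fin_seq_def)
  show "sgn x = inverse (norm x) *\<^sub>R x" by (rule sgn_fin_seq_def)
  show "dist x y = norm (x - y)" by (rule dist_fin_seq_def)
  show "uniformity = (INF e\<in>{0 <..}. principal {(x :: fin_seq, y). dist x y < e})"
    by (rule uniformity_fin_seq_def)
  show "open U = (\<forall>x\<in>U. \<forall>\<^sub>F (x', y) in uniformity. x' = x \<longrightarrow> y \<in> U)" for U :: "fin_seq set"
    by (rule open_fin_seq_def)
qed

end


section \<open>Canonical systems\<close>

text \<open>A function \<open>\<I> \<rightarrow> X\<close> on an interval \<open>\<I>\<close> is represented by its extension by zero to the real line.\<close>

definition interval_from :: "real \<Rightarrow> ereal \<Rightarrow> real set \<Rightarrow> bool"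
  where "interval_from a b I \<longleftrightarrow> ereal a < b \<and>
    (I = {t. a \<le> t \<and> ereal t < b} \<or> I = {t. a \<le> t \<and> ereal t \<le> b})"

type_synonym ('h, 'k) spH = "'h \<times> 'k \<times> 'h"

type_synonym ('h, 'k) opH = "('h, 'k) spH \<Rightarrow>\<^sub>L ('h, 'k) spH"

definition J :: "('h::complex_inner, 'k::complex_inner) spH \<Rightarrow> ('h, 'k) spH"
  where "J x = (- snd (snd x), \<i> *\<^sub>C fst (snd x), fst x)"

definition clinear_op :: "('x::complex_inner \<Rightarrow>\<^sub>L 'x) \<Rightarrow> bool"
  where "clinear_op T \<longleftrightarrow> (\<forall>c x. blinfun_apply T (c *\<^sub>C x) = c *\<^sub>C blinfun_apply T x)"

definition self_adjoint_op :: "('x::complex_inner \<Rightarrow>\<^sub>L 'x) \<Rightarrow> bool"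
  where "self_adjoint_op T \<longleftrightarrow> (\<forall>x y. cinner (blinfun_apply T x) y = cinner x (blinfun_apply T y))"

definition nonneg_op :: "('x::complex_inner \<Rightarrow>\<^sub>L 'x) \<Rightarrow> bool"
  where "nonneg_op T \<longleftrightarrow>
    (\<forall>x. cinner (blinfun_apply T x) x \<in> \<real> \<and> 0 \<le> Re (cinner (blinfun_apply T x) x))"

definition loc_integrable_coeff :: "real \<Rightarrow> real set \<Rightarrow> (real \<Rightarrow> ('x::complex_inner \<Rightarrow>\<^sub>L 'x)) \<Rightarrow> bool"
  where "loc_integrable_coeff a I A \<longleftrightarrow> (\<forall>t\<in>I. clinear_op (A t)) \<and> set_borel_measurable borel I A \<and>
    (\<forall>\<beta>\<in>I. set_integrable lborel {a..\<beta>} (\<lambda>t. norm (A t)))"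

definition abs_cont_on :: "real \<Rightarrow> real \<Rightarrow> (real \<Rightarrow> 'x::real_normed_vector) \<Rightarrow> bool"
  where "abs_cont_on a \<beta> y \<longleftrightarrow> (\<forall>\<epsilon>>0. \<exists>\<delta>>0. \<forall>(n::nat) c d.
    (\<forall>i<n. a \<le> c i \<and> c i \<le> d i \<and> d i \<le> \<beta>) \<and>
    (\<forall>i<n. \<forall>j<n. i \<noteq> j \<longrightarrow> {c i<..<d i} \<inter> {c j<..<d j} = {}) \<and>
    (\<Sum>i<n. d i - c i) < \<delta> \<longrightarrow> (\<Sum>i<n. norm (y (d i) - y (c i))) < \<epsilon>)"

definition AC :: "real \<Rightarrow> real set \<Rightarrow> (real \<Rightarrow> 'x::real_normed_vector) set"
  where "AC a I = {y. (\<forall>t. t \<notin> I \<longrightarrow> y t = 0) \<and> (\<forall>\<beta>\<in>I. abs_cont_on a \<beta> y)}"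

text \<open>The equation \<open>J y' - B y = g\<close> a.e. on \<open>\<I>\<close>.\<close>

definition solves ::
  "real set \<Rightarrow> (real \<Rightarrow> ('h::complex_inner, 'k::complex_inner) opH) \<Rightarrow>
   (real \<Rightarrow> ('h, 'k) spH) \<Rightarrow> (real \<Rightarrow> ('h, 'k) spH) \<Rightarrow> bool"
  where "solves I B y g \<longleftrightarrow> (AE t in lborel. t \<in> I \<longrightarrow>
    (\<exists>y'. (y has_vector_derivative y') (at t within I) \<and> J y' - blinfun_apply (B t) (y t) = g t))"

definition definite_system ::
  "real \<Rightarrow> ereal \<Rightarrow> real set \<Rightarrow> (real \<Rightarrow> ('h::complex_inner, 'k::complex_inner) opH) \<Rightarrow>
   (real \<Rightarrow> ('h, 'k) opH) \<Rightarrow> bool"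
  where "definite_system a b I B \<Delta> \<longleftrightarrow>
    interval_from a b I \<and>
    loc_integrable_coeff a I B \<and> loc_integrable_coeff a I \<Delta> \<and>
    (AE t in lborel. t \<in> I \<longrightarrow> self_adjoint_op (B t)) \<and>
    (AE t in lborel. t \<in> I \<longrightarrow> nonneg_op (\<Delta> t)) \<and>
    (\<forall>\<mu> y. y \<in> AC a I \<and> solves I B y (\<lambda>t. \<mu> *\<^sub>C blinfun_apply (\<Delta> t) (y t)) \<and>
       (AE t in lborel. t \<in> I \<longrightarrow> blinfun_apply (\<Delta> t) (y t) = 0) \<longrightarrow> (\<forall>t\<in>I. y t = 0))"

definition L2fun :: "real set \<Rightarrow> (real \<Rightarrow> ('x::complex_inner \<Rightarrow>\<^sub>L 'x)) \<Rightarrow> (real \<Rightarrow> 'x) set"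
  where "L2fun I \<Delta> = {f. (\<forall>t. t \<notin> I \<longrightarrow> f t = 0) \<and> f \<in> borel_measurable borel \<and>
    set_integrable lborel I (\<lambda>t. Re (cinner (blinfun_apply (\<Delta> t) (f t)) (f t)))}"

definition normL2 :: "real set \<Rightarrow> (real \<Rightarrow> ('x::complex_inner \<Rightarrow>\<^sub>L 'x)) \<Rightarrow> (real \<Rightarrow> 'x) \<Rightarrow> real"
  where "normL2 I \<Delta> f =
    sqrt (set_lebesgue_integral lborel I (\<lambda>t. Re (cinner (blinfun_apply (\<Delta> t) (f t)) (f t))))"

text \<open>The quotient map onto \<open>L\<^sup>2\<^sub>\<Delta>\<close>, whose elements are cosets.\<close>

definition quot :: "real set \<Rightarrow> (real \<Rightarrow> ('x::complex_inner \<Rightarrow>\<^sub>L 'x)) \<Rightarrow> (real \<Rightarrow> 'x) \<Rightarrow> (real \<Rightarrow> 'x) set"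
  where "quot I \<Delta> f = {g \<in> L2fun I \<Delta>. normL2 I \<Delta> (\<lambda>t. f t - g t) = 0}"

definition lincomb :: "nat \<Rightarrow> (nat \<Rightarrow> complex) \<Rightarrow> (nat \<Rightarrow> real \<Rightarrow> 'x::complex_inner) \<Rightarrow> real \<Rightarrow> 'x"
  where "lincomb n c f t = (\<Sum>i<n. c i *\<^sub>C f i t)"

text \<open>Dimension of a linear subspace \<open>U\<close> of \<open>L\<^sup>2\<^sub>\<Delta>\<close>: the largest length of a family in \<open>U\<close> that is
  linearly independent in the quotient.\<close>

definition dimL2 :: "real set \<Rightarrow> (real \<Rightarrow> ('x::complex_inner \<Rightarrow>\<^sub>L 'x)) \<Rightarrow> (real \<Rightarrow> 'x) set set \<Rightarrow> enat"
  where "dimL2 I \<Delta> U = Sup {enat n | n. \<exists>f.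
    (\<forall>i<n. f i \<in> L2fun I \<Delta> \<and> quot I \<Delta> (f i) \<in> U) \<and>
    (\<forall>c. quot I \<Delta> (lincomb n c f) = quot I \<Delta> (\<lambda>_. 0) \<longrightarrow> (\<forall>i<n. c i = 0))}"

definition Tmax_fun ::
  "real \<Rightarrow> real set \<Rightarrow> (real \<Rightarrow> ('h::complex_inner, 'k::complex_inner) opH) \<Rightarrow>
   (real \<Rightarrow> ('h, 'k) opH) \<Rightarrow>
   ((real \<Rightarrow> ('h, 'k) spH) \<times> (real \<Rightarrow> ('h, 'k) spH)) set"
  where "Tmax_fun a I B \<Delta> = {(y, f). y \<in> L2fun I \<Delta> \<and> f \<in> L2fun I \<Delta> \<and> y \<in> AC a I \<and>
    solves I B y (\<lambda>t. blinfun_apply (\<Delta> t) (f t))}"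

definition Tmax ::
  "real \<Rightarrow> real set \<Rightarrow> (real \<Rightarrow> ('h::complex_inner, 'k::complex_inner) opH) \<Rightarrow>
   (real \<Rightarrow> ('h, 'k) opH) \<Rightarrow>
   ((real \<Rightarrow> ('h, 'k) spH) set \<times> (real \<Rightarrow> ('h, 'k) spH) set) set"
  where "Tmax a I B \<Delta> = {(quot I \<Delta> y, quot I \<Delta> f) | y f. (y, f) \<in> Tmax_fun a I B \<Delta>}"

abbreviation dom_Tmax ::
  "real \<Rightarrow> real set \<Rightarrow> (real \<Rightarrow> ('h::complex_inner, 'k::complex_inner) opH) \<Rightarrow>
   (real \<Rightarrow> ('h, 'k) opH) \<Rightarrow> (real \<Rightarrow> ('h, 'k) spH) set"
  where "dom_Tmax a I B \<Delta> \<equiv> Domain (Tmax_fun a I B \<Delta>)"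

text \<open>\<open>dim ker (T\<^sub>m\<^sub>a\<^sub>x - \<mu>)\<close>. As \<open>T\<^sub>m\<^sub>a\<^sub>x\<close> is the adjoint of \<open>T\<^sub>m\<^sub>i\<^sub>n\<close>, this is the deficiency index
  \<open>n\<^sub>+\<close> of \<open>T\<^sub>m\<^sub>i\<^sub>n\<close> for \<open>\<mu>\<close> in the open upper and \<open>n\<^sub>-\<close> for \<open>\<mu>\<close> in the open lower half-plane.\<close>

definition deficiency ::
  "real \<Rightarrow> real set \<Rightarrow> (real \<Rightarrow> ('h::complex_inner, 'k::complex_inner) opH) \<Rightarrow>
   (real \<Rightarrow> ('h, 'k) opH) \<Rightarrow> complex \<Rightarrow> enat"
  where "deficiency a I B \<Delta> \<mu> = dimL2 I \<Delta>
    {quot I \<Delta> f | f. f \<in> L2fun I \<Delta> \<and> (quot I \<Delta> f, quot I \<Delta> (\<lambda>t. \<mu> *\<^sub>C f t)) \<in> Tmax a I B \<Delta>}"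

definition form_b ::
  "ereal \<Rightarrow> (real \<Rightarrow> ('h::complex_inner, 'k::complex_inner) spH) \<Rightarrow> (real \<Rightarrow> ('h, 'k) spH) \<Rightarrow> complex"
  where "form_b b y z =
    Lim (if b = \<infinity> then at_top else at_left (real_of_ereal b)) (\<lambda>t. cinner (J (y t)) (z t))"

text \<open>Number of positive squares of a Hermitian form \<open>h\<close> on a linear space \<open>D\<close> of functions: the
  largest dimension of a subspace of \<open>D\<close> on which \<open>h\<close> is positive definite.\<close>

definition pos_squares ::
  "(real \<Rightarrow> 'x::complex_inner) set \<Rightarrow> ((real \<Rightarrow> 'x) \<Rightarrow> (real \<Rightarrow> 'x) \<Rightarrow> complex) \<Rightarrow> enat"
  where "pos_squares D h = Sup {enat n | n. \<exists>f. (\<forall>i<n. f i \<in> D) \<and>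
    (\<forall>c. (\<exists>i<n. c i \<noteq> 0) \<longrightarrow> 0 < Re (h (lincomb n c f) (lincomb n c f)))}"

definition nu_b_plus ::
  "real \<Rightarrow> ereal \<Rightarrow> real set \<Rightarrow> (real \<Rightarrow> ('h::complex_inner, 'k::complex_inner) opH) \<Rightarrow>
   (real \<Rightarrow> ('h, 'k) opH) \<Rightarrow> enat"
  where "nu_b_plus a b I B \<Delta> = pos_squares (dom_Tmax a I B \<Delta>) (\<lambda>y z. - \<i> * form_b b y z)"

definition nu_b_minus ::
  "real \<Rightarrow> ereal \<Rightarrow> real set \<Rightarrow> (real \<Rightarrow> ('h::complex_inner, 'k::complex_inner) opH) \<Rightarrow>
   (real \<Rightarrow> ('h, 'k) opH) \<Rightarrow> enat"
  where "nu_b_minus a b I B \<Delta> = pos_squares (dom_Tmax a I B \<Delta>) (\<lambda>y z. \<i> * form_b b y z)"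

definition clinear_map_on :: "(real \<Rightarrow> 'x::complex_inner) set \<Rightarrow> ((real \<Rightarrow> 'x) \<Rightarrow> 'v::complex_inner) \<Rightarrow> bool"
  where "clinear_map_on D G \<longleftrightarrow>
    (\<forall>y\<in>D. \<forall>z\<in>D. \<forall>c d. G (\<lambda>t. c *\<^sub>C y t + d *\<^sub>C z t) = c *\<^sub>C G y + d *\<^sub>C G z)"

text \<open>\<open>W\<close> and \<open>V\<close> are the spaces \<open>\<H>\<^sub>b\<close> with and without tilde; \<open>G = (G0, Gh, G1)\<close> is \<open>\<Gamma>\<^sub>b\<close>.\<close>

definition boundary_map_b ::
  "real \<Rightarrow> ereal \<Rightarrow> real set \<Rightarrow> (real \<Rightarrow> ('h::complex_inner, 'k::complex_inner) opH) \<Rightarrow>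
   (real \<Rightarrow> ('h, 'k) opH) \<Rightarrow> 'w::complex_inner set \<Rightarrow> 'w set \<Rightarrow>
   ((real \<Rightarrow> ('h, 'k) spH) \<Rightarrow> 'w \<times> 'k \<times> 'w) \<Rightarrow> bool"
  where "boundary_map_b a b I B \<Delta> W V G \<longleftrightarrow>
    csubspace W \<and> fin_dim W \<and> csubspace V \<and> V \<subseteq> W \<and>
    clinear_map_on (dom_Tmax a I B \<Delta>) G \<and> G ` dom_Tmax a I B \<Delta> = W \<times> UNIV \<times> V \<and>
    (let G0 = \<lambda>y. fst (G y); Gh = \<lambda>y. fst (snd (G y)); G1 = \<lambda>y. snd (snd (G y));
         P = orth_proj (orth_compl_in W V)
     in \<forall>y\<in>dom_Tmax a I B \<Delta>. \<forall>z\<in>dom_Tmax a I B \<Delta>.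
       form_b b y z = cinner (G0 y) (G1 z) - cinner (G1 y) (G0 z)
         + \<i> * cinner (P (G0 y)) (P (G0 z)) + \<i> * cinner (Gh y) (Gh z))"

end

theory Submission
  imports Defs "HOL-Library.Function_Algebras"
begin

text \<open>Everything is controlled by the flux \<open>Im (J x, x)\<close>. By the Lagrange identity, along a solution of
  \<open>J y' - B y = \<mu> \<Delta> y\<close> the flux grows at the rate \<open>2 Im \<mu> (\<Delta> y, y)\<close>; and for \<open>y\<close> in the domain of
  the maximal relation its limit at \<open>b\<close> is the imaginary part of \<open>[y, y]\<^sub>b\<close>, that is, the Hermitian form
  \<open>-i [y, y]\<^sub>b\<close> whose squares are counted by \<open>\<nu>\<^sub>b\<^sub>+\<close> and \<open>\<nu>\<^sub>b\<^sub>-\<close>. Write \<open>H \<oplus> K \<oplus> H\<close> for the space of values. The theorem combines three facts.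

  The formulas \<open>n\<^sub>+ = dim H + \<nu>\<^sub>b\<^sub>+\<close> and \<open>n\<^sub>- = dim H + dim K + \<nu>\<^sub>b\<^sub>-\<close>
  (\<open>deficiency_formulas\<close>). For the upper bound, take those square-integrable solutions for \<open>\<mu>\<close> whose
  initial value lies in a subspace on which the flux is nonnegative (for \<open>Im \<mu> > 0\<close>). The flux can
  only grow, and definiteness makes it grow strictly, so the form at \<open>b\<close> is positive definite on them
  (\<open>deficiency_upper\<close>). For the lower bound, adjoin all solutions for \<open>\<mu>\<close> to a family of functions
  on which the form at \<open>b\<close> is positive definite. For each point \<open>t\<close> there is a coefficient space of
  prescribed dimension on which the flux at \<open>t\<close> is nonpositive. A flux that is nonpositive at \<open>t\<close>,
  corrected by a term that tends to zero, was so before \<open>t\<close>; hence, as \<open>t\<close> tends to \<open>b\<close>, these spaces have a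
  limit by compactness, on which it is nonpositive throughout. The limit combinations therefore
  have finite norm, as in Weyl's limit circle construction, and their solution parts are linearly
  independent because no combination of the adjoined family alone can have nonpositive form at \<open>b\<close>
  (\<open>deficiency_lower\<close>).

  Sylvester's law of inertia. As the indices are finite, the form is a difference of sums of squares
  of linear functionals \<open>\<alpha>\<^sub>i\<close> (\<open>\<nu>\<^sub>b\<^sub>+\<close> of them) and \<open>\<beta>\<^sub>j\<close> (\<open>\<nu>\<^sub>b\<^sub>-\<close> of them)
  (\<open>normal_form\<close>). The hypothesis \<open>n\<^sub>- \<le> n\<^sub>+\<close> says \<open>\<nu>\<^sub>b\<^sub>- + dim K \<le> \<nu>\<^sub>b\<^sub>+\<close>, so that every \<open>\<beta>\<^sub>j\<close>
  can be paired with an \<open>\<alpha>\<^sub>j\<close> to a hyperbolic plane, which contributes a component to \<open>\<Gamma>\<^sub>0\<^sub>b\<close> and one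
  to \<open>\<Gamma>\<^sub>1\<^sub>b\<close>, while there remain \<open>dim K\<close> functionals \<open>\<alpha>\<^sub>i\<close> for the middle component; the others are
  the part of \<open>\<Gamma>\<^sub>0\<^sub>b\<close> orthogonal to \<open>\<H>\<^sub>b\<close> (\<open>boundary_map_exists\<close>).

  Invariance of the dimensions. For an arbitrary boundary map, the maximal definite subspaces of the
  model space can be written down, and surjectivity transports them to the domain
  (\<open>boundary_map_dimensions\<close>). The formulas for the deficiency indices then translate their equality
  into equality of the dimensions of the two spaces.\<close>

section \<open>Complex inner product spaces\<close>

interpretation cs: vector_space "scaleC :: complex \<Rightarrow> 'a::complex_inner \<Rightarrow> 'a"
  by (rule vector_space_scaleC)

lemma cinner_zero_left [simp]: "cinner 0 y = 0"
  using cinner_add_left[of 0 0 y] by simp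

lemma cinner_zero_right [simp]: "cinner x 0 = 0"
  using cinner_commute[of x 0] by simp

lemma cinner_add_right: "cinner x (y + z) = cinner x y + cinner x z"
  by (metis cinner_add_left cinner_commute complex_cnj_add)

lemma cinner_scaleC_right: "cinner x (c *\<^sub>C y) = cnj c * cinner x y"
  by (metis cinner_scaleC_left cinner_commute complex_cnj_mult)

lemma cinner_minus_left [simp]: "cinner (- x) y = - cinner x y"
  using cinner_add_left[of x "- x" y] by (simp add: add_eq_0_iff)

lemma cinner_minus_right [simp]: "cinner x (- y) = - cinner x y"
  using cinner_add_right[of x y "- y"] by (simp add: add_eq_0_iff)

lemma cinner_diff_left: "cinner (x - y) z = cinner x z - cinner y z"
  using cinner_add_left[of x "- y" z] by simp

lemma cinner_diff_right: "cinner x (y - z) = cinner x y - cinner x z"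
  using cinner_add_right[of x y "- z"] by simp

lemma cinner_sum_left: "cinner (\<Sum>i\<in>A. f i) y = (\<Sum>i\<in>A. cinner (f i) y)"
  by (induction A rule: infinite_finite_induct) (simp_all add: cinner_add_left)

lemma cinner_sum_right: "cinner x (\<Sum>i\<in>A. f i) = (\<Sum>i\<in>A. cinner x (f i))"
  by (induction A rule: infinite_finite_induct) (simp_all add: cinner_add_right)

lemma cinner_eq_zero_iff [simp]: "cinner x x = 0 \<longleftrightarrow> x = 0"
  by (simp add: cinner_self)

lemma Re_cinner: "Re (cinner x y) = inner x y"
proof -
  have "(norm (x + y))\<^sup>2 = Re (cinner (x + y) (x + y))"
    by (simp add: cinner_self del: of_real_power)
  also have "\<dots> = (norm x)\<^sup>2 + (norm y)\<^sup>2 + 2 * Re (cinner x y)"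
    using cinner_commute[of y x] unfolding cinner_add_left cinner_add_right
    by (simp add: cinner_self del: of_real_power)
  finally show ?thesis
    by (simp add: power2_norm_eq_inner inner_add_left inner_add_right inner_commute)
qed

lemma norm_scaleC [simp]: "norm (c *\<^sub>C (x :: 'a::complex_inner)) = norm c * norm x"
proof -
  have "complex_of_real ((norm (c *\<^sub>C x))\<^sup>2) = complex_of_real ((norm c * norm x)\<^sup>2)"
    using cinner_self[of "c *\<^sub>C x"] cinner_self[of x] complex_norm_square[of c]
    by (simp add: cinner_scaleC_left cinner_scaleC_right power_mult_distrib ac_simps)
  then have "(norm (c *\<^sub>C x))\<^sup>2 = (norm c * norm x)\<^sup>2"
    using of_real_eq_iff by blast
  then show ?thesis
    by (simp add: power2_eq_iff_nonneg)
qed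

lemma norm_eq_one_if: "cinner x x = 1 \<Longrightarrow> norm x = 1"
  by (metis cinner_self norm_ge_zero of_real_eq_1_iff power2_eq_1_iff abs_of_nonneg abs_minus_cancel abs_1)

lemma norm_cinner_le: "norm (cinner x y) \<le> norm x * norm y"
proof (cases "cinner x y = 0")
  case False
  define c where "c = cnj (sgn (cinner x y))"
  have nc: "norm c = 1"
    using False by (simp add: c_def norm_sgn)
  have "c * cinner x y = norm (cinner x y)"
    using False complex_norm_square[of "cinner x y"]
    by (simp add: c_def sgn_div_norm scaleR_conv_of_real field_simps power2_eq_square)
  then have "norm (cinner x y) = Re (cinner (c *\<^sub>C x) y)"
    by (simp add: cinner_scaleC_left)
  also have "\<dots> = inner (c *\<^sub>C x) y"
    by (rule Re_cinner)
  also have "\<dots> \<le> norm (c *\<^sub>C x) * norm y"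
    by (rule norm_cauchy_schwarz)
  finally show ?thesis
    by (simp add: nc)
qed simp

lemma cinner_scaleR_left: "cinner (r *\<^sub>R x) y = r *\<^sub>R cinner x y"
  using cinner_scaleC_left[of "complex_of_real r" x y] by (simp add: scaleC_of_real scaleR_conv_of_real)

lemma cinner_scaleR_right: "cinner x (r *\<^sub>R y) = r *\<^sub>R cinner x y"
  using cinner_scaleC_right[of x "complex_of_real r" y] by (simp add: scaleC_of_real scaleR_conv_of_real)

lemma bounded_bilinear_cinner: "bounded_bilinear (cinner :: 'a::complex_inner \<Rightarrow> 'a \<Rightarrow> complex)"
proof
  show "\<exists>K. \<forall>x y :: 'a. norm (cinner x y) \<le> norm x * norm y * K"
    by (intro exI[of _ 1]) (simp add: norm_cinner_le)
qed (simp_all add: cinner_add_left cinner_add_right cinner_scaleR_left cinner_scaleR_right)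

lemma bounded_bilinear_scaleC: "bounded_bilinear (scaleC :: complex \<Rightarrow> 'a::complex_inner \<Rightarrow> 'a)"
proof
  show "\<exists>K. \<forall>c (x :: 'a). norm (c *\<^sub>C x) \<le> norm c * norm x * K"
    by (intro exI[of _ 1]) simp
  fix r :: real and c :: complex and x :: 'a
  show "(r *\<^sub>R c) *\<^sub>C x = r *\<^sub>R c *\<^sub>C x" "c *\<^sub>C r *\<^sub>R x = r *\<^sub>R c *\<^sub>C x"
    by (simp_all add: scaleC_of_real[where 'a='a, symmetric] scaleC_scaleC scaleR_conv_of_real mult.commute)
qed (simp_all add: scaleC_add_left scaleC_add_right)

interpretation cinner: bounded_bilinear "cinner :: 'a::complex_inner \<Rightarrow> 'a \<Rightarrow> complex"
  by (rule bounded_bilinear_cinner)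

interpretation scaleC: bounded_bilinear "scaleC :: complex \<Rightarrow> 'a::complex_inner \<Rightarrow> 'a"
  by (rule bounded_bilinear_scaleC)


section \<open>Systems of linear equations and orthonormal families\<close>

text \<open>Induction on the number of equations: if two solutions of the first equations have different
  supports, a suitable combination of them solves the next equation as well. Removing an index from
  the support of the first solution provides the second.\<close>

lemma underdetermined_system:
  fixes f :: "nat \<Rightarrow> 'i \<Rightarrow> complex"
  assumes "finite A" "r < card A"
  shows "\<exists>c. (\<exists>i\<in>A. c i \<noteq> 0) \<and> (\<forall>i. i \<notin> A \<longrightarrow> c i = 0) \<and> (\<forall>j<r. (\<Sum>i\<in>A. c i * f j i) = 0)"
  using assms
proof (induction r arbitrary: A)
  case 0
  then show ?case
    by (intro exI[of _ "\<lambda>i. if i \<in> A then 1 else 0"]) (auto simp: card_gt_0_iff)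
next
  case (Suc r)
  from Suc.IH[OF Suc.prems(1)] Suc.prems obtain c i0 where
    c: "i0 \<in> A" "c i0 \<noteq> 0" "\<forall>i. i \<notin> A \<longrightarrow> c i = 0" "\<forall>j<r. (\<Sum>i\<in>A. c i * f j i) = 0" by auto
  have "finite (A - {i0})" "r < card (A - {i0})"
    using Suc.prems c(1) by (auto simp: card_Diff_singleton)
  from Suc.IH[OF this] obtain c' i1 where
    c': "i1 \<in> A - {i0}" "c' i1 \<noteq> 0" "\<forall>i. i \<notin> A - {i0} \<longrightarrow> c' i = 0"
      "\<forall>j<r. (\<Sum>i\<in>A - {i0}. c' i * f j i) = 0" by auto
  have eq: "(\<Sum>i\<in>A. c' i * f j i) = (\<Sum>i\<in>A - {i0}. c' i * f j i)" for j
    using Suc.prems(1) c'(3) by (intro sum.mono_neutral_right) auto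
  define \<alpha> \<beta> where "\<alpha> = (\<Sum>i\<in>A. c i * f r i)" and "\<beta> = (\<Sum>i\<in>A. c' i * f r i)"
  show ?case
  proof (cases "\<beta> = 0")
    case True
    then show ?thesis
      using c' eq by (intro exI[of _ c']) (auto simp: \<beta>_def less_Suc_eq)
  next
    case False
    let ?d = "\<lambda>i. \<beta> * c i - \<alpha> * c' i"
    have *: "(\<Sum>i\<in>A. ?d i * f j i) = \<beta> * (\<Sum>i\<in>A. c i * f j i) - \<alpha> * (\<Sum>i\<in>A. c' i * f j i)" for j
      by (simp add: sum_distrib_left sum_subtractf algebra_simps)
    have "(\<Sum>i\<in>A. ?d i * f j i) = 0" if "j < Suc r" for j
    proof (cases "j = r")
      case True
      then show ?thesis unfolding * by (simp add: \<alpha>_def \<beta>_def)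
    next
      case False
      then show ?thesis unfolding * using that c(4) c'(4) eq by simp
    qed
    moreover have "?d i0 \<noteq> 0"
      using False c(2) c'(3) by simp
    ultimately show ?thesis
      using c(1,3) c'(3) by (intro exI[of _ ?d] conjI bexI[of _ i0]) auto
  qed
qed

definition orthonormal_on :: "('v \<Rightarrow> 'v \<Rightarrow> complex) \<Rightarrow> nat \<Rightarrow> (nat \<Rightarrow> 'v) \<Rightarrow> bool"
  where "orthonormal_on h m e \<longleftrightarrow> (\<forall>i<m. \<forall>j<m. h (e i) (e j) = (if i = j then 1 else 0))"

text \<open>A Hermitian form on a subspace of a vector space given by an explicit scalar multiplication. It
  is applied to vectors, to coefficient families and to functions.\<close>

locale hermitian_form = vector_space scale
  for scale :: "complex \<Rightarrow> 'v::ab_group_add \<Rightarrow> 'v" +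
  fixes D :: "'v set" and h :: "'v \<Rightarrow> 'v \<Rightarrow> complex"
  assumes subspace_D: "subspace D"
    and form_add_left: "\<lbrakk>x \<in> D; y \<in> D; z \<in> D\<rbrakk> \<Longrightarrow> h (x + y) z = h x z + h y z"
    and form_scale_left: "\<lbrakk>x \<in> D; y \<in> D\<rbrakk> \<Longrightarrow> h (scale c x) y = c * h x y"
    and form_commute: "\<lbrakk>x \<in> D; y \<in> D\<rbrakk> \<Longrightarrow> h x y = cnj (h y x)"
begin

lemma form_add_right: "\<lbrakk>x \<in> D; y \<in> D; z \<in> D\<rbrakk> \<Longrightarrow> h x (y + z) = h x y + h x z"
  by (metis form_add_left form_commute subspace_D subspace_add complex_cnj_add)

lemma form_scale_right: "\<lbrakk>x \<in> D; y \<in> D\<rbrakk> \<Longrightarrow> h x (scale c y) = cnj c * h x y"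
  by (metis form_scale_left form_commute subspace_D subspace_scale complex_cnj_mult)

lemma form_zero_left: "y \<in> D \<Longrightarrow> h 0 y = 0"
  using form_scale_left[of y y 0] by simp

lemma sum_mem: "(\<And>i. i \<in> A \<Longrightarrow> f i \<in> D) \<Longrightarrow> (\<Sum>i\<in>A. f i) \<in> D"
  using subspace_D by (rule subspace_sum)

lemma scale_mem: "x \<in> D \<Longrightarrow> scale c x \<in> D"
  using subspace_D by (rule subspace_scale)

lemma form_sum_left:
  assumes "\<And>i. i \<in> A \<Longrightarrow> f i \<in> D" "y \<in> D"
  shows "h (\<Sum>i\<in>A. f i) y = (\<Sum>i\<in>A. h (f i) y)"
  using assms
  by (induction A rule: infinite_finite_induct)
     (simp_all add: form_zero_left form_add_left sum_mem)

lemma form_sum_right: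
  assumes "\<And>i. i \<in> A \<Longrightarrow> f i \<in> D" "x \<in> D"
  shows "h x (\<Sum>i\<in>A. f i) = (\<Sum>i\<in>A. h x (f i))"
  using assms form_sum_left[of A f x] form_commute[of x] sum_mem[of A f]
  by (auto simp: cnj_sum intro!: sum.cong)

lemma form_self_real: "x \<in> D \<Longrightarrow> complex_of_real (Re (h x x)) = h x x"
  by (metis form_commute Reals_cnj_iff of_real_Re)

lemma negative_form: "hermitian_form scale D (\<lambda>x y. - h x y)"
proof
  show "- h x y = cnj (- h y x)" if "x \<in> D" "y \<in> D" for x y
    using form_commute[OF that] by simp
qed (simp_all add: subspace_D form_add_left form_scale_left)

lemma form_restrict: "\<lbrakk>subspace D'; D' \<subseteq> D\<rbrakk> \<Longrightarrow> hermitian_form scale D' h"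
proof
  assume "subspace D'" and sub: "D' \<subseteq> D"
  show "h x y = cnj (h y x)" if "x \<in> D'" "y \<in> D'" for x y
    using form_commute[of x y] sub that by blast
qed (auto simp: form_add_left form_scale_left subset_iff)

text \<open>Maximality forces the form to be nonpositive on the orthogonal complement, since a vector with
  positive square could be normalized and adjoined. The carrier \<open>D\<close> may be infinite-dimensional;
  only the length of orthonormal families has to be bounded.\<close>

lemma ex_maximal_orthonormal:
  assumes bound: "\<And>m e. \<lbrakk>\<And>i. i < m \<Longrightarrow> e i \<in> D; orthonormal_on h m e\<rbrakk> \<Longrightarrow> m \<le> p"
  shows "\<exists>m e. (\<forall>i<m. e i \<in> D) \<and> orthonormal_on h m e \<and>
    (\<forall>y\<in>D. (\<forall>i<m. h y (e i) = 0) \<longrightarrow> Re (h y y) \<le> 0)"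
proof -
  define P where "P m \<longleftrightarrow> (\<exists>e. (\<forall>i<m. e i \<in> D) \<and> orthonormal_on h m e)" for m
  have P0: "P 0" by (auto simp: P_def orthonormal_on_def)
  have Pb: "P m \<Longrightarrow> m \<le> p" for m unfolding P_def using bound by blast
  define m where "m = Greatest P"
  have Pm: "P m" unfolding m_def using GreatestI_nat[of P, OF P0] Pb by blast
  have max: "P k \<Longrightarrow> k \<le> m" for k unfolding m_def using Greatest_le_nat[of P] Pb by blast
  obtain e where e: "\<forall>i<m. e i \<in> D" "orthonormal_on h m e" using Pm by (auto simp: P_def)
  show ?thesis
  proof (intro exI[of _ m] exI[of _ e] conjI ballI impI e)
    fix y assume y: "y \<in> D" "\<forall>i<m. h y (e i) = 0"
    show "Re (h y y) \<le> 0"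
    proof (rule ccontr)
      assume "\<not> ?thesis"
      then have pos: "0 < Re (h y y)" by simp
      define z where "z = scale (complex_of_real (1 / sqrt (Re (h y y)))) y"
      have zD: "z \<in> D" using y(1) by (simp add: z_def scale_mem)
      have "h z z = complex_of_real (1 / sqrt (Re (h y y)) * (1 / sqrt (Re (h y y))) * Re (h y y))"
        unfolding of_real_mult form_self_real[OF y(1)] z_def using y(1)
        by (simp add: form_scale_left form_scale_right scale_mem)
      also have "\<dots> = 1" using pos by simp
      finally have zz: "h z z = 1" .
      have ze: "h z (e i) = 0" "h (e i) z = 0" if "i < m" for i
        using y that e form_commute[of "e i" z] zD by (auto simp: z_def form_scale_left)
      have "orthonormal_on h (Suc m) (e(m := z))"
        using e(2) zz ze by (auto simp: orthonormal_on_def less_Suc_eq)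
      then have "P (Suc m)"
        unfolding P_def using e(1) zD by (intro exI[of _ "e(m := z)"]) (auto simp: less_Suc_eq)
      then show False using max by fastforce
    qed
  qed
qed

lemma form_orthonormal_sum:
  assumes "\<And>i. i < m \<Longrightarrow> e i \<in> D" "orthonormal_on h m e" "j < m"
  shows "h (\<Sum>i<m. scale (c i) (e i)) (e j) = c j"
proof -
  have "h (\<Sum>i<m. scale (c i) (e i)) (e j) = (\<Sum>i<m. c i * h (e i) (e j))"
    using assms by (subst form_sum_left) (auto simp: scale_mem form_scale_left)
  also have "\<dots> = (\<Sum>i<m. if i = j then c j else 0)"
    using assms by (intro sum.cong) (auto simp: orthonormal_on_def)
  finally show ?thesis using assms(3) by simp
qed

text \<open>Projection along an orthonormal family involves only the values of the form against its members,
  so it is available for a form that is indefinite or degenerate elsewhere.\<close>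

lemma form_orthonormal_decomp:
  assumes e: "\<And>i. i < m \<Longrightarrow> e i \<in> D" "orthonormal_on h m e" and y: "y \<in> D" and z: "z \<in> D"
  defines "P \<equiv> \<lambda>x. \<Sum>i<m. scale (h x (e i)) (e i)"
  shows "y - P y \<in> D" "\<And>i. i < m \<Longrightarrow> h (y - P y) (e i) = 0"
    and "h y z = (\<Sum>i<m. h y (e i) * cnj (h z (e i))) + h (y - P y) (z - P z)"
proof -
  have P: "P x = (\<Sum>i<m. scale (h x (e i)) (e i))" for x by (simp add: P_def)
  have PD: "P x \<in> D" for x unfolding P_def using e by (intro sum_mem scale_mem) auto
  have dD: "x - P x \<in> D" if "x \<in> D" for x using subspace_D PD that by (simp add: subspace_diff)
  show "y - P y \<in> D" using y by (rule dD)
  have orth: "h (x - P x) (e i) = 0" if "x \<in> D" "i < m" for x i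
    using form_add_left[of "x - P x" "P x" "e i"] that dD PD e form_orthonormal_sum[OF e, of i]
    by (simp add: P_def)
  show "\<And>i. i < m \<Longrightarrow> h (y - P y) (e i) = 0" using orth[OF y] .
  have o2: "h (x - P x) (P w) = 0" if "x \<in> D" for x w
  proof -
    have "h (x - P x) (P w) = (\<Sum>i<m. cnj (h w (e i)) * h (x - P x) (e i))"
      unfolding P[of w] using that e dD
      by (subst form_sum_right) (auto simp: scale_mem form_scale_right)
    then show ?thesis using orth[OF that] by simp
  qed
  have o3: "h (P w) (x - P x) = 0" if "x \<in> D" for x w
    using o2[OF that, of w] form_commute[OF PD dD[OF that]] by simp
  have "h y z = h (P y + (y - P y)) (P z + (z - P z))" by simp
  also have "\<dots> = h (P y) (P z) + h (y - P y) (z - P z)"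
  proof -
    have "h (u + v) (u' + v') = h u u' + h u v' + h v u' + h v v'"
      if "u \<in> D" "v \<in> D" "u' \<in> D" "v' \<in> D" for u v u' v'
      using that subspace_add[OF subspace_D] by (simp add: form_add_left form_add_right)
    from this[OF PD[of y] dD[OF y] PD[of z] dD[OF z]] show ?thesis
      unfolding o2[OF y] o3[OF z] by simp
  qed
  also have "h (P y) (P z) = (\<Sum>i<m. h y (e i) * cnj (h z (e i)))"
  proof -
    have "h (P y) (P z) = (\<Sum>i<m. h y (e i) * h (e i) (P z))"
      unfolding P[of y] using e PD by (subst form_sum_left) (auto simp: scale_mem form_scale_left)
    also have "h (e i) (P z) = cnj (h z (e i))" if "i < m" for i
      using form_commute[OF e(1)[OF that] PD, of z] form_orthonormal_sum[OF e that, of "\<lambda>i. h z (e i)"]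
      by (simp add: P_def)
    then have "(\<Sum>i<m. h y (e i) * h (e i) (P z)) = (\<Sum>i<m. h y (e i) * cnj (h z (e i)))" by simp
    finally show ?thesis .
  qed
  finally show "h y z = (\<Sum>i<m. h y (e i) * cnj (h z (e i))) + h (y - P y) (z - P z)" .
qed

lemma form_orthonormal_combination:
  assumes "\<And>i. i < m \<Longrightarrow> e i \<in> D" "orthonormal_on h m e"
  shows "h (\<Sum>i<m. scale (c i) (e i)) (\<Sum>i<m. scale (c i) (e i)) = complex_of_real (\<Sum>i<m. (norm (c i))\<^sup>2)"
proof -
  let ?s = "\<Sum>i<m. scale (c i) (e i)"
  have s: "?s \<in> D" using assms by (intro sum_mem scale_mem) auto
  have z: "h 0 0 = 0" using form_zero_left subspace_D subspace_0 by blast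
  have coeff: "h ?s (e i) = c i" if "i < m" for i
    using form_orthonormal_sum[OF assms that] .
  have self: "(\<Sum>i<m. scale (h ?s (e i)) (e i)) = ?s"
    by (rule sum.cong) (simp_all add: coeff)
  have "h ?s ?s = (\<Sum>i<m. h ?s (e i) * cnj (h ?s (e i)))"
    using form_orthonormal_decomp(3)[OF assms s s, unfolded self] z by simp
  also have "\<dots> = (\<Sum>i<m. complex_of_real ((norm (c i))\<^sup>2))"
    by (intro sum.cong refl) (simp add: coeff complex_norm_square del: of_real_power)
  finally show ?thesis by simp
qed

end

lemma hermitian_form_cinner: "csubspace V \<Longrightarrow> hermitian_form scaleC V cinner"
proof
  show "cinner x y = cnj (cinner y x)" for x y :: 'a
    by (rule cinner_commute)
qed (auto simp: cinner_add_left cinner_scaleC_left)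

abbreviation orthonormal :: "nat \<Rightarrow> (nat \<Rightarrow> 'a::complex_inner) \<Rightarrow> bool"
  where "orthonormal \<equiv> orthonormal_on cinner"

lemma orthonormal_sum_cinner:
  assumes "orthonormal m e" "j < m"
  shows "cinner (\<Sum>i<m. c i *\<^sub>C e i) (e j) = c j"
  using hermitian_form.form_orthonormal_sum[OF hermitian_form_cinner[OF cs.subspace_UNIV], of m e j c] assms
  by simp

lemma orthonormal_inj_independent:
  assumes "orthonormal m e"
  shows "inj_on e {..<m}" "cs.independent (e ` {..<m})"
proof -
  show inj: "inj_on e {..<m}"
  proof (rule inj_onI)
    fix i j assume "i \<in> {..<m}" "j \<in> {..<m}" "e i = e j"
    then show "i = j"
      using assms[unfolded orthonormal_on_def, rule_format, of i j]
        assms[unfolded orthonormal_on_def, rule_format, of j j] by (simp split: if_splits)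
  qed
  show "cs.independent (e ` {..<m})"
  proof (subst cs.independent_explicit_module, intro allI impI)
    fix t u v
    assume "finite t" "t \<subseteq> e ` {..<m}" "(\<Sum>v\<in>t. u v *\<^sub>C v) = 0" "v \<in> t"
    define c where "c i = (if e i \<in> t then u (e i) else 0)" for i
    have "(\<Sum>i<m. c i *\<^sub>C e i) = (\<Sum>v\<in>e ` {..<m}. (if v \<in> t then u v else 0) *\<^sub>C v)"
      by (simp add: sum.reindex[OF inj] c_def)
    also have "\<dots> = (\<Sum>v\<in>t. u v *\<^sub>C v)"
      using \<open>t \<subseteq> e ` {..<m}\<close> by (intro sum.mono_neutral_cong_right) auto
    finally have 0: "(\<Sum>i<m. c i *\<^sub>C e i) = 0" using \<open>(\<Sum>v\<in>t. u v *\<^sub>C v) = 0\<close> by simp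
    obtain i where i: "i < m" "v = e i" using \<open>v \<in> t\<close> \<open>t \<subseteq> e ` {..<m}\<close> by auto
    have "c i = 0" using orthonormal_sum_cinner[OF assms i(1), of c] 0 by simp
    then show "u v = 0" using i \<open>v \<in> t\<close> by (simp add: c_def)
  qed
qed

lemma combination_in_span: "(\<And>i. i \<in> A \<Longrightarrow> e i \<in> S) \<Longrightarrow> (\<Sum>i\<in>A. c i *\<^sub>C e i) \<in> cspan S"
  by (intro cs.span_sum cs.span_scale cs.span_base)

text \<open>A maximal orthonormal family exists because orthonormal vectors are independent and hence at
  most as many as the spanning vectors; for a definite form it leaves no orthogonal vector.\<close>

lemma fin_dim_orthonormal_basis:
  assumes V: "csubspace V" and "fin_dim V"
  shows "\<exists>e. (\<forall>i<cdim V. e i \<in> V) \<and> orthonormal (cdim V) e \<and>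
    (\<forall>x\<in>V. x = (\<Sum>i<cdim V. cinner x (e i) *\<^sub>C e i))"
proof -
  interpret hermitian_form scaleC V cinner by (rule hermitian_form_cinner[OF V])
  obtain S where S: "finite S" "V \<subseteq> cspan S" using assms(2) by (auto simp: fin_dim_def)
  have bound: "m \<le> card S" if "\<And>i. i < m \<Longrightarrow> e i \<in> V" "orthonormal m e" for m e
  proof -
    have "e ` {..<m} \<subseteq> cspan S" using that S by auto
    from cs.independent_span_bound[OF S(1) orthonormal_inj_independent(2)[OF that(2)] this]
    show ?thesis using card_image[OF orthonormal_inj_independent(1)[OF that(2)]] by simp
  qed
  obtain m e where e: "\<forall>i<m. e i \<in> V" "orthonormal m e"
      "\<forall>y\<in>V. (\<forall>i<m. cinner y (e i) = 0) \<longrightarrow> Re (cinner y y) \<le> 0"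
    using ex_maximal_orthonormal[of "card S"] bound by blast
  have exp: "x = (\<Sum>i<m. cinner x (e i) *\<^sub>C e i)" if "x \<in> V" for x
  proof -
    have "Re (cinner (x - (\<Sum>i<m. cinner x (e i) *\<^sub>C e i)) (x - (\<Sum>i<m. cinner x (e i) *\<^sub>C e i))) \<le> 0"
      using e(3) form_orthonormal_decomp(1,2)[OF e(1)[rule_format] e(2) that that] by blast
    then show ?thesis by (simp add: cinner_self)
  qed
  have dim: "cdim V = m"
  proof (rule cs.dim_unique)
    show "e ` {..<m} \<subseteq> V" using e by auto
    show "cs.independent (e ` {..<m})" by (rule orthonormal_inj_independent(2)[OF e(2)])
    show "card (e ` {..<m}) = m" using card_image[OF orthonormal_inj_independent(1)[OF e(2)]] by simp
    show "V \<subseteq> cspan (e ` {..<m})"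
    proof
      fix x assume "x \<in> V"
      then have "x = (\<Sum>i<m. cinner x (e i) *\<^sub>C e i)" by (rule exp)
      also have "\<dots> \<in> cspan (e ` {..<m})" by (rule combination_in_span) simp
      finally show "x \<in> cspan (e ` {..<m})" .
    qed
  qed
  show ?thesis
    unfolding dim using e exp by blast
qed

lemma cdim_eqI:
  assumes "\<And>i. i < m \<Longrightarrow> e i \<in> V" "orthonormal m e" "\<And>x. x \<in> V \<Longrightarrow> x \<in> cspan (e ` {..<m})"
  shows "cdim V = m"
proof (rule cs.dim_unique)
  show "e ` {..<m} \<subseteq> V" using assms by auto
  show "cs.independent (e ` {..<m})" by (rule orthonormal_inj_independent(2)[OF assms(2)])
  show "card (e ` {..<m}) = m" using card_image[OF orthonormal_inj_independent(1)[OF assms(2)]] by simp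
  show "V \<subseteq> cspan (e ` {..<m})" using assms by auto
qed

text \<open>The dimension count used throughout: more vectors than the dimension and the number of further
  linear conditions together admit a nontrivial relation.\<close>

lemma ex_nontrivial_combination:
  fixes v :: "nat \<Rightarrow> 'v::complex_inner" and f :: "nat \<Rightarrow> nat \<Rightarrow> complex"
  assumes R: "csubspace R" "fin_dim R" and v: "\<And>i. i < n \<Longrightarrow> v i \<in> R" and n: "cdim R + r < n"
  shows "\<exists>c. (\<exists>i<n. c i \<noteq> 0) \<and> (\<forall>i\<ge>n. c i = 0) \<and> (\<Sum>i<n. c i *\<^sub>C v i) = 0 \<and>
    (\<forall>j<r. (\<Sum>i<n. c i * f j i) = 0)"
proof -
  obtain e where e: "\<forall>i<cdim R. e i \<in> R" "orthonormal (cdim R) e"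
    "\<forall>x\<in>R. x = (\<Sum>i<cdim R. cinner x (e i) *\<^sub>C e i)"
    using fin_dim_orthonormal_basis[OF R] by blast
  let ?g = "\<lambda>j i. if j < r then f j i else cinner (v i) (e (j - r))"
  obtain c where c: "\<exists>i\<in>{..<n}. c i \<noteq> 0" "\<forall>i. i \<notin> {..<n} \<longrightarrow> c i = 0"
      "\<forall>j<r + cdim R. (\<Sum>i\<in>{..<n}. c i * ?g j i) = 0"
    using underdetermined_system[of "{..<n}" "r + cdim R" ?g] n by (auto simp: add.commute)
  have 1: "(\<Sum>i<n. c i * f j i) = 0" if "j < r" for j
    using c(3)[rule_format, of j] that by simp
  let ?s = "\<Sum>i<n. c i *\<^sub>C v i"
  have z: "cinner ?s (e j) = 0" if "j < cdim R" for j
    using c(3)[rule_format, of "r + j"] that by (simp add: cinner_sum_left cinner_scaleC_left)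
  have "?s \<in> R"
    using R(1) v by (intro cs.subspace_sum cs.subspace_scale) auto
  then have "?s = (\<Sum>i<cdim R. cinner ?s (e i) *\<^sub>C e i)" using e(3) by blast
  also have "\<dots> = 0" by (rule sum.neutral) (simp add: z)
  finally have "?s = 0" .
  with 1 c show ?thesis by (intro exI[of _ c]) auto
qed

lemma fin_dim_UNIV [simp]: "fin_dim (UNIV :: 'a::fd_complex_hilbert set)"
proof -
  obtain S :: "'a set" where S: "finite S" "\<forall>x. \<exists>c. x = (\<Sum>v\<in>S. c v *\<^sub>C v)" using finite_spanning_set by blast
  have "x \<in> cspan S" for x
  proof -
    obtain c where c: "x = (\<Sum>v\<in>S. c v *\<^sub>C v)" using S(2) by blast
    show ?thesis unfolding c by (rule combination_in_span)
  qed
  then show ?thesis using S(1) by (auto simp: fin_dim_def)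
qed

lemma fin_dim_mono: "\<lbrakk>fin_dim W; V \<subseteq> W\<rbrakk> \<Longrightarrow> fin_dim V"
  by (auto simp: fin_dim_def)

instance prod :: (fd_complex_hilbert, fd_complex_hilbert) fd_complex_hilbert
proof
  obtain e :: "nat \<Rightarrow> 'a" where
    e: "\<And>x. x = (\<Sum>i<cdim (UNIV::'a set). cinner x (e i) *\<^sub>C e i)"
    using fin_dim_orthonormal_basis[OF cs.subspace_UNIV fin_dim_UNIV[where 'a='a]] by blast
  obtain e' :: "nat \<Rightarrow> 'b" where
    e': "\<And>x. x = (\<Sum>i<cdim (UNIV::'b set). cinner x (e' i) *\<^sub>C e' i)"
    using fin_dim_orthonormal_basis[OF cs.subspace_UNIV fin_dim_UNIV[where 'a='b]] by blast
  let ?S = "(\<lambda>i. (e i, 0)) ` {..<cdim (UNIV::'a set)} \<union> (\<lambda>i. (0, e' i)) ` {..<cdim (UNIV::'b set)}"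
  have span: "(x, y) \<in> cspan ?S" for x y
  proof -
    have "(x, y) = (\<Sum>i<cdim (UNIV::'a set). cinner x (e i) *\<^sub>C (e i, 0))
        + (\<Sum>i<cdim (UNIV::'b set). cinner y (e' i) *\<^sub>C (0, e' i))"
      using e[of x] e'[of y] by (simp add: prod_eq_iff fst_sum snd_sum scaleC_prod_def)
    also have "\<dots> \<in> cspan ?S"
      by (intro cs.span_add combination_in_span) auto
    finally show ?thesis .
  qed
  have fin: "finite ?S" by simp
  show "\<exists>S. finite S \<and> (\<forall>x::'a \<times> 'b. \<exists>c. x = (\<Sum>v\<in>S. c v *\<^sub>C v))"
  proof (intro exI[of _ ?S] conjI allI fin)
    fix x :: "'a \<times> 'b"
    have "x \<in> cspan ?S" using span[of "fst x" "snd x"] by simp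
    then show "\<exists>c. x = (\<Sum>v\<in>?S. c v *\<^sub>C v)"
      unfolding cs.span_finite[OF fin] by auto
  qed
qed

definition cbasis :: "nat \<Rightarrow> 'a::fd_complex_hilbert"
  where "cbasis = (SOME e. orthonormal (cdim (UNIV::'a set)) e \<and>
    (\<forall>x. x = (\<Sum>i<cdim (UNIV::'a set). cinner x (e i) *\<^sub>C e i)))"

abbreviation cDIM :: "'a::fd_complex_hilbert itself \<Rightarrow> nat"
  where "cDIM _ \<equiv> cdim (UNIV :: 'a set)"

lemma cbasis_ex: "orthonormal (cDIM TYPE('a)) (cbasis :: nat \<Rightarrow> 'a::fd_complex_hilbert) \<and>
    (\<forall>x::'a. x = (\<Sum>i<cDIM TYPE('a). cinner x (cbasis i) *\<^sub>C cbasis i))"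
proof -
  have "\<exists>e::nat \<Rightarrow> 'a. orthonormal (cDIM TYPE('a)) e \<and>
      (\<forall>x. x = (\<Sum>i<cDIM TYPE('a). cinner x (e i) *\<^sub>C e i))"
    using fin_dim_orthonormal_basis[OF cs.subspace_UNIV fin_dim_UNIV[where 'a='a]] by blast
  from someI_ex[OF this] show ?thesis unfolding cbasis_def .
qed

lemma orthonormal_cbasis: "orthonormal (cDIM TYPE('a)) (cbasis :: nat \<Rightarrow> 'a::fd_complex_hilbert)"
  using cbasis_ex by blast

lemma cbasis_expansion: "(\<Sum>i<cDIM TYPE('a). cinner x (cbasis i) *\<^sub>C cbasis i) = (x :: 'a::fd_complex_hilbert)"
  using cbasis_ex[where 'a='a] by simp

lemma cdim_prod: "cDIM TYPE('a::fd_complex_hilbert \<times> 'b::fd_complex_hilbert) = cDIM TYPE('a) + cDIM TYPE('b)"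
proof -
  let ?n = "cDIM TYPE('a)" and ?m = "cDIM TYPE('b)"
  let ?e = "\<lambda>i. if i < ?n then (cbasis i :: 'a, 0 :: 'b) else (0, cbasis (i - ?n))"
  have orth: "orthonormal (?n + ?m) ?e"
    unfolding orthonormal_on_def
  proof (intro allI impI)
    fix i j assume "i < ?n + ?m" "j < ?n + ?m"
    then show "cinner (?e i) (?e j) = (if i = j then 1 else 0)"
      using orthonormal_cbasis[where 'a='a, unfolded orthonormal_on_def, rule_format, of i j]
        orthonormal_cbasis[where 'a='b, unfolded orthonormal_on_def, rule_format, of "i - ?n" "j - ?n"]
        eq_diff_iff[of ?n i j]
      by (cases "i < ?n"; cases "j < ?n") (simp_all add: cinner_prod_def)
  qed
  have span: "x \<in> cspan (?e ` {..<?n + ?m})" for x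
  proof -
    have mem: "(cbasis i, 0) \<in> ?e ` {..<?n + ?m}" if "i \<in> {..<?n}" for i
      using that by (intro image_eqI[of _ _ i]) auto
    have mem2: "(0, cbasis i) \<in> ?e ` {..<?n + ?m}" if "i \<in> {..<?m}" for i
      using that by (intro image_eqI[of _ _ "?n + i"]) auto
    have "x = (\<Sum>i<?n. cinner (fst x) (cbasis i) *\<^sub>C (cbasis i, 0))
        + (\<Sum>i<?m. cinner (snd x) (cbasis i) *\<^sub>C (0, cbasis i))"
      by (rule prod_eqI) (simp_all add: fst_sum snd_sum scaleC_prod_def cbasis_expansion)
    also have "\<dots> \<in> cspan (?e ` {..<?n + ?m})"
      by (rule cs.span_add; rule combination_in_span; (rule mem mem2); assumption)
    finally show ?thesis .
  qed
  show ?thesis by (rule cdim_eqI[of _ ?e, OF UNIV_I orth span])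
qed

text \<open>Completeness, and separability in the next instance, make the Bochner integral and the
  contraction principle available for functions with values in a finite-dimensional space.\<close>

instance fd_complex_hilbert \<subseteq> banach
proof
  fix X :: "nat \<Rightarrow> 'a"
  assume X: "Cauchy X"
  have "\<exists>l. (\<lambda>n. cinner (X n) (cbasis i)) \<longlonglongrightarrow> l" for i
  proof -
    have "Cauchy (\<lambda>n. cinner (X n) (cbasis i))"
      using X by (intro bounded_linear.Cauchy[OF cinner.bounded_linear_left])
    then show ?thesis using Cauchy_convergent convergent_def by blast
  qed
  then obtain l where l: "\<And>i. (\<lambda>n. cinner (X n) (cbasis i)) \<longlonglongrightarrow> l i" by metis
  have "X = (\<lambda>n. \<Sum>i<cDIM TYPE('a). cinner (X n) (cbasis i) *\<^sub>C cbasis i)"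
    by (rule ext) (rule cbasis_expansion[symmetric])
  also have "\<dots> \<longlonglongrightarrow> (\<Sum>i<cDIM TYPE('a). l i *\<^sub>C cbasis i)"
    by (intro tendsto_sum scaleC.tendsto tendsto_const l)
  finally show "convergent X" by (rule convergentI)
qed

instance fd_complex_hilbert \<subseteq> second_countable_topology
proof
  let ?n = "cDIM TYPE('a)"
  obtain C :: "complex set" where C: "countable C" "\<And>U. open U \<Longrightarrow> U \<noteq> {} \<Longrightarrow> \<exists>d\<in>C. d \<in> U"
    by (rule countable_dense_setE) blast
  define Q where "Q = (\<lambda>c. \<Sum>i<?n. c i *\<^sub>C (cbasis i :: 'a)) ` (PiE {..<?n} (\<lambda>_. C))"
  have cQ: "countable Q" unfolding Q_def by (intro countable_image countable_PiE) (auto simp: C)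
  have dense: "\<exists>q\<in>Q. dist q x < r" if "r > 0" for x :: 'a and r
  proof -
    have "\<exists>d\<in>C. dist d (cinner x (cbasis i)) < r / (?n + 1)" for i
      using C(2)[of "ball (cinner x (cbasis i)) (r / (?n + 1))"] \<open>r > 0\<close>
      by (auto simp: dist_commute ball_eq_empty not_le)
    then obtain d where d: "\<And>i. d i \<in> C" "\<And>i. dist (d i) (cinner x (cbasis i)) < r / (?n + 1)" by metis
    let ?q = "\<Sum>i<?n. d i *\<^sub>C (cbasis i :: 'a)"
    have "?q - x = (\<Sum>i<?n. (d i - cinner x (cbasis i)) *\<^sub>C cbasis i)"
      by (simp add: cs.scale_left_diff_distrib sum_subtractf cbasis_expansion)
    then have "dist ?q x \<le> (\<Sum>i<?n. norm ((d i - cinner x (cbasis i)) *\<^sub>C (cbasis i :: 'a)))"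
      by (simp add: dist_norm norm_sum del: norm_scaleC)
    also have "\<dots> \<le> (\<Sum>i<?n. r / (?n + 1))"
    proof (rule sum_mono)
      fix i assume "i \<in> {..<?n}"
      then have "norm (cbasis i :: 'a) = 1"
        using orthonormal_cbasis[where 'a='a, unfolded orthonormal_on_def, rule_format, of i i]
          norm_eq_one_if[of "cbasis i :: 'a"]
        by simp
      then show "norm ((d i - cinner x (cbasis i)) *\<^sub>C (cbasis i :: 'a)) \<le> r / (?n + 1)"
        using d(2)[of i] by (simp add: dist_norm)
    qed
    also have "\<dots> < r" using \<open>r > 0\<close> by (simp add: field_simps)
    finally have "dist ?q x < r" .
    moreover have "?q \<in> Q"
      unfolding Q_def
    proof (rule image_eqI[of _ _ "restrict d {..<?n}"])
      show "?q = (\<Sum>i<?n. restrict d {..<?n} i *\<^sub>C cbasis i)" by (rule sum.cong) auto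
      show "restrict d {..<?n} \<in> PiE {..<?n} (\<lambda>_. C)" using d(1) by auto
    qed
    ultimately show ?thesis by blast
  qed
  define \<B> where "\<B> = (\<lambda>(q, k::nat). ball q (1 / Suc k)) ` (Q \<times> UNIV)"
  have "topological_basis \<B>"
  proof (rule topological_basisI)
    show "open U" if "U \<in> \<B>" for U using that by (auto simp: \<B>_def)
    fix U :: "'a set" and x assume U: "open U" "x \<in> U"
    then obtain \<epsilon> where \<epsilon>: "\<epsilon> > 0" "ball x \<epsilon> \<subseteq> U" by (auto simp: open_contains_ball)
    obtain k where k: "1 / Suc k < \<epsilon> / 2" using \<epsilon>(1) by (metis half_gt_zero nat_approx_posE)
    obtain q where q: "q \<in> Q" "dist q x < 1 / Suc k" using dense[of "1 / Suc k" x] by auto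
    have "ball q (1 / Suc k) \<subseteq> U"
    proof
      fix y assume "y \<in> ball q (1 / Suc k)"
      then have "dist x y < \<epsilon>" using k q(2) dist_triangle[of x y q] by (simp add: dist_commute)
      then show "y \<in> U" using \<epsilon> by auto
    qed
    moreover have "x \<in> ball q (1 / Suc k)" using q by simp
    ultimately show "\<exists>B'\<in>\<B>. x \<in> B' \<and> B' \<subseteq> U"
      using q(1) by (intro bexI[of _ "ball q (1 / Suc k)"]) (auto simp: \<B>_def)
  qed
  moreover have "countable \<B>" unfolding \<B>_def using cQ by auto
  ultimately show "\<exists>B :: 'a set set. countable B \<and> open = generate_topology B"
    using topological_basis_imp_subbasis by blast
qed

lemma orth_proj_unique:
  assumes "p \<in> M" "\<And>m. m \<in> M \<Longrightarrow> cinner (x - p) m = 0" "csubspace M"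
  shows "orth_proj M x = p"
  unfolding orth_proj_def
proof (rule the_equality)
  fix q assume q: "q \<in> M \<and> (\<forall>m\<in>M. cinner (x - q) m = 0)"
  have "q - p \<in> M" using q assms by (simp add: cs.subspace_diff)
  then have "cinner (x - p) (q - p) = 0" "cinner (x - q) (q - p) = 0" using q assms(2) by auto
  then have "cinner (q - p) (q - p) = 0" by (simp add: cinner_diff_left)
  then show "q = p" by simp
qed (use assms in auto)

lemma fin_dim_projection:
  assumes "csubspace V" "fin_dim V"
  obtains Q where "\<And>x. Q x \<in> V" "\<And>x m. m \<in> V \<Longrightarrow> cinner (x - Q x) m = 0"
    "\<And>x y. Q (x + y) = Q x + Q y" "\<And>c x. Q (c *\<^sub>C x) = c *\<^sub>C Q x" "\<And>x. x \<in> V \<Longrightarrow> Q x = x"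
proof -
  obtain e where e: "\<forall>i<cdim V. e i \<in> V" "orthonormal (cdim V) e"
    "\<forall>x\<in>V. x = (\<Sum>i<cdim V. cinner x (e i) *\<^sub>C e i)"
    using fin_dim_orthonormal_basis[OF assms] by blast
  define Q where "Q x = (\<Sum>i<cdim V. cinner x (e i) *\<^sub>C e i)" for x
  have o: "cinner (x - Q x) m = 0" if "m \<in> V" for x m
  proof -
    have "cinner (x - Q x) (e j) = 0" if "j < cdim V" for j
      using orthonormal_sum_cinner[OF e(2) that, of "\<lambda>i. cinner x (e i)"]
      by (simp add: Q_def cinner_diff_left)
    then show ?thesis
      by (subst e(3)[rule_format, OF that]) (simp add: cinner_sum_right cinner_scaleC_right)
  qed
  show ?thesis
  proof (rule that[of Q])
    show "Q x \<in> V" for x unfolding Q_def using e assms by (intro cs.subspace_sum cs.subspace_scale) auto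
    show "cinner (x - Q x) m = 0" if "m \<in> V" for x m using that by (rule o)
    show "Q x = x" if "x \<in> V" for x using e(3) that unfolding Q_def by simp
  qed (simp_all add: Q_def cinner_add_left scaleC_add_left sum.distrib
      cinner_scaleC_left cs.scale_sum_right)
qed

section \<open>Absolutely continuous functions of one real variable\<close>

text \<open>The Lebesgue differentiation theorem. If the difference quotients at \<open>x\<close> stay away from \<open>f x\<close>,
  then \<open>x\<close> is an endpoint of arbitrarily short intervals whose Riemann term differs from the integral
  by a fixed proportion of the length. Such intervals cover the exceptional set in the sense of
  Vitali, so disjoint ones cover almost all of it, and by Henstock's lemma their total length is
  small.\<close>

theorem integral_has_vector_derivative_AE:
  fixes f :: "real \<Rightarrow> 'n::euclidean_space"
  assumes int: "f integrable_on {a..b}"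
  shows "negligible {x \<in> {a..b}. \<not> ((\<lambda>t. integral {a..t} f) has_vector_derivative f x) (at x within {a..b})}"
proof -
  define F where "F t = integral {a..t} f" for t
  define E where "E k = {x \<in> {a..b}. \<forall>d>0. \<exists>y\<in>{a..b}. \<bar>y - x\<bar> < d \<and>
      norm (F y - F x - (y - x) *\<^sub>R f x) > inverse (Suc k) * \<bar>y - x\<bar>}" for k :: nat
  have Fdiff: "integral {u..v} f = F v - F u" if "a \<le> u" "u \<le> v" "v \<le> b" for u v
  proof -
    have "f integrable_on {a..v}"
      by (rule integrable_on_subinterval[OF int]) (use that in auto)
    then show ?thesis
      using Henstock_Kurzweil_Integration.integral_combine[of a u v f] that by (simp add: F_def algebra_simps)
  qed
  have "{x \<in> {a..b}. \<not> (F has_vector_derivative f x) (at x within {a..b})} \<subseteq> (\<Union>k. E k)"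
  proof clarify
    fix x assume x: "x \<in> {a..b}" and nd: "\<not> (F has_vector_derivative f x) (at x within {a..b})"
    have "bounded_linear (\<lambda>h. h *\<^sub>R f x)" by (rule bounded_linear_scaleR_left)
    with nd obtain e where e: "e > 0"
      "\<forall>d>0. \<exists>y\<in>{a..b}. \<bar>y - x\<bar> < d \<and> \<not> norm (F y - F x - (y - x) *\<^sub>R f x) \<le> e * \<bar>y - x\<bar>"
      unfolding has_vector_derivative_def has_derivative_within_alt real_norm_def by blast
    obtain k where k: "inverse (real (Suc k)) < e" using reals_Archimedean[OF e(1)] by auto
    have "x \<in> E k"
      unfolding E_def
    proof (intro CollectI conjI allI impI x)
      fix d :: real assume "d > 0"
      then obtain y where y: "y \<in> {a..b}" "\<bar>y - x\<bar> < d" "\<not> norm (F y - F x - (y - x) *\<^sub>R f x) \<le> e * \<bar>y - x\<bar>"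
        using e(2) by blast
      moreover have "inverse (real (Suc k)) * \<bar>y - x\<bar> \<le> e * \<bar>y - x\<bar>"
        by (rule mult_right_mono) (use k in auto)
      ultimately show "\<exists>y\<in>{a..b}. \<bar>y - x\<bar> < d \<and> norm (F y - F x - (y - x) *\<^sub>R f x) > inverse (Suc k) * \<bar>y - x\<bar>"
        by (intro bexI[of _ y]) auto
    qed
    then show "x \<in> (\<Union>k. E k)" by blast
  qed
  moreover have "negligible (E k)" for k
    unfolding negligible_outer
  proof (intro allI impI)
    fix e :: real assume e: "e > 0"
    define \<kappa> where "\<kappa> = inverse (real (Suc k))"
    have \<kappa>: "\<kappa> > 0" by (simp add: \<kappa>_def)
    have intc: "f integrable_on cbox a b" using int by simp
    have e2: "\<kappa> * e / 2 > 0" using \<kappa> e by simp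
    have "\<exists>\<gamma>. gauge \<gamma> \<and> (\<forall>p. p tagged_partial_division_of (cbox a b) \<and> \<gamma> fine p \<longrightarrow>
         (\<Sum>(x,k)\<in>p. norm (measure lborel k *\<^sub>R f x - integral k f)) < \<kappa> * e / 2)"
    proof (rule Henstock_lemma[OF intc e2])
      fix \<gamma> :: "real \<Rightarrow> real set"
      assume "gauge \<gamma>" and H: "\<And>p. \<lbrakk>p tagged_partial_division_of (cbox a b); \<gamma> fine p\<rbrakk> \<Longrightarrow>
         (\<Sum>(x,k)\<in>p. norm (measure lborel k *\<^sub>R f x - integral k f)) < \<kappa> * e / 2"
      then show ?thesis by (intro exI[of _ \<gamma>] conjI allI impI H) auto
    qed
    then obtain \<gamma> where \<gamma>: "gauge \<gamma>" "\<forall>p. p tagged_partial_division_of (cbox a b) \<and> \<gamma> fine p \<longrightarrow>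
         (\<Sum>(x,k)\<in>p. norm (measure lborel k *\<^sub>R f x - integral k f)) < \<kappa> * e / 2"
      by (elim exE conjE)
    define K where "K = {(x, u, v). x \<in> E k \<and> a \<le> u \<and> u < v \<and> v \<le> b \<and> (x = u \<or> x = v) \<and> {u..v} \<subseteq> \<gamma> x \<and>
        norm (F v - F u - (v - u) *\<^sub>R f x) > \<kappa> * (v - u)}"
    define c where "c = (\<lambda>(x::real, u::real, v::real). (u + v) / 2)"
    define r where "r = (\<lambda>(x::real, u::real, v::real). (v - u) / 2)"
    have cball: "cball (c i) (r i) = {fst (snd i)..snd (snd i)}" if "i \<in> K" for i
      using that unfolding K_def c_def r_def cball_eq_atLeastAtMost by (auto simp: field_simps)
    have cover: "\<exists>i. i \<in> K \<and> x \<in> cball (c i) (r i) \<and> r i < d" if x: "x \<in> E k" and d: "d > 0" for x d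
    proof -
      obtain \<delta> where \<delta>: "\<delta> > 0" "ball x \<delta> \<subseteq> \<gamma> x"
        using \<gamma>(1) unfolding gauge_def by (meson open_contains_ball)
      have "min d \<delta> > 0" using d \<delta> by simp
      with x obtain y where y: "y \<in> {a..b}" "\<bar>y - x\<bar> < min d \<delta>"
        "norm (F y - F x - (y - x) *\<^sub>R f x) > \<kappa> * \<bar>y - x\<bar>" unfolding E_def \<kappa>_def by blast
      have xab: "x \<in> {a..b}" using x by (simp add: E_def)
      have xy: "x \<noteq> y" using y(3) by auto
      define i where "i = (x, min x y, max x y)"
      have "norm (F (max x y) - F (min x y) - (max x y - min x y) *\<^sub>R f x) = norm (F y - F x - (y - x) *\<^sub>R f x)"
      proof (cases "x \<le> y")
        case False
        have "F x - F y - (x - y) *\<^sub>R f x = - (F y - F x - (y - x) *\<^sub>R f x)"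
          by (simp add: algebra_simps)
        with False show ?thesis by (metis max.absorb1 min.absorb2 norm_minus_cancel nle_le)
      qed simp
      moreover have "{min x y..max x y} \<subseteq> ball x \<delta>"
        using y(2) by (auto simp: dist_real_def)
      ultimately have iK: "i \<in> K"
        unfolding K_def i_def using x xab y xy \<delta>(2)
        by (auto simp: max_def min_def abs_if split: if_splits)
      moreover have "x \<in> cball (c i) (r i)" unfolding cball[OF iK] by (auto simp: i_def)
      moreover have "\<bar>y - x\<bar> < d" using y(2) by simp
      then have "r i < d" using d by (auto simp: r_def i_def max_def min_def)
      ultimately show ?thesis by blast
    qed
    have rpos: "0 < r i" if "i \<in> K" for i using that by (auto simp: K_def r_def)
    obtain C where C: "countable C" "C \<subseteq> K"
        "pairwise (\<lambda>i j. disjnt (cball (c i) (r i)) (cball (c j) (r j))) C"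
        "negligible (E k - (\<Union>i \<in> C. cball (c i) (r i)))"
      by (rule Vitali_covering_theorem_cballs[OF rpos cover])
    have bound: "measure lebesgue (\<Union>i\<in>I. cball (c i) (r i)) \<le> e / 2" if I: "I \<subseteq> C" "finite I" for I
    proof -
      define g where "g = (\<lambda>i. (fst i, cball (c i) (r i)))"
      have IK: "I \<subseteq> K" using I C by blast
      have inj: "inj_on g I"
      proof (rule inj_onI)
        fix i j assume ij: "i \<in> I" "j \<in> I" "g i = g j"
        show "i = j"
        proof (rule ccontr)
          assume "i \<noteq> j"
          then have "disjnt (cball (c i) (r i)) (cball (c j) (r j))" using C(3) I ij by (meson pairwiseD subsetD)
          moreover have "c i \<in> cball (c i) (r i)" using rpos[of i] IK ij by auto
          ultimately show False using ij(3) by (auto simp: g_def disjnt_def)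
        qed
      qed
      have tag: "(g ` I) tagged_partial_division_of cbox a b"
        unfolding tagged_partial_division_of_def
      proof (intro conjI allI impI)
        show "finite (g ` I)" using I by simp
        fix x L assume "(x, L) \<in> g ` I"
        then obtain i where i: "i \<in> I" "x = fst i" "L = cball (c i) (r i)" by (auto simp: g_def)
        have L: "L = {fst (snd i)..snd (snd i)}" unfolding i(3) by (rule cball) (use i IK in blast)
        have "i \<in> K" using i IK by blast
        then show "x \<in> L" "L \<subseteq> cbox a b" unfolding L i(2) by (auto simp: K_def)
        show "\<exists>a b. L = cbox a b" unfolding L by auto
      next
        fix x1 K1 x2 K2 assume H: "(x1, K1) \<in> g ` I \<and> (x2, K2) \<in> g ` I \<and> (x1, K1) \<noteq> (x2, K2)"
        then obtain i j where ij: "i \<in> I" "j \<in> I" "(x1, K1) = g i" "(x2, K2) = g j" by blast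
        have "i \<noteq> j" using H ij(3,4) by auto
        moreover have "K1 = cball (c i) (r i)" "K2 = cball (c j) (r j)"
          using ij(3,4) by (simp_all add: g_def)
        ultimately have "disjnt K1 K2" using pairwiseD[OF C(3), of i j] I ij(1,2) by blast
        then show "interior K1 \<inter> interior K2 = {}"
          using interior_subset[of K1] interior_subset[of K2] by (auto simp: disjnt_def)
      qed
      have fine: "\<gamma> fine (g ` I)"
      proof (rule fineI)
        fix x L assume "(x, L) \<in> g ` I"
        then obtain i where i: "i \<in> I" "x = fst i" "L = cball (c i) (r i)" by (auto simp: g_def)
        have L: "L = {fst (snd i)..snd (snd i)}" unfolding i(3) by (rule cball) (use i IK in blast)
        have "i \<in> K" using i IK by blast
        then show "L \<subseteq> \<gamma> x" unfolding L i(2) by (auto simp: K_def)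
      qed
      have "measure lebesgue (\<Union>i\<in>I. cball (c i) (r i)) \<le> (\<Sum>i\<in>I. measure lebesgue (cball (c i) (r i)))"
        by (rule measure_UNION_le) (use I in auto)
      also have "\<dots> \<le> (\<Sum>i\<in>I. (case g i of (x, L) \<Rightarrow> norm (measure lborel L *\<^sub>R f x - integral L f)) / \<kappa>)"
      proof (rule sum_mono)
        fix i assume i: "i \<in> I"
        obtain x u v where iuv: "i = (x, u, v)" by (metis prod.exhaust)
        have K: "a \<le> u" "u < v" "v \<le> b" "norm (F v - F u - (v - u) *\<^sub>R f x) > \<kappa> * (v - u)"
          using i IK unfolding iuv by (auto simp: K_def)
        have cb: "cball (c i) (r i) = {u..v}" using cball[of i] i IK by (auto simp: iuv)
        have "(v - u) *\<^sub>R f x - integral {u..v} f = - (F v - F u - (v - u) *\<^sub>R f x)"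
          using Fdiff[of u v] K by simp
        then have "norm ((v - u) *\<^sub>R f x - integral {u..v} f) > \<kappa> * (v - u)"
          using K(4) by (metis norm_minus_cancel)
        then show "measure lebesgue (cball (c i) (r i))
            \<le> (case g i of (x, L) \<Rightarrow> norm (measure lborel L *\<^sub>R f x - integral L f)) / \<kappa>"
        proof -
          assume "norm ((v - u) *\<^sub>R f x - integral {u..v} f) > \<kappa> * (v - u)"
          moreover have "g i = (x, {u..v})" unfolding g_def cb by (simp add: iuv)
          ultimately show ?thesis unfolding cb using K \<kappa> by (simp add: pos_le_divide_eq mult.commute)
        qed
      qed
      also have "\<dots> = (\<Sum>(x, L)\<in>g ` I. norm (measure lborel L *\<^sub>R f x - integral L f)) / \<kappa>"
        by (simp add: sum.reindex[OF inj] sum_divide_distrib)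
      also have "\<dots> \<le> (\<kappa> * e / 2) / \<kappa>"
        using \<gamma>(2)[rule_format, OF conjI, OF tag fine] \<kappa> by (intro divide_right_mono) auto
      also have "\<dots> = e / 2" using \<kappa> by simp
      finally show ?thesis .
    qed
    have meas: "cball (c i) (r i) \<in> lmeasurable" for i by simp
    let ?U = "\<Union>i\<in>C. cball (c i) (r i)"
    have U: "?U \<in> lmeasurable" "measure lebesgue ?U \<le> e / 2"
      using fmeasurable_UN_bound[OF C(1) meas bound] measure_UN_bound[OF C(1) meas bound] by auto
    let ?N = "E k - ?U"
    have N: "?N \<in> lmeasurable" "measure lebesgue ?N = 0"
      using C(4) by (auto simp: negligible_iff_measure)
    show "\<exists>T. E k \<subseteq> T \<and> T \<in> lmeasurable \<and> measure lebesgue T < e"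
    proof (intro exI conjI)
      show "E k \<subseteq> ?U \<union> ?N" by blast
      show "?U \<union> ?N \<in> lmeasurable" using U N by (rule_tac fmeasurable.Un)
      have "measure lebesgue (?U \<union> ?N) \<le> measure lebesgue ?U + measure lebesgue ?N"
        by (rule measure_Un_le) (use U N in auto)
      then show "measure lebesgue (?U \<union> ?N) < e" using U(2) N(2) e by linarith
    qed
  qed
  then have "negligible (\<Union>k. E k)" by (rule negligible_Union_nat)
  ultimately show ?thesis unfolding F_def using negligible_subset by blast
qed

text \<open>The fundamental theorem for absolutely continuous functions. The gauge is chosen by
  differentiability off the null set \<open>N\<close>; on \<open>N\<close> it is subordinate to an open set of small measure, so
  that by absolute continuity the intervals tagged there contribute little.\<close>

theorem abs_cont_on_has_integral:
  fixes F :: "real \<Rightarrow> 'n::euclidean_space"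
  assumes ab: "a \<le> b" and ac: "abs_cont_on a b F" and N: "negligible N"
    and der: "\<And>x. \<lbrakk>x \<in> {a..b}; x \<notin> N\<rbrakk> \<Longrightarrow> (F has_vector_derivative f x) (at x within {a..b})"
  shows "(f has_integral (F b - F a)) {a..b}"
proof -
  define f0 where "f0 x = (if x \<in> N then 0 else f x)" for x
  have "(f0 has_integral (F b - F a)) (cbox a b)"
    unfolding has_integral
  proof (intro allI impI)
    fix e :: real assume e: "e > 0"
    define e' where "e' = e / (4 * (b - a + 1))"
    have e': "e' > 0" using e ab by (simp add: e'_def)
    from ac[unfolded abs_cont_on_def, THEN spec, THEN mp, OF half_gt_zero[OF e]]
    obtain \<delta> where \<delta>: "\<delta> > 0" "\<forall>(n::nat) c d.
        (\<forall>i<n. a \<le> c i \<and> c i \<le> d i \<and> d i \<le> b) \<and>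
        (\<forall>i<n. \<forall>j<n. i \<noteq> j \<longrightarrow> {c i<..<d i} \<inter> {c j<..<d j} = {}) \<and>
        (\<Sum>i<n. d i - c i) < \<delta> \<longrightarrow> (\<Sum>i<n. norm (F (d i) - F (c i))) < e / 2"
      by (elim exE conjE)
    have Ns: "N \<in> sets lebesgue" "emeasure lebesgue N = 0" using N by (auto simp: negligible_iff_null_sets)
    obtain U where U: "open U" "N \<subseteq> U" "U - N \<in> lmeasurable" "emeasure lebesgue (U - N) < ennreal \<delta>"
      by (rule sets_lebesgue_outer_open[OF Ns(1) \<delta>(1)])
    have UN: "U = (U - N) \<union> N" using U by blast
    have Nm: "N \<in> lmeasurable" "measure lebesgue N = 0" using N by (auto simp: negligible_iff_measure)
    have Um: "U \<in> lmeasurable" by (subst UN) (rule fmeasurable.Un[OF U(3) Nm(1)])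
    have "measure lebesgue U \<le> measure lebesgue (U - N) + measure lebesgue N"
      by (subst UN) (rule measure_Un_le[OF fmeasurableD[OF U(3)] fmeasurableD[OF Nm(1)]])
    also have "\<dots> < \<delta>" using U(3,4) Nm(2) \<delta>(1) by (simp add: emeasure_eq_measure2 ennreal_less_iff)
    finally have mU: "measure lebesgue U < \<delta>" .
    have "\<forall>x. \<exists>d>0. x \<in> {a..b} - N \<longrightarrow>
         (\<forall>y\<in>{a..b}. norm (y-x) < d \<longrightarrow> norm (F y - F x - (y-x) *\<^sub>R f x) \<le> e' * norm (y-x))"
    proof
      fix x
      show "\<exists>d>0. x \<in> {a..b} - N \<longrightarrow>
         (\<forall>y\<in>{a..b}. norm (y-x) < d \<longrightarrow> norm (F y - F x - (y-x) *\<^sub>R f x) \<le> e' * norm (y-x))"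
      proof (cases "x \<in> {a..b} - N")
        case True
        then show ?thesis
          using der[of x] e' unfolding has_vector_derivative_def has_derivative_within_alt by blast
      qed (auto intro: exI[of _ 1])
    qed
    then obtain d where d0: "\<forall>x. 0 < d x \<and> (x \<in> {a..b} - N \<longrightarrow>
         (\<forall>y\<in>{a..b}. norm (y-x) < d x \<longrightarrow> norm (F y - F x - (y-x) *\<^sub>R f x) \<le> e' * norm (y-x)))"
      using choice[of "\<lambda>x d. 0 < d \<and> (x \<in> {a..b} - N \<longrightarrow>
         (\<forall>y\<in>{a..b}. norm (y-x) < d \<longrightarrow> norm (F y - F x - (y-x) *\<^sub>R f x) \<le> e' * norm (y-x)))"] by blast
    have d: "\<And>x. 0 < d x"
        "\<And>x y. \<lbrakk>x \<in> {a..b}; x \<notin> N; y \<in> {a..b}; norm (y-x) < d x\<rbrakk>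
          \<Longrightarrow> norm (F y - F x - (y-x) *\<^sub>R f x) \<le> e' * norm (y-x)"
      using d0 by auto
    define \<gamma> where "\<gamma> x = (if x \<in> N then U else ball x (d x))" for x
    show "\<exists>\<gamma>. gauge \<gamma> \<and> (\<forall>p. p tagged_division_of cbox a b \<and> \<gamma> fine p \<longrightarrow>
        norm ((\<Sum>(x, k)\<in>p. measure lborel k *\<^sub>R f0 x) - (F b - F a)) < e)"
    proof (intro exI[of _ \<gamma>] conjI allI impI)
      show "gauge \<gamma>" using U d(1) by (auto simp: gauge_def \<gamma>_def)
      fix p assume "p tagged_division_of cbox a b \<and> \<gamma> fine p"
      then have p: "p tagged_division_of cbox a b" and fine: "\<gamma> fine p" by auto
      note pD = tagged_division_ofD[OF p]
      have ivl: "\<exists>u v. L = {u..v} \<and> u \<le> x \<and> x \<le> v \<and> a \<le> u \<and> v \<le> b \<and> Inf L = u \<and> Sup L = v \<and> measure lborel L = v - u"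
        if xL: "(x, L) \<in> p" for x L
      proof -
        obtain u v where L: "L = cbox u v" using pD(4)[OF xL] by blast
        have "x \<in> L" "L \<subseteq> cbox a b" using pD(2,3)[OF xL] by auto
        then show ?thesis unfolding L by (intro exI[of _ u] exI[of _ v]) auto
      qed
      let ?g = "\<lambda>(x, L). measure lborel L *\<^sub>R f0 x - (F (Sup L) - F (Inf L))"
      define p1 p2 where "p1 = {z \<in> p. fst z \<notin> N}" and "p2 = {z \<in> p. fst z \<in> N}"
      have fin: "finite p" using pD(1) .
      have p12: "p = p1 \<union> p2" "p1 \<inter> p2 = {}" "finite p1" "finite p2"
        using fin by (auto simp: p1_def p2_def)
      have telescope: "(\<Sum>(x, K)\<in>p. F (Sup K) - F (Inf K)) = F b - F a"
        by (rule additive_tagged_division_1[OF ab p[unfolded cbox_interval]])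
      have "(\<Sum>(x, k)\<in>p. measure lborel k *\<^sub>R f0 x) - (F b - F a) = (\<Sum>z\<in>p. ?g z)"
        unfolding telescope[symmetric] sum_subtractf[symmetric] by (rule sum.cong[OF refl]) (simp add: case_prod_unfold)
      also have "\<dots> = (\<Sum>z\<in>p1. ?g z) + (\<Sum>z\<in>p2. ?g z)"
        unfolding p12(1) by (rule sum.union_disjoint) (use p12 in auto)
      finally have split: "(\<Sum>(x, k)\<in>p. measure lborel k *\<^sub>R f0 x) - (F b - F a)
          = (\<Sum>z\<in>p1. ?g z) + (\<Sum>z\<in>p2. ?g z)" .
      have "norm ((\<Sum>(x, k)\<in>p. measure lborel k *\<^sub>R f0 x) - (F b - F a))
          \<le> norm (\<Sum>z\<in>p1. ?g z) + norm (\<Sum>z\<in>p2. ?g z)" unfolding split by (rule norm_triangle_ineq)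
      moreover have "norm (\<Sum>z\<in>p1. ?g z) \<le> e / 4"
      proof -
        have "norm (\<Sum>z\<in>p1. ?g z) \<le> (\<Sum>z\<in>p1. e' * measure lborel (snd z))"
        proof (rule sum_norm_le, clarify)
          fix x L assume "(x, L) \<in> p1"
          then have xL: "(x, L) \<in> p" "x \<notin> N" by (auto simp: p1_def)
          obtain u v where uv: "L = {u..v}" "u \<le> x" "x \<le> v" "a \<le> u" "v \<le> b" "Inf L = u" "Sup L = v" "measure lborel L = v - u"
            using ivl[OF xL(1)] by blast
          have "L \<subseteq> ball x (d x)" using fineD[OF fine xL(1)] xL(2) by (simp add: \<gamma>_def)
          then have "u \<in> ball x (d x)" "v \<in> ball x (d x)" using uv by (auto simp del: mem_ball)
          then have s: "norm (F v - F x - (v - x) *\<^sub>R f x) \<le> e' * norm (v - x)"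
              "norm (F u - F x - (u - x) *\<^sub>R f x) \<le> e' * norm (u - x)"
          proof -
            assume b: "u \<in> ball x (d x)" "v \<in> ball x (d x)"
            have x: "x \<in> {a..b}" using uv by simp
            have nv: "norm (v - x) < d x" "norm (u - x) < d x"
              using b by (simp_all add: dist_real_def abs_minus_commute)
            show "norm (F v - F x - (v - x) *\<^sub>R f x) \<le> e' * norm (v - x)"
              by (rule d(2)[OF x xL(2) _ nv(1)]) (use uv in auto)
            show "norm (F u - F x - (u - x) *\<^sub>R f x) \<le> e' * norm (u - x)"
              by (rule d(2)[OF x xL(2) _ nv(2)]) (use uv in auto)
          qed
          have "norm ((v - u) *\<^sub>R f x - (F v - F u))
              = norm ((F u - F x - (u - x) *\<^sub>R f x) - (F v - F x - (v - x) *\<^sub>R f x))"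
            by (simp add: algebra_simps)
          also have "\<dots> \<le> e' * norm (u - x) + e' * norm (v - x)"
            by (rule order_trans[OF norm_triangle_ineq4 add_mono[OF s(2) s(1)]])
          also have "\<dots> = e' * (v - u)" using uv by (simp add: algebra_simps)
          finally show "norm (measure lborel L *\<^sub>R f0 x - (F (Sup L) - F (Inf L))) \<le> e' * measure lborel (snd (x, L))"
            using uv xL(2) by (simp add: f0_def)
        qed
        also have "\<dots> = e' * (\<Sum>(x, L)\<in>p1. measure lborel L)" by (simp add: sum_distrib_left case_prod_unfold)
        also have "(\<Sum>(x, L)\<in>p1. measure lborel L) \<le> (\<Sum>(x, L)\<in>p. measure lborel L)"
          by (rule sum_mono2) (use fin p12 in auto)
        also have "(\<Sum>(x, L)\<in>p. measure lborel L) = b - a"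
          using additive_content_tagged_division[OF p] ab by simp
        also have "e' * (b - a) \<le> e / 4" using e ab by (simp add: e'_def field_simps)
        finally show ?thesis using e' by simp
      qed
      moreover have "norm (\<Sum>z\<in>p2. ?g z) < e / 2"
      proof -
        obtain g where g: "bij_betw g {..<card p2} p2"
          using ex_bij_betw_nat_finite[OF p12(4)] by (auto simp: lessThan_atLeast0)
        define c where "c i = Inf (snd (g i))" for i
        define s where "s i = Sup (snd (g i))" for i
        have gi: "g i \<in> p" "fst (g i) \<in> N" if "i < card p2" for i
          using bij_betwE[OF g] that by (auto simp: p2_def)
        have cd: "a \<le> c i \<and> c i \<le> s i \<and> s i \<le> b \<and> snd (g i) = {c i..s i}" if "i < card p2" for i
        proof -
          have "(fst (g i), snd (g i)) \<in> p" using gi[OF that] by simp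
          from ivl[OF this] show ?thesis unfolding c_def s_def by auto
        qed
        have disj: "{c i<..<s i} \<inter> {c j<..<s j} = {}" if "i < card p2" "j < card p2" "i \<noteq> j" for i j
        proof -
          have "g i \<noteq> g j" using g that by (auto simp: bij_betw_def inj_on_def)
          then have "interior (snd (g i)) \<inter> interior (snd (g j)) = {}"
            using pD(5)[of "fst (g i)" "snd (g i)" "fst (g j)" "snd (g j)"] gi that by (auto simp: prod_eq_iff)
          then show ?thesis using cd that by simp
        qed
        have "(\<Sum>i<card p2. s i - c i) = (\<Sum>i<card p2. measure lebesgue {c i<..<s i})"
          using cd by (intro sum.cong) auto
        also have "\<dots> = measure lebesgue (\<Union>i<card p2. {c i<..<s i})"
        proof (rule measure_finite_Union[symmetric])
          show "disjoint_family_on (\<lambda>i. {c i<..<s i}) {..<card p2}"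
            using disj by (auto simp: disjoint_family_on_def)
        qed (use cd in auto)
        also have "\<dots> \<le> measure lebesgue U"
        proof (rule measure_mono_fmeasurable)
          show "(\<Union>i<card p2. {c i<..<s i}) \<subseteq> U"
          proof clarify
            fix i x assume i: "i < card p2" and x: "x \<in> {c i<..<s i}"
            have "(fst (g i), snd (g i)) \<in> p" using gi[OF i] by simp
            from fineD[OF fine this] have "snd (g i) \<subseteq> U" using gi(2)[OF i] by (simp add: \<gamma>_def)
            moreover have "x \<in> snd (g i)" using cd[OF i] x by auto
            ultimately show "x \<in> U" by blast
          qed
        qed (use Um in auto)
        finally have "(\<Sum>i<card p2. s i - c i) < \<delta>" using mU by simp
        then have lt: "(\<Sum>i<card p2. norm (F (s i) - F (c i))) < e / 2"
          using cd disj by (intro \<delta>(2)[rule_format] conjI allI impI) auto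
        have "norm (\<Sum>z\<in>p2. ?g z) \<le> (\<Sum>z\<in>p2. norm (?g z))" by (rule norm_sum)
        also have "\<dots> = (\<Sum>z\<in>p2. norm (F (Sup (snd z)) - F (Inf (snd z))))"
          by (intro sum.cong) (auto simp: p2_def f0_def norm_minus_commute)
        also have "\<dots> = (\<Sum>i<card p2. norm (F (s i) - F (c i)))"
          by (simp add: sum.reindex_bij_betw[OF g, symmetric] s_def c_def)
        finally show ?thesis using lt by simp
      qed
      ultimately show "norm ((\<Sum>(x, k)\<in>p. measure lborel k *\<^sub>R f0 x) - (F b - F a)) < e"
        using e by linarith
    qed
  qed
  then have "(f0 has_integral (F b - F a)) {a..b}" by simp
  then show ?thesis
    by (rule has_integral_spike[OF N, rotated]) (auto simp: f0_def)
qed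

text \<open>A function whose increments are dominated by an integral is absolutely continuous: truncating
  \<open>\<phi>\<close> at a high level \<open>n\<close> leaves a remainder of small integral, and the bounded part contributes at most
  \<open>n\<close> times the total length.\<close>

lemma abs_cont_onI_integrable:
  fixes F :: "real \<Rightarrow> 'x::real_normed_vector"
  assumes \<phi>: "set_integrable lborel {a..b} \<phi>" and pos: "\<And>t. 0 \<le> \<phi> t"
    and F: "\<And>c d. \<lbrakk>a \<le> c; c \<le> d; d \<le> b\<rbrakk> \<Longrightarrow> norm (F d - F c) \<le> (LBINT t:{c..d}. \<phi> t)"
  shows "abs_cont_on a b F"
  unfolding abs_cont_on_def
proof (intro allI impI)
  fix e :: real assume e: "e > 0"
  define \<psi> where "\<psi> t = indicator {a..b} t * \<phi> t" for t :: real
  have \<psi>: "integrable lborel \<psi>" "\<And>t. 0 \<le> \<psi> t"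
    using \<phi> pos by (simp_all add: \<psi>_def[abs_def] set_integrable_def)
  have lim: "(\<lambda>n. \<integral>t. min (\<psi> t) (real n) \<partial>lborel) \<longlonglongrightarrow> (\<integral>t. \<psi> t \<partial>lborel)"
  proof (rule integral_dominated_convergence[where w=\<psi>])
    show "AE t in lborel. (\<lambda>n. min (\<psi> t) (real n)) \<longlonglongrightarrow> \<psi> t"
    proof (intro AE_I2 tendsto_eventually)
      fix t
      obtain m :: nat where "\<psi> t \<le> real m" using real_arch_simple by blast
      then show "\<forall>\<^sub>F n in sequentially. min (\<psi> t) (real n) = \<psi> t"
        unfolding eventually_sequentially by (intro exI[of _ m]) auto
    qed
  qed (use \<psi> in auto)
  have "\<forall>\<^sub>F n in sequentially. dist (\<integral>t. min (\<psi> t) (real n) \<partial>lborel) (\<integral>t. \<psi> t \<partial>lborel) < e / 2"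
    using lim half_gt_zero[OF e] unfolding tendsto_iff by blast
  then obtain n :: nat where n: "dist (\<integral>t. min (\<psi> t) (real n) \<partial>lborel) (\<integral>t. \<psi> t \<partial>lborel) < e / 2"
    by (auto simp: eventually_sequentially)
  have intm: "integrable lborel (\<lambda>t. min (\<psi> t) (real n))"
    by (rule Bochner_Integration.integrable_bound[OF \<psi>(1)]) (use \<psi> in auto)
  define \<eta> where "\<eta> t = \<psi> t - min (\<psi> t) (real n)" for t
  have \<eta>: "integrable lborel \<eta>" "\<And>t. 0 \<le> \<eta> t" "(\<integral>t. \<eta> t \<partial>lborel) < e / 2"
  proof -
    show "integrable lborel \<eta>" unfolding \<eta>_def[abs_def] by (rule Bochner_Integration.integrable_diff[OF \<psi>(1) intm])
    show "0 \<le> \<eta> t" for t by (simp add: \<eta>_def)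
    have "(\<integral>t. \<eta> t \<partial>lborel) = (\<integral>t. \<psi> t \<partial>lborel) - (\<integral>t. min (\<psi> t) (real n) \<partial>lborel)"
      unfolding \<eta>_def by (rule Bochner_Integration.integral_diff[OF \<psi>(1) intm])
    then show "(\<integral>t. \<eta> t \<partial>lborel) < e / 2" using n unfolding dist_real_def by linarith
  qed
  define \<delta> where "\<delta> = e / (2 * (real n + 1))"
  have \<delta>: "\<delta> > 0" using e by (simp add: \<delta>_def)
  show "\<exists>\<delta>>0. \<forall>(m::nat) c d.
    (\<forall>i<m. a \<le> c i \<and> c i \<le> d i \<and> d i \<le> b) \<and>
    (\<forall>i<m. \<forall>j<m. i \<noteq> j \<longrightarrow> {c i<..<d i} \<inter> {c j<..<d j} = {}) \<and>
    (\<Sum>i<m. d i - c i) < \<delta> \<longrightarrow> (\<Sum>i<m. norm (F (d i) - F (c i))) < e"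
  proof (intro exI[of _ \<delta>] conjI \<delta> allI impI)
    fix m :: nat and c d :: "nat \<Rightarrow> real"
    assume H: "(\<forall>i<m. a \<le> c i \<and> c i \<le> d i \<and> d i \<le> b) \<and>
      (\<forall>i<m. \<forall>j<m. i \<noteq> j \<longrightarrow> {c i<..<d i} \<inter> {c j<..<d j} = {}) \<and> (\<Sum>i<m. d i - c i) < \<delta>"
    have one: "(\<Sum>i<m. indicat_real {c i<..<d i} t) \<le> 1" for t
    proof -
      have "(\<Sum>i<m. indicat_real {c i<..<d i} t) = indicator (\<Union>i<m. {c i<..<d i}) t"
        by (rule indicator_UN_disjoint[symmetric]) (use H in \<open>auto simp: disjoint_family_on_def\<close>)
      then show ?thesis by simp
    qed
    have le: "norm (F (d i) - F (c i)) \<le> (\<integral>t. indicator {c i<..<d i} t * \<eta> t \<partial>lborel) + real n * (d i - c i)"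
      if i: "i < m" for i
    proof -
      have ci: "a \<le> c i" "c i \<le> d i" "d i \<le> b" using H i by auto
      have "norm (F (d i) - F (c i)) \<le> (LBINT t:{c i..d i}. \<phi> t)" by (rule F) (use ci in auto)
      also have "\<dots> = (LBINT t:{c i<..<d i}. \<phi> t)"
        unfolding set_lebesgue_integral_def
      proof (rule integral_cong_AE)
        have m: "set_borel_measurable lborel {a..b} \<phi>" using \<phi> by (simp add: set_integrable_def set_borel_measurable_def)
        have "set_borel_measurable lborel {c i..d i} \<phi>" "set_borel_measurable lborel {c i<..<d i} \<phi>"
          by (rule set_borel_measurable_subset[OF m]; use ci in auto)+
        then show "(\<lambda>x. indicator {c i..d i} x *\<^sub>R \<phi> x) \<in> borel_measurable lborel"
          "(\<lambda>x. indicator {c i<..<d i} x *\<^sub>R \<phi> x) \<in> borel_measurable lborel"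
          by (simp_all add: set_borel_measurable_def)
        show "AE x in lborel. indicator {c i..d i} x *\<^sub>R \<phi> x = indicator {c i<..<d i} x *\<^sub>R \<phi> x"
          using AE_lborel_singleton[of "c i"] AE_lborel_singleton[of "d i"]
          by eventually_elim (auto simp: indicator_def)
      qed
      also have "\<dots> = (\<integral>t. indicator {c i<..<d i} t * \<psi> t \<partial>lborel)"
        unfolding set_lebesgue_integral_def
        by (rule Bochner_Integration.integral_cong) (use ci in \<open>auto simp: \<psi>_def indicator_def\<close>)
      also have "\<dots> \<le> (\<integral>t. indicator {c i<..<d i} t * \<eta> t + real n * indicator {c i<..<d i} t \<partial>lborel)"
      proof (rule integral_mono)
        show "integrable lborel (\<lambda>t. indicator {c i<..<d i} t * \<psi> t)"
          using integrable_mult_indicator[of "{c i<..<d i}" lborel \<psi>] \<psi> by simp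
        show "integrable lborel (\<lambda>t. indicator {c i<..<d i} t * \<eta> t + real n * indicator {c i<..<d i} t)"
          using integrable_mult_indicator[of "{c i<..<d i}" lborel \<eta>] \<eta> ci
          by (intro Bochner_Integration.integrable_add integrable_mult_right) auto
        show "indicator {c i<..<d i} t * \<psi> t \<le> indicator {c i<..<d i} t * \<eta> t + real n * indicator {c i<..<d i} t" for t
          by (auto simp: \<eta>_def indicator_def)
      qed
      also have "\<dots> = (\<integral>t. indicator {c i<..<d i} t * \<eta> t \<partial>lborel) + real n * (d i - c i)"
        using integrable_mult_indicator[of "{c i<..<d i}" lborel \<eta>] \<eta> ci by (subst Bochner_Integration.integral_add) auto
      finally show ?thesis .
    qed
    have "(\<Sum>i<m. norm (F (d i) - F (c i)))
        \<le> (\<Sum>i<m. (\<integral>t. indicator {c i<..<d i} t * \<eta> t \<partial>lborel) + real n * (d i - c i))"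
      by (rule sum_mono) (use le in auto)
    also have "\<dots> = (\<Sum>i<m. \<integral>t. indicator {c i<..<d i} t * \<eta> t \<partial>lborel) + real n * (\<Sum>i<m. d i - c i)"
      by (simp add: sum.distrib sum_distrib_left)
    also have "(\<Sum>i<m. \<integral>t. indicator {c i<..<d i} t * \<eta> t \<partial>lborel) = (\<integral>t. (\<Sum>i<m. indicator {c i<..<d i} t * \<eta> t) \<partial>lborel)"
      using integrable_mult_indicator[of _ lborel \<eta>] \<eta> by (subst Bochner_Integration.integral_sum) auto
    also have "\<dots> \<le> (\<integral>t. \<eta> t \<partial>lborel)"
    proof (rule integral_mono)
      show "integrable lborel (\<lambda>t. \<Sum>i<m. indicator {c i<..<d i} t * \<eta> t)"
        using integrable_mult_indicator[of _ lborel \<eta>] \<eta> by (intro Bochner_Integration.integrable_sum) auto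
      show "(\<Sum>i<m. indicator {c i<..<d i} t * \<eta> t) \<le> \<eta> t" for t
        using mult_right_mono[OF one[of t] \<eta>(2)[of t]] by (simp add: sum_distrib_right)
    qed (rule \<eta>)
    also have "real n * (\<Sum>i<m. d i - c i) \<le> real n * \<delta>" using H by (intro mult_left_mono) auto
    also have "real n * \<delta> \<le> e / 2" using e by (simp add: \<delta>_def field_simps)
    finally show "(\<Sum>i<m. norm (F (d i) - F (c i))) < e" using \<eta>(3) by simp
  qed
qed

section \<open>Linear differential equations with integrable coefficients\<close>

lemma abs_cont_on_continuous:
  assumes "abs_cont_on a b y"
  shows "continuous_on {a..b} y"
  unfolding continuous_on_iff
proof (intro ballI allI impI)
  fix x e :: real assume x: "x \<in> {a..b}" and e: "e > 0"
  from assms[unfolded abs_cont_on_def, THEN spec, THEN mp, OF e]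
  obtain \<delta> where \<delta>: "\<delta> > 0" "\<forall>(n::nat) c d.
        (\<forall>i<n. a \<le> c i \<and> c i \<le> d i \<and> d i \<le> b) \<and>
        (\<forall>i<n. \<forall>j<n. i \<noteq> j \<longrightarrow> {c i<..<d i} \<inter> {c j<..<d j} = {}) \<and>
        (\<Sum>i<n. d i - c i) < \<delta> \<longrightarrow> (\<Sum>i<n. norm (y (d i) - y (c i))) < e"
    by (elim exE conjE)
  have small: "norm (y s - y r) < e" if "a \<le> r" "r \<le> s" "s \<le> b" "s - r < \<delta>" for r s
    using \<delta>(2)[THEN spec[of _ 1], THEN spec[of _ "\<lambda>_. r"], THEN spec[of _ "\<lambda>_. s"]] that by simp
  show "\<exists>d>0. \<forall>x'\<in>{a..b}. dist x' x < d \<longrightarrow> dist (y x') (y x) < e"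
  proof (intro exI[of _ \<delta>] conjI \<delta>(1) ballI impI)
    fix x' assume x': "x' \<in> {a..b}" "dist x' x < \<delta>"
    show "dist (y x') (y x) < e"
    proof (cases "x \<le> x'")
      case True
      then show ?thesis using small[of x x'] x x' by (simp add: dist_norm)
    next
      case False
      then show ?thesis using small[of x' x] x x' by (simp add: dist_norm norm_minus_commute)
    qed
  qed
qed

lemma abs_cont_on_subset:
  assumes "abs_cont_on a b y" "a \<le> c" "d \<le> b"
  shows "abs_cont_on c d y"
  unfolding abs_cont_on_def
proof (intro allI impI)
  fix e :: real assume e: "e > 0"
  from assms(1)[unfolded abs_cont_on_def, THEN spec, THEN mp, OF e]
  obtain \<delta> where \<delta>: "\<delta> > 0" "\<forall>(n::nat) c d.
        (\<forall>i<n. a \<le> c i \<and> c i \<le> d i \<and> d i \<le> b) \<and>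
        (\<forall>i<n. \<forall>j<n. i \<noteq> j \<longrightarrow> {c i<..<d i} \<inter> {c j<..<d j} = {}) \<and>
        (\<Sum>i<n. d i - c i) < \<delta> \<longrightarrow> (\<Sum>i<n. norm (y (d i) - y (c i))) < e"
    by (elim exE conjE)
  show "\<exists>\<delta>>0. \<forall>(n::nat) c' d'.
        (\<forall>i<n. c \<le> c' i \<and> c' i \<le> d' i \<and> d' i \<le> d) \<and>
        (\<forall>i<n. \<forall>j<n. i \<noteq> j \<longrightarrow> {c' i<..<d' i} \<inter> {c' j<..<d' j} = {}) \<and>
        (\<Sum>i<n. d' i - c' i) < \<delta> \<longrightarrow> (\<Sum>i<n. norm (y (d' i) - y (c' i))) < e"
  proof (intro exI[of _ \<delta>] conjI \<delta>(1) allI impI)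
    fix n :: nat and c' d'
    assume H: "(\<forall>i<n. c \<le> c' i \<and> c' i \<le> d' i \<and> d' i \<le> d) \<and>
        (\<forall>i<n. \<forall>j<n. i \<noteq> j \<longrightarrow> {c' i<..<d' i} \<inter> {c' j<..<d' j} = {}) \<and>
        (\<Sum>i<n. d' i - c' i) < \<delta>"
    have "\<forall>i<n. a \<le> c' i \<and> c' i \<le> d' i \<and> d' i \<le> b"
    proof (intro allI impI)
      fix i assume "i < n"
      then have "c \<le> c' i \<and> c' i \<le> d' i \<and> d' i \<le> d" using H by blast
      then show "a \<le> c' i \<and> c' i \<le> d' i \<and> d' i \<le> b" using assms(2,3) by linarith
    qed
    with H \<delta>(2) show "(\<Sum>i<n. norm (y (d' i) - y (c' i))) < e" by blast
  qed
qed

lemma abs_cont_on_Lipschitz_bound: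
  assumes ac: "abs_cont_on a b y" "abs_cont_on a b z"
    and L: "\<And>c d. \<lbrakk>a \<le> c; c \<le> d; d \<le> b\<rbrakk> \<Longrightarrow> norm (w d - w c) \<le> K * norm (y d - y c) + M * norm (z d - z c)"
    and pos: "K > 0" "M > 0"
  shows "abs_cont_on a b w"
  unfolding abs_cont_on_def
proof (intro allI impI)
  fix e :: real assume e: "e > 0"
  have e1: "e / (2 * K) > 0" "e / (2 * M) > 0" using e pos by auto
  from ac(1)[unfolded abs_cont_on_def, THEN spec, THEN mp, OF e1(1)]
  obtain \<delta>1 where \<delta>1: "\<delta>1 > 0" "\<forall>(n::nat) c d.
        (\<forall>i<n. a \<le> c i \<and> c i \<le> d i \<and> d i \<le> b) \<and>
        (\<forall>i<n. \<forall>j<n. i \<noteq> j \<longrightarrow> {c i<..<d i} \<inter> {c j<..<d j} = {}) \<and>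
        (\<Sum>i<n. d i - c i) < \<delta>1 \<longrightarrow> (\<Sum>i<n. norm (y (d i) - y (c i))) < e / (2 * K)"
    by (elim exE conjE)
  from ac(2)[unfolded abs_cont_on_def, THEN spec, THEN mp, OF e1(2)]
  obtain \<delta>2 where \<delta>2: "\<delta>2 > 0" "\<forall>(n::nat) c d.
        (\<forall>i<n. a \<le> c i \<and> c i \<le> d i \<and> d i \<le> b) \<and>
        (\<forall>i<n. \<forall>j<n. i \<noteq> j \<longrightarrow> {c i<..<d i} \<inter> {c j<..<d j} = {}) \<and>
        (\<Sum>i<n. d i - c i) < \<delta>2 \<longrightarrow> (\<Sum>i<n. norm (z (d i) - z (c i))) < e / (2 * M)"
    by (elim exE conjE)
  show "\<exists>\<delta>>0. \<forall>(n::nat) c d.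
        (\<forall>i<n. a \<le> c i \<and> c i \<le> d i \<and> d i \<le> b) \<and>
        (\<forall>i<n. \<forall>j<n. i \<noteq> j \<longrightarrow> {c i<..<d i} \<inter> {c j<..<d j} = {}) \<and>
        (\<Sum>i<n. d i - c i) < \<delta> \<longrightarrow> (\<Sum>i<n. norm (w (d i) - w (c i))) < e"
  proof (intro exI[of _ "min \<delta>1 \<delta>2"] conjI allI impI)
    show "min \<delta>1 \<delta>2 > 0" using \<delta>1(1) \<delta>2(1) by simp
    fix n :: nat and c d
    assume H: "(\<forall>i<n. a \<le> c i \<and> c i \<le> d i \<and> d i \<le> b) \<and>
        (\<forall>i<n. \<forall>j<n. i \<noteq> j \<longrightarrow> {c i<..<d i} \<inter> {c j<..<d j} = {}) \<and>
        (\<Sum>i<n. d i - c i) < min \<delta>1 \<delta>2"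
    then have "(\<Sum>i<n. d i - c i) < \<delta>1" "(\<Sum>i<n. d i - c i) < \<delta>2" by simp_all
    with H \<delta>1(2) \<delta>2(2) have yz: "(\<Sum>i<n. norm (y (d i) - y (c i))) < e / (2 * K)"
        "(\<Sum>i<n. norm (z (d i) - z (c i))) < e / (2 * M)" by blast+
    have "(\<Sum>i<n. norm (w (d i) - w (c i))) \<le> (\<Sum>i<n. K * norm (y (d i) - y (c i)) + M * norm (z (d i) - z (c i)))"
      using H by (intro sum_mono L) auto
    also have "\<dots> = K * (\<Sum>i<n. norm (y (d i) - y (c i))) + M * (\<Sum>i<n. norm (z (d i) - z (c i)))"
      by (simp add: sum.distrib sum_distrib_left)
    also have "\<dots> < K * (e / (2 * K)) + M * (e / (2 * M))"
      by (intro add_strict_mono mult_strict_left_mono yz pos)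
    also have "\<dots> = e" using pos by simp
    finally show "(\<Sum>i<n. norm (w (d i) - w (c i))) < e" .
  qed
qed

lemma abs_cont_on_cinner:
  fixes y z :: "real \<Rightarrow> 'x::complex_inner"
  assumes y: "abs_cont_on a b y" and z: "abs_cont_on a b z"
  shows "abs_cont_on a b (\<lambda>t. cinner (y t) (z t))"
proof -
  have "bounded (y ` {a..b})" "bounded (z ` {a..b})"
    using y z by (intro compact_imp_bounded compact_continuous_image abs_cont_on_continuous; simp)+
  then obtain M N where "\<forall>x\<in>y ` {a..b}. norm x \<le> M" "\<forall>x\<in>z ` {a..b}. norm x \<le> N"
    unfolding bounded_iff by blast
  then have M: "norm (y t) \<le> M" "norm (z t) \<le> N" if "t \<in> {a..b}" for t using that by blast+
  have M': "norm (y t) \<le> \<bar>M\<bar> + 1" "norm (z t) \<le> \<bar>N\<bar> + 1" if "t \<in> {a..b}" for t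
    using M[OF that] by linarith+
  show ?thesis
  proof (rule abs_cont_on_Lipschitz_bound[OF y z, where K = "\<bar>N\<bar> + 1" and M = "\<bar>M\<bar> + 1"])
    fix c d assume cd: "a \<le> c" "c \<le> d" "d \<le> b"
    have "cinner (y d) (z d) - cinner (y c) (z c) = cinner (y d - y c) (z d) + cinner (y c) (z d - z c)"
      by (simp add: cinner_diff_left cinner_diff_right)
    then have "norm (cinner (y d) (z d) - cinner (y c) (z c))
        \<le> norm (cinner (y d - y c) (z d)) + norm (cinner (y c) (z d - z c))"
      using norm_triangle_ineq by simp
    also have "\<dots> \<le> norm (y d - y c) * norm (z d) + norm (y c) * norm (z d - z c)"
      by (intro add_mono norm_cinner_le)
    also have "\<dots> \<le> norm (y d - y c) * (\<bar>N\<bar> + 1) + (\<bar>M\<bar> + 1) * norm (z d - z c)"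
      using cd by (intro add_mono mult_left_mono mult_right_mono M') auto
    finally show "norm (cinner (y d) (z d) - cinner (y c) (z c))
        \<le> (\<bar>N\<bar> + 1) * norm (y d - y c) + (\<bar>M\<bar> + 1) * norm (z d - z c)"
      by (simp add: mult.commute)
  qed auto
qed

lemma set_integral_split:
  fixes f :: "real \<Rightarrow> 'x::{banach, second_countable_topology}"
  assumes f: "set_integrable lborel {r..t} f" and st: "r \<le> s" "s \<le> t"
  shows "(LBINT x:{r..t}. f x) = (LBINT x:{r..s}. f x) + (LBINT x:{s..t}. f x)"
proof -
  have i: "set_integrable lborel {r..s} f" "set_integrable lborel {s..t} f"
    by (rule set_integrable_subset[OF f]; use st in auto)+
  have "(LBINT x:{r..t}. f x) = (\<integral>x. indicator {r..s} x *\<^sub>R f x + indicator {s..t} x *\<^sub>R f x \<partial>lborel)"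
    unfolding set_lebesgue_integral_def
  proof (rule integral_cong_AE)
    show "AE x in lborel. indicator {r..t} x *\<^sub>R f x = indicator {r..s} x *\<^sub>R f x + indicator {s..t} x *\<^sub>R f x"
      using AE_lborel_singleton[of s] by eventually_elim (use st in \<open>auto simp: indicator_def\<close>)
  qed (use i f in \<open>auto simp: set_integrable_def\<close>)
  also have "\<dots> = (LBINT x:{r..s}. f x) + (LBINT x:{s..t}. f x)"
    unfolding set_lebesgue_integral_def using i by (intro Bochner_Integration.integral_add) (auto simp: set_integrable_def)
  finally show ?thesis .
qed

lemma AE_imp_negligible_exceptions:
  assumes "AE t in lborel. P t"
  obtains N where "negligible N" "\<And>t. t \<notin> N \<Longrightarrow> P t"
proof -
  from assms obtain N where N: "{t \<in> space lborel. \<not> P t} \<subseteq> N" "emeasure lborel N = 0" "N \<in> sets lborel"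
    by (rule AE_E)
  then have "N \<in> null_sets lebesgue" by (intro null_sets_completionI) auto
  then have "negligible N" by (simp add: negligible_iff_null_sets)
  with N(1) show ?thesis by (intro that[of N]) auto
qed

lemma negligible_imp_AE:
  assumes "negligible N"
  shows "AE t in lborel. t \<notin> N"
proof -
  have "N \<in> null_sets lebesgue" using assms by (simp add: negligible_iff_null_sets)
  then have "AE t in lebesgue. t \<notin> N" by (rule AE_not_in)
  then show ?thesis by (simp add: AE_completion_iff)
qed

lemma abs_cont_on_fundamental_theorem:
  fixes y g :: "real \<Rightarrow> complex"
  assumes st: "s \<le> t" "{s..t} \<subseteq> I" and ac: "abs_cont_on s t y"
    and der: "AE \<tau> in lborel. \<tau> \<in> I \<longrightarrow> (y has_vector_derivative g \<tau>) (at \<tau> within I)"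
    and int: "set_integrable lborel {s..t} g"
  shows "y t - y s = (LBINT \<tau>:{s..t}. g \<tau>)"
proof -
  obtain N where N: "negligible N" "\<And>\<tau>. \<tau> \<notin> N \<Longrightarrow> \<tau> \<in> I \<longrightarrow> (y has_vector_derivative g \<tau>) (at \<tau> within I)"
    using AE_imp_negligible_exceptions[OF der] by blast
  have "(g has_integral (y t - y s)) {s..t}"
    by (rule abs_cont_on_has_integral[OF st(1) ac N(1)])
       (use N(2) st(2) in \<open>blast intro: has_vector_derivative_within_subset\<close>)
  then show ?thesis
    using set_borel_integral_eq_integral(2)[OF int] by (simp add: integral_unique)
qed

lemma interval_from_exhaustion:
  assumes "interval_from a b I"
  shows "\<exists>c :: nat \<Rightarrow> real. mono c \<and> (\<forall>n. a < c n) \<and> (\<forall>n. ereal (c n) < b) \<and>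
    (\<forall>t. ereal t < b \<longrightarrow> (\<exists>n. t < c n))"
proof (cases b)
  case (real r)
  then have ar: "a < r" using assms by (simp add: interval_from_def)
  define c where "c n = r - (r - a) / (real n + 2)" for n :: nat
  show ?thesis
  proof (intro exI[of _ c] conjI allI impI)
    show "mono c" unfolding c_def using ar by (intro monoI diff_left_mono divide_left_mono) auto
    show "a < c n" for n
    proof -
      have "(r - a) / (real n + 2) < (r - a) / 1" using ar by (intro divide_strict_left_mono) auto
      then show ?thesis by (simp add: c_def)
    qed
    show "ereal (c n) < b" for n using ar by (simp add: c_def real)
    show "\<exists>n. t < c n" if "ereal t < b" for t
    proof -
      have "r - t > 0" using that by (simp add: real)
      then obtain n :: nat where n: "(r - a) / (r - t) < real n" using reals_Archimedean2 by blast
      then have "r - a < real n * (r - t)" using \<open>r - t > 0\<close> by (simp add: pos_divide_less_eq)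
      also have "\<dots> \<le> (r - t) * (real n + 2)"
        using \<open>r - t > 0\<close> by (simp add: algebra_simps)
      finally have "(r - a) / (real n + 2) < r - t" by (simp add: pos_divide_less_eq)
      then show ?thesis by (intro exI[of _ n]) (simp add: c_def)
    qed
  qed
next
  case PInf
  show ?thesis
  proof (intro exI[of _ "\<lambda>n. a + real n + 1"] conjI allI impI)
    show "\<exists>n. t < a + real n + 1" for t
    proof -
      obtain n :: nat where "t - a < real n" using reals_Archimedean2 by blast
      then show ?thesis by (intro exI[of _ n]) linarith
    qed
  qed (auto simp: PInf mono_def)
next
  case MInf
  then show ?thesis using assms by (simp add: interval_from_def)
qed

text \<open>Fields of linear maps with a locally integrable bound. The fields are taken to be defined on the
  whole line, which costs nothing as they can be cut off outside the interval.\<close>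

locale linear_flow =
  fixes a :: real and b :: ereal and I :: "real set"
    and A :: "real \<Rightarrow> 'x::fd_complex_hilbert \<Rightarrow> 'x" and \<alpha> :: "real \<Rightarrow> real"
  assumes interval: "interval_from a b I"
    and A_add: "A t (x + y) = A t x + A t y" and A_scale: "A t (c *\<^sub>C x) = c *\<^sub>C A t x"
    and A_measurable: "(\<lambda>t. A t x) \<in> borel_measurable borel"
    and A_bound: "norm (A t x) \<le> \<alpha> t * norm x" and \<alpha>_nonneg: "0 \<le> \<alpha> t"
    and \<alpha>_integrable: "\<beta> \<in> I \<Longrightarrow> set_integrable lborel {a..\<beta>} \<alpha>"
begin

lemma I_D: "t \<in> I \<Longrightarrow> a \<le> t" "\<lbrakk>t \<in> I; a \<le> s; s \<le> t\<rbrakk> \<Longrightarrow> s \<in> I" "a \<in> I"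
  using interval unfolding interval_from_def
  by (auto, (meson dual_order.trans order_le_less_trans ereal_less_eq(3))+)

lemma I_sub: "\<lbrakk>a \<le> s; t \<in> I\<rbrakk> \<Longrightarrow> {s..t} \<subseteq> I"
  using I_D by (meson atLeastAtMost_iff dual_order.trans subsetI)

lemma \<alpha>_int: "\<lbrakk>a \<le> s; t \<in> I\<rbrakk> \<Longrightarrow> set_integrable lborel {s..t} \<alpha>"
  by (rule set_integrable_subset[OF \<alpha>_integrable[of t]]) auto

lemma \<alpha>_integral_mono:
  assumes "a \<le> s" "q \<in> {s..t}" "t \<in> I"
  shows "(LBINT \<tau>:{s..q}. \<alpha> \<tau>) \<le> (LBINT \<tau>:{s..t}. \<alpha> \<tau>)"
proof -
  have "0 \<le> (LBINT \<tau>:{q..t}. \<alpha> \<tau>)"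
    unfolding set_lebesgue_integral_def by (rule integral_nonneg_AE) (simp add: \<alpha>_nonneg)
  then show ?thesis using set_integral_split[OF \<alpha>_int[OF assms(1,3)], of q] assms(2) by simp
qed

lemma A_sum: "A t (\<Sum>i\<in>S. f i) = (\<Sum>i\<in>S. A t (f i))"
proof (induction S rule: infinite_finite_induct)
  have "A t 0 = 0" using A_scale[of t 0 0] by simp
  case (infinite S) then show ?case using \<open>A t 0 = 0\<close> by simp
next
  case empty show ?case using A_scale[of t 0 0] by simp
qed (simp add: A_add)

lemma A_diff: "A t (x - y) = A t x - A t y"
  using A_add[of t "x - y" y] by simp

lemma A_expand: "A t x = (\<Sum>i<cDIM TYPE('x). cinner x (cbasis i) *\<^sub>C A t (cbasis i))"
proof -
  have "A t x = A t (\<Sum>i<cDIM TYPE('x). cinner x (cbasis i) *\<^sub>C cbasis i)" by (simp add: cbasis_expansion)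
  then show ?thesis by (simp add: A_sum A_scale)
qed

lemma A_comp_measurable:
  assumes u: "u \<in> borel_measurable borel"
  shows "(\<lambda>t. A t (u t)) \<in> borel_measurable borel"
proof -
  have "(\<lambda>t. cinner (u t) e) \<in> borel_measurable borel" for e
    by (rule borel_measurable_continuous_on[OF _ u])
       (simp add: linear_continuous_on cinner.bounded_linear_left)
  moreover have "continuous_on UNIV (\<lambda>p. fst p *\<^sub>C snd p :: 'x)"
    by (intro scaleC.continuous_on continuous_intros)
  ultimately have "(\<lambda>t. cinner (u t) (cbasis i) *\<^sub>C A t (cbasis i)) \<in> borel_measurable borel" for i
    using borel_measurable_continuous_on[OF _ borel_measurable_Pair[OF _ A_measurable],
      of "\<lambda>p. fst p *\<^sub>C snd p" "\<lambda>t. cinner (u t) (cbasis i)"] by simp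
  then show ?thesis unfolding A_expand[of _ "u _"] by (intro borel_measurable_sum)
qed

lemma A_comp_integrable:
  assumes st: "a \<le> s" "t \<in> I" and u: "continuous_on {s..t} u"
  shows "set_integrable lborel {s..t} (\<lambda>\<tau>. A \<tau> (u \<tau>))"
proof -
  have "bounded (u ` {s..t})"
    using u by (intro compact_imp_bounded compact_continuous_image) auto
  then obtain M where "\<forall>x\<in>u ` {s..t}. norm x \<le> M" unfolding bounded_iff by blast
  then have M: "norm (u \<tau>) \<le> M" if "\<tau> \<in> {s..t}" for \<tau> using that by blast
  define v where "v \<tau> = indicator {s..t} \<tau> *\<^sub>R u \<tau>" for \<tau> :: real
  have v: "v \<in> borel_measurable borel"
    unfolding v_def[abs_def] by (rule borel_measurable_continuous_on_indicator) (use u in auto)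
  show ?thesis
  proof (rule set_integrable_bound[where f = "\<lambda>\<tau>. \<bar>M\<bar> * \<alpha> \<tau>"])
    show "set_integrable lborel {s..t} (\<lambda>\<tau>. \<bar>M\<bar> * \<alpha> \<tau>)" using \<alpha>_int[OF st] by auto
    have "(\<lambda>\<tau>. indicator {s..t} \<tau> *\<^sub>R A \<tau> (u \<tau>)) = (\<lambda>\<tau>. indicator {s..t} \<tau> *\<^sub>R A \<tau> (v \<tau>))"
      by (auto simp: fun_eq_iff v_def indicator_def)
    also have "\<dots> \<in> borel_measurable borel" using A_comp_measurable[OF v] by measurable
    finally show "set_borel_measurable lborel {s..t} (\<lambda>\<tau>. A \<tau> (u \<tau>))" by (simp add: set_borel_measurable_def)
    show "AE x in lborel. x \<in> {s..t} \<longrightarrow> norm (A x (u x)) \<le> norm (\<bar>M\<bar> * \<alpha> x)"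
    proof (intro AE_I2 impI)
      fix x assume "x \<in> {s..t}"
      have "norm (A x (u x)) \<le> \<alpha> x * norm (u x)" by (rule A_bound)
      also have "\<dots> \<le> \<alpha> x * \<bar>M\<bar>" using M[OF \<open>x \<in> {s..t}\<close>] \<alpha>_nonneg by (intro mult_left_mono) auto
      finally show "norm (A x (u x)) \<le> norm (\<bar>M\<bar> * \<alpha> x)" using \<alpha>_nonneg[of x] by (simp add: abs_mult mult.commute)
    qed
  qed
qed

lemma A_comp_integral_bound:
  assumes st: "a \<le> s" "t \<in> I" and u: "continuous_on {s..t} u" and M: "\<And>\<tau>. \<tau> \<in> {s..t} \<Longrightarrow> norm (u \<tau>) \<le> M"
  shows "norm (LBINT \<tau>:{s..t}. A \<tau> (u \<tau>)) \<le> M * (LBINT \<tau>:{s..t}. \<alpha> \<tau>)"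
proof -
  have "norm (LBINT \<tau>:{s..t}. A \<tau> (u \<tau>)) \<le> (LBINT \<tau>:{s..t}. norm (A \<tau> (u \<tau>)))"
    by (rule set_integral_norm_bound[OF A_comp_integrable[OF st u]])
  also have "\<dots> \<le> (LBINT \<tau>:{s..t}. M * \<alpha> \<tau>)"
  proof (rule set_integral_mono)
    show "set_integrable lborel {s..t} (\<lambda>\<tau>. norm (A \<tau> (u \<tau>)))"
      by (rule set_integrable_norm[OF A_comp_integrable[OF st u]])
    show "set_integrable lborel {s..t} (\<lambda>\<tau>. M * \<alpha> \<tau>)" using \<alpha>_int[OF st] by auto
    fix x assume "x \<in> {s..t}"
    have "norm (A x (u x)) \<le> \<alpha> x * norm (u x)" by (rule A_bound)
    also have "\<dots> \<le> \<alpha> x * M" using M[OF \<open>x \<in> {s..t}\<close>] \<alpha>_nonneg by (intro mult_left_mono) auto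
    finally show "norm (A x (u x)) \<le> M * \<alpha> x" by (simp add: mult.commute)
  qed
  finally show ?thesis by simp
qed

lemma A_integral_abs_cont:
  assumes st: "a \<le> s" "t \<in> I" and u: "continuous_on {s..t} u"
  shows "abs_cont_on s t (\<lambda>r. x + (LBINT \<tau>:{s..r}. A \<tau> (u \<tau>)))"
proof -
  note int = A_comp_integrable[OF st u]
  show ?thesis
  proof (rule abs_cont_onI_integrable[where \<phi> = "\<lambda>\<tau>. norm (A \<tau> (u \<tau>))"])
    show "set_integrable lborel {s..t} (\<lambda>\<tau>. norm (A \<tau> (u \<tau>)))" by (rule set_integrable_norm[OF int])
    fix c d assume cd: "s \<le> c" "c \<le> d" "d \<le> t"
    have i: "set_integrable lborel {s..d} (\<lambda>\<tau>. A \<tau> (u \<tau>))" "set_integrable lborel {c..d} (\<lambda>\<tau>. A \<tau> (u \<tau>))"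
      by (rule set_integrable_subset[OF int]; use cd in auto)+
    show "norm (x + (LBINT \<tau>:{s..d}. A \<tau> (u \<tau>)) - (x + (LBINT \<tau>:{s..c}. A \<tau> (u \<tau>))))
        \<le> (LBINT \<tau>:{c..d}. norm (A \<tau> (u \<tau>)))"
      using set_integral_norm_bound[OF i(2)] set_integral_split[OF i(1) cd(1,2)] by simp
  qed auto
qed

text \<open>The differential equation \<open>u' = A u\<close> is treated in its integrated form, which needs no
  exceptional set.\<close>

definition sol :: "real \<Rightarrow> real \<Rightarrow> 'x \<Rightarrow> (real \<Rightarrow> 'x) \<Rightarrow> bool"
  where "sol s t x u \<longleftrightarrow> continuous_on {s..t} u \<and> (\<forall>r\<in>{s..t}. u r = x + (LBINT \<tau>:{s..r}. A \<tau> (u \<tau>)))"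

lemma sol_continuous: "sol s t x u \<Longrightarrow> continuous_on {s..t} u"
  unfolding sol_def by (rule conjunct1)

lemma sol_eq: "\<lbrakk>sol s t x u; r \<in> {s..t}\<rbrakk> \<Longrightarrow> u r = x + (LBINT \<tau>:{s..r}. A \<tau> (u \<tau>))"
  unfolding sol_def by (elim conjE) (rule bspec)

lemma solI: "\<lbrakk>continuous_on {s..t} u; \<And>r. r \<in> {s..t} \<Longrightarrow> u r = x + (LBINT \<tau>:{s..r}. A \<tau> (u \<tau>))\<rbrakk> \<Longrightarrow> sol s t x u"
  unfolding sol_def by (intro conjI ballI)

lemma sol_cong:
  assumes "sol s t x u" "\<And>r. r \<in> {s..t} \<Longrightarrow> u r = v r"
  shows "sol s t x v"
proof -
  have "continuous_on {s..t} u" using assms(1) by (rule sol_continuous)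
  then have "continuous_on {s..t} v" by (rule continuous_on_eq[OF _ assms(2)])
  moreover have "v r = x + (LBINT \<tau>:{s..r}. A \<tau> (v \<tau>))" if "r \<in> {s..t}" for r
  proof -
    have "(LBINT \<tau>:{s..r}. A \<tau> (u \<tau>)) = (LBINT \<tau>:{s..r}. A \<tau> (v \<tau>))"
      by (rule set_lebesgue_integral_cong) (use assms(2) that in auto)
    then show ?thesis using sol_eq[OF assms(1) that] assms(2)[OF that] by (simp only:)
  qed
  ultimately show ?thesis by (rule solI)
qed

lemma sol_restrict:
  assumes u: "sol s t x u" and st: "a \<le> s" "s \<le> r" "r \<le> t" "t \<in> I"
  shows "sol s r x u" "sol r t (u r) u"
proof -
  have c: "continuous_on {s..t} u" using u by (rule sol_continuous)
  have c1: "continuous_on {s..r} u" "continuous_on {r..t} u"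
    by (rule continuous_on_subset[OF c]; use st in auto)+
  show "sol s r x u" by (rule solI[OF c1(1) sol_eq[OF u]]) (use st in auto)
  have "u q = u r + (LBINT \<tau>:{r..q}. A \<tau> (u \<tau>))" if "q \<in> {r..t}" for q
  proof -
    have "set_integrable lborel {s..q} (\<lambda>\<tau>. A \<tau> (u \<tau>))"
      by (rule set_integrable_subset[OF A_comp_integrable[OF st(1,4) c]]) (use that in auto)
    from set_integral_split[OF this, of r]
    have "(LBINT \<tau>:{s..q}. A \<tau> (u \<tau>)) = (LBINT \<tau>:{s..r}. A \<tau> (u \<tau>)) + (LBINT \<tau>:{r..q}. A \<tau> (u \<tau>))"
      using that st by auto
    moreover have "u q = x + (LBINT \<tau>:{s..q}. A \<tau> (u \<tau>))" "u r = x + (LBINT \<tau>:{s..r}. A \<tau> (u \<tau>))"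
      by (rule sol_eq[OF u]; use that st in auto)+
    ultimately show ?thesis by (metis add.assoc)
  qed
  with c1(2) show "sol r t (u r) u" by (rule solI)
qed

lemma sol_paste:
  assumes u: "sol s r x u" "sol r t (u r) u" and st: "a \<le> s" "s \<le> r" "r \<le> t" "t \<in> I"
  shows "sol s t x u"
proof -
  have "{s..t} = {s..r} \<union> {r..t}" using st by auto
  moreover have "continuous_on ({s..r} \<union> {r..t}) u"
    by (rule continuous_on_closed_Un[OF _ _ sol_continuous[OF u(1)] sol_continuous[OF u(2)]]) auto
  ultimately have c: "continuous_on {s..t} u" by simp
  have "u q = x + (LBINT \<tau>:{s..q}. A \<tau> (u \<tau>))" if q: "q \<in> {s..t}" for q
  proof (cases "q \<le> r")
    case True
    then show ?thesis by (intro sol_eq[OF u(1)]) (use q in auto)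
  next
    case False
    have "set_integrable lborel {s..q} (\<lambda>\<tau>. A \<tau> (u \<tau>))"
      by (rule set_integrable_subset[OF A_comp_integrable[OF st(1,4) c]]) (use q in auto)
    from set_integral_split[OF this, of r]
    have "(LBINT \<tau>:{s..q}. A \<tau> (u \<tau>)) = (LBINT \<tau>:{s..r}. A \<tau> (u \<tau>)) + (LBINT \<tau>:{r..q}. A \<tau> (u \<tau>))"
      using False st by auto
    moreover have "u q = u r + (LBINT \<tau>:{r..q}. A \<tau> (u \<tau>))"
      by (rule sol_eq[OF u(2)]) (use q False in auto)
    moreover have "u r = x + (LBINT \<tau>:{s..r}. A \<tau> (u \<tau>))"
      by (rule sol_eq[OF u(1)]) (use st in auto)
    ultimately show ?thesis by (metis add.assoc)
  qed
  with c show ?thesis by (rule solI)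
qed

text \<open>Over an interval on which the coefficient has integral at most \<open>1/2\<close>, the integral operator is a
  contraction of the bounded continuous functions. These live on the whole line, whence the
  clamping of the argument to the interval.\<close>

lemma local_solution_ex:
  assumes st: "a \<le> s" "s \<le> t" "t \<in> I" and small: "(LBINT \<tau>:{s..t}. \<alpha> \<tau>) \<le> 1/2"
  shows "\<exists>u. sol s t x u"
proof -
  define cl where "cl r = max s (min t r)" for r
  have cl: "cl r \<in> {s..t}" for r using st by (auto simp: cl_def)
  have cl_id: "cl r = r" if "r \<in> {s..t}" for r using that by (auto simp: cl_def)
  have cont_cl: "continuous_on UNIV cl" unfolding cl_def by (intro continuous_intros)
  define F where "F (u :: real \<Rightarrow>\<^sub>C 'x) r = x + (LBINT \<tau>:{s..cl r}. A \<tau> (apply_bcontfun u \<tau>))" for u r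
  have cu: "continuous_on S (apply_bcontfun u)" for S and u :: "real \<Rightarrow>\<^sub>C 'x" by simp
  have F: "F u \<in> bcontfun" for u
  proof -
    have c: "continuous_on {s..t} (\<lambda>r. x + (LBINT \<tau>:{s..r}. A \<tau> (apply_bcontfun u \<tau>)))"
      by (rule abs_cont_on_continuous[OF A_integral_abs_cont[OF st(1,3) cu]])
    have "continuous_on UNIV (F u)"
      unfolding F_def by (rule continuous_on_compose2[OF c cont_cl]) (use cl in auto)
    moreover have "bounded ((\<lambda>r. x + (LBINT \<tau>:{s..r}. A \<tau> (apply_bcontfun u \<tau>))) ` {s..t})"
      using c by (intro compact_imp_bounded compact_continuous_image) auto
    then obtain M where "\<forall>z\<in>(\<lambda>r. x + (LBINT \<tau>:{s..r}. A \<tau> (apply_bcontfun u \<tau>))) ` {s..t}. norm z \<le> M"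
      unfolding bounded_iff by blast
    then have "norm (F u r) \<le> M" for r unfolding F_def using cl[of r] by blast
    ultimately show ?thesis by (rule bcontfun_normI)
  qed
  define T where "T u = Bcontfun (F u)" for u
  have T: "apply_bcontfun (T u) = F u" for u unfolding T_def using F by (simp add: Bcontfun_inverse)
  have "dist (T u) (T v) \<le> 1/2 * dist u v" for u v
  proof (rule dist_bound)
    fix r
    let ?q = "cl r"
    have q: "?q \<in> {s..t}" by (rule cl)
    have qI: "?q \<in> I" using I_sub[OF st(1,3)] q by blast
    have i: "set_integrable lborel {s..?q} (\<lambda>\<tau>. A \<tau> (apply_bcontfun u \<tau>))" for u
      by (rule A_comp_integrable[OF st(1) qI cu])
    have "apply_bcontfun (T u) r - apply_bcontfun (T v) r
        = (LBINT \<tau>:{s..?q}. A \<tau> (apply_bcontfun u \<tau> - apply_bcontfun v \<tau>))"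
      unfolding T F_def A_diff using set_integral_diff(2)[OF i i] by simp
    also have "norm \<dots> \<le> dist u v * (LBINT \<tau>:{s..?q}. \<alpha> \<tau>)"
    proof (rule A_comp_integral_bound[OF st(1) qI])
      show "norm (apply_bcontfun u \<tau> - apply_bcontfun v \<tau>) \<le> dist u v" for \<tau>
        using dist_bounded[of u \<tau> v] by (simp add: dist_norm)
    qed (intro continuous_intros cu)
    also have "(LBINT \<tau>:{s..?q}. \<alpha> \<tau>) \<le> (LBINT \<tau>:{s..t}. \<alpha> \<tau>)"
      by (rule \<alpha>_integral_mono[OF st(1) q st(3)])
    also have "dist u v * (LBINT \<tau>:{s..t}. \<alpha> \<tau>) \<le> dist u v * (1/2)"
      using small by (intro mult_left_mono) auto
    finally show "dist (apply_bcontfun (T u) r) (apply_bcontfun (T v) r) \<le> 1/2 * dist u v"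
      by (simp add: dist_norm mult_left_mono)
  qed
  then have "\<exists>!u. T u = u" by (intro banach_fix_type[of "1/2"]) auto
  then obtain u where u: "T u = u" by blast
  have "sol s t x (apply_bcontfun u)"
  proof (rule solI[OF cu])
    fix r assume "r \<in> {s..t}"
    then show "apply_bcontfun u r = x + (LBINT \<tau>:{s..r}. A \<tau> (apply_bcontfun u \<tau>))"
      using fun_cong[OF T[of u], of r] cl_id[of r] unfolding u F_def by (simp only:)
  qed
  then show ?thesis by blast
qed

text \<open>The difference of two solutions is bounded at its maximum by half of itself.\<close>

lemma local_solution_unique:
  assumes st: "a \<le> s" "s \<le> t" "t \<in> I" and small: "(LBINT \<tau>:{s..t}. \<alpha> \<tau>) \<le> 1/2"
    and uv: "sol s t x u" "sol s t x v" and r: "r \<in> {s..t}"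
  shows "u r = v r"
proof -
  define w where "w r = u r - v r" for r
  have c: "continuous_on {s..t} u" "continuous_on {s..t} v" by (rule sol_continuous[OF uv(1)], rule sol_continuous[OF uv(2)])
  then have cw: "continuous_on {s..t} w" unfolding w_def by (intro continuous_intros)
  then have "continuous_on {s..t} (\<lambda>r. norm (w r))" by (intro continuous_intros)
  then obtain m where m: "m \<in> {s..t}" "\<And>r. r \<in> {s..t} \<Longrightarrow> norm (w r) \<le> norm (w m)"
    using continuous_attains_sup[of "{s..t}" "\<lambda>r. norm (w r)"] st by auto
  have mI: "m \<in> I" using I_sub[OF st(1,3)] m by blast
  have cm: "continuous_on {s..m} f" if "continuous_on {s..t} f" for f :: "real \<Rightarrow> 'x"
    by (rule continuous_on_subset[OF that]) (use m in auto)
  have "w m = (LBINT \<tau>:{s..m}. A \<tau> (w \<tau>))"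
    unfolding w_def A_diff
      set_integral_diff(2)[OF A_comp_integrable[OF st(1) mI cm[OF c(1)]] A_comp_integrable[OF st(1) mI cm[OF c(2)]]]
    by (subst sol_eq[OF uv(1) m(1)], subst sol_eq[OF uv(2) m(1)]) simp
  also have "norm \<dots> \<le> norm (w m) * (LBINT \<tau>:{s..m}. \<alpha> \<tau>)"
    by (rule A_comp_integral_bound[OF st(1) mI cm[OF cw]]) (use m in auto)
  also have "(LBINT \<tau>:{s..m}. \<alpha> \<tau>) \<le> (LBINT \<tau>:{s..t}. \<alpha> \<tau>)"
    by (rule \<alpha>_integral_mono[OF st(1) m(1) st(3)])
  also have "norm (w m) * (LBINT \<tau>:{s..t}. \<alpha> \<tau>) \<le> norm (w m) * (1/2)"
    using small by (intro mult_left_mono) auto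
  finally have "norm (w m) \<le> norm (w m) * (1/2)" by (simp add: mult_left_mono)
  then have "norm (w m) = 0" using norm_ge_zero[of "w m"] by linarith
  with m(2)[OF r] show ?thesis by (simp add: w_def)
qed

text \<open>Bisection: short intervals carry a small integral of the coefficient, and existence and
  uniqueness for all initial values pass from two adjacent intervals to their union.\<close>

lemma solution_ex_unique:
  assumes "\<beta> \<in> I"
  shows "\<exists>u. sol a \<beta> x u" "\<lbrakk>sol a \<beta> x u; sol a \<beta> x v; r \<in> {a..\<beta>}\<rbrakk> \<Longrightarrow> u r = v r"
proof -
  have ab: "a \<le> \<beta>" using I_D assms by blast
  define P where "P s t \<longleftrightarrow> a \<le> s \<longrightarrow> s \<le> t \<longrightarrow> t \<le> \<beta> \<longrightarrow> (\<forall>x. \<exists>u. sol s t x u) \<and>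
      (\<forall>x u v. sol s t x u \<longrightarrow> sol s t x v \<longrightarrow> (\<forall>r\<in>{s..t}. u r = v r))" for s t
  have tI: "t \<in> I" if "a \<le> t" "t \<le> \<beta>" for t using I_D assms that by blast
  have "P a \<beta>"
  proof (rule Bolzano[OF ab])
    fix s r t assume P: "P s r" "P r t" and st: "s \<le> r" "r \<le> t"
    show "P s t"
      unfolding P_def
    proof (intro impI conjI allI ballI)
      assume as: "a \<le> s" "t \<le> \<beta>"
      then have tI': "t \<in> I" using tI st by auto
      have P1: "\<forall>x. \<exists>u. sol s r x u" "\<forall>x u v. sol s r x u \<longrightarrow> sol s r x v \<longrightarrow> (\<forall>q\<in>{s..r}. u q = v q)"
        and P2: "\<forall>x. \<exists>u. sol r t x u" "\<forall>x u v. sol r t x u \<longrightarrow> sol r t x v \<longrightarrow> (\<forall>q\<in>{r..t}. u q = v q)"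
        using P as st unfolding P_def by auto
      {
        fix x
        obtain u1 where u1: "sol s r x u1" using P1 by blast
        obtain u2 where u2: "sol r t (u1 r) u2" using P2 by blast
        define u where "u q = (if q \<le> r then u1 q else u2 q)" for q
        have 1: "sol s r x u" by (rule sol_cong[OF u1]) (simp add: u_def)
        have "u2 r = u1 r"
        proof -
          have "u2 r = u1 r + (LBINT \<tau>:{r..r}. A \<tau> (u2 \<tau>))" by (rule sol_eq[OF u2]) (use st in auto)
          also have "(LBINT \<tau>:{r..r}. A \<tau> (u2 \<tau>)) = 0"
            unfolding set_lebesgue_integral_def
            by (rule integral_eq_zero_AE) (use AE_lborel_singleton[of r] in \<open>eventually_elim, auto\<close>)
          finally show ?thesis by simp
        qed
        then have "sol r t (u1 r) u"
          by (intro sol_cong[OF u2]) (auto simp: u_def)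
        then have "sol r t (u r) u" by (simp add: u_def)
        then show "\<exists>u. sol s t x u" using sol_paste[OF 1 _ as(1) st tI'] by blast
      }
      {
        fix x u v q assume u: "sol s t x u" and v: "sol s t x v" and q: "q \<in> {s..t}"
        have e: "\<forall>q\<in>{s..r}. u q = v q"
          using P1(2) sol_restrict(1)[OF u as(1) st tI'] sol_restrict(1)[OF v as(1) st tI'] by blast
        then have "u r = v r" using st by simp
        then have "\<forall>q\<in>{r..t}. u q = v q"
          using P2(2) sol_restrict(2)[OF u as(1) st tI'] sol_restrict(2)[OF v as(1) st tI'] by metis
        with e show "u q = v q" using q by (cases "q \<le> r") auto
      }
    qed
  next
    fix x assume x: "a \<le> x" "x \<le> \<beta>"
    have ac: "abs_cont_on a \<beta> (\<lambda>r. LBINT \<tau>:{a..r}. \<alpha> \<tau>)"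
    proof (rule abs_cont_onI_integrable[OF \<alpha>_int[OF order_refl assms] \<alpha>_nonneg])
      fix c d assume cd: "a \<le> c" "c \<le> d" "d \<le> \<beta>"
      have "0 \<le> (LBINT \<tau>:{c..d}. \<alpha> \<tau>)" unfolding set_lebesgue_integral_def by (rule integral_nonneg_AE) (simp add: \<alpha>_nonneg)
      then show "norm ((LBINT \<tau>:{a..d}. \<alpha> \<tau>) - (LBINT \<tau>:{a..c}. \<alpha> \<tau>)) \<le> (LBINT \<tau>:{c..d}. \<alpha> \<tau>)"
        using set_integral_split[OF \<alpha>_int[OF order_refl], of d c] cd tI by simp
    qed
    from ac[unfolded abs_cont_on_def, THEN spec, THEN mp, of "1/2"]
    obtain \<delta> where \<delta>: "\<delta> > 0" "\<forall>(n::nat) c d.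
          (\<forall>i<n. a \<le> c i \<and> c i \<le> d i \<and> d i \<le> \<beta>) \<and>
          (\<forall>i<n. \<forall>j<n. i \<noteq> j \<longrightarrow> {c i<..<d i} \<inter> {c j<..<d j} = {}) \<and>
          (\<Sum>i<n. d i - c i) < \<delta> \<longrightarrow>
          (\<Sum>i<n. norm ((LBINT \<tau>:{a..d i}. \<alpha> \<tau>) - (LBINT \<tau>:{a..c i}. \<alpha> \<tau>))) < 1/2"
      by auto
    show "\<exists>d>0. \<forall>s t. s \<le> x \<and> x \<le> t \<and> t - s < d \<longrightarrow> P s t"
    proof (intro exI[of _ \<delta>] conjI \<delta>(1) allI impI)
      fix s t assume st: "s \<le> x \<and> x \<le> t \<and> t - s < \<delta>"
      have "(LBINT \<tau>:{s..t}. \<alpha> \<tau>) \<le> 1/2" if "a \<le> s" "s \<le> t" "t \<le> \<beta>"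
      proof -
        have "norm ((LBINT \<tau>:{a..t}. \<alpha> \<tau>) - (LBINT \<tau>:{a..s}. \<alpha> \<tau>)) < 1/2"
          using \<delta>(2)[THEN spec[of _ 1], THEN spec[of _ "\<lambda>_. s"], THEN spec[of _ "\<lambda>_. t"]] that st by simp
        then show ?thesis
          using set_integral_split[OF \<alpha>_int[OF order_refl], of t s] that tI by simp
      qed
      then show "P s t"
        unfolding P_def
      proof (intro impI conjI allI ballI)
        assume H: "\<lbrakk>a \<le> s; s \<le> t; t \<le> \<beta>\<rbrakk> \<Longrightarrow> (LBINT \<tau>:{s..t}. \<alpha> \<tau>) \<le> 1/2" and as: "a \<le> s" "s \<le> t" "t \<le> \<beta>"
        have tI': "t \<in> I" by (rule tI) (use as in auto)
        show "\<exists>u. sol s t x u" for x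
          by (rule local_solution_ex[OF as(1,2) tI' H[OF as]])
        show "u r = v r" if "sol s t x u" "sol s t x v" "r \<in> {s..t}" for x u v r
          by (rule local_solution_unique[OF as(1,2) tI' H[OF as] that])
      qed
    qed
  qed
  then show "\<exists>u. sol a \<beta> x u" "\<lbrakk>sol a \<beta> x u; sol a \<beta> x v; r \<in> {a..\<beta>}\<rbrakk> \<Longrightarrow> u r = v r"
    unfolding P_def using ab by blast+
qed

lemma global_solution:
  obtains u where "\<And>t. t \<notin> I \<Longrightarrow> u t = 0" "\<And>\<beta>. \<beta> \<in> I \<Longrightarrow> sol a \<beta> x u"
proof -
  have "\<forall>\<beta>. \<exists>u. \<beta> \<in> I \<longrightarrow> sol a \<beta> x u" using solution_ex_unique(1) by blast
  from choice[OF this] obtain w where w: "\<And>\<beta>. \<beta> \<in> I \<Longrightarrow> sol a \<beta> x (w \<beta>)" by blast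
  define u where "u t = (if t \<in> I then w t t else 0)" for t
  show ?thesis
  proof (rule that[of u])
    show "sol a \<beta> x u" if \<beta>: "\<beta> \<in> I" for \<beta>
    proof (rule sol_cong[OF w[OF \<beta>]])
      fix r assume r: "r \<in> {a..\<beta>}"
      have rI: "r \<in> I" using I_D(2)[OF \<beta>] r by simp
      have "sol a r x (w \<beta>)" by (rule sol_restrict(1)[OF w[OF \<beta>]]) (use r \<beta> in auto)
      from solution_ex_unique(2)[OF rI this w[OF rI], of r] show "w \<beta> r = u r" using r rI by (simp add: u_def)
    qed
  qed (simp add: u_def)
qed

lemma solution_at_start: "sol a \<beta> x u \<Longrightarrow> a \<le> \<beta> \<Longrightarrow> u a = x"
proof -
  assume u: "sol a \<beta> x u" "a \<le> \<beta>"
  have "(LBINT \<tau>:{a..a}. A \<tau> (u \<tau>)) = 0"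
    unfolding set_lebesgue_integral_def
    by (rule integral_eq_zero_AE) (use AE_lborel_singleton[of a] in \<open>eventually_elim, auto\<close>)
  moreover have "u a = x + (LBINT \<tau>:{a..a}. A \<tau> (u \<tau>))" by (rule sol_eq[OF u(1)]) (use u(2) in auto)
  ultimately show ?thesis by simp
qed

lemma solution_in_AC:
  assumes "\<And>t. t \<notin> I \<Longrightarrow> u t = 0" "\<And>\<beta>. \<beta> \<in> I \<Longrightarrow> sol a \<beta> x u"
  shows "u \<in> AC a I"
  unfolding AC_def
proof (intro CollectI conjI ballI)
  fix \<beta> assume \<beta>: "\<beta> \<in> I"
  have ac: "abs_cont_on a \<beta> (\<lambda>r. x + (LBINT \<tau>:{a..r}. A \<tau> (u \<tau>)))" (is "abs_cont_on _ _ ?v")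
    by (rule A_integral_abs_cont[OF order_refl \<beta> sol_continuous[OF assms(2)[OF \<beta>]]])
  show "abs_cont_on a \<beta> u"
  proof (rule abs_cont_on_Lipschitz_bound[OF ac ac, where K=1 and M=1])
    fix c d assume "a \<le> c" "c \<le> d" "d \<le> \<beta>"
    then have "u d = ?v d" "u c = ?v c" by (auto intro!: sol_eq[OF assms(2)[OF \<beta>]])
    then show "norm (u d - u c) \<le> 1 * norm (?v d - ?v c) + 1 * norm (?v d - ?v c)"
      by (simp only: mult_1 norm_ge_zero le_add_same_cancel1)
  qed auto
qed (use assms(1) in blast)

text \<open>The components of a solution in an orthonormal basis are integrals, so they are differentiable
  almost everywhere on each interval of a countable exhaustion.\<close>

lemma solution_derivative:
  assumes u: "\<And>\<beta>. \<beta> \<in> I \<Longrightarrow> sol a \<beta> x u"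
  shows "AE t in lborel. t \<in> I \<longrightarrow> (u has_vector_derivative A t (u t)) (at t within I)"
proof -
  obtain c :: "nat \<Rightarrow> real" where c: "mono c" "\<And>n. a < c n" "\<And>n. ereal (c n) < b" "\<And>t. ereal t < b \<Longrightarrow> \<exists>n. t < c n"
    using interval_from_exhaustion[OF interval] by blast
  have cI: "c n \<in> I" for n using interval c(2,3)[of n] unfolding interval_from_def by (auto intro: less_imp_le)
  let ?f = "\<lambda>i t. cinner (A t (u t)) (cbasis i)"
  let ?U = "\<lambda>i t. cinner (u t) (cbasis i)"
  have 1: "AE t in lborel. t \<in> {a..c n} \<longrightarrow> (?U i has_vector_derivative ?f i t) (at t within {a..c n})" for i n
  proof -
    note s = u[OF cI[of n]]
    have si: "set_integrable lborel {a..c n} (\<lambda>t. A t (u t))"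
      by (rule A_comp_integrable[OF order_refl cI[of n] sol_continuous[OF s]])
    have bl: "bounded_linear (\<lambda>x::'x. cinner x (cbasis i))" by (rule cinner.bounded_linear_left)
    have si': "set_integrable lborel {a..r} (?f i)"
      and eq: "?U i r = cinner x (cbasis i) + integral {a..r} (?f i)" if "r \<in> {a..c n}" for r
    proof -
      have sr: "set_integrable lborel {a..r} (\<lambda>t. A t (u t))"
        by (rule set_integrable_subset[OF si]) (use that in auto)
      from integrable_bounded_linear[OF bl sr[unfolded set_integrable_def]]
      show i: "set_integrable lborel {a..r} (?f i)"
        by (simp add: set_integrable_def cinner_scaleR_left)
      have "cinner (LBINT t:{a..r}. A t (u t)) (cbasis i) = (LBINT t:{a..r}. ?f i t)"
        using integral_bounded_linear[OF bl sr[unfolded set_integrable_def]]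
        by (simp add: set_lebesgue_integral_def cinner_scaleR_left)
      then show "?U i r = cinner x (cbasis i) + integral {a..r} (?f i)"
        unfolding set_borel_integral_eq_integral(2)[OF i, symmetric]
        by (subst sol_eq[OF s that]) (simp only: cinner_add_left)
    qed
    have "?f i integrable_on {a..c n}"
      by (rule set_borel_integral_eq_integral(1)[OF si']) (use c(2)[of n] in auto)
    from negligible_imp_AE[OF integral_has_vector_derivative_AE[OF this]] show ?thesis
    proof eventually_elim
      case (elim t)
      show ?case
      proof
        assume t: "t \<in> {a..c n}"
        with elim have "((\<lambda>r. integral {a..r} (?f i)) has_vector_derivative ?f i t) (at t within {a..c n})" by blast
        then have "((\<lambda>r. cinner x (cbasis i) + integral {a..r} (?f i)) has_vector_derivative 0 + ?f i t) (at t within {a..c n})"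
          by (intro derivative_intros) 
        then show "(?U i has_vector_derivative ?f i t) (at t within {a..c n})"
          using has_vector_derivative_transform[OF t eq] by simp
      qed
    qed
  qed
  have "AE t in lborel. \<forall>n. \<forall>i. t \<in> {a..c n} \<longrightarrow> (?U i has_vector_derivative ?f i t) (at t within {a..c n})"
    unfolding AE_all_countable using 1 by blast
  moreover have "AE t in lborel. t \<noteq> real_of_ereal b" by (rule AE_lborel_singleton)
  ultimately show ?thesis
  proof eventually_elim
    case (elim t)
    show ?case
    proof
      assume t: "t \<in> I"
      have tb: "ereal t < b"
        using t elim(2) interval unfolding interval_from_def by (cases b) auto
      obtain n where n: "t < c n" using c(4)[OF tb] by blast
      have at: "at t within {a..c n} = at t within I"
        by (rule at_within_nhd[of t "{..<c n}"]) (use n I_sub[OF order_refl cI[of n]] I_D(1) in \<open>auto intro: less_imp_le\<close>)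
      have "(?U i has_vector_derivative ?f i t) (at t within I)" for i
        using elim(1) n I_D(1)[OF t] unfolding at[symmetric] by auto
      then have "((\<lambda>t. \<Sum>i<cDIM TYPE('x). ?U i t *\<^sub>C (cbasis i :: 'x)) has_vector_derivative (\<Sum>i<cDIM TYPE('x). ?f i t *\<^sub>C cbasis i)) (at t within I)"
        by (intro has_vector_derivative_sum bounded_linear.has_vector_derivative[OF scaleC.bounded_linear_left])
      then show "(u has_vector_derivative A t (u t)) (at t within I)" by (simp add: cbasis_expansion)
    qed
  qed
qed

text \<open>Converse to \<open>solution_derivative\<close>, by the fundamental theorem for each component.\<close>

lemma derivative_imp_solution:
  assumes y: "y \<in> AC a I" and der: "AE t in lborel. t \<in> I \<longrightarrow> (y has_vector_derivative A t (y t)) (at t within I)"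
    and \<beta>: "\<beta> \<in> I"
  shows "sol a \<beta> (y a) y"
proof -
  have ac: "abs_cont_on a \<beta> y" using y \<beta> by (simp add: AC_def)
  have cont: "continuous_on {a..\<beta>} y" by (rule abs_cont_on_continuous[OF ac])
  have "y r = y a + (LBINT \<tau>:{a..r}. A \<tau> (y \<tau>))" if r: "r \<in> {a..\<beta>}" for r
  proof -
    have si: "set_integrable lborel {a..r} (\<lambda>t. A t (y t))"
      by (rule set_integrable_subset[OF A_comp_integrable[OF order_refl \<beta> cont]]) (use r in auto)
    have "cinner (y r - (y a + (LBINT \<tau>:{a..r}. A \<tau> (y \<tau>)))) e = 0" for e
    proof -
      have bl: "bounded_linear (\<lambda>x::'x. cinner x e)" by (rule cinner.bounded_linear_left)
      have i: "set_integrable lborel {a..r} (\<lambda>t. cinner (A t (y t)) e)"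
        using integrable_bounded_linear[OF bl si[unfolded set_integrable_def]]
        by (simp add: set_integrable_def cinner_scaleR_left)
      have "cinner (y r) e - cinner (y a) e = (LBINT \<tau>:{a..r}. cinner (A \<tau> (y \<tau>)) e)"
      proof (rule abs_cont_on_fundamental_theorem[where I=I, OF _ _ _ _ i])
        show "{a..r} \<subseteq> I" using I_sub[OF order_refl \<beta>] r by auto
        have "abs_cont_on a r y" by (rule abs_cont_on_subset[OF ac]) (use r in auto)
        then show "abs_cont_on a r (\<lambda>t. cinner (y t) e)"
        proof (rule abs_cont_on_cinner)
          show "abs_cont_on a r (\<lambda>t. e)" by (auto simp: abs_cont_on_def intro: exI[of _ 1])
        qed
        show "AE \<tau> in lborel. \<tau> \<in> I \<longrightarrow> ((\<lambda>t. cinner (y t) e) has_vector_derivative cinner (A \<tau> (y \<tau>)) e) (at \<tau> within I)"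
          using der by eventually_elim (use bounded_linear.has_vector_derivative[OF bl] in blast)
      qed (use r in auto)
      also have "\<dots> = cinner (LBINT \<tau>:{a..r}. A \<tau> (y \<tau>)) e"
        using integral_bounded_linear[OF bl si[unfolded set_integrable_def]]
        by (simp add: set_lebesgue_integral_def cinner_scaleR_left)
      finally show ?thesis by (simp add: cinner_diff_left cinner_add_left algebra_simps)
    qed
    then show ?thesis using cinner_eq_zero_iff right_minus_eq by metis
  qed
  with cont show ?thesis by (rule solI)
qed

end

section \<open>Nonnegative operators and the matrix J\<close>

lemma J_add: "J (x + y) = J x + J y"
  by (simp add: J_def scaleC_add_right prod_eq_iff)

lemma J_scaleC: "J (c *\<^sub>C x) = c *\<^sub>C J x"
  by (simp add: J_def scaleC_prod_def prod_eq_iff scaleC_scaleC mult.commute)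

lemma J_J: "J (J x) = - x"
  by (simp add: J_def scaleC_scaleC prod_eq_iff)

lemma cinner_J_left: "cinner (J x) y = - cinner x (J y)"
  by (simp add: J_def cinner_prod_def cinner_scaleC_left cinner_scaleC_right)

lemma norm_J: "norm (J x) = norm x"
proof -
  have "cinner (J x) (J x) = cinner x x" by (simp add: cinner_J_left J_J)
  then have "complex_of_real ((norm (J x))\<^sup>2) = complex_of_real ((norm x)\<^sup>2)" by (simp only: cinner_self)
  then have "(norm (J x))\<^sup>2 = (norm x)\<^sup>2" using of_real_eq_iff by blast
  then show ?thesis by (simp add: power2_eq_iff_nonneg)
qed

lemma bounded_linear_J: "bounded_linear J"
proof
  show "J (r *\<^sub>R x) = r *\<^sub>R J x" for r x by (metis J_scaleC scaleC_of_real)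
  show "\<exists>K. \<forall>x. norm (J x) \<le> norm x * K" by (intro exI[of _ 1]) (simp add: norm_J)
qed (rule J_add)

lemma nonneg_op_hermitian:
  assumes T: "nonneg_op T" "clinear_op T"
  shows "cinner (blinfun_apply T x) y = cnj (cinner (blinfun_apply T y) x)"
proof -
  have im: "Im (cinner (blinfun_apply T z) z) = 0" for z
    using T(1) by (auto simp: nonneg_op_def complex_is_Real_iff)
  have lin: "blinfun_apply T (c *\<^sub>C z) = c *\<^sub>C blinfun_apply T z" for c z
    using T(2) by (simp add: clinear_op_def)
  have "Im (cinner (blinfun_apply T (x + y)) (x + y)) = 0" "Im (cinner (blinfun_apply T (x + \<i> *\<^sub>C y)) (x + \<i> *\<^sub>C y)) = 0"
    by (rule im)+
  then have "Im (cinner (blinfun_apply T x) y) + Im (cinner (blinfun_apply T y) x) = 0"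
    "Re (cinner (blinfun_apply T y) x) - Re (cinner (blinfun_apply T x) y) = 0"
    using im[of x] im[of y]
    by (simp_all add: blinfun.add_right lin cinner_add_left cinner_add_right cinner_scaleC_left cinner_scaleC_right)
  then show ?thesis by (simp add: complex_eq_iff)
qed

text \<open>Expand the nonnegative square of \<open>\<eta> c x + y\<close> for a unimodular \<open>c\<close> that turns the mixed term into
  minus its modulus.\<close>

lemma nonneg_op_Young:
  assumes T: "nonneg_op T" "clinear_op T" and \<eta>: "\<eta> > 0"
  shows "2 * norm (cinner (blinfun_apply T x) y)
    \<le> \<eta> * Re (cinner (blinfun_apply T x) x) + (1 / \<eta>) * Re (cinner (blinfun_apply T y) y)"
proof -
  let ?z = "cinner (blinfun_apply T x) y"
  have lin: "blinfun_apply T (c *\<^sub>C z) = c *\<^sub>C blinfun_apply T z" for c z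
    using T(2) by (simp add: clinear_op_def)
  obtain c where c: "norm c = 1" "c * ?z = - complex_of_real (norm ?z)"
  proof (cases "?z = 0")
    case True
    then show ?thesis using that[of 1] by simp
  next
    case False
    show ?thesis
    proof (rule that[of "- cnj ?z / norm ?z"])
      show "norm (- cnj ?z / norm ?z) = 1" using False by (simp add: norm_divide)
      show "- cnj ?z / norm ?z * ?z = - complex_of_real (norm ?z)"
        using False complex_norm_square[of ?z] by (simp add: field_simps power2_eq_square)
    qed
  qed
  define k where "k = complex_of_real (sqrt \<eta>)"
  define l where "l = complex_of_real (1 / sqrt \<eta>)"
  have kl: "k * cnj k = \<eta>" "l * cnj l = 1 / \<eta>" "k * cnj l = 1" "cnj k * l = 1"
    using \<eta> by (simp_all add: k_def l_def real_sqrt_mult[symmetric] flip: of_real_mult)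
  have cc: "c * cnj c = 1" using c(1) complex_norm_square[of c] by simp
  let ?w = "(k * c) *\<^sub>C x + l *\<^sub>C y"
  have "cinner (blinfun_apply T ?w) ?w = (k * cnj k) * (c * cnj c) * cinner (blinfun_apply T x) x
      + (l * cnj l) * cinner (blinfun_apply T y) y + (k * cnj l) * (c * ?z) + (cnj k * l) * cnj (c * ?z)"
    using nonneg_op_hermitian[OF T, of y x]
    by (simp add: blinfun.add_right lin cinner_add_left cinner_add_right cinner_scaleC_left cinner_scaleC_right algebra_simps)
  also have "\<dots> = \<eta> * cinner (blinfun_apply T x) x + (1 / \<eta>) * cinner (blinfun_apply T y) y - 2 * norm ?z"
    unfolding kl cc c(2) by simp
  finally have "Re (cinner (blinfun_apply T ?w) ?w)
      = \<eta> * Re (cinner (blinfun_apply T x) x) + (1 / \<eta>) * Re (cinner (blinfun_apply T y) y) - 2 * norm ?z"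
    by simp
  moreover have "0 \<le> Re (cinner (blinfun_apply T ?w) ?w)" using T(1) by (simp add: nonneg_op_def)
  ultimately show ?thesis by linarith
qed

lemma nonneg_op_eq_0:
  assumes T: "nonneg_op T" "clinear_op T" and x: "Re (cinner (blinfun_apply T x) x) = 0"
  shows "blinfun_apply T x = 0"
proof (rule ccontr)
  let ?y = "blinfun_apply T x"
  assume "?y \<noteq> 0"
  then have n: "(norm ?y)\<^sup>2 > 0" by simp
  define q where "q = Re (cinner (blinfun_apply T ?y) ?y)"
  have q: "q \<ge> 0" using T(1) by (simp add: q_def nonneg_op_def)
  define \<eta> where "\<eta> = (q + 1) / (norm ?y)\<^sup>2"
  have \<eta>: "\<eta> > 0" using n q by (simp add: \<eta>_def)
  have "2 * norm (cinner ?y ?y) \<le> \<eta> * 0 + (1 / \<eta>) * q"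
    using nonneg_op_Young[OF T \<eta>, of x ?y] unfolding x q_def .
  then have "2 * (norm ?y)\<^sup>2 \<le> q / (q + 1) * (norm ?y)\<^sup>2"
    by (simp add: cinner_self \<eta>_def norm_power mult.commute)
  also have "\<dots> \<le> 1 * (norm ?y)\<^sup>2" using q by (intro mult_right_mono) auto
  finally show False using n by simp
qed


section \<open>Canonical systems\<close>

locale canonical_system =
  fixes a :: real and b :: ereal and I :: "real set"
    and B \<Delta> :: "real \<Rightarrow> ('h::fd_complex_hilbert, 'k::fd_complex_hilbert) opH"
  assumes system: "definite_system a b I B \<Delta>"
begin

abbreviation D :: "real \<Rightarrow> ('h, 'k) spH \<Rightarrow> ('h, 'k) spH" where "D t \<equiv> blinfun_apply (\<Delta> t)"

lemma interval: "interval_from a b I"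
  using system by (simp add: definite_system_def)

lemma clinear_D: "t \<in> I \<Longrightarrow> clinear_op (\<Delta> t)" and clinear_B: "t \<in> I \<Longrightarrow> clinear_op (B t)"
  using system by (auto simp: definite_system_def loc_integrable_coeff_def)

lemma D_scaleC: "t \<in> I \<Longrightarrow> D t (c *\<^sub>C x) = c *\<^sub>C D t x"
  using clinear_D[of t] unfolding clinear_op_def by blast

lemma nonneg_D: "AE t in lborel. t \<in> I \<longrightarrow> nonneg_op (\<Delta> t) \<and> clinear_op (\<Delta> t)"
proof -
  have "AE t in lborel. t \<in> I \<longrightarrow> nonneg_op (\<Delta> t)" using system by (simp add: definite_system_def)
  then show ?thesis by eventually_elim (use clinear_D in blast)
qed

lemma I_sets [measurable]: "I \<in> sets borel"
proof -
  have "I = {a..} \<inter> {t. ereal t < b} \<or> I = {a..} \<inter> {t. ereal t \<le> b}"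
    using interval by (auto simp: interval_from_def)
  moreover have "{t. ereal t < b} \<in> sets borel" "{t. ereal t \<le> b} \<in> sets borel" by measurable
  ultimately show ?thesis by auto
qed

lemma D_measurable: "(\<lambda>t. indicator I t *\<^sub>R D t x) \<in> borel_measurable borel"
  and B_measurable: "(\<lambda>t. indicator I t *\<^sub>R blinfun_apply (B t) x) \<in> borel_measurable borel"
proof -
  have *: "(\<lambda>t. indicator I t *\<^sub>R blinfun_apply (C t) x) \<in> borel_measurable borel"
    if "set_borel_measurable borel I C" for C :: "real \<Rightarrow> ('h, 'k) opH"
  proof -
    have "continuous_on UNIV (\<lambda>T :: ('h, 'k) opH. blinfun_apply T x)"
      by (simp add: linear_continuous_on blinfun.bounded_linear_left)
    from borel_measurable_continuous_on[OF this that[unfolded set_borel_measurable_def]]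
    show ?thesis by (simp add: blinfun.scaleR_left)
  qed
  show "(\<lambda>t. indicator I t *\<^sub>R D t x) \<in> borel_measurable borel"
    "(\<lambda>t. indicator I t *\<^sub>R blinfun_apply (B t) x) \<in> borel_measurable borel"
    by (rule *; use system in \<open>simp add: definite_system_def loc_integrable_coeff_def\<close>)+
qed

definition coeff :: "complex \<Rightarrow> real \<Rightarrow> ('h, 'k) spH \<Rightarrow> ('h, 'k) spH"
  where "coeff \<mu> t x = indicator I t *\<^sub>R (- J (blinfun_apply (B t) x + \<mu> *\<^sub>C D t x))"

lemma linear_flow_coeff:
  "linear_flow a b I (coeff \<mu>) (\<lambda>t. indicator I t * (norm (B t) + norm \<mu> * norm (\<Delta> t)))"
proof
  fix t x y and c :: complex
  show "coeff \<mu> t (x + y) = coeff \<mu> t x + coeff \<mu> t y"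
    by (simp add: coeff_def blinfun.add_right scaleC_add_right J_add scaleR_right_diff_distrib algebra_simps)
  show "coeff \<mu> t (c *\<^sub>C x) = c *\<^sub>C coeff \<mu> t x"
  proof (cases "t \<in> I")
    case True
    have "blinfun_apply (B t) (c *\<^sub>C x) + \<mu> *\<^sub>C D t (c *\<^sub>C x) = c *\<^sub>C (blinfun_apply (B t) x + \<mu> *\<^sub>C D t x)"
    proof -
      have "blinfun_apply (B t) (c *\<^sub>C x) = c *\<^sub>C blinfun_apply (B t) x"
        using clinear_B[OF True] unfolding clinear_op_def by blast
      then show ?thesis using True by (simp add: D_scaleC scaleC_add_right scaleC_scaleC mult.commute)
    qed
    then show ?thesis using True by (simp add: coeff_def J_scaleC)
  qed (simp add: coeff_def)
  have "norm (blinfun_apply (B t) x + \<mu> *\<^sub>C D t x) \<le> norm (B t) * norm x + norm \<mu> * (norm (\<Delta> t) * norm x)"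
    by (rule order_trans[OF norm_triangle_ineq add_mono])
       (auto simp: norm_blinfun intro: mult_left_mono norm_blinfun)
  then show "norm (coeff \<mu> t x) \<le> indicator I t * (norm (B t) + norm \<mu> * norm (\<Delta> t)) * norm x"
    by (auto simp: coeff_def norm_J indicator_def algebra_simps)
  show "0 \<le> indicator I t * (norm (B t) + norm \<mu> * norm (\<Delta> t))" by simp
next
  fix x :: "('h, 'k) spH"
  have c: "continuous_on UNIV (J :: ('h, 'k) spH \<Rightarrow> _)" by (simp add: linear_continuous_on bounded_linear_J)
  have "(\<lambda>t. indicator I t *\<^sub>R blinfun_apply (B t) x + \<mu> *\<^sub>C (indicator I t *\<^sub>R D t x)) \<in> borel_measurable borel"
    by (intro borel_measurable_add B_measurable borel_measurable_continuous_on[OF _ D_measurable]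
        linear_continuous_on scaleC.bounded_linear_right)
  then have "(\<lambda>t. - J (indicator I t *\<^sub>R blinfun_apply (B t) x + \<mu> *\<^sub>C (indicator I t *\<^sub>R D t x))) \<in> borel_measurable borel"
    by (intro borel_measurable_uminus borel_measurable_continuous_on[OF c])
  also have "(\<lambda>t. - J (indicator I t *\<^sub>R blinfun_apply (B t) x + \<mu> *\<^sub>C (indicator I t *\<^sub>R D t x))) = (\<lambda>t. coeff \<mu> t x)"
    using bounded_linear_J bounded_linear.linear linear_0 by (auto simp: fun_eq_iff coeff_def indicator_def)
  finally show "(\<lambda>t. coeff \<mu> t x) \<in> borel_measurable borel" .
next
  fix \<beta> assume \<beta>: "\<beta> \<in> I"
  have i: "set_integrable lborel {a..\<beta>} (\<lambda>t. norm (B t))" "set_integrable lborel {a..\<beta>} (\<lambda>t. norm (\<Delta> t))"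
    using system \<beta> by (auto simp: definite_system_def loc_integrable_coeff_def)
  have sub: "t \<in> I" if "t \<in> {a..\<beta>}" for t
    using that \<beta> interval unfolding interval_from_def
    by (auto, (meson dual_order.trans order_le_less_trans ereal_less_eq(3))+)
  have "set_integrable lborel {a..\<beta>} (\<lambda>t. norm (B t) + norm \<mu> * norm (\<Delta> t))"
    using i by auto
  then show "set_integrable lborel {a..\<beta>} (\<lambda>t. indicator I t * (norm (B t) + norm \<mu> * norm (\<Delta> t)))"
    by (rule iffD1[OF set_integrable_cong, rotated -1]) (use sub in auto)
qed (rule interval)

sublocale flow: linear_flow a b I "coeff \<mu>" "\<lambda>t. indicator I t * (norm (B t) + norm \<mu> * norm (\<Delta> t))" for \<mu>
  by (rule linear_flow_coeff)


lemma solves_iff: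
  "solves I B y (\<lambda>t. \<mu> *\<^sub>C D t (y t)) \<longleftrightarrow>
    (AE t in lborel. t \<in> I \<longrightarrow> (y has_vector_derivative coeff \<mu> t (y t)) (at t within I))"
proof -
  have *: "J y' - z = w \<longleftrightarrow> y' = - J (z + w)" for y' z w :: "('h, 'k) spH"
  proof
    assume "J y' - z = w"
    then have "J y' = z + w" by (simp add: algebra_simps)
    moreover have "y' = - J (J y')" by (simp add: J_J)
    ultimately show "y' = - J (z + w)" by simp
  next
    assume "y' = - J (z + w)"
    moreover have "J (- J (z + w)) = z + w"
      using linear_neg[OF bounded_linear.linear[OF bounded_linear_J], of "J (z + w)"] by (simp add: J_J)
    ultimately show "J y' - z = w" by simp
  qed
  show ?thesis
    unfolding solves_def * coeff_def by (rule AE_cong) (auto simp del: split_paired_Ex split_paired_All)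
qed

text \<open>Applying \<open>-J\<close>, the inverse of \<open>J\<close>, turns the equation into \<open>y' = A y\<close> with the locally integrable
  coefficient \<open>A = -J (B + \<mu> \<Delta>)\<close>.\<close>

lemma fundamental_solution:
  obtains u where "u \<in> AC a I" "solves I B u (\<lambda>t. \<mu> *\<^sub>C D t (u t))" "u a = x"
proof -
  obtain u where u: "\<And>t. t \<notin> I \<Longrightarrow> u t = 0" "\<And>\<beta>. \<beta> \<in> I \<Longrightarrow> flow.sol \<mu> a \<beta> x u"
    using flow.global_solution[of \<mu> x] by blast
  have "u \<in> AC a I" using flow.solution_in_AC[of u \<mu> x] u by blast
  moreover have "solves I B u (\<lambda>t. \<mu> *\<^sub>C D t (u t))"
    unfolding solves_iff using flow.solution_derivative[of \<mu> x u] u(2) by blast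
  moreover have "u a = x"
    by (rule flow.solution_at_start[OF u(2) order_refl]) (rule flow.I_D(3))
  ultimately show ?thesis by (rule that)
qed

lemma solution_eq_0:
  assumes y: "y \<in> AC a I" "solves I B y (\<lambda>t. \<mu> *\<^sub>C D t (y t))" "y a = 0"
  shows "y t = 0"
proof (cases "t \<in> I")
  case True
  have 1: "flow.sol \<mu> a t 0 y"
    using flow.derivative_imp_solution[OF y(1) y(2)[unfolded solves_iff] True] y(3) by simp
  have z: "coeff \<mu> \<tau> 0 = 0" for \<tau> using flow.A_diff[of \<mu> \<tau> 0 0] by simp
  have 2: "flow.sol \<mu> a t 0 (\<lambda>_. 0)" by (rule flow.solI) (simp_all add: z set_lebesgue_integral_def)
  show ?thesis using flow.solution_ex_unique(2)[OF True 1 2, of t] flow.I_D(1)[OF True] by simp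
next
  case False
  then show ?thesis using y(1) by (simp add: AC_def)
qed


subsection \<open>Square integrable functions\<close>

definition dens :: "(real \<Rightarrow> ('h, 'k) spH) \<Rightarrow> (real \<Rightarrow> ('h, 'k) spH) \<Rightarrow> real \<Rightarrow> complex"
  where "dens f g t = cinner (D t (f t)) (g t)"

definition sqint :: "real set \<Rightarrow> (real \<Rightarrow> ('h, 'k) spH) \<Rightarrow> bool"
  where "sqint S f \<longleftrightarrow> f \<in> borel_measurable borel \<and> set_integrable lborel S (\<lambda>t. Re (dens f f t))"

lemma L2fun_iff: "f \<in> L2fun I \<Delta> \<longleftrightarrow> (\<forall>t. t \<notin> I \<longrightarrow> f t = 0) \<and> sqint I f"
  by (auto simp: L2fun_def sqint_def dens_def)

lemma sqint_subset: "\<lbrakk>sqint S f; R \<subseteq> S; R \<in> sets borel\<rbrakk> \<Longrightarrow> sqint R f"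
  by (auto simp: sqint_def intro: set_integrable_subset)

lemma D_comp_measurable:
  assumes f: "f \<in> borel_measurable borel"
  shows "(\<lambda>t. indicator I t *\<^sub>R D t (f t)) \<in> borel_measurable borel"
proof -
  have c: "continuous_on UNIV (\<lambda>p. fst p *\<^sub>C snd p :: ('h, 'k) spH)"
    by (intro scaleC.continuous_on continuous_intros)
  have "(\<lambda>t. cinner (f t) e) \<in> borel_measurable borel" for e
    by (rule borel_measurable_continuous_on[OF _ f])
       (simp add: linear_continuous_on cinner.bounded_linear_left)
  then have m: "(\<lambda>t. cinner (f t) (cbasis i) *\<^sub>C (indicator I t *\<^sub>R D t (cbasis i))) \<in> borel_measurable borel" for i
    using borel_measurable_continuous_on[OF c borel_measurable_Pair[OF _ D_measurable],
      of "\<lambda>t. cinner (f t) (cbasis i)"] by simp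
  let ?n = "cDIM TYPE(('h, 'k) spH)"
  have "indicator I t *\<^sub>R D t (f t) = (\<Sum>i<?n. cinner (f t) (cbasis i) *\<^sub>C (indicator I t *\<^sub>R D t (cbasis i)))" for t
  proof (cases "t \<in> I")
    case True
    have "D t (f t) = D t (\<Sum>i<?n. cinner (f t) (cbasis i) *\<^sub>C cbasis i)" by (simp add: cbasis_expansion)
    also have "\<dots> = (\<Sum>i<?n. cinner (f t) (cbasis i) *\<^sub>C D t (cbasis i))"
      by (simp add: blinfun.sum_right D_scaleC[OF True])
    finally show ?thesis using True by simp
  qed simp
  then show ?thesis using m by (simp add: borel_measurable_sum)
qed

lemma dens_measurable:
  assumes "f \<in> borel_measurable borel" "g \<in> borel_measurable borel" "S \<subseteq> I" "S \<in> sets borel"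
  shows "set_borel_measurable lborel S (dens f g)"
proof -
  have c: "continuous_on UNIV (\<lambda>p. cinner (fst p) (snd p) :: complex)"
    by (intro cinner.continuous_on continuous_intros)
  have "(\<lambda>t. cinner (indicator I t *\<^sub>R D t (f t)) (g t)) \<in> borel_measurable borel"
    using borel_measurable_continuous_on[OF c borel_measurable_Pair[OF D_comp_measurable[OF assms(1)] assms(2)]] by simp
  then have "(\<lambda>t. indicator S t *\<^sub>R cinner (indicator I t *\<^sub>R D t (f t)) (g t)) \<in> borel_measurable borel"
    using assms(4) by measurable
  moreover have "indicator S t *\<^sub>R cinner (indicator I t *\<^sub>R D t (f t)) (g t) = indicator S t *\<^sub>R dens f g t" for t
    using assms(3) by (auto simp: indicator_def dens_def)
  ultimately show ?thesis by (simp add: set_borel_measurable_def)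
qed

lemma dens_integrable:
  assumes f: "sqint S f" and g: "sqint S g" and S: "S \<subseteq> I" "S \<in> sets borel"
  shows "set_integrable lborel S (dens f g)"
proof (rule set_integrable_bound[where f = "\<lambda>t. Re (dens f f t) + Re (dens g g t)"])
  show "set_integrable lborel S (\<lambda>t. Re (dens f f t) + Re (dens g g t))" using f g by (auto simp: sqint_def)
  show "set_borel_measurable lborel S (dens f g)" using f g S by (intro dens_measurable) (auto simp: sqint_def)
  show "AE t in lborel. t \<in> S \<longrightarrow> norm (dens f g t) \<le> norm (Re (dens f f t) + Re (dens g g t))"
    using nonneg_D
  proof eventually_elim
    case (elim t)
    show ?case
    proof
      assume "t \<in> S"
      then have T: "nonneg_op (\<Delta> t)" "clinear_op (\<Delta> t)" using elim S by auto
      show "norm (dens f g t) \<le> norm (Re (dens f f t) + Re (dens g g t))"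
        using nonneg_op_Young[OF T zero_less_one, of "f t" "g t"] norm_ge_zero[of "dens f g t"]
        unfolding dens_def real_norm_def by linarith
    qed
  qed
qed

lemma dens_Re_nonneg: "AE t in lborel. t \<in> I \<longrightarrow> 0 \<le> Re (dens f f t)"
  using nonneg_D
proof eventually_elim
  case (elim t)
  then show ?case unfolding dens_def nonneg_op_def by blast
qed

lemma set_integrable_Re: "set_integrable lborel S f \<Longrightarrow> set_integrable lborel S (\<lambda>t. Re (f t))"
  using integrable_bounded_linear[OF bounded_linear_Re, of lborel "\<lambda>t. indicator S t *\<^sub>R f t"]
  by (simp add: set_integrable_def)

lemma sqint_add:
  assumes f: "sqint S f" and g: "sqint S g" and S: "S \<subseteq> I" "S \<in> sets borel"
  shows "sqint S (\<lambda>t. f t + g t)"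
proof -
  have eq: "dens (\<lambda>t. f t + g t) (\<lambda>t. f t + g t) = (\<lambda>t. dens f f t + dens f g t + (dens g f t + dens g g t))"
    by (auto simp: dens_def fun_eq_iff blinfun.add_right cinner_add_left cinner_add_right)
  have "set_integrable lborel S (\<lambda>t. dens f f t + dens f g t + (dens g f t + dens g g t))"
    by (intro set_integral_add(1) dens_integrable f g S)
  then have "set_integrable lborel S (\<lambda>t. Re (dens (\<lambda>t. f t + g t) (\<lambda>t. f t + g t) t))"
    unfolding eq by (rule set_integrable_Re)
  moreover have "(\<lambda>t. f t + g t) \<in> borel_measurable borel" using f g by (intro borel_measurable_add) (auto simp: sqint_def)
  ultimately show ?thesis by (simp add: sqint_def)
qed

lemma sqint_scale:
  assumes f: "sqint S f" and S: "S \<subseteq> I"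
  shows "sqint S (\<lambda>t. c *\<^sub>C f t)"
proof -
  have "(\<lambda>t. c *\<^sub>C f t) \<in> borel_measurable borel"
    using f by (intro borel_measurable_continuous_on[OF linear_continuous_on[OF scaleC.bounded_linear_right]]) (auto simp: sqint_def)
  moreover have eq: "Re (dens (\<lambda>t. c *\<^sub>C f t) (\<lambda>t. c *\<^sub>C f t) t) = (norm c)\<^sup>2 * Re (dens f f t)" if "t \<in> S" for t
  proof -
    have "dens (\<lambda>t. c *\<^sub>C f t) (\<lambda>t. c *\<^sub>C f t) t = (c * cnj c) * dens f f t"
      using that S by (auto simp: dens_def D_scaleC subset_iff cinner_scaleC_left cinner_scaleC_right)
    then show ?thesis by (simp only: complex_norm_square[symmetric] Re_complex_of_real Im_complex_of_real times_complex.simps)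
  qed
  moreover have "set_integrable lborel S (\<lambda>t. (norm c)\<^sup>2 * Re (dens f f t))"
    using f by (auto simp: sqint_def)
  then have "set_integrable lborel S (\<lambda>t. Re (dens (\<lambda>t. c *\<^sub>C f t) (\<lambda>t. c *\<^sub>C f t) t))"
    by (rule iffD1[OF set_integrable_cong, rotated -1]) (use eq in auto)
  ultimately show ?thesis by (simp add: sqint_def)
qed

lemma sqint_zero: "sqint S (\<lambda>_. 0)"
  by (simp add: sqint_def dens_def set_integrable_def)

lemma sqint_lincomb:
  assumes "\<And>i. i < n \<Longrightarrow> sqint S (f i)" and S: "S \<subseteq> I" "S \<in> sets borel"
  shows "sqint S (lincomb n c f)"
  using assms(1)
proof (induction n)
  case 0
  then show ?case using sqint_zero by (simp add: lincomb_def[abs_def])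
next
  case (Suc n)
  have "lincomb (Suc n) c f = (\<lambda>t. lincomb n c f t + c n *\<^sub>C f n t)" by (simp add: lincomb_def fun_eq_iff)
  then show ?case using Suc by (auto intro!: sqint_add sqint_scale S)
qed

lemma AC_continuous: "\<lbrakk>y \<in> AC a I; \<beta> \<in> I\<rbrakk> \<Longrightarrow> continuous_on {a..\<beta>} y"
  by (rule abs_cont_on_continuous) (simp add: AC_def)

lemma AC_measurable:
  assumes y: "y \<in> AC a I"
  shows "y \<in> borel_measurable borel"
proof -
  obtain c :: "nat \<Rightarrow> real" where c: "mono c" "\<And>n. a < c n" "\<And>n. ereal (c n) < b" "\<And>t. ereal t < b \<Longrightarrow> \<exists>n. t < c n"
    using interval_from_exhaustion[OF interval] by blast
  have cI: "c n \<in> I" for n using interval c(2,3)[of n] unfolding interval_from_def by (auto intro: less_imp_le)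
  define S where "S n = {a..c n} \<union> ({real_of_ereal b} \<inter> I)" for n
  have m: "(\<lambda>t. indicator (S n) t *\<^sub>R y t) \<in> borel_measurable borel" for n
  proof -
    have ac: "continuous_on {a..c n} y" by (rule AC_continuous[OF y cI])
    have "continuous_on ({real_of_ereal b} \<inter> I) y" by (rule continuous_on_subset[of "{real_of_ereal b}"]) auto
    then have "continuous_on (S n) y" unfolding S_def
    proof (intro continuous_on_closed_Un ac)
      show "closed ({real_of_ereal b} \<inter> I)" by (rule finite_imp_closed) simp
    qed auto
    moreover have "S n \<in> sets borel" unfolding S_def by auto
    ultimately show ?thesis by (intro borel_measurable_continuous_on_indicator)
  qed
  show ?thesis
  proof (rule borel_measurable_LIMSEQ_metric[OF m])
    fix t
    show "(\<lambda>n. indicator (S n) t *\<^sub>R y t) \<longlonglongrightarrow> y t"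
    proof (cases "t \<in> I \<and> t \<noteq> real_of_ereal b")
      case True
      then have "ereal t < b" using interval unfolding interval_from_def by (cases b) auto
      then obtain N where N: "t < c N" using c(4) by blast
      have "\<forall>n\<ge>N. t \<in> S n"
      proof (intro allI impI)
        fix n assume "n \<ge> N"
        then have "t < c n" using N monoD[OF c(1), of N n] by linarith
        then show "t \<in> S n" using True flow.I_D(1)[of t] by (simp add: S_def)
      qed
      then show ?thesis
        by (intro tendsto_eventually, unfold eventually_sequentially, intro exI[of _ N]) auto
    next
      case False
      then have "indicator (S n) t *\<^sub>R y t = y t" for n
        using y by (cases "t \<in> I") (auto simp: S_def AC_def)
      then show ?thesis by simp
    qed
  qed
qed

lemma AC_sqint:
  assumes y: "y \<in> AC a I" and st: "a \<le> s" "t \<in> I"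
  shows "sqint {s..t} y"
proof -
  have "continuous_on {a..t} y" by (rule AC_continuous[OF y st(2)])
  then have "bounded (y ` {a..t})" by (intro compact_imp_bounded compact_continuous_image) auto
  then obtain M where "\<forall>x\<in>y ` {a..t}. norm x \<le> M" unfolding bounded_iff by blast
  then have M: "norm (y \<tau>) \<le> M" if "\<tau> \<in> {s..t}" for \<tau> using that st by auto
  have sub: "{s..t} \<subseteq> I" using flow.I_sub st by blast
  have "set_integrable lborel {a..t} (\<lambda>t. norm (\<Delta> t))"
    using system st by (auto simp: definite_system_def loc_integrable_coeff_def)
  then have i: "set_integrable lborel {s..t} (\<lambda>\<tau>. M\<^sup>2 * norm (\<Delta> \<tau>))"
    using set_integrable_subset[of lborel "{a..t}" "\<lambda>t. norm (\<Delta> t)" "{s..t}"] st by auto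
  have m: "y \<in> borel_measurable borel" by (rule AC_measurable[OF y])
  have "set_integrable lborel {s..t} (dens y y)"
  proof (rule set_integrable_bound[OF i])
    show "set_borel_measurable lborel {s..t} (dens y y)" by (rule dens_measurable[OF m m sub]) simp
    show "AE x in lborel. x \<in> {s..t} \<longrightarrow> norm (dens y y x) \<le> norm (M\<^sup>2 * norm (\<Delta> x))"
    proof (intro AE_I2 impI)
      fix x assume x: "x \<in> {s..t}"
      have "norm (dens y y x) \<le> norm (D x (y x)) * norm (y x)" unfolding dens_def by (rule norm_cinner_le)
      also have "\<dots> \<le> (norm (\<Delta> x) * norm (y x)) * norm (y x)" by (intro mult_right_mono norm_blinfun) auto
      also have "\<dots> \<le> (norm (\<Delta> x) * M) * M"
        using M[OF x] order_trans[OF norm_ge_zero M[OF x]] by (intro mult_mono mult_left_mono mult_nonneg_nonneg) auto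
      finally show "norm (dens y y x) \<le> norm (M\<^sup>2 * norm (\<Delta> x))" by (simp add: power2_eq_square mult.commute mult.left_commute)
    qed
  qed
  then show ?thesis using m set_integrable_Re by (auto simp: sqint_def)
qed


subsection \<open>The Lagrange identity and the boundary form\<close>

text \<open>The product rule for the absolutely continuous function \<open>(J y, z)\<close>, in which the terms with \<open>B\<close>
  cancel because \<open>B\<close> is self-adjoint and \<open>J\<close> is skew-adjoint.\<close>

lemma Lagrange_identity:
  assumes y: "y \<in> AC a I" "solves I B y (\<lambda>t. D t (p t))" and z: "z \<in> AC a I" "solves I B z (\<lambda>t. D t (q t))"
    and st: "a \<le> s" "s \<le> t" "t \<in> I" and pq: "sqint {s..t} p" "sqint {s..t} q"
  shows "cinner (J (y t)) (z t) - cinner (J (y s)) (z s) = (LBINT \<tau>:{s..t}. dens p z \<tau> - dens y q \<tau>)"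
proof -
  have sub: "{s..t} \<subseteq> I" using flow.I_sub st by blast
  have ac: "abs_cont_on s t y" "abs_cont_on s t z"
    using y(1) z(1) st by (auto simp: AC_def intro: abs_cont_on_subset)
  have acJ: "abs_cont_on s t (\<lambda>t. J (y t))"
  proof (rule abs_cont_on_Lipschitz_bound[OF ac(1) ac(1), where K=1 and M=1])
    fix c d
    have "J (y d) - J (y c) = J (y d - y c)" using linear_diff[OF bounded_linear.linear[OF bounded_linear_J], of "y d" "y c"] by simp
    then show "norm (J (y d) - J (y c)) \<le> 1 * norm (y d - y c) + 1 * norm (y d - y c)" by (simp add: norm_J)
  qed auto
  have sa: "AE t in lborel. t \<in> I \<longrightarrow> self_adjoint_op (B t)" using system by (simp add: definite_system_def)
  have der: "AE \<tau> in lborel. \<tau> \<in> I \<longrightarrow> ((\<lambda>t. cinner (J (y t)) (z t)) has_vector_derivative (dens p z \<tau> - dens y q \<tau>)) (at \<tau> within I)"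
    using y(2)[unfolded solves_def] z(2)[unfolded solves_def] sa nonneg_D
  proof eventually_elim
    case (elim \<tau>)
    show ?case
    proof
      assume \<tau>: "\<tau> \<in> I"
      obtain y' z' where y': "(y has_vector_derivative y') (at \<tau> within I)" "J y' - blinfun_apply (B \<tau>) (y \<tau>) = D \<tau> (p \<tau>)"
        and z': "(z has_vector_derivative z') (at \<tau> within I)" "J z' - blinfun_apply (B \<tau>) (z \<tau>) = D \<tau> (q \<tau>)"
        using elim(1,2) \<tau> by blast
      have Bs: "cinner (blinfun_apply (B \<tau>) (y \<tau>)) (z \<tau>) = cinner (y \<tau>) (blinfun_apply (B \<tau>) (z \<tau>))"
        using elim(3) \<tau> unfolding self_adjoint_op_def by blast
      have Dh: "cinner (y \<tau>) (D \<tau> (q \<tau>)) = dens y q \<tau>"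
        using nonneg_op_hermitian[of "\<Delta> \<tau>" "q \<tau>" "y \<tau>"] elim(4) \<tau> cinner_commute[of "y \<tau>" "D \<tau> (q \<tau>)"]
        by (simp add: dens_def)
      have Jy: "J y' = blinfun_apply (B \<tau>) (y \<tau>) + D \<tau> (p \<tau>)" "J z' = blinfun_apply (B \<tau>) (z \<tau>) + D \<tau> (q \<tau>)"
        using y'(2) z'(2) by (simp_all add: algebra_simps)
      have "cinner (J (y \<tau>)) z' + cinner (J y') (z \<tau>) = dens p z \<tau> - dens y q \<tau>"
        unfolding cinner_J_left[of "y \<tau>"] Jy using Bs Dh by (simp add: cinner_add_left cinner_add_right dens_def)
      moreover have "((\<lambda>t. cinner (J (y t)) (z t)) has_vector_derivative (cinner (J (y \<tau>)) z' + cinner (J y') (z \<tau>))) (at \<tau> within I)"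
        by (intro cinner.has_vector_derivative bounded_linear.has_vector_derivative[OF bounded_linear_J] y' z')
      ultimately show "((\<lambda>t. cinner (J (y t)) (z t)) has_vector_derivative (dens p z \<tau> - dens y q \<tau>)) (at \<tau> within I)" by simp
    qed
  qed
  have s: "sqint {s..t} y" "sqint {s..t} z" using AC_sqint y(1) z(1) st by auto
  show ?thesis
    by (rule abs_cont_on_fundamental_theorem[OF st(2) sub abs_cont_on_cinner[OF acJ ac(2)] der])
       (intro set_integral_diff(1) dens_integrable s pq sub; simp)
qed

definition end_filter :: "real filter"
  where "end_filter = (if b = \<infinity> then at_top else at_left (real_of_ereal b))"

lemma end_filter_nontrivial: "end_filter \<noteq> bot"
  by (simp add: end_filter_def)

lemma eventually_end_filter:
  assumes "ereal s < b"
  shows "\<forall>\<^sub>F t in end_filter. t \<in> I \<and> s < t \<and> ereal t < b"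
proof (cases b)
  case (real r)
  have "max a s < r" using assms interval by (simp add: real interval_from_def)
  then have "\<forall>\<^sub>F t in at_left r. t \<in> {max a s<..<r}" by (intro eventually_at_leftI[of "max a s"])
  then show ?thesis
    unfolding end_filter_def using interval by (auto simp: real interval_from_def elim!: eventually_mono)
next
  case PInf
  have "\<forall>\<^sub>F t in at_top. t > max a s" by (rule eventually_gt_at_top)
  then show ?thesis
    unfolding end_filter_def using interval by (auto simp: PInf interval_from_def elim!: eventually_mono)
next
  case MInf
  then show ?thesis using assms by simp
qed

definition approx :: "nat \<Rightarrow> real"
  where "approx = (SOME c. mono c \<and> (\<forall>n. a < c n) \<and> (\<forall>n. ereal (c n) < b) \<and>
    (\<forall>t. ereal t < b \<longrightarrow> (\<exists>n. t < c n)))"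

lemma approx_all: "mono approx \<and> (\<forall>n. a < approx n) \<and> (\<forall>n. ereal (approx n) < b) \<and>
    (\<forall>t. ereal t < b \<longrightarrow> (\<exists>n. t < approx n))"
  unfolding approx_def by (rule someI_ex[OF interval_from_exhaustion[OF interval]])

lemma approx: "mono approx" "a < approx n" "ereal (approx n) < b" "ereal t < b \<Longrightarrow> \<exists>n. t < approx n"
  using approx_all by blast+

lemma approx_in: "approx n \<in> I"
  using interval approx(2,3)[of n] unfolding interval_from_def by (auto intro: less_imp_le)

lemma filterlim_approx: "filterlim approx end_filter sequentially"
proof -
  have ev: "\<forall>\<^sub>F n in sequentially. s < approx n" if "ereal s < b" for s
  proof -
    obtain N where "s < approx N" using approx(4)[OF \<open>ereal s < b\<close>] by blast
    then show ?thesis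
      unfolding eventually_sequentially using monoD[OF approx(1)] by (intro exI[of _ N]) (meson less_le_trans)
  qed
  show ?thesis
  proof (cases b)
    case (real r)
    have lt: "approx n < r" for n
    proof -
      have "ereal (approx n) < ereal r" by (rule less_le_trans[OF approx(3)]) (simp add: real)
      then show ?thesis by simp
    qed
    have "filterlim approx (at_left r) sequentially"
      unfolding filterlim_at
    proof
      show "\<forall>\<^sub>F n in sequentially. approx n \<in> {..<r} \<and> approx n \<noteq> r"
      proof (intro always_eventually allI)
        fix n show "approx n \<in> {..<r} \<and> approx n \<noteq> r" using lt[of n] by simp
      qed
      show "approx \<longlonglongrightarrow> r"
      proof (rule order_tendstoI)
        show "\<forall>\<^sub>F n in sequentially. s < approx n" if "s < r" for s using ev[of s] that by (simp add: real)
        show "\<forall>\<^sub>F n in sequentially. approx n < s" if "r < s" for s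
        proof (intro always_eventually allI)
          fix n show "approx n < s" using lt[of n] that by simp
        qed
      qed
    qed
    then show ?thesis unfolding end_filter_def using real by simp
  next
    case PInf
    then show ?thesis using ev unfolding end_filter_def by (simp add: filterlim_at_top_dense)
  next
    case MInf
    then show ?thesis using interval by (simp add: interval_from_def)
  qed
qed

lemma tail_integral_tendsto_0:
  fixes \<phi> :: "real \<Rightarrow> real"
  assumes \<phi>: "set_integrable lborel I \<phi>"
  shows "(\<lambda>n. LBINT t:I \<inter> {approx n<..}. \<phi> t) \<longlonglongrightarrow> 0"
proof -
  have i: "integrable lborel (\<lambda>t. indicator I t *\<^sub>R \<phi> t)" using \<phi> by (simp add: set_integrable_def)
  define s where "s n t = indicator {approx n<..} t *\<^sub>R (indicator I t *\<^sub>R \<phi> t)" for n t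
  have "(\<lambda>n. integral\<^sup>L lborel (s n)) \<longlonglongrightarrow> integral\<^sup>L lborel (\<lambda>_::real. 0::real)"
  proof (rule integral_dominated_convergence[where w = "\<lambda>t. norm (indicator I t *\<^sub>R \<phi> t)"])
    show "integrable lborel (\<lambda>t. norm (indicator I t *\<^sub>R \<phi> t))" by (rule integrable_norm[OF i])
    show "s n \<in> borel_measurable lborel" for n
      unfolding s_def[abs_def] by (intro borel_measurable_scaleR borel_measurable_integrable[OF i]) simp
    show "AE t in lborel. (\<lambda>n. s n t) \<longlonglongrightarrow> 0"
      using AE_lborel_singleton[of "real_of_ereal b"]
    proof eventually_elim
      case (elim t)
      show ?case
      proof (cases "t \<in> I")
        case True
        then have "ereal t < b" using elim interval unfolding interval_from_def by (cases b) auto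
        then obtain N where N: "t < approx N" using approx(4) by blast
        have "\<forall>n\<ge>N. t \<notin> {approx n<..}"
        proof (intro allI impI)
          fix n assume "n \<ge> N"
          then show "t \<notin> {approx n<..}" using N monoD[OF approx(1), of N n] by simp
        qed
        then show ?thesis
          by (intro tendsto_eventually, unfold eventually_sequentially, intro exI[of _ N]) (auto simp: s_def)
      qed (simp add: s_def)
    qed
    show "AE x in lborel. norm (s n x) \<le> norm (indicator I x *\<^sub>R \<phi> x)" for n
      by (intro AE_I2) (auto simp: indicator_def s_def)
  qed simp
  moreover have "integral\<^sup>L lborel (s n) = (LBINT t:I \<inter> {approx n<..}. \<phi> t)" for n
    unfolding s_def set_lebesgue_integral_def by (rule Bochner_Integration.integral_cong) (auto simp: indicator_def)
  ultimately show ?thesis by simp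
qed

lemma Tmax_funD:
  assumes "(y, p) \<in> Tmax_fun a I B \<Delta>"
  shows "y \<in> AC a I" "solves I B y (\<lambda>t. D t (p t))" "sqint I y" "sqint I p" "\<And>t. t \<notin> I \<Longrightarrow> p t = 0"
  using assms by (auto simp: Tmax_fun_def L2fun_iff)

text \<open>By the Lagrange identity the increments of \<open>(J y, z)\<close> are integrals of an integrable function over
  the tail of the interval, hence the limit that defines the boundary form exists.\<close>

lemma boundary_form_tendsto:
  assumes y: "y \<in> dom_Tmax a I B \<Delta>" and z: "z \<in> dom_Tmax a I B \<Delta>"
  shows "((\<lambda>t. cinner (J (y t)) (z t)) \<longlongrightarrow> form_b b y z) end_filter"
proof -
  obtain p where p: "(y, p) \<in> Tmax_fun a I B \<Delta>" using y by (rule DomainE)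
  obtain q where q: "(z, q) \<in> Tmax_fun a I B \<Delta>" using z by (rule DomainE)
  note y = Tmax_funD[OF p] and z = Tmax_funD[OF q]
  define \<psi> where "\<psi> t = dens p z t - dens y q t" for t
  have \<psi>: "set_integrable lborel I \<psi>"
    unfolding \<psi>_def
    by (rule set_integral_diff(1)[OF dens_integrable[OF y(4) z(3)] dens_integrable[OF y(3) z(4)]]) (use I_sets in auto)
  let ?\<phi> = "\<lambda>t. cinner (J (y t)) (z t)"
  let ?L = "?\<phi> a + (LBINT t:I. \<psi> t)"
  have bound: "norm (?\<phi> t - ?L) \<le> (LBINT \<tau>:I \<inter> {s<..}. norm (\<psi> \<tau>))" if t: "t \<in> I" "s < t" for s t
  proof -
    have at: "a \<le> t" by (rule flow.I_D(1)[OF t(1)])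
    have at2: "{a..t} \<subseteq> I" by (rule flow.I_sub[OF order_refl t(1)])
    have "?\<phi> t - ?\<phi> a = (LBINT \<tau>:{a..t}. \<psi> \<tau>)"
      unfolding \<psi>_def
      by (rule Lagrange_identity[OF y(1,2) z(1,2) order_refl at t(1)
            sqint_subset[OF y(4) at2] sqint_subset[OF z(4) at2]]) simp_all
    moreover have decomp: "I = {a..t} \<union> (I \<inter> {t<..})"
    proof (intro set_eqI iffI)
      fix r assume "r \<in> I"
      then show "r \<in> {a..t} \<union> (I \<inter> {t<..})" using flow.I_D(1)[of r] by (cases "r \<le> t") simp_all
    next
      fix r assume "r \<in> {a..t} \<union> (I \<inter> {t<..})"
      then show "r \<in> I" using at2 by blast
    qed
    have "(LBINT \<tau>:{a..t} \<union> (I \<inter> {t<..}). \<psi> \<tau>) = (LBINT \<tau>:{a..t}. \<psi> \<tau>) + (LBINT \<tau>:I \<inter> {t<..}. \<psi> \<tau>)"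
    proof (rule set_integral_Un)
      show "{a..t} \<inter> (I \<inter> {t<..}) = {}" by auto
      show "set_integrable lborel {a..t} \<psi>" by (rule set_integrable_subset[OF \<psi> _ at2]) simp
      show "set_integrable lborel (I \<inter> {t<..}) \<psi>" by (rule set_integrable_subset[OF \<psi>]) (use I_sets in auto)
    qed
    then have "(LBINT \<tau>:I. \<psi> \<tau>) = (LBINT \<tau>:{a..t}. \<psi> \<tau>) + (LBINT \<tau>:I \<inter> {t<..}. \<psi> \<tau>)"
      using arg_cong[OF decomp, of "\<lambda>S. LBINT \<tau>:S. \<psi> \<tau>"] by (simp only:)
    ultimately have "?\<phi> t - ?L = - (LBINT \<tau>:I \<inter> {t<..}. \<psi> \<tau>)" by (simp add: algebra_simps)
    moreover have i: "set_integrable lborel (I \<inter> {t<..}) \<psi>"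
      by (rule set_integrable_subset[OF \<psi>]) (use I_sets in auto)
    ultimately have "norm (?\<phi> t - ?L) \<le> (LBINT \<tau>:I \<inter> {t<..}. norm (\<psi> \<tau>))"
      using set_integral_norm_bound[OF i] by simp
    also have "\<dots> \<le> (LBINT \<tau>:I \<inter> {s<..}. norm (\<psi> \<tau>))"
      unfolding set_lebesgue_integral_def
    proof (rule integral_mono)
      show "integrable lborel (\<lambda>x. indicator (I \<inter> {t<..}) x *\<^sub>R norm (\<psi> x))"
        using set_integrable_norm[OF i] by (simp add: set_integrable_def)
      have "set_integrable lborel (I \<inter> {s<..}) \<psi>"
        by (rule set_integrable_subset[OF \<psi>]) (use I_sets in auto)
      then show "integrable lborel (\<lambda>x. indicator (I \<inter> {s<..}) x *\<^sub>R norm (\<psi> x))"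
        using set_integrable_norm by (simp add: set_integrable_def)
    qed (use t in \<open>auto simp: indicator_def\<close>)
    finally show ?thesis .
  qed
  have "(?\<phi> \<longlongrightarrow> ?L) end_filter"
  proof (rule tendstoI)
    fix e :: real assume e: "e > 0"
    have "\<forall>\<^sub>F n in sequentially. dist (LBINT \<tau>:I \<inter> {approx n<..}. norm (\<psi> \<tau>)) 0 < e"
      using tail_integral_tendsto_0[OF set_integrable_norm[OF \<psi>]] e unfolding tendsto_iff by blast
    then obtain n where "dist (LBINT \<tau>:I \<inter> {approx n<..}. norm (\<psi> \<tau>)) 0 < e"
      unfolding eventually_sequentially by blast
    then have n: "(LBINT \<tau>:I \<inter> {approx n<..}. norm (\<psi> \<tau>)) < e" by (simp add: dist_real_def)
    from eventually_end_filter[OF approx(3)[of n]] show "\<forall>\<^sub>F t in end_filter. dist (?\<phi> t) ?L < e"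
    proof eventually_elim
      case (elim t)
      then show ?case using bound[of t "approx n"] n by (simp add: dist_norm)
    qed
  qed
  then show ?thesis
    using tendsto_Lim[OF end_filter_nontrivial, of ?\<phi> ?L] by (simp add: form_b_def end_filter_def)
qed

end

section \<open>Families, suprema of dimensions, and compactness\<close>

text \<open>Dimensions are defined as suprema over the lengths of certain families. As the set of lengths is
  closed downwards, a finite number is a lower bound of the supremum if and only if it is attained.\<close>

lemma enat_le_Sup_iff:
  assumes "P 0" and down: "\<And>m n. \<lbrakk>P n; m \<le> n\<rbrakk> \<Longrightarrow> P m"
  shows "enat m \<le> Sup {enat n | n. P n} \<longleftrightarrow> P m"
proof
  assume le: "enat m \<le> Sup {enat n | n. P n}"
  show "P m"
  proof (rule ccontr)
    assume nP: "\<not> P m"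
    then obtain m' where m': "m = Suc m'" using assms(1) by (cases m) auto
    have "Sup {enat n | n. P n} \<le> enat m'"
    proof (rule Sup_least)
      fix x assume "x \<in> {enat n | n. P n}"
      then obtain n where n: "x = enat n" "P n" by blast
      then have "n < m" using nP down[of n m] not_less by blast
      then show "x \<le> enat m'" using n m' by simp
    qed
    with le have "enat m \<le> enat m'" by (rule order_trans)
    then show False using m' by simp
  qed
next
  assume "P m"
  then show "enat m \<le> Sup {enat n | n. P n}" by (intro Sup_upper) blast
qed

lemma lincomb_extend:
  assumes "m \<le> n"
  shows "lincomb n (\<lambda>i. if i < m then c i else 0) f = lincomb m c f"
proof
  fix t
  have "lincomb n (\<lambda>i. if i < m then c i else 0) f t = (\<Sum>i<m. (if i < m then c i else 0) *\<^sub>C f i t)"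
    unfolding lincomb_def using assms by (intro sum.mono_neutral_right) auto
  then show "lincomb n (\<lambda>i. if i < m then c i else 0) f t = lincomb m c f t" by (simp add: lincomb_def)
qed

lemma lincomb_lincomb: "lincomb r d (\<lambda>j. lincomb n (q j) u) = lincomb n (\<lambda>i. \<Sum>j<r. d j * q j i) u"
proof
  fix t
  have "lincomb r d (\<lambda>j. lincomb n (q j) u) t = (\<Sum>j<r. \<Sum>i<n. (d j * q j i) *\<^sub>C u i t)"
    by (simp add: lincomb_def cs.scale_sum_right)
  also have "\<dots> = (\<Sum>i<n. \<Sum>j<r. (d j * q j i) *\<^sub>C u i t)" by (rule sum.swap)
  also have "\<dots> = lincomb n (\<lambda>i. \<Sum>j<r. d j * q j i) u t"
    by (simp add: lincomb_def cs.scale_sum_left)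
  finally show "lincomb r d (\<lambda>j. lincomb n (q j) u) t = lincomb n (\<lambda>i. \<Sum>j<r. d j * q j i) u t" .
qed

text \<open>Subspaces of coefficient vectors are represented by orthonormal families, which form a
  compact set; this makes limits of subspaces of fixed dimension available.\<close>

definition orthonormal_coeffs :: "nat \<Rightarrow> nat \<Rightarrow> (nat \<Rightarrow> nat \<Rightarrow> complex) \<Rightarrow> bool"
  where "orthonormal_coeffs n r q \<longleftrightarrow> (\<forall>j<r. \<forall>k<r. (\<Sum>i<n. q j i * cnj (q k i)) = (if j = k then 1 else 0))"

lemma orthonormal_coeffs_independent:
  assumes q: "orthonormal_coeffs n r q" and z: "\<And>i. i < n \<Longrightarrow> (\<Sum>j<r. d j * q j i) = 0" and k: "k < r"
  shows "d k = 0"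
proof -
  have "d k = (\<Sum>j<r. if j = k then d k else 0)" using k by simp
  also have "\<dots> = (\<Sum>j<r. d j * (\<Sum>i<n. q j i * cnj (q k i)))"
    using q k by (intro sum.cong) (auto simp: orthonormal_coeffs_def)
  also have "\<dots> = (\<Sum>j<r. \<Sum>i<n. d j * q j i * cnj (q k i))" by (simp add: sum_distrib_left mult.assoc)
  also have "\<dots> = (\<Sum>i<n. \<Sum>j<r. d j * q j i * cnj (q k i))" by (rule sum.swap)
  also have "\<dots> = (\<Sum>i<n. (\<Sum>j<r. d j * q j i) * cnj (q k i))" by (simp add: sum_distrib_right)
  also have "\<dots> = 0" using z by simp
  finally show ?thesis .
qed

text \<open>The rank-nullity theorem for the map \<open>c \<mapsto> \<Sum> c\<^sub>i v\<^sub>i\<close>, with an orthonormal family in the kernel.\<close>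

lemma kernel_orthonormal_coeffs:
  fixes v :: "nat \<Rightarrow> 'v::fd_complex_hilbert"
  shows "\<exists>q. orthonormal_coeffs n (n - cDIM TYPE('v)) q \<and> (\<forall>j<n - cDIM TYPE('v). (\<Sum>i<n. q j i *\<^sub>C v i) = 0)"
proof -
  let ?s = "\<lambda>(c::complex) (f::nat \<Rightarrow> complex) i. c * f i"
  interpret F: vector_space ?s
    by unfold_locales (auto simp: fun_eq_iff algebra_simps)
  define S where "S = {c :: nat \<Rightarrow> complex. (\<forall>i\<ge>n. c i = 0) \<and> (\<Sum>i<n. c i *\<^sub>C v i) = 0}"
  define h where "h c d = (\<Sum>i<n. c i * cnj (d i))" for c d :: "nat \<Rightarrow> complex"
  have S: "F.subspace S"
    unfolding F.subspace_def S_def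
    by (auto simp: scaleC_add_left sum.distrib cs.scale_scale[symmetric] cs.scale_sum_right[symmetric] simp del: cs.scale_scale)
  interpret hermitian_form ?s S h
  proof
    show "h x y = cnj (h y x)" for x y by (simp add: h_def cnj_sum mult.commute)
  qed (rule S, simp_all add: h_def sum.distrib algebra_simps sum_distrib_left)
  have bound: "m \<le> n" if e: "\<And>i. i < m \<Longrightarrow> e i \<in> S" "orthonormal_on h m e" for m e
  proof (rule ccontr)
    assume "\<not> m \<le> n"
    then obtain x where x: "\<exists>i\<in>{..<m}. x i \<noteq> 0" "\<forall>j<n. (\<Sum>i<m. x i * e i j) = 0"
      using underdetermined_system[of "{..<m}" n "\<lambda>j i. e i j"] by auto
    have fs: "(\<Sum>i<m. ?s (x i) (e i)) j = (\<Sum>i<m. x i * e i j)" for j by (induction m) auto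
    have hz: "h (\<Sum>i<m. ?s (x i) (e i)) (\<Sum>i<m. ?s (x i) (e i)) = 0"
      unfolding h_def by (rule sum.neutral) (simp add: fs x(2))
    have "complex_of_real (\<Sum>i<m. (norm (x i))\<^sup>2) = 0"
      using form_orthonormal_combination[OF e, of x] hz by (simp only:)
    then have "(\<Sum>i<m. (norm (x i))\<^sup>2) = 0" using of_real_eq_0_iff by blast
    then have "\<forall>i<m. x i = 0" by (subst (asm) sum_nonneg_eq_0_iff) auto
    with x(1) show False by auto
  qed
  obtain m e where e: "\<forall>i<m. e i \<in> S" "orthonormal_on h m e"
      "\<forall>y\<in>S. (\<forall>i<m. h y (e i) = 0) \<longrightarrow> Re (h y y) \<le> 0"
    using ex_maximal_orthonormal[of n] bound by blast
  have "n - cDIM TYPE('v) \<le> m"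
  proof (rule ccontr)
    assume "\<not> ?thesis"
    then have "cDIM TYPE('v) + m < n" by simp
    from ex_nontrivial_combination[OF cs.subspace_UNIV fin_dim_UNIV UNIV_I this, of v "\<lambda>j i. cnj (e j i)"]
    obtain c where c: "\<exists>i<n. c i \<noteq> 0" "\<forall>i\<ge>n. c i = 0" "(\<Sum>i<n. c i *\<^sub>C v i) = 0"
      "\<forall>j<m. (\<Sum>i<n. c i * cnj (e j i)) = 0" by blast
    have "Re (h c c) \<le> 0" using e(3) c by (auto simp: S_def h_def)
    moreover have "h c c = complex_of_real (\<Sum>i<n. (norm (c i))\<^sup>2)"
      unfolding h_def of_real_sum by (intro sum.cong refl complex_norm_square[symmetric])
    ultimately have "(\<Sum>i<n. (norm (c i))\<^sup>2) \<le> 0" by simp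
    then have "(\<Sum>i<n. (norm (c i))\<^sup>2) = 0" by (intro antisym sum_nonneg) auto
    then have "\<forall>i<n. c i = 0" by (subst (asm) sum_nonneg_eq_0_iff) auto
    with c(1) show False by blast
  qed
  then show ?thesis
    using e(1,2) by (intro exI[of _ e]) (auto simp: orthonormal_coeffs_def orthonormal_on_def h_def S_def)
qed

lemma bounded_family_subsequence:
  fixes x :: "nat \<Rightarrow> 's \<Rightarrow> complex"
  assumes "finite S" "\<And>n s. s \<in> S \<Longrightarrow> norm (x n s) \<le> 1"
  shows "\<exists>\<rho> l. strict_mono (\<rho> :: nat \<Rightarrow> nat) \<and> (\<forall>s\<in>S. (\<lambda>n. x (\<rho> n) s) \<longlonglongrightarrow> l s)"
  using assms
proof (induction S rule: finite_induct)
  case empty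
  then show ?case by (intro exI[of _ id]) (auto simp: strict_mono_def)
next
  case (insert s S)
  then obtain \<rho> l where \<rho>: "strict_mono (\<rho> :: nat \<Rightarrow> nat)" "\<forall>s\<in>S. (\<lambda>n. x (\<rho> n) s) \<longlonglongrightarrow> l s" by blast
  have "\<forall>n. x (\<rho> n) s \<in> cball 0 1" using insert.prems by auto
  then obtain k \<rho>' where \<rho>': "strict_mono (\<rho>' :: nat \<Rightarrow> nat)" "((\<lambda>n. x (\<rho> n) s) \<circ> \<rho>') \<longlonglongrightarrow> k"
    using compact_cball[of "0::complex" 1, unfolded compact_def, THEN spec[of _ "\<lambda>n. x (\<rho> n) s"]] by blast
  have "(\<lambda>n. x (\<rho> (\<rho>' n)) s') \<longlonglongrightarrow> (if s' = s then k else l s')" if s': "s' \<in> insert s S" for s'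
  proof (cases "s' = s")
    case True
    then show ?thesis using \<rho>'(2) by (simp add: o_def)
  next
    case False
    then have "(\<lambda>n. x (\<rho> n) s') \<longlonglongrightarrow> l s'" using \<rho>(2) s' by blast
    from LIMSEQ_subseq_LIMSEQ[OF this \<rho>'(1)] False show ?thesis by (simp add: o_def)
  qed
  moreover have "strict_mono (\<lambda>n. \<rho> (\<rho>' n))" using \<rho>(1) \<rho>'(1) by (simp add: strict_mono_def)
  ultimately show ?case by (intro exI[of _ "\<lambda>n. \<rho> (\<rho>' n)"] exI[of _ "\<lambda>s'. if s' = s then k else l s'"]) blast
qed

text \<open>Orthonormal bases of the subspaces for the single indices \<open>m\<close> have a convergent subsequence. By
  monotonicity \<open>S l\<close> is nonpositive on the subspaces for all large \<open>m\<close>, hence by continuity on the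
  limit.\<close>

lemma monotone_family_limit_subspace:
  fixes S :: "nat \<Rightarrow> (nat \<Rightarrow> complex) \<Rightarrow> real"
  assumes mono: "\<And>l m c. l \<le> m \<Longrightarrow> S l c \<le> S m c"
    and cont: "\<And>l c c'. (\<And>i. i < M \<Longrightarrow> (\<lambda>m. c m i) \<longlonglongrightarrow> c' i) \<Longrightarrow> (\<lambda>m. S l (c m)) \<longlonglongrightarrow> S l c'"
    and sub: "\<And>m. \<exists>q. orthonormal_coeffs M r q \<and> (\<forall>d. S m (\<lambda>i. \<Sum>j<r. d j * q j i) \<le> 0)"
  shows "\<exists>q. orthonormal_coeffs M r q \<and> (\<forall>l d. S l (\<lambda>i. \<Sum>j<r. d j * q j i) \<le> 0)"
proof -
  from sub have "\<forall>m. \<exists>q. orthonormal_coeffs M r q \<and> (\<forall>d. S m (\<lambda>i. \<Sum>j<r. d j * q j i) \<le> 0)" by blast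
  from choice[OF this] obtain q where q: "\<And>m. orthonormal_coeffs M r (q m)"
      "\<And>m d. S m (\<lambda>i. \<Sum>j<r. d j * q m j i) \<le> 0" by blast
  have le1: "norm (q m j i) \<le> 1" if "j < r" "i < M" for m j i
  proof -
    have "(\<Sum>i<M. q m j i * cnj (q m j i)) = 1" using q(1)[of m] that by (simp add: orthonormal_coeffs_def)
    moreover have "(\<Sum>i<M. q m j i * cnj (q m j i)) = complex_of_real (\<Sum>i<M. (norm (q m j i))\<^sup>2)"
      unfolding of_real_sum by (intro sum.cong refl complex_norm_square[symmetric])
    ultimately have "(\<Sum>i<M. (norm (q m j i))\<^sup>2) = 1" using of_real_eq_1_iff by metis
    moreover have "(norm (q m j i))\<^sup>2 \<le> (\<Sum>i<M. (norm (q m j i))\<^sup>2)"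
      using that by (intro member_le_sum) auto
    ultimately show ?thesis by (simp add: power_le_one_iff abs_square_le_1)
  qed
  have "\<exists>\<rho> l. strict_mono (\<rho> :: nat \<Rightarrow> nat) \<and>
      (\<forall>s\<in>{..<r} \<times> {..<M}. (\<lambda>n. q (\<rho> n) (fst s) (snd s)) \<longlonglongrightarrow> l s)"
    by (rule bounded_family_subsequence[of _ "\<lambda>n s. q n (fst s) (snd s)"]) (auto intro: le1)
  then obtain \<rho> l where \<rho>: "strict_mono (\<rho> :: nat \<Rightarrow> nat)"
      and "\<forall>s\<in>{..<r} \<times> {..<M}. (\<lambda>n. q (\<rho> n) (fst s) (snd s)) \<longlonglongrightarrow> l s" by blast
  then have l: "(\<lambda>n. q (\<rho> n) j i) \<longlonglongrightarrow> l (j, i)" if "j < r" "i < M" for j i using that by force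
  show ?thesis
  proof (intro exI[of _ "\<lambda>j i. l (j, i)"] conjI allI)
    show "orthonormal_coeffs M r (\<lambda>j i. l (j, i))"
      unfolding orthonormal_coeffs_def
    proof (intro allI impI)
      fix j k assume jk: "j < r" "k < r"
      have L1: "(\<lambda>n. \<Sum>i<M. q (\<rho> n) j i * cnj (q (\<rho> n) k i)) \<longlonglongrightarrow> (\<Sum>i<M. l (j, i) * cnj (l (k, i)))"
        using jk by (intro tendsto_sum tendsto_mult tendsto_cnj l) auto
      have L2: "(\<lambda>n. \<Sum>i<M. q (\<rho> n) j i * cnj (q (\<rho> n) k i)) = (\<lambda>n. if j = k then 1 else 0)"
        using q(1) jk by (auto simp: orthonormal_coeffs_def)
      show "(\<Sum>i<M. l (j, i) * cnj (l (k, i))) = (if j = k then 1 else 0)"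
        by (rule LIMSEQ_unique[OF L1[unfolded L2] tendsto_const])
    qed
    fix m d
    have "(\<lambda>n. S m (\<lambda>i. \<Sum>j<r. d j * q (\<rho> n) j i)) \<longlonglongrightarrow> S m (\<lambda>i. \<Sum>j<r. d j * l (j, i))"
      by (rule cont) (intro tendsto_sum tendsto_mult tendsto_const l; simp)
    moreover have "\<forall>\<^sub>F n in sequentially. S m (\<lambda>i. \<Sum>j<r. d j * q (\<rho> n) j i) \<le> 0"
      unfolding eventually_sequentially
    proof (intro exI[of _ m] allI impI)
      fix n assume "m \<le> n"
      also have "n \<le> \<rho> n" by (rule seq_suble[OF \<rho>])
      finally have "S m (\<lambda>i. \<Sum>j<r. d j * q (\<rho> n) j i) \<le> S (\<rho> n) (\<lambda>i. \<Sum>j<r. d j * q (\<rho> n) j i)" by (rule mono)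
      then show "S m (\<lambda>i. \<Sum>j<r. d j * q (\<rho> n) j i) \<le> 0" using q(2)[of "\<rho> n" d] by linarith
    qed
    ultimately show "S m (\<lambda>i. \<Sum>j<r. d j * l (j, i)) \<le> 0"
      by (rule tendsto_upperbound) simp
  qed
qed


section \<open>Deficiency indices and the boundary form\<close>

definition flux :: "('h::complex_inner, 'k::complex_inner) spH \<Rightarrow> real"
  where "flux x = Im (cinner (J x) x)"

lemma flux_tendsto: "(f \<longlongrightarrow> x) F \<Longrightarrow> ((\<lambda>n. flux (f n)) \<longlongrightarrow> flux x) F"
  unfolding flux_def by (intro tendsto_Im cinner.tendsto bounded_linear.tendsto[OF bounded_linear_J])

lemma flux_eq: "flux (x0, x1, x2) = (norm x1)\<^sup>2 + 2 * Im (cinner x0 x2)"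
  using cinner_commute[of x2 x0]
  by (simp add: flux_def J_def cinner_prod_def cinner_scaleC_left cinner_self del: of_real_power)

context canonical_system
begin

lemma solves_cong_AE:
  assumes "AE t in lborel. t \<in> I \<longrightarrow> f t = g t" "solves I B y f"
  shows "solves I B y g"
  using assms(2) unfolding solves_def using assms(1) by eventually_elim auto

text \<open>Pairs \<open>{y, p}\<close> as in the maximal relation, but with square integrability only up to
  interior points. The fundamental solutions belong to such pairs, whatever their behaviour at \<open>b\<close>.\<close>

definition sol_pair :: "(real \<Rightarrow> ('h, 'k) spH) \<Rightarrow> (real \<Rightarrow> ('h, 'k) spH) \<Rightarrow> bool"
  where "sol_pair y p \<longleftrightarrow> y \<in> AC a I \<and> solves I B y (\<lambda>t. D t (p t)) \<and> (\<forall>\<beta>\<in>I. sqint {a..\<beta>} p)"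

lemma initial_segment: "\<beta> \<in> I \<Longrightarrow> {a..\<beta>} \<subseteq> I"
  by (rule flow.I_sub[OF order_refl])

lemma sol_pair_zero: "sol_pair (\<lambda>_. 0) (\<lambda>_. 0)"
proof -
  have "J (0 :: ('h, 'k) spH) = 0" using linear_0[OF bounded_linear.linear[OF bounded_linear_J]] .
  then have "solves I B (\<lambda>_. 0) (\<lambda>t. D t 0)"
    unfolding solves_def by (intro AE_I2 impI exI[of _ 0]) simp
  then show ?thesis by (simp add: sol_pair_def AC_def abs_cont_on_def sqint_zero gt_ex)
qed

lemma sol_pair_comb:
  assumes y: "sol_pair y p" and z: "sol_pair z q"
  shows "sol_pair (\<lambda>t. y t + c *\<^sub>C z t) (\<lambda>t. p t + c *\<^sub>C q t)"
  unfolding sol_pair_def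
proof (intro conjI ballI)
  show "(\<lambda>t. y t + c *\<^sub>C z t) \<in> AC a I"
    unfolding AC_def
  proof (intro CollectI conjI allI impI ballI)
    fix \<beta> assume "\<beta> \<in> I"
    then have ac: "abs_cont_on a \<beta> y" "abs_cont_on a \<beta> z" using y z by (auto simp: sol_pair_def AC_def)
    show "abs_cont_on a \<beta> (\<lambda>t. y t + c *\<^sub>C z t)"
    proof (rule abs_cont_on_Lipschitz_bound[OF ac, where K=1 and M="norm c + 1"])
      fix r s
      have eq: "(y s + c *\<^sub>C z s) - (y r + c *\<^sub>C z r) = (y s - y r) + c *\<^sub>C (z s - z r)"
        by (simp add: cs.scale_right_diff_distrib)
      have "norm ((y s + c *\<^sub>C z s) - (y r + c *\<^sub>C z r)) \<le> norm (y s - y r) + norm c * norm (z s - z r)"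
        unfolding eq using norm_triangle_ineq[of "y s - y r" "c *\<^sub>C (z s - z r)"] by simp
      also have "\<dots> \<le> 1 * norm (y s - y r) + (norm c + 1) * norm (z s - z r)"
        by (simp add: distrib_right)
      finally show "norm ((y s + c *\<^sub>C z s) - (y r + c *\<^sub>C z r))
          \<le> 1 * norm (y s - y r) + (norm c + 1) * norm (z s - z r)" .
    qed (auto intro: add_nonneg_pos)
  qed (use y z in \<open>simp add: sol_pair_def AC_def\<close>)
  have sy: "solves I B y (\<lambda>t. D t (p t))" and sz: "solves I B z (\<lambda>t. D t (q t))"
    using y z by (simp_all add: sol_pair_def)
  show "solves I B (\<lambda>t. y t + c *\<^sub>C z t) (\<lambda>t. D t (p t + c *\<^sub>C q t))"
    using sy[unfolded solves_def] sz[unfolded solves_def] unfolding solves_def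
  proof eventually_elim
    case (elim t)
    show ?case
    proof
      assume t: "t \<in> I"
      obtain y' z' where y': "(y has_vector_derivative y') (at t within I)" "J y' - blinfun_apply (B t) (y t) = D t (p t)"
        and z': "(z has_vector_derivative z') (at t within I)" "J z' - blinfun_apply (B t) (z t) = D t (q t)"
        using elim t by blast
      have lB: "blinfun_apply (B t) (c *\<^sub>C x) = c *\<^sub>C blinfun_apply (B t) x" for x
        using clinear_B[OF t] unfolding clinear_op_def by blast
      show "\<exists>y'. ((\<lambda>t. y t + c *\<^sub>C z t) has_vector_derivative y') (at t within I) \<and>
          J y' - blinfun_apply (B t) (y t + c *\<^sub>C z t) = D t (p t + c *\<^sub>C q t)"
      proof (rule exI[of _ "y' + c *\<^sub>C z'"], rule conjI)
        show "((\<lambda>t. y t + c *\<^sub>C z t) has_vector_derivative (y' + c *\<^sub>C z')) (at t within I)"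
          by (intro has_vector_derivative_add y' bounded_linear.has_vector_derivative[OF scaleC.bounded_linear_right] z')
        have "J (y' + c *\<^sub>C z') - blinfun_apply (B t) (y t + c *\<^sub>C z t)
            = (J y' - blinfun_apply (B t) (y t)) + c *\<^sub>C (J z' - blinfun_apply (B t) (z t))"
          by (simp add: J_add J_scaleC blinfun.add_right lB cs.scale_right_diff_distrib)
        also have "\<dots> = D t (p t + c *\<^sub>C q t)" unfolding y'(2) z'(2) by (simp add: blinfun.add_right D_scaleC[OF t])
        finally show "J (y' + c *\<^sub>C z') - blinfun_apply (B t) (y t + c *\<^sub>C z t) = D t (p t + c *\<^sub>C q t)" .
      qed
    qed
  qed
  fix \<beta> assume \<beta>: "\<beta> \<in> I"
  have "sqint {a..\<beta>} p" "sqint {a..\<beta>} q" using y z \<beta> by (auto simp: sol_pair_def)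
  then show "sqint {a..\<beta>} (\<lambda>t. p t + c *\<^sub>C q t)"
    by (intro sqint_add sqint_scale initial_segment[OF \<beta>]) auto
qed

lemma sol_pair_lincomb:
  assumes "\<And>i. i < n \<Longrightarrow> sol_pair (y i) (p i)"
  shows "sol_pair (lincomb n c y) (lincomb n c p)"
  using assms
proof (induction n)
  case 0
  then show ?case using sol_pair_zero by (simp add: lincomb_def[abs_def])
next
  case (Suc n)
  have "lincomb (Suc n) c f = (\<lambda>t. lincomb n c f t + c n *\<^sub>C f n t)" for f :: "nat \<Rightarrow> real \<Rightarrow> ('h, 'k) spH"
    by (simp add: lincomb_def fun_eq_iff)
  then show ?case using sol_pair_comb[of "lincomb n c y" "lincomb n c p" "y n" "p n" "c n"] Suc by simp
qed

lemma Tmax_fun_iff: "(y, p) \<in> Tmax_fun a I B \<Delta> \<longleftrightarrow> sol_pair y p \<and> sqint I y \<and> sqint I p \<and> (\<forall>t. t \<notin> I \<longrightarrow> p t = 0)"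
  using sqint_subset[of I p] initial_segment
  by (auto simp: Tmax_fun_def L2fun_iff sol_pair_def AC_def)

lemma Tmax_fun_lincomb:
  assumes "\<And>i. i < n \<Longrightarrow> (y i, p i) \<in> Tmax_fun a I B \<Delta>"
  shows "(lincomb n c y, lincomb n c p) \<in> Tmax_fun a I B \<Delta>"
  unfolding Tmax_fun_iff
proof (intro conjI allI impI)
  show "sol_pair (lincomb n c y) (lincomb n c p)" using assms by (intro sol_pair_lincomb) (auto simp: Tmax_fun_iff)
  show "sqint I (lincomb n c y)" "sqint I (lincomb n c p)"
    using assms I_sets by (intro sqint_lincomb; auto simp: Tmax_fun_iff)+
  show "lincomb n c p t = 0" if "t \<notin> I" for t using assms that by (simp add: lincomb_def Tmax_fun_iff)
qed

lemma dom_Tmax_lincomb: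
  assumes "\<And>i. i < n \<Longrightarrow> y i \<in> dom_Tmax a I B \<Delta>"
  shows "lincomb n c y \<in> dom_Tmax a I B \<Delta>"
proof -
  have "\<forall>i. \<exists>p. i < n \<longrightarrow> (y i, p) \<in> Tmax_fun a I B \<Delta>" using assms by blast
  from choice[OF this] obtain p where "\<And>i. i < n \<Longrightarrow> (y i, p i) \<in> Tmax_fun a I B \<Delta>" by blast
  from DomainI[OF Tmax_fun_lincomb[of n y p c, OF this]] show ?thesis .
qed

subsection \<open>Defect functions\<close>

definition defect_space :: "complex \<Rightarrow> (real \<Rightarrow> ('h, 'k) spH) set"
  where "defect_space \<mu> = {y. sol_pair y (\<lambda>t. \<mu> *\<^sub>C y t) \<and> sqint I y}"

lemma solves_scaled: "solves I B y (\<lambda>t. D t (\<mu> *\<^sub>C y t)) \<longleftrightarrow> solves I B y (\<lambda>t. \<mu> *\<^sub>C D t (y t))"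
  using solves_cong_AE[of "\<lambda>t. D t (\<mu> *\<^sub>C y t)" "\<lambda>t. \<mu> *\<^sub>C D t (y t)" y]
    solves_cong_AE[of "\<lambda>t. \<mu> *\<^sub>C D t (y t)" "\<lambda>t. D t (\<mu> *\<^sub>C y t)" y] D_scaleC by auto

lemma eigen_sol_pair:
  assumes "y \<in> AC a I" "solves I B y (\<lambda>t. \<mu> *\<^sub>C D t (y t))"
  shows "sol_pair y (\<lambda>t. \<mu> *\<^sub>C y t)"
  using assms AC_sqint[OF assms(1) order_refl] initial_segment
  by (auto simp: sol_pair_def solves_scaled intro!: sqint_scale)

lemma sol_pair_eigen:
  assumes "sol_pair y (\<lambda>t. \<mu> *\<^sub>C y t)"
  shows "y \<in> AC a I" "solves I B y (\<lambda>t. \<mu> *\<^sub>C D t (y t))"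
  using assms by (auto simp: sol_pair_def solves_scaled)

lemma AC_zero_outside: "y \<in> AC a I \<Longrightarrow> t \<notin> I \<Longrightarrow> y t = 0"
  by (simp add: AC_def)

lemma defect_Tmax: "y \<in> defect_space \<mu> \<Longrightarrow> (y, \<lambda>t. \<mu> *\<^sub>C y t) \<in> Tmax_fun a I B \<Delta>"
  unfolding defect_space_def Tmax_fun_iff
  using AC_zero_outside[of y] by (auto simp: sol_pair_def intro: sqint_scale)

lemma eigen_lincomb:
  assumes "\<And>i. i < n \<Longrightarrow> sol_pair (u i) (\<lambda>t. \<mu> *\<^sub>C u i t)"
  shows "sol_pair (lincomb n c u) (\<lambda>t. \<mu> *\<^sub>C lincomb n c u t)"
proof -
  have "lincomb n c (\<lambda>i t. \<mu> *\<^sub>C u i t) = (\<lambda>t. \<mu> *\<^sub>C lincomb n c u t)"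
    by (simp add: lincomb_def fun_eq_iff cs.scale_sum_right mult.commute)
  with sol_pair_lincomb[of n u "\<lambda>i t. \<mu> *\<^sub>C u i t" c] assms show ?thesis by simp
qed

lemma defect_lincomb:
  assumes "\<And>i. i < n \<Longrightarrow> u i \<in> defect_space \<mu>"
  shows "lincomb n c u \<in> defect_space \<mu>"
proof -
  have "sol_pair (lincomb n c u) (\<lambda>t. \<mu> *\<^sub>C lincomb n c u t)"
    by (rule eigen_lincomb) (use assms in \<open>auto simp: defect_space_def\<close>)
  moreover have "sqint I (lincomb n c u)"
    by (rule sqint_lincomb) (use assms I_sets in \<open>auto simp: defect_space_def\<close>)
  ultimately show ?thesis by (simp add: defect_space_def)
qed

lemma defect_definite:
  assumes y: "sol_pair y (\<lambda>t. \<mu> *\<^sub>C y t)" and z: "AE t in lborel. t \<in> I \<longrightarrow> D t (y t) = 0"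
  shows "y = (\<lambda>_. 0)"
proof -
  note ys = sol_pair_eigen[OF y]
  have "\<forall>\<mu> y. y \<in> AC a I \<and> solves I B y (\<lambda>t. \<mu> *\<^sub>C D t (y t)) \<and>
       (AE t in lborel. t \<in> I \<longrightarrow> D t (y t) = 0) \<longrightarrow> (\<forall>t\<in>I. y t = 0)"
    using system unfolding definite_system_def by (elim conjE)
  then have "\<forall>t\<in>I. y t = 0" using ys z by blast
  then show ?thesis using AC_zero_outside[OF ys(1)] by (intro ext) blast
qed

lemma dens_integral_eq_0_iff:
  assumes f: "sqint S f" and S: "S \<subseteq> I"
  shows "(LBINT t:S. Re (dens f f t)) = 0 \<longleftrightarrow> (AE t in lborel. t \<in> S \<longrightarrow> D t (f t) = 0)"
proof -
  have i: "integrable lborel (\<lambda>t. indicator S t *\<^sub>R Re (dens f f t))" using f by (simp add: sqint_def set_integrable_def)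
  have nn: "AE t in lborel. 0 \<le> indicator S t *\<^sub>R Re (dens f f t)"
    using dens_Re_nonneg[of f] by eventually_elim (use S in \<open>auto simp: indicator_def\<close>)
  have "(LBINT t:S. Re (dens f f t)) = 0 \<longleftrightarrow> (AE t in lborel. indicator S t *\<^sub>R Re (dens f f t) = 0)"
    unfolding set_lebesgue_integral_def by (rule integral_nonneg_eq_0_iff_AE[OF i nn])
  also have "\<dots> \<longleftrightarrow> (AE t in lborel. t \<in> S \<longrightarrow> D t (f t) = 0)"
  proof
    assume "AE t in lborel. indicator S t *\<^sub>R Re (dens f f t) = 0"
    then show "AE t in lborel. t \<in> S \<longrightarrow> D t (f t) = 0"
      using nonneg_D
    proof eventually_elim
      case (elim t)
      then show ?case using nonneg_op_eq_0[of "\<Delta> t" "f t"] S by (auto simp: dens_def simp del: split_paired_All)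
    qed
  next
    assume "AE t in lborel. t \<in> S \<longrightarrow> D t (f t) = 0"
    then show "AE t in lborel. indicator S t *\<^sub>R Re (dens f f t) = 0"
      by eventually_elim (auto simp: dens_def indicator_def)
  qed
  finally show ?thesis .
qed

lemma sqint_diff: "\<lbrakk>sqint S f; sqint S g; S \<subseteq> I; S \<in> sets borel\<rbrakk> \<Longrightarrow> sqint S (\<lambda>t. f t - g t)"
  using sqint_add[of S f "\<lambda>t. (-1) *\<^sub>C g t"] sqint_scale[of S g "-1"] by (simp add: cs.scale_minus_left)

lemma normL2_diff_eq_0:
  assumes "f \<in> L2fun I \<Delta>" "g \<in> L2fun I \<Delta>"
  shows "normL2 I \<Delta> (\<lambda>t. f t - g t) = 0 \<longleftrightarrow> (AE t in lborel. t \<in> I \<longrightarrow> D t (f t) = D t (g t))"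
proof -
  have "sqint I (\<lambda>t. f t - g t)" using assms I_sets by (intro sqint_diff) (auto simp: L2fun_iff)
  from dens_integral_eq_0_iff[OF this order_refl] show ?thesis
    unfolding normL2_def dens_def by (simp add: blinfun.diff_right)
qed

lemma quot_eq_iff:
  assumes f: "f \<in> L2fun I \<Delta>" and g: "g \<in> L2fun I \<Delta>"
  shows "quot I \<Delta> f = quot I \<Delta> g \<longleftrightarrow> (AE t in lborel. t \<in> I \<longrightarrow> D t (f t) = D t (g t))"
proof
  assume "quot I \<Delta> f = quot I \<Delta> g"
  moreover have "g \<in> quot I \<Delta> g" using normL2_diff_eq_0[OF g g] g by (simp add: quot_def)
  ultimately have "g \<in> quot I \<Delta> f" by blast
  then have "normL2 I \<Delta> (\<lambda>t. f t - g t) = 0" unfolding quot_def by blast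
  then show "AE t in lborel. t \<in> I \<longrightarrow> D t (f t) = D t (g t)" using normL2_diff_eq_0[OF f g] by blast
next
  assume ae: "AE t in lborel. t \<in> I \<longrightarrow> D t (f t) = D t (g t)"
  have "normL2 I \<Delta> (\<lambda>t. f t - h t) = 0 \<longleftrightarrow> normL2 I \<Delta> (\<lambda>t. g t - h t) = 0" if h: "h \<in> L2fun I \<Delta>" for h
    unfolding normL2_diff_eq_0[OF f h] normL2_diff_eq_0[OF g h]
  proof
    assume "AE t in lborel. t \<in> I \<longrightarrow> D t (f t) = D t (h t)"
    with ae show "AE t in lborel. t \<in> I \<longrightarrow> D t (g t) = D t (h t)" by eventually_elim simp
  next
    assume "AE t in lborel. t \<in> I \<longrightarrow> D t (g t) = D t (h t)"
    with ae show "AE t in lborel. t \<in> I \<longrightarrow> D t (f t) = D t (h t)" by eventually_elim simp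
  qed
  then show "quot I \<Delta> f = quot I \<Delta> g" by (auto simp: quot_def)
qed

lemma L2fun_lincomb: "(\<And>i. i < n \<Longrightarrow> f i \<in> L2fun I \<Delta>) \<Longrightarrow> lincomb n c f \<in> L2fun I \<Delta>"
  using sqint_lincomb[of n I f c] I_sets by (auto simp: L2fun_iff lincomb_def)

lemma D_lincomb: "t \<in> I \<Longrightarrow> D t (lincomb n c f t) = (\<Sum>i<n. c i *\<^sub>C D t (f i t))"
  by (simp add: lincomb_def blinfun.sum_right D_scaleC)

lemma L2fun_zero: "(\<lambda>_. 0) \<in> L2fun I \<Delta>"
  by (simp add: L2fun_iff sqint_zero)

text \<open>A class in the kernel contains a solution: if \<open>{y, f}\<close> is a pair of functions whose classes are
  those of \<open>g\<close> and \<open>\<mu> g\<close>, then \<open>\<Delta> f = \<mu> \<Delta> y\<close> almost everywhere. By definiteness a solution whose class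
  is zero vanishes identically, so linear independence of classes is linear independence of
  solutions, and the quotient space can be forgotten.\<close>

lemma deficiency_ge_iff:
  "enat n \<le> deficiency a I B \<Delta> \<mu> \<longleftrightarrow>
    (\<exists>u. (\<forall>i<n. u i \<in> defect_space \<mu>) \<and> (\<forall>c. lincomb n c u = (\<lambda>_. 0) \<longrightarrow> (\<forall>i<n. c i = 0)))"
    (is "_ \<longleftrightarrow> ?R n")
proof -
  let ?U = "{quot I \<Delta> f | f. f \<in> L2fun I \<Delta> \<and> (quot I \<Delta> f, quot I \<Delta> (\<lambda>t. \<mu> *\<^sub>C f t)) \<in> Tmax a I B \<Delta>}"
  let ?P = "\<lambda>n. \<exists>f. (\<forall>i<n. f i \<in> L2fun I \<Delta> \<and> quot I \<Delta> (f i) \<in> ?U) \<and>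
    (\<forall>c. quot I \<Delta> (lincomb n c f) = quot I \<Delta> (\<lambda>_. 0) \<longrightarrow> (\<forall>i<n. c i = 0))"
  have down: "?P m" if P: "?P n" and "m \<le> n" for m n
  proof -
    obtain f where f: "\<forall>i<n. f i \<in> L2fun I \<Delta> \<and> quot I \<Delta> (f i) \<in> ?U"
        "\<forall>c. quot I \<Delta> (lincomb n c f) = quot I \<Delta> (\<lambda>_. 0) \<longrightarrow> (\<forall>i<n. c i = 0)" using P by blast
    have "\<forall>i<m. c i = 0" if z: "quot I \<Delta> (lincomb m c f) = quot I \<Delta> (\<lambda>_. 0)" for c
    proof -
      have "quot I \<Delta> (lincomb n (\<lambda>i. if i < m then c i else 0) f) = quot I \<Delta> (\<lambda>_. 0)"
        using z lincomb_extend[OF \<open>m \<le> n\<close>, of c f] by simp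
      with f(2) have "\<forall>i<n. (if i < m then c i else 0) = 0" by blast
      then show ?thesis using \<open>m \<le> n\<close> by (metis less_le_trans)
    qed
    moreover have "\<forall>i<m. f i \<in> L2fun I \<Delta> \<and> quot I \<Delta> (f i) \<in> ?U" using f(1) \<open>m \<le> n\<close> by (meson less_le_trans)
    ultimately show ?thesis by blast
  qed
  have rep: "\<exists>y\<in>defect_space \<mu>. quot I \<Delta> y = quot I \<Delta> f" if f: "f \<in> L2fun I \<Delta>" "quot I \<Delta> f \<in> ?U" for f
  proof -
    obtain f' where f': "quot I \<Delta> f = quot I \<Delta> f'" "f' \<in> L2fun I \<Delta>"
      "(quot I \<Delta> f', quot I \<Delta> (\<lambda>t. \<mu> *\<^sub>C f' t)) \<in> Tmax a I B \<Delta>" using f(2) by blast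
    obtain y g where yg: "quot I \<Delta> f' = quot I \<Delta> y" "quot I \<Delta> (\<lambda>t. \<mu> *\<^sub>C f' t) = quot I \<Delta> g" "(y, g) \<in> Tmax_fun a I B \<Delta>"
      using f'(3) unfolding Tmax_def by blast
    have L: "y \<in> L2fun I \<Delta>" "g \<in> L2fun I \<Delta>" "(\<lambda>t. \<mu> *\<^sub>C f' t) \<in> L2fun I \<Delta>"
      using yg(3) f'(2) sqint_scale[of I f' \<mu>] by (auto simp: Tmax_fun_def L2fun_iff)
    have ae: "AE t in lborel. t \<in> I \<longrightarrow> D t (f' t) = D t (y t)" "AE t in lborel. t \<in> I \<longrightarrow> D t (\<mu> *\<^sub>C f' t) = D t (g t)"
      using yg quot_eq_iff[OF f'(2) L(1)] quot_eq_iff[OF L(3,2)] by blast+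
    have "AE t in lborel. t \<in> I \<longrightarrow> D t (g t) = \<mu> *\<^sub>C D t (y t)"
      using ae by eventually_elim (use D_scaleC in auto)
    from solves_cong_AE[OF this] have "solves I B y (\<lambda>t. \<mu> *\<^sub>C D t (y t))" "y \<in> AC a I"
      using yg(3) by (auto simp: Tmax_fun_def)
    then have "y \<in> defect_space \<mu>" using eigen_sol_pair L(1) by (auto simp: defect_space_def L2fun_iff)
    then show ?thesis using yg(1) f'(1) by auto
  qed
  have in_U: "y \<in> L2fun I \<Delta> \<and> quot I \<Delta> y \<in> ?U" if "y \<in> defect_space \<mu>" for y
    using defect_Tmax[OF that] by (auto simp: Tmax_def Tmax_fun_def)
  have "enat n \<le> deficiency a I B \<Delta> \<mu> \<longleftrightarrow> ?P n"
    unfolding deficiency_def dimL2_def by (rule enat_le_Sup_iff[of ?P]) (blast, rule down)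
  also have "\<dots> \<longleftrightarrow> ?R n"
  proof
    assume "?P n"
    then obtain f where f: "\<forall>i<n. f i \<in> L2fun I \<Delta> \<and> quot I \<Delta> (f i) \<in> ?U"
        "\<forall>c. quot I \<Delta> (lincomb n c f) = quot I \<Delta> (\<lambda>_. 0) \<longrightarrow> (\<forall>i<n. c i = 0)" by blast
    have "\<forall>i. \<exists>y. i < n \<longrightarrow> y \<in> defect_space \<mu> \<and> quot I \<Delta> y = quot I \<Delta> (f i)" using f(1) rep by blast
    from choice[OF this] obtain u where u: "\<And>i. i < n \<Longrightarrow> u i \<in> defect_space \<mu>" "\<And>i. i < n \<Longrightarrow> quot I \<Delta> (u i) = quot I \<Delta> (f i)"
      by blast
    have uL: "\<And>i. i < n \<Longrightarrow> u i \<in> L2fun I \<Delta>" "\<And>i. i < n \<Longrightarrow> f i \<in> L2fun I \<Delta>" using u(1) in_U f(1) by blast+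
    have "\<forall>i<n. c i = 0" if z: "lincomb n c u = (\<lambda>_. 0)" for c
    proof -
      have "AE t in lborel. \<forall>i. i < n \<longrightarrow> t \<in> I \<longrightarrow> D t (u i t) = D t (f i t)"
        unfolding AE_all_countable
      proof
        fix i show "AE t in lborel. i < n \<longrightarrow> t \<in> I \<longrightarrow> D t (u i t) = D t (f i t)"
          using quot_eq_iff[OF uL(1) uL(2), of i i] u(2)[of i] by (cases "i < n") auto
      qed
      then have "AE t in lborel. t \<in> I \<longrightarrow> D t (lincomb n c f t) = D t 0"
      proof eventually_elim
        case (elim t)
        show ?case
        proof
          assume t: "t \<in> I"
          have "D t (lincomb n c f t) = D t (lincomb n c u t)" unfolding D_lincomb[OF t] using elim t by (intro sum.cong) auto
          then show "D t (lincomb n c f t) = D t 0" using z by simp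
        qed
      qed
      with quot_eq_iff[OF L2fun_lincomb[of n f c] L2fun_zero] uL(2) have "quot I \<Delta> (lincomb n c f) = quot I \<Delta> (\<lambda>_. 0)" by blast
      with f(2) show ?thesis by blast
    qed
    with u(1) show "?R n" by blast
  next
    assume "?R n"
    then obtain u where u: "\<forall>i<n. u i \<in> defect_space \<mu>" "\<forall>c. lincomb n c u = (\<lambda>_. 0) \<longrightarrow> (\<forall>i<n. c i = 0)" by blast
    have "\<forall>i<n. c i = 0" if z: "quot I \<Delta> (lincomb n c u) = quot I \<Delta> (\<lambda>_. 0)" for c
    proof -
      have N: "lincomb n c u \<in> defect_space \<mu>" by (rule defect_lincomb) (use u in blast)
      have "AE t in lborel. t \<in> I \<longrightarrow> D t (lincomb n c u t) = D t 0"
        using quot_eq_iff[OF _ L2fun_zero, of "lincomb n c u"] z in_U[OF N] by blast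
      then have "AE t in lborel. t \<in> I \<longrightarrow> D t (lincomb n c u t) = 0" by simp
      then have "lincomb n c u = (\<lambda>_. 0)"
        by (intro defect_definite[of _ \<mu>]) (use N in \<open>simp_all add: defect_space_def\<close>)
      with u(2) show ?thesis by blast
    qed
    with u(1) in_U show "?P n" by blast
  qed
  finally show ?thesis .
qed

text \<open>A solution is determined by its initial value.\<close>

lemma deficiency_finite: "deficiency a I B \<Delta> \<mu> \<le> enat (cDIM TYPE(('h, 'k) spH))"
proof (rule ccontr)
  let ?N = "cDIM TYPE(('h, 'k) spH)"
  assume "\<not> ?thesis"
  then have "enat (Suc ?N) \<le> deficiency a I B \<Delta> \<mu>" by (simp add: Suc_ile_eq)
  then obtain u where u: "\<forall>i<Suc ?N. u i \<in> defect_space \<mu>" "\<forall>c. lincomb (Suc ?N) c u = (\<lambda>_. 0) \<longrightarrow> (\<forall>i<Suc ?N. c i = 0)"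
    unfolding deficiency_ge_iff by blast
  obtain c where c: "\<exists>i<Suc ?N. c i \<noteq> 0" "(\<Sum>i<Suc ?N. c i *\<^sub>C u i a) = 0"
    using ex_nontrivial_combination[OF cs.subspace_UNIV fin_dim_UNIV UNIV_I, of 0 "Suc ?N" "\<lambda>i. u i a"] by auto
  have "lincomb (Suc ?N) c u \<in> defect_space \<mu>" by (rule defect_lincomb) (use u in blast)
  then have "sol_pair (lincomb (Suc ?N) c u) (\<lambda>t. \<mu> *\<^sub>C lincomb (Suc ?N) c u t)" by (simp add: defect_space_def)
  from solution_eq_0[OF sol_pair_eigen[OF this]] c(2)
  have "lincomb (Suc ?N) c u = (\<lambda>_. 0)" by (simp add: lincomb_def fun_eq_iff)
  with u(2) c(1) show False by blast
qed

end

lemma lincomb_append: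
  "lincomb (k + n) c F = (\<lambda>t. lincomb k c F t + lincomb n (\<lambda>i. c (k + i)) (\<lambda>i. F (k + i)) t)"
proof
  fix t
  show "lincomb (k + n) c F t = lincomb k c F t + lincomb n (\<lambda>i. c (k + i)) (\<lambda>i. F (k + i)) t"
    by (induction n) (simp_all add: lincomb_def add.assoc)
qed

lemma lincomb_cong: "(\<And>i. i < n \<Longrightarrow> f i = g i) \<Longrightarrow> lincomb n c f = lincomb n c g"
  by (auto simp: lincomb_def fun_eq_iff intro!: sum.cong)

text \<open>The bound is uniform in the coefficients; the crude factor \<open>M\<close> comes from estimating mixed terms
  by Young's inequality.\<close>

lemma nonneg_op_combination_bound:
  assumes T: "nonneg_op T" "clinear_op T"
  shows "Re (cinner (blinfun_apply T (\<Sum>i<M. c i *\<^sub>C x i)) (\<Sum>i<M. c i *\<^sub>C x i))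
    \<le> real M * (\<Sum>i<M. (norm (c i))\<^sup>2) * (\<Sum>i<M. Re (cinner (blinfun_apply T (x i)) (x i)))"
proof -
  define Q where "Q i = Re (cinner (blinfun_apply T (x i)) (x i))" for i
  define C where "C = (\<Sum>i<M. (norm (c i))\<^sup>2)"
  have C0: "0 \<le> C" unfolding C_def by (intro sum_nonneg) simp
  have lin: "blinfun_apply T (c *\<^sub>C z) = c *\<^sub>C blinfun_apply T z" for c z
    using T(2) unfolding clinear_op_def by blast
  have cc: "norm (c i) * norm (c j) \<le> C" if "i < M" "j < M" for i j
  proof -
    have "(norm (c i))\<^sup>2 \<le> C" "(norm (c j))\<^sup>2 \<le> C"
      unfolding C_def using that by (auto intro!: member_le_sum)
    moreover have "2 * (norm (c i) * norm (c j)) \<le> (norm (c i))\<^sup>2 + (norm (c j))\<^sup>2"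
      using sum_squares_bound[of "norm (c i)" "norm (c j)"] by (simp add: mult.assoc)
    ultimately show ?thesis by linarith
  qed
  have b: "norm (c i * cnj (c j) * cinner (blinfun_apply T (x i)) (x j)) \<le> C * ((Q i + Q j) / 2)"
    if "i < M" "j < M" for i j
  proof -
    have le: "norm (cinner (blinfun_apply T (x i)) (x j)) \<le> (Q i + Q j) / 2"
      using nonneg_op_Young[OF T zero_less_one, of "x i" "x j"] by (simp add: Q_def)
    show ?thesis
      unfolding norm_mult complex_mod_cnj by (rule mult_mono[OF cc[OF that] le C0 norm_ge_zero])
  qed
  have eq: "cinner (blinfun_apply T (\<Sum>i<M. c i *\<^sub>C x i)) (\<Sum>i<M. c i *\<^sub>C x i)
      = (\<Sum>i<M. \<Sum>j<M. c i * cnj (c j) * cinner (blinfun_apply T (x i)) (x j))"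
    by (simp add: blinfun.sum_right lin cinner_sum_left cinner_sum_right cinner_scaleC_left cinner_scaleC_right
        sum_distrib_left mult.assoc, subst sum.swap, simp add: mult.left_commute)
  have "Re (cinner (blinfun_apply T (\<Sum>i<M. c i *\<^sub>C x i)) (\<Sum>i<M. c i *\<^sub>C x i))
      \<le> norm (\<Sum>i<M. \<Sum>j<M. c i * cnj (c j) * cinner (blinfun_apply T (x i)) (x j))"
    unfolding eq by (rule complex_Re_le_cmod)
  also have "\<dots> \<le> (\<Sum>i<M. \<Sum>j<M. C * ((Q i + Q j) / 2))"
    by (intro sum_norm_le b) auto
  also have "\<dots> = real M * C * (\<Sum>i<M. Q i)"
    by (simp add: sum_distrib_left[symmetric] sum_divide_distrib[symmetric] sum.distrib)
  finally show ?thesis by (simp add: C_def Q_def)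
qed

context canonical_system
begin

lemma integral_tail_eq:
  fixes \<phi> :: "real \<Rightarrow> real"
  assumes \<phi>: "set_integrable lborel I \<phi>"
  shows "(LBINT t:I. \<phi> t) - (LBINT t:{a..approx n}. \<phi> t) = (LBINT t:I \<inter> {approx n<..}. \<phi> t)"
proof -
  have sub: "{a..approx n} \<subseteq> I" by (rule initial_segment[OF approx_in])
  have decomp: "I = {a..approx n} \<union> (I \<inter> {approx n<..})"
  proof (intro set_eqI iffI)
    fix r assume "r \<in> I"
    then show "r \<in> {a..approx n} \<union> (I \<inter> {approx n<..})" using flow.I_D(1)[of r] by (cases "r \<le> approx n") simp_all
  next
    fix r assume "r \<in> {a..approx n} \<union> (I \<inter> {approx n<..})"
    then show "r \<in> I" using sub by blast
  qed
  have "(LBINT t:{a..approx n} \<union> (I \<inter> {approx n<..}). \<phi> t) = (LBINT t:{a..approx n}. \<phi> t) + (LBINT t:I \<inter> {approx n<..}. \<phi> t)"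
  proof (rule set_integral_Un)
    show "{a..approx n} \<inter> (I \<inter> {approx n<..}) = {}" by auto
    show "set_integrable lborel {a..approx n} \<phi>" by (rule set_integrable_subset[OF \<phi> _ sub]) simp
    show "set_integrable lborel (I \<inter> {approx n<..}) \<phi>" by (rule set_integrable_subset[OF \<phi>]) (use I_sets in auto)
  qed
  then have "(LBINT t:I. \<phi> t) = (LBINT t:{a..approx n}. \<phi> t) + (LBINT t:I \<inter> {approx n<..}. \<phi> t)"
    using arg_cong[OF decomp, of "\<lambda>S. LBINT t:S. \<phi> t"] by (simp only:)
  then show ?thesis by simp
qed

lemma dens_integral_nonneg:
  assumes "S \<subseteq> I"
  shows "0 \<le> (LBINT t:S. Re (dens f f t))"
  unfolding set_lebesgue_integral_def
proof (rule integral_nonneg_AE)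
  show "AE t in lborel. 0 \<le> indicator S t *\<^sub>R Re (dens f f t)"
    using dens_Re_nonneg[of f] by eventually_elim (use assms in \<open>auto simp: indicator_def\<close>)
qed

text \<open>The function \<open>w\<close> is a solution for \<open>\<mu>\<close> up to the defect \<open>g = p - \<mu> w\<close>. By the Lagrange identity the
  flux grows at the rate \<open>2 Im \<mu> (\<Delta> w, w) + 2 Im (\<Delta> g, w)\<close>, and Young's inequality absorbs half of the
  first term into an estimate of the second. The sign \<open>\<sigma>\<close> covers both half-planes at once.\<close>

lemma flux_growth:
  assumes w: "sol_pair w p" and \<sigma>: "\<bar>\<sigma>\<bar> = 1" and \<eta>: "0 < \<sigma> * Im \<mu>" and st: "a \<le> s" "s \<le> t" "t \<in> I"
  defines "g \<equiv> \<lambda>t. p t - \<mu> *\<^sub>C w t"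
  shows "\<sigma> * Im \<mu> * (LBINT \<tau>:{s..t}. Re (dens w w \<tau>)) - 1 / (\<sigma> * Im \<mu>) * (LBINT \<tau>:{s..t}. Re (dens g g \<tau>))
    \<le> \<sigma> * flux (w t) - \<sigma> * flux (w s)"
proof -
  define \<eta>' where "\<eta>' = \<sigma> * Im \<mu>"
  have \<eta>0: "0 < \<eta>'" "0 < 1 / \<eta>'" using \<eta> by (simp_all add: \<eta>'_def)
  have sub: "{s..t} \<subseteq> I" by (rule flow.I_sub[OF st(1,3)])
  have w1: "w \<in> AC a I" "solves I B w (\<lambda>t. D t (p t))" using w by (auto simp: sol_pair_def)
  have sw: "sqint {s..t} w" by (rule AC_sqint[OF w1(1) st(1,3)])
  have "sqint {a..t} p" using w st by (auto simp: sol_pair_def)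
  then have sp: "sqint {s..t} p" by (rule sqint_subset) (use st in auto)
  have sg: "sqint {s..t} g" unfolding g_def by (intro sqint_diff sqint_scale sp sw sub) auto
  define \<psi> where "\<psi> \<tau> = dens p w \<tau> - dens w p \<tau>" for \<tau>
  have i\<psi>: "set_integrable lborel {s..t} \<psi>"
    unfolding \<psi>_def by (intro set_integral_diff(1) dens_integrable sp sw sub) auto
  have iw: "set_integrable lborel {s..t} (\<lambda>\<tau>. Re (dens w w \<tau>))" and ig: "set_integrable lborel {s..t} (\<lambda>\<tau>. Re (dens g g \<tau>))"
    using sw sg by (auto simp: sqint_def)
  have bl: "bounded_linear (\<lambda>z. \<sigma> * Im z)"
    by (rule bounded_linear_compose[OF bounded_linear_mult_right bounded_linear_Im])
  have "cinner (J (w t)) (w t) - cinner (J (w s)) (w s) = (LBINT \<tau>:{s..t}. \<psi> \<tau>)"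
    unfolding \<psi>_def by (rule Lagrange_identity[OF w1 w1 st sp sp])
  then have "\<sigma> * flux (w t) - \<sigma> * flux (w s) = \<sigma> * Im (LBINT \<tau>:{s..t}. \<psi> \<tau>)"
    by (simp add: flux_def right_diff_distrib[symmetric] flip: minus_complex.simps)
  also have "\<dots> = (\<integral>\<tau>. \<sigma> * Im (indicator {s..t} \<tau> *\<^sub>R \<psi> \<tau>) \<partial>lborel)"
    unfolding set_lebesgue_integral_def
    by (rule integral_bounded_linear[OF bl i\<psi>[unfolded set_integrable_def], symmetric])
  also have "\<dots> \<ge> (\<integral>\<tau>. \<eta>' * (indicator {s..t} \<tau> *\<^sub>R Re (dens w w \<tau>)) - 1 / \<eta>' * (indicator {s..t} \<tau> *\<^sub>R Re (dens g g \<tau>)) \<partial>lborel)"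
  proof (rule integral_mono_AE)
    show "integrable lborel (\<lambda>\<tau>. \<sigma> * Im (indicator {s..t} \<tau> *\<^sub>R \<psi> \<tau>))"
      by (rule integrable_bounded_linear[OF bl i\<psi>[unfolded set_integrable_def]])
    show "integrable lborel (\<lambda>\<tau>. \<eta>' * (indicator {s..t} \<tau> *\<^sub>R Re (dens w w \<tau>)) - 1 / \<eta>' * (indicator {s..t} \<tau> *\<^sub>R Re (dens g g \<tau>)))"
      by (intro Bochner_Integration.integrable_diff integrable_mult_right iw[unfolded set_integrable_def] ig[unfolded set_integrable_def])
    show "AE \<tau> in lborel. \<eta>' * (indicator {s..t} \<tau> *\<^sub>R Re (dens w w \<tau>)) - 1 / \<eta>' * (indicator {s..t} \<tau> *\<^sub>R Re (dens g g \<tau>))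
        \<le> \<sigma> * Im (indicator {s..t} \<tau> *\<^sub>R \<psi> \<tau>)"
      using nonneg_D
    proof eventually_elim
      case (elim \<tau>)
      show ?case
      proof (cases "\<tau> \<in> {s..t}")
        case True
        then have tI: "\<tau> \<in> I" using sub by blast
        then have T: "nonneg_op (\<Delta> \<tau>)" "clinear_op (\<Delta> \<tau>)" using elim by blast+
        have pg: "p \<tau> = \<mu> *\<^sub>C w \<tau> + g \<tau>" by (simp add: g_def)
        have real: "Im (dens w w \<tau>) = 0"
          using T(1) unfolding nonneg_op_def dens_def by (simp add: complex_is_Real_iff del: split_paired_All)
        have z: "dens p w \<tau> = \<mu> * dens w w \<tau> + dens g w \<tau>"
          unfolding dens_def pg by (simp add: blinfun.add_right D_scaleC[OF tI] cinner_add_left cinner_scaleC_left)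
        have "dens w p \<tau> = cnj (dens p w \<tau>)" unfolding dens_def by (rule nonneg_op_hermitian[OF T])
        then have "Im (\<psi> \<tau>) = 2 * Im (dens p w \<tau>)" by (simp add: \<psi>_def)
        also have "\<dots> = 2 * (Im \<mu> * Re (dens w w \<tau>)) + 2 * Im (dens g w \<tau>)" unfolding z using real by simp
        finally have "\<sigma> * Im (\<psi> \<tau>) = 2 * (\<eta>' * Re (dens w w \<tau>)) + 2 * (\<sigma> * Im (dens g w \<tau>))"
          by (simp add: \<eta>'_def algebra_simps)
        moreover have "\<bar>\<sigma> * Im (dens g w \<tau>)\<bar> \<le> norm (dens g w \<tau>)"
          using \<sigma> abs_Im_le_cmod[of "dens g w \<tau>"] by (simp add: abs_mult)
        moreover have "2 * norm (dens g w \<tau>) \<le> 1 / \<eta>' * Re (dens g g \<tau>) + \<eta>' * Re (dens w w \<tau>)"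
          using nonneg_op_Young[OF T \<eta>0(2), of "g \<tau>" "w \<tau>"] by (simp add: dens_def)
        ultimately have "\<eta>' * Re (dens w w \<tau>) - 1 / \<eta>' * Re (dens g g \<tau>) \<le> \<sigma> * Im (\<psi> \<tau>)" by linarith
        then show ?thesis using True by simp
      qed simp
    qed
  qed
  also have "(\<integral>\<tau>. \<eta>' * (indicator {s..t} \<tau> *\<^sub>R Re (dens w w \<tau>)) - 1 / \<eta>' * (indicator {s..t} \<tau> *\<^sub>R Re (dens g g \<tau>)) \<partial>lborel)
      = \<eta>' * (LBINT \<tau>:{s..t}. Re (dens w w \<tau>)) - 1 / \<eta>' * (LBINT \<tau>:{s..t}. Re (dens g g \<tau>))"
  proof -
    have i1: "integrable lborel (\<lambda>\<tau>. \<eta>' * (indicator {s..t} \<tau> *\<^sub>R Re (dens w w \<tau>)))"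
      by (intro integrable_mult_right iw[unfolded set_integrable_def])
    have i2: "integrable lborel (\<lambda>\<tau>. 1 / \<eta>' * (indicator {s..t} \<tau> *\<^sub>R Re (dens g g \<tau>)))"
      by (intro integrable_mult_right ig[unfolded set_integrable_def])
    show ?thesis
      unfolding set_lebesgue_integral_def Bochner_Integration.integral_diff[OF i1 i2] integral_mult_right_zero ..
  qed
  finally show ?thesis unfolding \<eta>'_def .
qed

lemma flux_tendsto_form:
  assumes "y \<in> dom_Tmax a I B \<Delta>"
  shows "(\<lambda>n. flux (y (approx n))) \<longlonglongrightarrow> Im (form_b b y y)"
  unfolding flux_def
  by (rule tendsto_Im[OF filterlim_compose[OF boundary_form_tendsto[OF assms assms] filterlim_approx]])

text \<open>For \<open>\<sigma> = 1\<close> and \<open>\<sigma> = -1\<close> these are the families counted by the indices \<open>\<nu>\<^sub>b\<^sub>+\<close> and \<open>\<nu>\<^sub>b\<^sub>-\<close>.\<close>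

definition positive_family :: "real \<Rightarrow> nat \<Rightarrow> bool"
  where "positive_family \<sigma> n \<longleftrightarrow> (\<exists>f. (\<forall>i<n. f i \<in> dom_Tmax a I B \<Delta>) \<and>
    (\<forall>c. (\<exists>i<n. c i \<noteq> 0) \<longrightarrow> 0 < \<sigma> * Im (form_b b (lincomb n c f) (lincomb n c f))))"

lemma positive_family_0: "positive_family \<sigma> 0"
  by (simp add: positive_family_def)

lemma positive_family_mono:
  assumes "positive_family \<sigma> n" "m \<le> n"
  shows "positive_family \<sigma> m"
proof -
  obtain f where f: "\<forall>i<n. f i \<in> dom_Tmax a I B \<Delta>"
    "\<forall>c. (\<exists>i<n. c i \<noteq> 0) \<longrightarrow> 0 < \<sigma> * Im (form_b b (lincomb n c f) (lincomb n c f))"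
    using assms(1) unfolding positive_family_def by blast
  have pos: "0 < \<sigma> * Im (form_b b (lincomb m c f) (lincomb m c f))" if c: "\<exists>i<m. c i \<noteq> 0" for c
  proof -
    obtain i where i: "i < m" "c i \<noteq> 0" using c by blast
    then have "i < n \<and> (if i < m then c i else 0) \<noteq> 0" using assms(2) by simp
    then have ex: "\<exists>i<n. (if i < m then c i else 0) \<noteq> 0" by (rule exI)
    from f(2)[THEN spec, THEN mp, OF ex] show ?thesis unfolding lincomb_extend[OF assms(2)] .
  qed
  show ?thesis
    unfolding positive_family_def
  proof (rule exI[of _ f], intro conjI allI impI)
    show "f i \<in> dom_Tmax a I B \<Delta>" if "i < m" for i
      by (rule f(1)[THEN spec, THEN mp]) (use that assms(2) in simp)
    fix c :: "nat \<Rightarrow> complex" assume "\<exists>i<m. c i \<noteq> 0"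
    then show "0 < \<sigma> * Im (form_b b (lincomb m c f) (lincomb m c f))" by (rule pos)
  qed
qed

lemma nu_b_plus_ge_iff: "enat n \<le> nu_b_plus a b I B \<Delta> \<longleftrightarrow> positive_family 1 n"
  and nu_b_minus_ge_iff: "enat n \<le> nu_b_minus a b I B \<Delta> \<longleftrightarrow> positive_family (-1) n"
proof -
  have eq: "nu_b_plus a b I B \<Delta> = Sup {enat n | n. positive_family 1 n}"
    "nu_b_minus a b I B \<Delta> = Sup {enat n | n. positive_family (-1) n}"
    unfolding nu_b_plus_def nu_b_minus_def pos_squares_def positive_family_def by simp_all
  show "enat n \<le> nu_b_plus a b I B \<Delta> \<longleftrightarrow> positive_family 1 n"
    unfolding eq by (rule enat_le_Sup_iff[of "positive_family 1", OF positive_family_0 positive_family_mono])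
  show "enat n \<le> nu_b_minus a b I B \<Delta> \<longleftrightarrow> positive_family (-1) n"
    unfolding eq by (rule enat_le_Sup_iff[of "positive_family (-1)", OF positive_family_0 positive_family_mono])
qed

text \<open>The flux starts with the right sign and can only increase; it increases strictly, since by
  definiteness a nontrivial solution has a nonzero norm on some compact subinterval.\<close>

lemma defect_positive:
  assumes y: "y \<in> defect_space \<mu>" "y \<noteq> (\<lambda>_. 0)" and \<sigma>: "\<bar>\<sigma>\<bar> = 1" and \<eta>: "0 < \<sigma> * Im \<mu>" and start: "0 \<le> \<sigma> * flux (y a)"
  shows "0 < \<sigma> * Im (form_b b y y)"
proof -
  have sp: "sol_pair y (\<lambda>t. \<mu> *\<^sub>C y t)" using y by (simp add: defect_space_def)
  have yd: "y \<in> dom_Tmax a I B \<Delta>" using defect_Tmax[OF y(1)] by blast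
  have sub: "{a..approx n} \<subseteq> I" for n by (rule initial_segment[OF approx_in])
  have sq: "sqint {a..approx n} y" for n by (rule AC_sqint[OF sol_pair_eigen(1)[OF sp] order_refl approx_in])
  have gr: "\<sigma> * Im \<mu> * (LBINT \<tau>:{a..approx n}. Re (dens y y \<tau>)) \<le> \<sigma> * flux (y (approx n))" for n
    using flux_growth[OF sp \<sigma> \<eta> order_refl less_imp_le[OF approx(2)] approx_in, of n] start
    by (simp add: dens_def set_lebesgue_integral_def)
  have "\<exists>N. (LBINT \<tau>:{a..approx N}. Re (dens y y \<tau>)) \<noteq> 0"
  proof (rule ccontr)
    assume "\<not> ?thesis"
    then have "AE t in lborel. t \<in> {a..approx n} \<longrightarrow> D t (y t) = 0" for n
      using dens_integral_eq_0_iff[OF sq sub, of n] by blast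
    then have "AE t in lborel. \<forall>n. t \<in> {a..approx n} \<longrightarrow> D t (y t) = 0" unfolding AE_all_countable by blast
    then have "AE t in lborel. t \<in> I \<longrightarrow> D t (y t) = 0"
      using AE_lborel_singleton[of "real_of_ereal b"]
    proof eventually_elim
      case (elim t)
      show ?case
      proof
        assume t: "t \<in> I"
        have "ereal t < b" using t elim(2) interval unfolding interval_from_def by (cases b) auto
        then obtain n where "t < approx n" using approx(4) by blast
        then have "t \<in> {a..approx n}" using flow.I_D(1)[OF t] by simp
        then show "D t (y t) = 0" using elim(1) by blast
      qed
    qed
    from defect_definite[OF sp this] y(2) show False by contradiction
  qed
  then obtain N where "(LBINT \<tau>:{a..approx N}. Re (dens y y \<tau>)) \<noteq> 0" by blast
  then have pos: "0 < (LBINT \<tau>:{a..approx N}. Re (dens y y \<tau>))"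
    using dens_integral_nonneg[OF sub, of N y] by linarith
  let ?e = "\<sigma> * Im \<mu> * (LBINT \<tau>:{a..approx N}. Re (dens y y \<tau>))"
  have "\<forall>\<^sub>F n in sequentially. ?e \<le> \<sigma> * flux (y (approx n))"
    unfolding eventually_sequentially
  proof (intro exI[of _ N] allI impI)
    fix n assume "N \<le> n"
    then have le: "approx N \<le> approx n" by (rule monoD[OF approx(1)])
    have "(LBINT \<tau>:{a..approx n}. Re (dens y y \<tau>)) = (LBINT \<tau>:{a..approx N}. Re (dens y y \<tau>)) + (LBINT \<tau>:{approx N..approx n}. Re (dens y y \<tau>))"
      by (rule set_integral_split) (use sq[of n] less_imp_le[OF approx(2)] le in \<open>auto simp: sqint_def\<close>)
    moreover have "0 \<le> (LBINT \<tau>:{approx N..approx n}. Re (dens y y \<tau>))"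
      by (rule dens_integral_nonneg) (use flow.I_sub[OF less_imp_le[OF approx(2)] approx_in] in blast)
    ultimately have "?e \<le> \<sigma> * Im \<mu> * (LBINT \<tau>:{a..approx n}. Re (dens y y \<tau>))"
      using \<eta> by (intro mult_left_mono) auto
    with gr[of n] show "?e \<le> \<sigma> * flux (y (approx n))" by linarith
  qed
  from tendsto_lowerbound[OF tendsto_mult_left[OF flux_tendsto_form[OF yd]] this]
  have "?e \<le> \<sigma> * Im (form_b b y y)" by simp
  moreover have "0 < ?e" using \<eta> pos by simp
  ultimately show ?thesis by linarith
qed

text \<open>The map \<open>\<Lambda>\<close> describes by \<open>\<Lambda> x = 0\<close> a subspace of initial values on which the flux has the sign
  \<open>\<sigma>\<close>. It is given by equations, so that the loss of dimension is at most the dimension of its range.\<close>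

lemma deficiency_upper:
  fixes \<Lambda> :: "('h, 'k) spH \<Rightarrow> 'v::fd_complex_hilbert"
  assumes lin: "\<And>n c (x :: nat \<Rightarrow> ('h, 'k) spH). \<Lambda> (\<Sum>i<n. c i *\<^sub>C x i) = (\<Sum>i<n. c i *\<^sub>C \<Lambda> (x i))"
    and semi: "\<And>x. \<Lambda> x = 0 \<Longrightarrow> 0 \<le> \<sigma> * flux x"
    and \<sigma>: "\<bar>\<sigma>\<bar> = 1" and \<eta>: "0 < \<sigma> * Im \<mu>" and n: "enat n \<le> deficiency a I B \<Delta> \<mu>"
  shows "positive_family \<sigma> (n - cDIM TYPE('v))"
proof -
  let ?r = "n - cDIM TYPE('v)"
  obtain u where u: "\<forall>i<n. u i \<in> defect_space \<mu>" "\<forall>c. lincomb n c u = (\<lambda>_. 0) \<longrightarrow> (\<forall>i<n. c i = 0)"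
    using n unfolding deficiency_ge_iff by blast
  obtain q where q: "orthonormal_coeffs n ?r q" "\<forall>j<?r. (\<Sum>i<n. q j i *\<^sub>C \<Lambda> (u i a)) = 0"
    using kernel_orthonormal_coeffs[of n "\<lambda>i. \<Lambda> (u i a)"] by blast
  let ?f = "\<lambda>j. lincomb n (q j) u"
  have fN: "?f j \<in> defect_space \<mu>" for j by (rule defect_lincomb) (use u in blast)
  have pos: "0 < \<sigma> * Im (form_b b (lincomb ?r d ?f) (lincomb ?r d ?f))" if d: "\<exists>j<?r. d j \<noteq> 0" for d
  proof (rule defect_positive[OF _ _ \<sigma> \<eta>])
    show "lincomb ?r d ?f \<in> defect_space \<mu>" by (rule defect_lincomb) (rule fN)
    show "lincomb ?r d ?f \<noteq> (\<lambda>_. 0)"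
    proof
      assume "lincomb ?r d ?f = (\<lambda>_. 0)"
      then have "\<forall>i<n. (\<Sum>j<?r. d j * q j i) = 0" unfolding lincomb_lincomb using u(2) by blast
      then show False using orthonormal_coeffs_independent[OF q(1), of d] d by blast
    qed
    have 0: "\<Lambda> (?f j a) = 0" if "j < ?r" for j using q(2) that by (simp add: lincomb_def lin)
    have "\<Lambda> (lincomb ?r d ?f a) = (\<Sum>j<?r. d j *\<^sub>C \<Lambda> (?f j a))" unfolding lincomb_def[of ?r] by (rule lin)
    also have "\<dots> = 0" by (rule sum.neutral) (use 0 in simp)
    finally show "0 \<le> \<sigma> * flux (lincomb ?r d ?f a)" by (rule semi)
  qed
  show ?thesis
    unfolding positive_family_def
  proof (rule exI[of _ ?f], intro conjI allI impI)
    show "?f j \<in> dom_Tmax a I B \<Delta>" for j using defect_Tmax[OF fN] by (rule DomainI)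
    fix d :: "nat \<Rightarrow> complex" assume "\<exists>j<?r. d j \<noteq> 0"
    then show "0 < \<sigma> * Im (form_b b (lincomb ?r d ?f) (lincomb ?r d ?f))" by (rule pos)
  qed
qed

text \<open>Monotone convergence along the exhaustion; the endpoint \<open>b\<close>, if it belongs to the interval, is
  missed by the exhausting intervals and is removed as a null set.\<close>

lemma set_integrable_exhaustion:
  fixes f :: "real \<Rightarrow> real"
  assumes m: "set_borel_measurable lborel I f" and nn: "AE t in lborel. t \<in> I \<longrightarrow> 0 \<le> f t"
    and i: "\<And>n. set_integrable lborel {a..approx n} f" and bound: "\<And>n. (LBINT t:{a..approx n}. f t) \<le> K"
  shows "set_integrable lborel I f"
proof -
  define F where "F n t = indicator {a..approx n} t *\<^sub>R f t" for n t
  have sub: "{a..approx n} \<subseteq> I" for n by (rule initial_segment[OF approx_in])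
  have monoF: "AE t in lborel. mono (\<lambda>n. F n t)"
    using nn
  proof eventually_elim
    case (elim t)
    show ?case
    proof (rule monoI)
      fix m n :: nat assume "m \<le> n"
      then have "approx m \<le> approx n" by (rule monoD[OF approx(1)])
      then show "F m t \<le> F n t"
        using elim sub[of n] unfolding F_def indicator_def by (auto simp: subset_iff)
    qed
  qed
  have iF: "integrable lborel (F n)" for n using i[of n] unfolding set_integrable_def F_def .
  have "incseq (\<lambda>n. integral\<^sup>L lborel (F n))"
  proof (rule incseq_SucI)
    fix n
    show "integral\<^sup>L lborel (F n) \<le> integral\<^sup>L lborel (F (Suc n))"
      by (rule integral_mono_AE[OF iF iF]) (use monoF in \<open>eventually_elim, simp add: mono_def\<close>)
  qed
  moreover have "\<forall>n. integral\<^sup>L lborel (F n) \<le> K"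
    using bound unfolding set_lebesgue_integral_def F_def by blast
  ultimately obtain L where L: "(\<lambda>n. integral\<^sup>L lborel (F n)) \<longlonglongrightarrow> L"
    using incseq_convergent[of "\<lambda>n. integral\<^sup>L lborel (F n)" K] by blast
  have lim: "AE t in lborel. (\<lambda>n. F n t) \<longlonglongrightarrow> indicator I t *\<^sub>R f t"
    using AE_lborel_singleton[of "real_of_ereal b"]
  proof eventually_elim
    case (elim t)
    show ?case
    proof (cases "t \<in> I")
      case True
      then have "ereal t < b" using elim interval unfolding interval_from_def by (cases b) auto
      then obtain N where N: "t < approx N" using approx(4) by blast
      have "\<forall>n\<ge>N. t \<in> {a..approx n}"
      proof (intro allI impI)
        fix n assume "n \<ge> N"
        then show "t \<in> {a..approx n}" using N monoD[OF approx(1), of N n] flow.I_D(1)[OF True] by simp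
      qed
      then show ?thesis using True
        by (intro tendsto_eventually, unfold eventually_sequentially, intro exI[of _ N]) (auto simp: F_def)
    next
      case False
      then have "t \<notin> {a..approx n}" for n using sub[of n] by blast
      then show ?thesis using False by (simp add: F_def)
    qed
  qed
  show ?thesis
    unfolding set_integrable_def
    by (rule integrable_monotone_convergence[OF iF monoF lim L]) (use m in \<open>simp add: set_borel_measurable_def\<close>)
qed

text \<open>Let \<open>F\<close> consist of the given family \<open>e\<close> of length \<open>k\<close> and a basis \<open>u\<close> of all solutions for \<open>\<mu>\<close>, and let
  \<open>w c\<close> be the combination with coefficients \<open>c\<close>. It solves the equation for \<open>\<mu>\<close> up to a defect that is a
  combination of square-integrable functions, so \<open>flux_growth\<close> bounds the norm of \<open>w c\<close> over an
  interval by the increase of its flux and \<open>|c|\<^sup>2\<close> times the tail \<open>G\<close> of a convergent integral.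
  Subtracting the tail from the flux at the \<open>l\<close>-th point of the exhaustion makes it a monotone function \<open>S l c\<close> of \<open>l\<close>.
  The condition \<open>\<Lambda> (w c) = 0\<close> at the \<open>l\<close>-th point makes it nonpositive there, and
  \<open>monotone_family_limit_subspace\<close> yields coefficients for which it is nonpositive for all
  \<open>l\<close>. For these, \<open>w c\<close> and hence its part in the solution space has finite norm. If that part
  vanishes, \<open>w c\<close> is a combination of \<open>e\<close> with nonpositive form at \<open>b\<close>, so that \<open>c = 0\<close>; hence no
  dimension is lost by passing to the solution parts.\<close>

lemma deficiency_lower:
  fixes \<Lambda> :: "('h, 'k) spH \<Rightarrow> 'v::fd_complex_hilbert"
  assumes lin: "\<And>n c (x :: nat \<Rightarrow> ('h, 'k) spH). \<Lambda> (\<Sum>i<n. c i *\<^sub>C x i) = (\<Sum>i<n. c i *\<^sub>C \<Lambda> (x i))"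
    and semi: "\<And>x. \<Lambda> x = 0 \<Longrightarrow> \<sigma> * flux x \<le> 0"
    and \<sigma>: "\<bar>\<sigma>\<bar> = 1" and \<eta>: "0 < \<sigma> * Im \<mu>" and k: "positive_family \<sigma> k"
  shows "enat (k + cDIM TYPE(('h, 'k) spH) - cDIM TYPE('v)) \<le> deficiency a I B \<Delta> \<mu>"
proof -
  let ?N = "cDIM TYPE(('h, 'k) spH)"
  define M where "M = k + ?N"
  define r where "r = M - cDIM TYPE('v)"
  define \<eta>' where "\<eta>' = \<sigma> * Im \<mu>"
  have \<eta>0: "0 < \<eta>'" using \<eta> by (simp add: \<eta>'_def)
  obtain e where e: "\<forall>i<k. e i \<in> dom_Tmax a I B \<Delta>"
    "\<forall>c. (\<exists>i<k. c i \<noteq> 0) \<longrightarrow> 0 < \<sigma> * Im (form_b b (lincomb k c e) (lincomb k c e))"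
    using k unfolding positive_family_def by blast
  have "\<forall>i. \<exists>p. i < k \<longrightarrow> (e i, p) \<in> Tmax_fun a I B \<Delta>" using e(1) by blast
  from choice[OF this] obtain p where p: "\<And>i. i < k \<Longrightarrow> (e i, p i) \<in> Tmax_fun a I B \<Delta>" by blast
  have "\<exists>u. u \<in> AC a I \<and> solves I B u (\<lambda>t. \<mu> *\<^sub>C D t (u t)) \<and> u a = cbasis j" for j
    by (rule fundamental_solution[of \<mu> "cbasis j"]) blast
  then have "\<forall>j. \<exists>u. u \<in> AC a I \<and> solves I B u (\<lambda>t. \<mu> *\<^sub>C D t (u t)) \<and> u a = cbasis j" by blast
  from choice[OF this] obtain u where u: "\<And>j. u j \<in> AC a I" "\<And>j. solves I B (u j) (\<lambda>t. \<mu> *\<^sub>C D t (u j t))" "\<And>j. u j a = cbasis j"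
    by blast
  have su: "sol_pair (u j) (\<lambda>t. \<mu> *\<^sub>C u j t)" for j by (rule eigen_sol_pair[OF u(1,2)])
  define F where "F i = (if i < k then e i else u (i - k))" for i
  define P where "P i = (if i < k then p i else (\<lambda>t. \<mu> *\<^sub>C u (i - k) t))" for i
  define g where "g i t = P i t - \<mu> *\<^sub>C F i t" for i t
  have sFP: "sol_pair (F i) (P i)" if "i < M" for i
    using p[of i] su[of "i - k"] by (simp add: F_def P_def Tmax_fun_iff)
  have sg: "sqint I (g i)" if "i < M" for i
  proof (cases "i < k")
    case True
    then have "sqint I (p i)" "sqint I (e i)" using p[of i] by (auto simp: Tmax_fun_iff)
    then have "sqint I (\<lambda>t. p i t - \<mu> *\<^sub>C e i t)" using I_sets by (intro sqint_diff sqint_scale) auto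
    moreover have "g i = (\<lambda>t. p i t - \<mu> *\<^sub>C e i t)" using True by (simp add: fun_eq_iff g_def F_def P_def)
    ultimately show ?thesis by simp
  next
    case False
    then have "g i = (\<lambda>_. 0)" by (simp add: fun_eq_iff g_def F_def P_def)
    then show ?thesis using sqint_zero by simp
  qed
  define R where "R i t = Re (dens (g i) (g i) t)" for i t
  have iR: "set_integrable lborel I (R i)" if "i < M" for i using sg[OF that] unfolding sqint_def R_def by blast
  define G where "G n = (\<Sum>i<M. (LBINT t:I. R i t) - (LBINT t:{a..approx n}. R i t))" for n
  define G0 where "G0 = (\<Sum>i<M. (LBINT t:I. R i t))"
  have sub: "{a..approx n} \<subseteq> I" for n by (rule initial_segment[OF approx_in])
  have subR: "{approx l..approx m} \<subseteq> I" for l m by (rule flow.I_sub[OF less_imp_le[OF approx(2)] approx_in])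
  have G_nonneg: "0 \<le> G n" for n
    unfolding G_def
  proof (rule sum_nonneg)
    fix i assume i: "i \<in> {..<M}"
    have "0 \<le> (LBINT t:I \<inter> {approx n<..}. R i t)" unfolding R_def by (rule dens_integral_nonneg) simp
    then show "0 \<le> (LBINT t:I. R i t) - (LBINT t:{a..approx n}. R i t)" using integral_tail_eq[OF iR, of i n] i by simp
  qed
  have G_le: "G n \<le> G0" for n
    unfolding G_def G0_def
  proof (rule sum_mono)
    fix i assume i: "i \<in> {..<M}"
    have "0 \<le> (LBINT t:{a..approx n}. R i t)" unfolding R_def by (rule dens_integral_nonneg[OF sub])
    then show "(LBINT t:I. R i t) - (LBINT t:{a..approx n}. R i t) \<le> (LBINT t:I. R i t)" by simp
  qed
  have G_lim: "G \<longlonglongrightarrow> 0"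
  proof -
    have "(\<lambda>n. \<Sum>i<M. LBINT t:I \<inter> {approx n<..}. R i t) \<longlonglongrightarrow> (\<Sum>i<M. 0)"
      by (intro tendsto_sum tail_integral_tendsto_0 iR) auto
    moreover have "G = (\<lambda>n. \<Sum>i<M. LBINT t:I \<inter> {approx n<..}. R i t)"
      unfolding G_def by (intro ext sum.cong refl integral_tail_eq iR) auto
    ultimately show ?thesis by simp
  qed
  define w where "w c = lincomb M c F" for c
  define gc where "gc c t = lincomb M c P t - \<mu> *\<^sub>C w c t" for c t
  define C where "C c = (\<Sum>i<M. (norm (c i))\<^sup>2)" for c :: "nat \<Rightarrow> complex"
  have C0: "0 \<le> C c" for c unfolding C_def by (intro sum_nonneg) simp
  have sw: "sol_pair (w c) (lincomb M c P)" for c unfolding w_def by (rule sol_pair_lincomb) (rule sFP)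
  have gc: "gc c = lincomb M c g" for c
    by (simp add: fun_eq_iff gc_def w_def lincomb_def g_def cs.scale_sum_right cs.scale_right_diff_distrib
        sum_subtractf mult.commute)
  have sgc: "sqint I (gc c)" for c unfolding gc by (rule sqint_lincomb) (use sg I_sets in auto)
  have gc_bound: "(LBINT t:S. Re (dens (gc c) (gc c) t)) \<le> real M * C c * (\<Sum>i<M. (LBINT t:S. R i t))"
    if S: "S \<subseteq> I" "S \<in> sets borel" for S c
  proof -
    have iS: "set_integrable lborel S (R i)" if "i < M" for i by (rule set_integrable_subset[OF iR[OF that]]) (use S in auto)
    have igc: "integrable lborel (\<lambda>t. indicator S t *\<^sub>R Re (dens (gc c) (gc c) t))"
      using sqint_subset[OF sgc S] unfolding sqint_def set_integrable_def by blast
    have "(LBINT t:S. Re (dens (gc c) (gc c) t)) \<le> (\<integral>t. real M * C c * (\<Sum>i<M. indicator S t *\<^sub>R R i t) \<partial>lborel)"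
      unfolding set_lebesgue_integral_def
    proof (rule integral_mono_AE[OF igc])
      show "integrable lborel (\<lambda>t. real M * C c * (\<Sum>i<M. indicator S t *\<^sub>R R i t))"
        by (intro integrable_mult_right Bochner_Integration.integrable_sum) (use iS in \<open>auto simp: set_integrable_def\<close>)
      show "AE t in lborel. indicator S t *\<^sub>R Re (dens (gc c) (gc c) t) \<le> real M * C c * (\<Sum>i<M. indicator S t *\<^sub>R R i t)"
        using nonneg_D
      proof eventually_elim
        case (elim t)
        show ?case
        proof (cases "t \<in> S")
          case True
          then have T: "nonneg_op (\<Delta> t)" "clinear_op (\<Delta> t)" using elim S by auto
          show ?thesis
            using nonneg_op_combination_bound[OF T, where M = M and c = c and x = "\<lambda>i. g i t"] True
            by (simp add: gc lincomb_def dens_def R_def C_def)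
        qed simp
      qed
    qed
    also have "\<dots> = real M * C c * (\<integral>t. (\<Sum>i<M. indicator S t *\<^sub>R R i t) \<partial>lborel)"
      by (rule integral_mult_right_zero)
    also have "(\<integral>t. (\<Sum>i<M. indicator S t *\<^sub>R R i t) \<partial>lborel) = (\<Sum>i<M. (LBINT t:S. R i t))"
      unfolding set_lebesgue_integral_def
      by (rule Bochner_Integration.integral_sum) (use iS in \<open>simp add: set_integrable_def\<close>)
    finally show ?thesis .
  qed
  define K where "K = real M / \<eta>'"
  have K0: "0 \<le> K" using \<eta>0 by (simp add: K_def)
  have growth: "\<eta>' * (LBINT \<tau>:{s..t}. Re (dens (w c) (w c) \<tau>)) - K * C c * (\<Sum>i<M. (LBINT \<tau>:{s..t}. R i \<tau>))
      \<le> \<sigma> * flux (w c t) - \<sigma> * flux (w c s)" if st: "a \<le> s" "s \<le> t" "t \<in> I" for c s t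
  proof -
    have "1 / \<eta>' * (LBINT \<tau>:{s..t}. Re (dens (gc c) (gc c) \<tau>)) \<le> 1 / \<eta>' * (real M * C c * (\<Sum>i<M. (LBINT t:{s..t}. R i t)))"
      using \<eta>0 flow.I_sub[OF st(1,3)] by (intro mult_left_mono gc_bound) auto
    moreover have "1 / \<eta>' * (real M * C c * (\<Sum>i<M. (LBINT t:{s..t}. R i t))) = K * C c * (\<Sum>i<M. (LBINT t:{s..t}. R i t))"
      by (simp add: K_def)
    ultimately show ?thesis
      using flux_growth[OF sw \<sigma> \<eta> st, of c] unfolding \<eta>'_def gc_def[abs_def] by linarith
  qed
  define S where "S l c = \<sigma> * flux (w c (approx l)) - K * C c * G l" for l c
  have S_mono: "S l c \<le> S m c" if "l \<le> m" for l m c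
  proof -
    have le: "approx l \<le> approx m" by (rule monoD[OF approx(1) that])
    have "(\<Sum>i<M. (LBINT \<tau>:{approx l..approx m}. R i \<tau>)) = G l - G m"
      unfolding G_def sum_subtractf[symmetric]
    proof (rule sum.cong[OF refl])
      fix i assume i: "i \<in> {..<M}"
      have "set_integrable lborel {a..approx m} (R i)" by (rule set_integrable_subset[OF iR _ sub]) (use i in auto)
      from set_integral_split[OF this less_imp_le[OF approx(2)] le]
      show "(LBINT \<tau>:{approx l..approx m}. R i \<tau>) = (LBINT t:I. R i t) - (LBINT t:{a..approx l}. R i t) - ((LBINT t:I. R i t) - (LBINT t:{a..approx m}. R i t))"
        by simp
    qed
    with growth[OF less_imp_le[OF approx(2)] le approx_in, of c]
    have "\<eta>' * (LBINT \<tau>:{approx l..approx m}. Re (dens (w c) (w c) \<tau>)) - K * C c * (G l - G m)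
        \<le> \<sigma> * flux (w c (approx m)) - \<sigma> * flux (w c (approx l))" by simp
    moreover have "0 \<le> \<eta>' * (LBINT \<tau>:{approx l..approx m}. Re (dens (w c) (w c) \<tau>))"
      using \<eta>0 dens_integral_nonneg[OF subR] by simp
    ultimately show ?thesis by (simp add: S_def right_diff_distrib)
  qed
  have S_cont: "(\<lambda>m. S l (c m)) \<longlonglongrightarrow> S l c'" if "\<And>i. i < M \<Longrightarrow> (\<lambda>m. c m i) \<longlonglongrightarrow> c' i" for l c c'
    unfolding S_def C_def w_def lincomb_def
    by (intro tendsto_diff tendsto_mult tendsto_const flux_tendsto tendsto_sum scaleC.tendsto tendsto_power tendsto_norm that; simp)
  have S_sub: "\<exists>q. orthonormal_coeffs M r q \<and> (\<forall>d. S m (\<lambda>i. \<Sum>j<r. d j * q j i) \<le> 0)" for m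
  proof -
    obtain q where q: "orthonormal_coeffs M r q" "\<forall>j<r. (\<Sum>i<M. q j i *\<^sub>C \<Lambda> (F i (approx m))) = 0"
      using kernel_orthonormal_coeffs[of M "\<lambda>i. \<Lambda> (F i (approx m))"] unfolding r_def by blast
    have "S m (\<lambda>i. \<Sum>j<r. d j * q j i) \<le> 0" for d
    proof -
      let ?c = "\<lambda>i. \<Sum>j<r. d j * q j i"
      have 0: "\<Lambda> (lincomb M (q j) F (approx m)) = 0" if "j < r" for j using q(2) that by (simp add: lincomb_def lin)
      have "w ?c = lincomb r d (\<lambda>j. lincomb M (q j) F)" unfolding w_def lincomb_lincomb ..
      then have "\<Lambda> (w ?c (approx m)) = (\<Sum>j<r. d j *\<^sub>C \<Lambda> (lincomb M (q j) F (approx m)))"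
        unfolding lincomb_def[of r] by (simp only: lin)
      also have "\<dots> = 0" by (rule sum.neutral) (use 0 in simp)
      finally have "\<sigma> * flux (w ?c (approx m)) \<le> 0" by (rule semi)
      moreover have "0 \<le> K * C ?c * G m" using K0 C0 G_nonneg by simp
      ultimately show ?thesis by (simp add: S_def)
    qed
    with q(1) show ?thesis by blast
  qed
  from monotone_family_limit_subspace[where S = S and M = M and r = r, OF S_mono S_cont S_sub]
  obtain q where q: "orthonormal_coeffs M r q" "\<And>l d. S l (\<lambda>i. \<Sum>j<r. d j * q j i) \<le> 0" by blast
  have w_split: "w c = (\<lambda>t. lincomb k c e t + lincomb ?N (\<lambda>i. c (k + i)) u t)" for c
  proof -
    have "lincomb k c F = lincomb k c e" by (rule lincomb_cong) (simp add: F_def)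
    moreover have "lincomb ?N (\<lambda>i. c (k + i)) (\<lambda>i. F (k + i)) = lincomb ?N (\<lambda>i. c (k + i)) u"
      by (rule lincomb_cong) (simp add: F_def)
    ultimately show ?thesis unfolding w_def M_def lincomb_append by simp
  qed
  have sqw: "sqint I (w c)" if neg: "\<And>l. S l c \<le> 0" for c
  proof -
    have AC: "w c \<in> AC a I" using sw by (simp add: sol_pair_def)
    have m: "w c \<in> borel_measurable borel" by (rule AC_measurable[OF AC])
    have sqn: "sqint {a..approx n} (w c)" for n by (rule AC_sqint[OF AC order_refl approx_in])
    let ?K = "(2 * (K * C c * G0) + \<bar>flux (w c a)\<bar>) / \<eta>'"
    have "set_integrable lborel I (\<lambda>t. Re (dens (w c) (w c) t))"
    proof (rule set_integrable_exhaustion[where K = ?K])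
      have "set_borel_measurable lborel I (dens (w c) (w c))" by (rule dens_measurable[OF m m order_refl I_sets])
      from measurable_compose[OF this[unfolded set_borel_measurable_def] borel_measurable_Re]
      show "set_borel_measurable lborel I (\<lambda>t. Re (dens (w c) (w c) t))" by (simp add: set_borel_measurable_def)
      show "AE t in lborel. t \<in> I \<longrightarrow> 0 \<le> Re (dens (w c) (w c) t)" by (rule dens_Re_nonneg)
      fix n
      show "set_integrable lborel {a..approx n} (\<lambda>t. Re (dens (w c) (w c) t))" using sqn unfolding sqint_def by blast
      have "(\<Sum>i<M. (LBINT \<tau>:{a..approx n}. R i \<tau>)) = G0 - G n" by (simp add: G_def G0_def sum_subtractf)
      then have "\<eta>' * (LBINT \<tau>:{a..approx n}. Re (dens (w c) (w c) \<tau>))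
          \<le> \<sigma> * flux (w c (approx n)) - \<sigma> * flux (w c a) + K * C c * (G0 - G n)"
        using growth[where c = c, OF order_refl less_imp_le[OF approx(2)[of n]] approx_in[of n]] by simp
      moreover have "\<sigma> * flux (w c (approx n)) \<le> K * C c * G n" using neg[of n] by (simp add: S_def)
      moreover have "- (\<sigma> * flux (w c a)) \<le> \<bar>flux (w c a)\<bar>"
        using \<sigma> abs_ge_minus_self[of "\<sigma> * flux (w c a)"] by (simp add: abs_mult)
      moreover have "K * C c * (G0 - G n) \<le> K * C c * G0" "K * C c * G n \<le> K * C c * G0"
        using K0 C0 G_nonneg G_le by (auto intro!: mult_left_mono)
      ultimately have "\<eta>' * (LBINT \<tau>:{a..approx n}. Re (dens (w c) (w c) \<tau>)) \<le> 2 * (K * C c * G0) + \<bar>flux (w c a)\<bar>"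
        by linarith
      then show "(LBINT \<tau>:{a..approx n}. Re (dens (w c) (w c) \<tau>)) \<le> ?K"
        using \<eta>0 by (simp add: pos_le_divide_eq mult.commute)
    qed
    with m show ?thesis by (simp add: sqint_def)
  qed
  have se: "sqint I (lincomb k c e)" for c
    by (rule sqint_lincomb) (use p I_sets in \<open>auto simp: Tmax_fun_iff\<close>)
  have U_defect: "lincomb ?N (\<lambda>i. c (k + i)) u \<in> defect_space \<mu>" if neg: "\<And>l. S l c \<le> 0" for c
  proof -
    have "sqint I (\<lambda>t. w c t - lincomb k c e t)" by (rule sqint_diff[OF sqw[OF neg] se]) (use I_sets in auto)
    moreover have "(\<lambda>t. w c t - lincomb k c e t) = lincomb ?N (\<lambda>i. c (k + i)) u" by (simp add: w_split)
    moreover have "sol_pair (lincomb ?N (\<lambda>i. c (k + i)) u) (\<lambda>t. \<mu> *\<^sub>C lincomb ?N (\<lambda>i. c (k + i)) u t)"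
      by (rule eigen_lincomb) (rule su)
    ultimately show ?thesis by (simp add: defect_space_def)
  qed
  let ?U = "\<lambda>j. lincomb ?N (\<lambda>i. q j (k + i)) u"
  have "?U j \<in> defect_space \<mu>" if j: "j < r" for j
  proof -
    have "(\<Sum>j'<r. (if j' = j then 1 else 0) * q j' i) = q j i" for i using j by (simp add: if_distrib[of "\<lambda>x. x * _"] cong: if_cong)
    then have "S l (q j) \<le> 0" for l using q(2)[of l "\<lambda>j'. if j' = j then 1 else 0"] by simp
    from U_defect[OF this] show ?thesis .
  qed
  moreover have "\<forall>j<r. d j = 0" if z: "lincomb r d ?U = (\<lambda>_. 0)" for d
  proof -
    define c where "c i = (\<Sum>j<r. d j * q j i)" for i
    have neg: "S l c \<le> 0" for l unfolding c_def by (rule q(2))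
    have z': "lincomb ?N (\<lambda>i. c (k + i)) u = (\<lambda>_. 0)" using z unfolding lincomb_lincomb c_def .
    have c2: "c (k + i) = 0" if "i < ?N" for i
    proof -
      have "(\<Sum>i<?N. c (k + i) *\<^sub>C (cbasis i :: ('h, 'k) spH)) = 0"
        using fun_cong[OF z', of a] by (simp add: lincomb_def u(3))
      then show ?thesis using orthonormal_sum_cinner[OF orthonormal_cbasis that, of "\<lambda>i. c (k + i)"] by simp
    qed
    have we: "w c = lincomb k c e" using w_split[of c] z' by (simp add: fun_eq_iff)
    have wd: "w c \<in> dom_Tmax a I B \<Delta>" unfolding we by (rule dom_Tmax_lincomb) (use e(1) in blast)
    have "\<sigma> * Im (form_b b (w c) (w c)) \<le> K * C c * 0"
    proof (rule LIMSEQ_le)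
      show "(\<lambda>n. \<sigma> * flux (w c (approx n))) \<longlonglongrightarrow> \<sigma> * Im (form_b b (w c) (w c))"
        by (rule tendsto_mult_left[OF flux_tendsto_form[OF wd]])
      show "(\<lambda>n. K * C c * G n) \<longlonglongrightarrow> K * C c * 0" by (rule tendsto_mult_left[OF G_lim])
      show "\<exists>N. \<forall>n\<ge>N. \<sigma> * flux (w c (approx n)) \<le> K * C c * G n" using neg by (simp add: S_def)
    qed
    then have np: "\<not> 0 < \<sigma> * Im (form_b b (lincomb k c e) (lincomb k c e))" unfolding we by simp
    have "\<not> (\<exists>i<k. c i \<noteq> 0)"
    proof
      assume ex: "\<exists>i<k. c i \<noteq> 0"
      from np e(2)[THEN spec, THEN mp, OF ex] show False by contradiction
    qed
    then have c1: "\<forall>i<k. c i = 0" by simp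
    have "(\<Sum>j<r. d j * q j i) = 0" if i: "i < M" for i
    proof (cases "i < k")
      case True
      then show ?thesis using c1 by (simp add: c_def)
    next
      case False
      then show ?thesis using c2[of "i - k"] i by (simp add: c_def M_def)
    qed
    then show ?thesis using orthonormal_coeffs_independent[OF q(1), of d] by blast
  qed
  ultimately have "enat r \<le> deficiency a I B \<Delta> \<mu>"
    unfolding deficiency_ge_iff by (intro exI[of _ ?U]) blast
  then show ?thesis by (simp add: r_def M_def)
qed

text \<open>The two bounds determine the index. Finiteness is needed to turn the truncated subtraction in the
  upper bound into an addition.\<close>

lemma index_arith:
  assumes fin: "x \<le> enat p0" and up: "\<And>n. enat n \<le> x \<Longrightarrow> P (n - d)" and low: "\<And>k. P k \<Longrightarrow> enat (k + d) \<le> x"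
    and \<nu>: "\<And>n. enat n \<le> \<nu> \<longleftrightarrow> P n" and P0: "P 0"
  shows "x = \<nu> + enat d"
proof -
  obtain p where p: "x = enat p" using fin by (cases x) auto
  have dp: "d \<le> p" using low[OF P0] p by simp
  have "enat (p - d) \<le> \<nu>" unfolding \<nu> by (rule up) (simp add: p)
  moreover have "\<nu> \<le> enat (p - d)"
  proof (rule ccontr)
    assume "\<not> ?thesis"
    then have "enat (Suc (p - d)) \<le> \<nu>" by (simp add: Suc_ile_eq)
    then have "enat (Suc (p - d) + d) \<le> x" unfolding \<nu> by (rule low)
    then show False using p dp by simp
  qed
  ultimately have "\<nu> = enat (p - d)" by (rule antisym[rotated])
  then show ?thesis using p dp by simp
qed

text \<open>The flux of \<open>(x\<^sub>0, x\<^sub>1, x\<^sub>2)\<close> is \<open>|x\<^sub>1|\<^sup>2 + 2 Im (x\<^sub>0, x\<^sub>2)\<close>. It is nonnegative on the subspace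
  \<open>x\<^sub>2 = -i x\<^sub>0\<close>, of codimension \<open>dim H\<close>, and nonpositive on \<open>x\<^sub>1 = 0\<close>, \<open>x\<^sub>2 = i x\<^sub>0\<close>, of
  codimension \<open>dim K + dim H\<close>. The two codimensions add up to the dimension of the whole space, so
  the upper and the lower bound meet.\<close>

theorem deficiency_formulas:
  assumes "Im mu_plus > 0" "Im mu_minus < 0"
  shows "deficiency a I B \<Delta> mu_plus = nu_b_plus a b I B \<Delta> + enat (cDIM TYPE('h))"
    and "deficiency a I B \<Delta> mu_minus = nu_b_minus a b I B \<Delta> + enat (cDIM TYPE('h) + cDIM TYPE('k))"
proof -
  define \<Lambda>n :: "('h, 'k) spH \<Rightarrow> 'h" where "\<Lambda>n x = snd (snd x) + \<i> *\<^sub>C fst x" for x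
  define \<Lambda>p :: "('h, 'k) spH \<Rightarrow> 'k \<times> 'h" where "\<Lambda>p x = (fst (snd x), snd (snd x) - \<i> *\<^sub>C fst x)" for x
  have lin1: "\<Lambda>n (\<Sum>i<n. c i *\<^sub>C x i) = (\<Sum>i<n. c i *\<^sub>C \<Lambda>n (x i))" for n c and x :: "nat \<Rightarrow> ('h, 'k) spH"
    by (simp add: \<Lambda>n_def fst_sum snd_sum scaleC_prod_def scaleC_add_right sum.distrib cs.scale_sum_right scaleC_scaleC mult.commute)
  have lin2: "\<Lambda>p (\<Sum>i<n. c i *\<^sub>C x i) = (\<Sum>i<n. c i *\<^sub>C \<Lambda>p (x i))" for n c and x :: "nat \<Rightarrow> ('h, 'k) spH"
    by (simp add: \<Lambda>p_def prod_eq_iff fst_sum snd_sum scaleC_prod_def cs.scale_right_diff_distrib sum_subtractf cs.scale_sum_right scaleC_scaleC mult.commute)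
  have nonneg: "0 \<le> flux x" if "\<Lambda>n x = 0" for x
  proof -
    obtain x0 x1 x2 where x: "x = (x0, x1, x2)" by (metis prod.exhaust)
    have "x2 = - \<i> *\<^sub>C x0" using that by (simp add: \<Lambda>n_def x add_eq_0_iff)
    then show ?thesis unfolding x flux_eq by (simp add: cinner_scaleC_right cinner_self cs.scale_minus_left flip: of_real_power)
  qed
  have nonpos: "flux x \<le> 0" if "\<Lambda>p x = 0" for x
  proof -
    obtain x0 x1 x2 where x: "x = (x0, x1, x2)" by (metis prod.exhaust)
    have "x1 = 0" "x2 = \<i> *\<^sub>C x0" using that by (simp_all add: \<Lambda>p_def x zero_prod_def)
    then show ?thesis unfolding x flux_eq by (simp add: cinner_scaleC_right cinner_self flip: of_real_power)
  qed
  have dims: "cDIM TYPE(('h, 'k) spH) = cDIM TYPE('h) + cDIM TYPE('k) + cDIM TYPE('h)"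
    "cDIM TYPE('k \<times> 'h) = cDIM TYPE('k) + cDIM TYPE('h)" by (simp_all add: cdim_prod)
  show "deficiency a I B \<Delta> mu_plus = nu_b_plus a b I B \<Delta> + enat (cDIM TYPE('h))"
  proof (rule index_arith[where P = "positive_family 1", OF deficiency_finite _ _ nu_b_plus_ge_iff positive_family_0])
    show "positive_family 1 (n - cDIM TYPE('h))" if "enat n \<le> deficiency a I B \<Delta> mu_plus" for n
      by (rule deficiency_upper[of \<Lambda>n 1 mu_plus n, OF lin1 _ _ _ that]) (use nonneg assms in auto)
    show "enat (k + cDIM TYPE('h)) \<le> deficiency a I B \<Delta> mu_plus" if "positive_family 1 k" for k
      using deficiency_lower[of \<Lambda>p 1 mu_plus k, OF lin2 _ _ _ that] nonpos assms by (simp add: dims)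
  qed
  show "deficiency a I B \<Delta> mu_minus = nu_b_minus a b I B \<Delta> + enat (cDIM TYPE('h) + cDIM TYPE('k))"
  proof (rule index_arith[where P = "positive_family (-1)", OF deficiency_finite _ _ nu_b_minus_ge_iff positive_family_0])
    show "positive_family (-1) (n - (cDIM TYPE('h) + cDIM TYPE('k)))" if "enat n \<le> deficiency a I B \<Delta> mu_minus" for n
      using deficiency_upper[of \<Lambda>p "-1" mu_minus n, OF lin2 _ _ _ that] nonpos assms by (simp add: dims add.commute)
    show "enat (k + (cDIM TYPE('h) + cDIM TYPE('k))) \<le> deficiency a I B \<Delta> mu_minus" if "positive_family (-1) k" for k
      using deficiency_lower[of \<Lambda>n "-1" mu_minus k, OF lin1 _ _ _ that] nonneg assms by (simp add: dims ac_simps)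
  qed
qed

end

section \<open>Finitely supported sequences as coordinate spaces\<close>

definition fseq :: "nat \<Rightarrow> (nat \<Rightarrow> complex) \<Rightarrow> fin_seq"
  where "fseq n f = Abs_fin_seq (\<lambda>i. if i < n then f i else 0)"

lemma seq_nth_fseq: "seq_nth (fseq n f) i = (if i < n then f i else 0)"
proof -
  have "finite {i. (if i < n then f i else 0) \<noteq> 0}" by (rule finite_subset[of _ "{..<n}"]) auto
  then show ?thesis unfolding fseq_def by (simp add: Abs_fin_seq_inverse)
qed

lemma fin_seq_eqI: "(\<And>i. seq_nth x i = seq_nth y i) \<Longrightarrow> x = y"
  by (metis ext seq_nth_inject)

lemma seq_nth_simps [simp]:
  "seq_nth (x + y) i = seq_nth x i + seq_nth y i" "seq_nth (c *\<^sub>C x) i = c * seq_nth x i" "seq_nth 0 i = 0"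
  by (transfer, simp)+

lemma seq_nth_sum: "seq_nth (\<Sum>j\<in>A. f j) i = (\<Sum>j\<in>A. seq_nth (f j) i)"
  by (induction A rule: infinite_finite_induct) simp_all

lemma seq_nth_diff: "seq_nth (x - y) i = seq_nth x i - seq_nth y i"
  using seq_nth_simps(1)[of "x - y" y i] by (simp add: algebra_simps del: seq_nth_simps(1))

definition seq_space :: "nat \<Rightarrow> fin_seq set"
  where "seq_space n = {x. \<forall>i\<ge>n. seq_nth x i = 0}"

lemma seq_space_subspace: "csubspace (seq_space n)"
  unfolding cs.subspace_def by (auto simp: seq_space_def)

lemma seq_space_fin_dim: "fin_dim (seq_space n)"
  unfolding fin_dim_def
proof (intro exI[of _ "(\<lambda>j. fseq (Suc j) (\<lambda>i. if i = j then 1 else 0)) ` {..<n}"] conjI subsetI)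
  let ?e = "\<lambda>j. fseq (Suc j) (\<lambda>i. if i = j then 1 else 0)"
  fix x assume x: "x \<in> seq_space n"
  have "x = (\<Sum>j<n. seq_nth x j *\<^sub>C ?e j)"
  proof (rule fin_seq_eqI)
    fix i
    have "seq_nth (\<Sum>j<n. seq_nth x j *\<^sub>C ?e j) i = (\<Sum>j<n. if j = i then seq_nth x i else 0)"
      unfolding seq_nth_sum by (rule sum.cong) (auto simp: seq_nth_fseq)
    also have "\<dots> = seq_nth x i" using x by (auto simp: seq_space_def not_less)
    finally show "seq_nth x i = seq_nth (\<Sum>j<n. seq_nth x j *\<^sub>C ?e j) i" ..
  qed
  also have "\<dots> \<in> cspan (?e ` {..<n})" by (rule combination_in_span) simp
  finally show "x \<in> cspan (?e ` {..<n})" .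
qed simp

lemma cinner_seq_space: "x \<in> seq_space n \<Longrightarrow> cinner x y = (\<Sum>i<n. seq_nth x i * cnj (seq_nth y i))"
  by (rule cinner_fin_seq_on) (auto simp: seq_space_def not_less[symmetric])

lemma orth_compl_seq_space:
  assumes "m \<le> n"
  shows "orth_compl_in (seq_space n) (seq_space m) = {x \<in> seq_space n. \<forall>i<m. seq_nth x i = 0}"
proof (intro set_eqI iffI)
  fix x assume x: "x \<in> orth_compl_in (seq_space n) (seq_space m)"
  have "seq_nth x i = 0" if i: "i < m" for i
  proof -
    let ?e = "fseq (Suc i) (\<lambda>j. if j = i then 1 else 0)"
    have "?e \<in> seq_space m" using i by (auto simp: seq_space_def seq_nth_fseq)
    then have "cinner x ?e = 0" using x by (simp add: orth_compl_in_def)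
    moreover have "cinner x ?e = (\<Sum>j<n. seq_nth x j * cnj (seq_nth ?e j))"
      using x by (intro cinner_seq_space) (simp add: orth_compl_in_def)
    moreover have "\<dots> = (\<Sum>j<n. if j = i then seq_nth x i else 0)" by (rule sum.cong) (auto simp: seq_nth_fseq)
    ultimately show ?thesis using i assms by simp
  qed
  with x show "x \<in> {x \<in> seq_space n. \<forall>i<m. seq_nth x i = 0}" by (simp add: orth_compl_in_def)
next
  fix x assume x: "x \<in> {x \<in> seq_space n. \<forall>i<m. seq_nth x i = 0}"
  have "cinner x y = 0" if "y \<in> seq_space m" for y
  proof -
    have "cinner y x = (\<Sum>i<m. seq_nth y i * cnj (seq_nth x i))" by (rule cinner_seq_space[OF that])
    also have "\<dots> = 0" using x by simp
    finally show ?thesis using cinner_commute[of x y] by simp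
  qed
  with x show "x \<in> orth_compl_in (seq_space n) (seq_space m)" by (simp add: orth_compl_in_def)
qed

lemma orth_proj_seq_space:
  assumes "m \<le> n" "x \<in> seq_space n"
  shows "orth_proj (orth_compl_in (seq_space n) (seq_space m)) x = x - fseq m (seq_nth x)"
  unfolding orth_compl_seq_space[OF assms(1)]
proof (rule orth_proj_unique)
  show "x - fseq m (seq_nth x) \<in> {x \<in> seq_space n. \<forall>i<m. seq_nth x i = 0}"
    using assms by (simp add: seq_space_def seq_nth_diff seq_nth_fseq)
  show "csubspace {x \<in> seq_space n. \<forall>i<m. seq_nth x i = 0}"
    unfolding cs.subspace_def by (auto simp: seq_space_def)
  fix y assume y: "y \<in> {x \<in> seq_space n. \<forall>i<m. seq_nth x i = 0}"
  have "fseq m (seq_nth x) \<in> seq_space m" by (simp add: seq_space_def seq_nth_fseq)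
  from cinner_seq_space[OF this, of y] y
  show "cinner (x - (x - fseq m (seq_nth x))) y = 0" by simp
qed


section \<open>The normal form of the boundary form\<close>

lemma vector_space_functions: "vector_space (\<lambda>(c::complex) (f :: real \<Rightarrow> 'a::complex_inner) t. c *\<^sub>C f t)"
  by unfold_locales (auto simp: fun_eq_iff scaleC_add_right scaleC_add_left scaleC_scaleC)

interpretation fs: vector_space "\<lambda>(c::complex) (f :: real \<Rightarrow> 'a::complex_inner) t. c *\<^sub>C f t"
  by (rule vector_space_functions)

lemma lincomb_eq_sum: "(\<Sum>i<n. (\<lambda>t. c i *\<^sub>C f i t)) = lincomb n c f"
proof
  fix t show "(\<Sum>i<n. (\<lambda>t. c i *\<^sub>C f i t)) t = lincomb n c f t"
    by (induction n) (simp_all add: lincomb_def)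
qed

context canonical_system
begin

abbreviation dom :: "(real \<Rightarrow> ('h, 'k) spH) set" where "dom \<equiv> dom_Tmax a I B \<Delta>"

lemma dom_comb: "\<lbrakk>y \<in> dom; z \<in> dom\<rbrakk> \<Longrightarrow> (\<lambda>t. c *\<^sub>C y t + d *\<^sub>C z t) \<in> dom"
proof -
  assume yz: "y \<in> dom" "z \<in> dom"
  have "lincomb 2 (\<lambda>i. if i = 0 then c else d) (\<lambda>i. if i = 0 then y else z) \<in> dom"
    by (rule dom_Tmax_lincomb) (use yz in auto)
  moreover have "lincomb 2 (\<lambda>i. if i = 0 then c else d) (\<lambda>i. if i = 0 then y else z) = (\<lambda>t. c *\<^sub>C y t + d *\<^sub>C z t)"
    by (simp add: lincomb_def fun_eq_iff numeral_2_eq_2)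
  ultimately show ?thesis by simp
qed

lemma dom_subspace: "fs.subspace dom"
  unfolding fs.subspace_def
proof (intro conjI ballI allI)
  have "lincomb 0 (\<lambda>_. 0) (\<lambda>_. 0) \<in> dom" by (rule dom_Tmax_lincomb) simp
  moreover have "lincomb 0 (\<lambda>_. 0) (\<lambda>_. 0) = (0 :: real \<Rightarrow> ('h, 'k) spH)" by (simp add: lincomb_def fun_eq_iff)
  ultimately show "0 \<in> dom" by simp
  show "y + z \<in> dom" if "y \<in> dom" "z \<in> dom" for y z
    using dom_comb[OF that, of 1 1] by (simp add: plus_fun_def)
  show "(\<lambda>t. c *\<^sub>C y t) \<in> dom" if "y \<in> dom" for c y
    using dom_comb[OF that that, of c 0] by simp
qed

lemma form_eqI:
  "\<lbrakk>y \<in> dom; z \<in> dom; ((\<lambda>t. cinner (J (y t)) (z t)) \<longlongrightarrow> L) end_filter\<rbrakk> \<Longrightarrow> form_b b y z = L"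
  by (rule tendsto_unique[OF end_filter_nontrivial boundary_form_tendsto])

definition hform :: "(real \<Rightarrow> ('h, 'k) spH) \<Rightarrow> (real \<Rightarrow> ('h, 'k) spH) \<Rightarrow> complex"
  where "hform y z = - \<i> * form_b b y z"

lemma form_b_hform: "form_b b y z = \<i> * hform y z"
  by (simp add: hform_def)

lemma Re_hform: "Re (hform y z) = Im (form_b b y z)"
  by (simp add: hform_def)

lemma hermitian_hform: "hermitian_form (\<lambda>c f t. c *\<^sub>C f t) dom hform"
proof
  show "fs.subspace dom" by (rule dom_subspace)
  fix x y z assume x: "x \<in> dom" and y: "y \<in> dom" and z: "z \<in> dom"
  have xy: "x + y \<in> dom" by (rule fs.subspace_add[OF dom_subspace x y])
  have "form_b b (x + y) z = form_b b x z + form_b b y z"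
  proof (rule form_eqI[OF xy z])
    show "((\<lambda>t. cinner (J ((x + y) t)) (z t)) \<longlongrightarrow> form_b b x z + form_b b y z) end_filter"
      using tendsto_add[OF boundary_form_tendsto[OF x z] boundary_form_tendsto[OF y z]]
      by (simp add: J_add cinner_add_left)
  qed
  then show "hform (x + y) z = hform x z + hform y z" by (simp add: hform_def algebra_simps)
next
  fix x y c assume x: "x \<in> dom" and y: "y \<in> dom"
  have cx: "(\<lambda>t. c *\<^sub>C x t) \<in> dom" by (rule fs.subspace_scale[OF dom_subspace x])
  have "form_b b (\<lambda>t. c *\<^sub>C x t) y = c * form_b b x y"
  proof (rule form_eqI[OF cx y])
    show "((\<lambda>t. cinner (J (c *\<^sub>C x t)) (y t)) \<longlongrightarrow> c * form_b b x y) end_filter"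
      using tendsto_mult[OF tendsto_const boundary_form_tendsto[OF x y], of c]
      by (simp add: J_scaleC cinner_scaleC_left)
  qed
  then show "hform (\<lambda>t. c *\<^sub>C x t) y = c * hform x y" by (simp add: hform_def)
next
  fix x y assume x: "x \<in> dom" and y: "y \<in> dom"
  have "form_b b x y = - cnj (form_b b y x)"
  proof (rule form_eqI[OF x y])
    have "cinner (J (x t)) (y t) = - cnj (cinner (J (y t)) (x t))" for t
      unfolding cinner_J_left[of "x t"] using cinner_commute[of "x t" "J (y t)"] by simp
    then show "((\<lambda>t. cinner (J (x t)) (y t)) \<longlongrightarrow> - cnj (form_b b y x)) end_filter"
      using tendsto_minus[OF tendsto_cnj[OF boundary_form_tendsto[OF y x]]] by simp
  qed
  then show "hform x y = cnj (hform y x)" by (simp add: hform_def)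
qed

sublocale H: hermitian_form "\<lambda>c f t. c *\<^sub>C f t" dom hform
  by (rule hermitian_hform)

lemma positive_familyI_orthonormal:
  assumes \<sigma>: "\<sigma> * \<sigma> = (1::real)" and e: "\<And>i. i < n \<Longrightarrow> e i \<in> dom"
    and o: "orthonormal_on (\<lambda>y z. complex_of_real \<sigma> * hform y z) n e"
  shows "positive_family \<sigma> n"
  unfolding positive_family_def
proof (intro exI[of _ e] conjI allI impI)
  show "e i \<in> dom" if "i < n" for i using e that .
  fix c :: "nat \<Rightarrow> complex" assume c: "\<exists>i<n. c i \<noteq> 0"
  interpret S: hermitian_form "\<lambda>c f t. c *\<^sub>C f t" dom "\<lambda>y z. complex_of_real \<sigma> * hform y z"
  proof
    show "complex_of_real \<sigma> * hform x y = cnj (complex_of_real \<sigma> * hform y x)" if "x \<in> dom" "y \<in> dom" for x y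
      using H.form_commute[OF that] by simp
  qed (simp_all add: dom_subspace H.form_add_left H.form_scale_left distrib_left)
  have "complex_of_real \<sigma> * hform (lincomb n c e) (lincomb n c e) = complex_of_real (\<Sum>i<n. (norm (c i))\<^sup>2)"
    using S.form_orthonormal_combination[OF e o, of c] unfolding lincomb_eq_sum .
  from arg_cong[OF this, of Re]
  have "\<sigma> * Im (form_b b (lincomb n c e) (lincomb n c e)) = (\<Sum>i<n. (norm (c i))\<^sup>2)" by (simp add: Re_hform)
  also have "\<dots> > 0" using c by (auto intro!: sum_pos2)
  finally show "0 < \<sigma> * Im (form_b b (lincomb n c e) (lincomb n c e))" .
qed

lemma hform_lincomb_left:
  assumes "\<And>i. i < n \<Longrightarrow> f i \<in> dom" "z \<in> dom"
  shows "hform (lincomb n c f) z = (\<Sum>i<n. c i * hform (f i) z)"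
  unfolding lincomb_eq_sum[symmetric] using assms
  by (subst H.form_sum_left) (auto simp: H.scale_mem H.form_scale_left)

text \<open>Sylvester's law of inertia for a form on an infinite-dimensional domain. A maximal orthonormal
  family for the form, and then one for its negative on the orthogonal complement, leave a subspace on
  which the form vanishes by polarization. Their lengths are the two indices: otherwise a longer
  definite family would have a nontrivial combination orthogonal to the shorter one.\<close>

lemma normal_form:
  assumes p: "nu_b_plus a b I B \<Delta> = enat p" and q: "nu_b_minus a b I B \<Delta> = enat q"
  obtains E F where "\<forall>i<p. E i \<in> dom" "\<forall>j<q. F j \<in> dom" "orthonormal_on hform p E"
    "orthonormal_on (\<lambda>y z. - hform y z) q F" "\<forall>i<p. \<forall>j<q. hform (F j) (E i) = 0"
    "\<forall>y\<in>dom. \<forall>z\<in>dom. hform y z = (\<Sum>i<p. hform y (E i) * cnj (hform z (E i)))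
      - (\<Sum>j<q. hform y (F j) * cnj (hform z (F j)))"
proof -
  have pos: "positive_family 1 n \<longleftrightarrow> n \<le> p" "positive_family (-1) n \<longleftrightarrow> n \<le> q" for n
    using nu_b_plus_ge_iff[of n] nu_b_minus_ge_iff[of n] p q by simp_all
  have b1: "m \<le> p" if "\<And>i. i < m \<Longrightarrow> e i \<in> dom" "orthonormal_on hform m e" for m e
    using positive_familyI_orthonormal[of 1 m e] that pos(1) by simp
  obtain m E where E: "\<forall>i<m. E i \<in> dom" "orthonormal_on hform m E"
      "\<forall>y\<in>dom. (\<forall>i<m. hform y (E i) = 0) \<longrightarrow> Re (hform y y) \<le> 0"
    using H.ex_maximal_orthonormal[of p] b1 by blast
  have "m = p"
  proof (rule antisym[OF b1])
    show "p \<le> m"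
    proof (rule ccontr)
      assume "\<not> p \<le> m"
      obtain f where f: "\<forall>i<p. f i \<in> dom"
          "\<forall>c. (\<exists>i<p. c i \<noteq> 0) \<longrightarrow> 0 < 1 * Im (form_b b (lincomb p c f) (lincomb p c f))"
        using pos(1)[of p] unfolding positive_family_def by blast
      obtain c where c: "\<exists>i\<in>{..<p}. c i \<noteq> 0" "\<forall>j<m. (\<Sum>i<p. c i * hform (f i) (E j)) = 0"
        using underdetermined_system[of "{..<p}" m "\<lambda>j i. hform (f i) (E j)"] \<open>\<not> p \<le> m\<close> by auto
      have "lincomb p c f \<in> dom" by (rule dom_Tmax_lincomb) (use f in blast)
      moreover have "hform (lincomb p c f) (E j) = 0" if "j < m" for j
        using hform_lincomb_left[of p f "E j" c] f(1) E(1) c(2) that by simp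
      ultimately have "Re (hform (lincomb p c f) (lincomb p c f)) \<le> 0" using E(3) by blast
      moreover have "\<exists>i<p. c i \<noteq> 0" using c(1) by blast
      from f(2)[THEN spec, THEN mp, OF this] have "0 < 1 * Im (form_b b (lincomb p c f) (lincomb p c f))" .
      ultimately show False by (simp add: Re_hform)
    qed
  qed (use E in auto)
  note E = E[unfolded this]
  define D' where "D' = {y \<in> dom. \<forall>i<p. hform y (E i) = 0}"
  have D'sub: "fs.subspace D'"
    unfolding fs.subspace_def D'_def
    using dom_subspace E(1) H.form_zero_left
    by (auto simp: H.form_add_left H.form_scale_left intro: fs.subspace_add fs.subspace_scale fs.subspace_0)
  have D'dom: "D' \<subseteq> dom" by (auto simp: D'_def)
  interpret N: hermitian_form "\<lambda>c f t. c *\<^sub>C f t" D' "\<lambda>y z. - hform y z"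
    by (rule hermitian_form.form_restrict[OF H.negative_form D'sub D'dom])
  have b2: "m \<le> q" if "\<And>i. i < m \<Longrightarrow> e i \<in> D'" "orthonormal_on (\<lambda>y z. - hform y z) m e" for m e
    using positive_familyI_orthonormal[of "-1" m e] that pos(2) D'dom by auto
  obtain m' F where F: "\<forall>i<m'. F i \<in> D'" "orthonormal_on (\<lambda>y z. - hform y z) m' F"
      "\<forall>y\<in>D'. (\<forall>i<m'. - hform y (F i) = 0) \<longrightarrow> Re (- hform y y) \<le> 0"
    using N.ex_maximal_orthonormal[of q] b2 by blast
  have Fdom: "\<forall>j<m'. F j \<in> dom" and FE: "\<forall>i<p. \<forall>j<m'. hform (F j) (E i) = 0"
    using F(1) by (auto simp: D'_def)
  define D2 where "D2 = {y \<in> D'. \<forall>j<m'. hform y (F j) = 0}"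
  have D2_comb: "(\<lambda>t. c *\<^sub>C y t) + z \<in> D2" if "y \<in> D2" "z \<in> D2" for c y z
    using that D'sub Fdom D'dom
    by (auto simp: D2_def H.form_add_left H.form_scale_left H.scale_mem subset_iff
        intro!: fs.subspace_add fs.subspace_scale)
  have D2_dom: "y \<in> dom" if "y \<in> D2" for y using that D'dom by (auto simp: D2_def)
  have D2_0: "Re (hform y y) = 0" if "y \<in> D2" for y
  proof -
    have "Re (hform y y) \<le> 0" using E(3) that by (auto simp: D2_def D'_def)
    moreover have "Re (- hform y y) \<le> 0" using F(3) that by (auto simp: D2_def)
    ultimately show ?thesis by simp
  qed
  have D2_zero: "hform y z = 0" if y: "y \<in> D2" and z: "z \<in> D2" for y z
  proof -
    have re: "Re (c * hform y z) = 0" for c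
    proof -
      have cy: "(\<lambda>t. c *\<^sub>C y t) \<in> dom" by (rule H.scale_mem[OF D2_dom[OF y]])
      have "Re (hform ((\<lambda>t. c *\<^sub>C y t) + z) ((\<lambda>t. c *\<^sub>C y t) + z)) = 0" by (rule D2_0[OF D2_comb[OF y z]])
      moreover have "Re (hform (\<lambda>t. c *\<^sub>C y t) (\<lambda>t. c *\<^sub>C y t)) = 0"
        using D2_0[OF D2_comb[OF y, of 0 c]] z D2_0[OF y] D2_dom[OF y] cy H.form_self_real[OF D2_dom[OF y]]
        by (simp add: H.form_scale_left H.form_scale_right mult.assoc[symmetric] complex_norm_square[symmetric])
      moreover have "hform z (\<lambda>t. c *\<^sub>C y t) = cnj (hform (\<lambda>t. c *\<^sub>C y t) z)"
        by (rule H.form_commute[OF D2_dom[OF z] cy])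
      ultimately show ?thesis
        using cy D2_dom[OF z] D2_0[OF z] D2_dom[OF y] fs.subspace_add[OF dom_subspace cy D2_dom[OF z]]
        by (simp add: H.form_add_left H.form_add_right H.form_scale_left)
    qed
    from re[of 1] re[of "\<i>"] show ?thesis by (simp add: complex_eq_iff)
  qed
  have formula: "hform y z = (\<Sum>i<p. hform y (E i) * cnj (hform z (E i))) - (\<Sum>j<m'. hform y (F j) * cnj (hform z (F j)))"
    if y: "y \<in> dom" and z: "z \<in> dom" for y z
  proof -
    define P where "P x = (\<Sum>i<p. (\<lambda>t. hform x (E i) *\<^sub>C E i t))" for x
    note dec = H.form_orthonormal_decomp[OF E(1)[rule_format] E(2), folded P_def]
    have y': "y - P y \<in> D'" "z - P z \<in> D'" using dec(1,2) y z by (auto simp: D'_def)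
    define R where "R x = (\<Sum>j<m'. (\<lambda>t. (- hform x (F j)) *\<^sub>C F j t))" for x
    note dec2 = N.form_orthonormal_decomp[OF F(1)[rule_format] F(2), folded R_def]
    have y2: "(y - P y) - R (y - P y) \<in> D2" "(z - P z) - R (z - P z) \<in> D2"
      using dec2(1,2)[OF _ y'(1) y'(2)] dec2(1,2)[OF _ y'(2) y'(1)] by (auto simp: D2_def)
    have FP: "hform (x - P x) (F j) = hform x (F j)" if x: "x \<in> dom" and j: "j < m'" for x j
    proof -
      have Fj: "F j \<in> dom" using Fdom j by blast
      have Px: "P x \<in> dom" unfolding P_def using E(1) by (intro H.sum_mem H.scale_mem) auto
      have "hform (P x) (F j) = (\<Sum>i<p. hform x (E i) * hform (E i) (F j))"
        unfolding P_def using E(1) Fj by (subst H.form_sum_left) (auto simp: H.scale_mem H.form_scale_left)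
      also have "\<dots> = 0"
      proof (rule sum.neutral, rule ballI)
        fix i assume i: "i \<in> {..<p}"
        then have "hform (E i) (F j) = cnj (hform (F j) (E i))" using E(1) Fj by (intro H.form_commute) auto
        then show "hform x (E i) * hform (E i) (F j) = 0" using FE i j by simp
      qed
      finally have "hform (P x) (F j) = 0" .
      moreover have "hform (x - P x + P x) (F j) = hform (x - P x) (F j) + hform (P x) (F j)"
        by (rule H.form_add_left[OF fs.subspace_diff[OF dom_subspace x Px] Px Fj])
      ultimately show ?thesis by simp
    qed
    have "- hform (y - P y) (z - P z) = (\<Sum>j<m'. - hform (y - P y) (F j) * cnj (- hform (z - P z) (F j)))"
      using dec2(3)[OF _ y'] D2_zero[OF y2] by simp
    also have "\<dots> = (\<Sum>j<m'. hform y (F j) * cnj (hform z (F j)))"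
      by (rule sum.cong) (simp_all add: FP y z)
    finally have "hform (y - P y) (z - P z) = - (\<Sum>j<m'. hform y (F j) * cnj (hform z (F j)))"
      by (metis minus_minus)
    then show ?thesis using dec(3)[OF _ y z] by simp
  qed
  have "m' = q"
  proof (rule antisym[OF b2])
    show "q \<le> m'"
    proof (rule ccontr)
      assume "\<not> q \<le> m'"
      obtain f where f: "\<forall>i<q. f i \<in> dom"
          "\<forall>c. (\<exists>i<q. c i \<noteq> 0) \<longrightarrow> 0 < -1 * Im (form_b b (lincomb q c f) (lincomb q c f))"
        using pos(2)[of q] unfolding positive_family_def by blast
      obtain c where c: "\<exists>i\<in>{..<q}. c i \<noteq> 0" "\<forall>j<m'. (\<Sum>i<q. c i * hform (f i) (F j)) = 0"
        using underdetermined_system[of "{..<q}" m' "\<lambda>j i. hform (f i) (F j)"] \<open>\<not> q \<le> m'\<close> by auto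
      let ?y = "lincomb q c f"
      have y: "?y \<in> dom" by (rule dom_Tmax_lincomb) (use f in blast)
      have z: "hform ?y (F j) = 0" if "j < m'" for j
        using hform_lincomb_left[of q f "F j" c] f(1) Fdom c(2) that by simp
      have "hform ?y ?y = (\<Sum>i<p. hform ?y (E i) * cnj (hform ?y (E i)))" using formula[OF y y] z by simp
      also have "\<dots> = complex_of_real (\<Sum>i<p. (norm (hform ?y (E i)))\<^sup>2)"
        unfolding of_real_sum by (intro sum.cong refl complex_norm_square[symmetric])
      finally have "Re (hform ?y ?y) = (\<Sum>i<p. (norm (hform ?y (E i)))\<^sup>2)" by simp
      also have "\<dots> \<ge> 0" by (intro sum_nonneg) simp
      finally have "0 \<le> Re (hform ?y ?y)" .
      moreover have "\<exists>i<q. c i \<noteq> 0" using c(1) by blast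
      from f(2)[THEN spec, THEN mp, OF this] have "0 < -1 * Im (form_b b ?y ?y)" .
      ultimately show False by (simp add: Re_hform)
    qed
  qed (use F in auto)
  then show ?thesis using that[of E F] E Fdom F(2) FE formula by blast
qed

end

section \<open>Boundary maps at the right endpoint\<close>

context canonical_system
begin

lemma hform_comb:
  assumes "y \<in> dom" "z \<in> dom" "x \<in> dom"
  shows "hform (\<lambda>t. c *\<^sub>C y t + d *\<^sub>C z t) x = c * hform y x + d * hform z x"
proof -
  have eq: "(\<lambda>t. c *\<^sub>C y t + d *\<^sub>C z t) = (\<lambda>t. c *\<^sub>C y t) + (\<lambda>t. d *\<^sub>C z t)" by (simp add: plus_fun_def)
  show ?thesis
    unfolding eq H.form_add_left[OF H.scale_mem[OF assms(1)] H.scale_mem[OF assms(2)] assms(3)]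
    by (simp add: H.form_scale_left assms)
qed

text \<open>With the functionals \<open>\<alpha>\<^sub>i = h(\<cdot>, E\<^sub>i)\<close> and \<open>\<beta>\<^sub>j = h(\<cdot>, F\<^sub>j)\<close> of the normal form of \<open>h\<close>, the definitions
  \<open>\<Gamma>\<^sub>0 = (\<alpha> + \<beta>) / \<surd>2\<close> and \<open>\<Gamma>\<^sub>1 = -i (\<alpha> - \<beta>) / \<surd>2\<close> for the first \<open>q\<close> indices give
  \<open>\<Gamma>\<^sub>0 y \<Gamma>\<^sub>1 z\<^sup>* - \<Gamma>\<^sub>1 y \<Gamma>\<^sub>0 z\<^sup>* = i (\<alpha> y \<alpha> z\<^sup>* - \<beta> y \<beta> z\<^sup>*)\<close>. The functionals \<open>\<alpha>\<^sub>i\<close> with \<open>q \<le> i < w\<close> are further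
  components of \<open>\<Gamma>\<^sub>0\<close>, and the remaining ones form the middle component. The families \<open>E\<close> and \<open>F\<close> are
  dual to these functionals up to sign, whence surjectivity.\<close>

lemma boundary_map_exists:
  assumes p: "nu_b_plus a b I B \<Delta> = enat (w + cDIM TYPE('k))" and q: "nu_b_minus a b I B \<Delta> = enat q" and qw: "q \<le> w"
  shows "\<exists>(W :: fin_seq set) V G. boundary_map_b a b I B \<Delta> W V G"
proof -
  let ?N = "cDIM TYPE('k)"
  obtain E F where E: "\<forall>i<w + ?N. E i \<in> dom" and F: "\<forall>j<q. F j \<in> dom"
    and oE: "orthonormal_on hform (w + ?N) E" and oF: "orthonormal_on (\<lambda>y z. - hform y z) q F"
    and FE: "\<forall>i<w + ?N. \<forall>j<q. hform (F j) (E i) = 0"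
    and nf: "\<forall>y\<in>dom. \<forall>z\<in>dom. hform y z = (\<Sum>i<w + ?N. hform y (E i) * cnj (hform z (E i)))
      - (\<Sum>j<q. hform y (F j) * cnj (hform z (F j)))"
    by (rule normal_form[OF p q])
  define s where "s = complex_of_real (1 / sqrt 2)"
  have ss: "s * s = 1 / 2" and cs: "cnj s = s"
    by (simp_all add: s_def real_sqrt_mult[symmetric] flip: of_real_mult)
  define \<alpha> where "\<alpha> i y = hform y (E i)" for i y
  define \<beta> where "\<beta> j y = hform y (F j)" for j y
  define G0 where "G0 y = fseq w (\<lambda>i. if i < q then s * (\<alpha> i y + \<beta> i y) else \<alpha> i y)" for y
  define Gh where "Gh y = (\<Sum>i<?N. \<alpha> (w + i) y *\<^sub>C (cbasis i :: 'k))" for y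
  define G1 where "G1 y = fseq q (\<lambda>i. - \<i> * s * (\<alpha> i y - \<beta> i y))" for y
  define G where "G y = (G0 y, Gh y, G1 y)" for y
  have \<alpha>lin: "\<alpha> i (\<lambda>t. c *\<^sub>C y t + d *\<^sub>C z t) = c * \<alpha> i y + d * \<alpha> i z" if "y \<in> dom" "z \<in> dom" "i < w + ?N" for i y z c d
    unfolding \<alpha>_def using that E by (intro hform_comb) auto
  have \<beta>lin: "\<beta> i (\<lambda>t. c *\<^sub>C y t + d *\<^sub>C z t) = c * \<beta> i y + d * \<beta> i z" if "y \<in> dom" "z \<in> dom" "i < q" for i y z c d
    unfolding \<beta>_def using that F by (intro hform_comb) auto
  have lin: "clinear_map_on dom G"
    unfolding clinear_map_on_def
  proof (intro ballI allI)
    fix y z c d assume yz: "y \<in> dom" "z \<in> dom"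
    let ?x = "\<lambda>t. c *\<^sub>C y t + d *\<^sub>C z t"
    have "G0 ?x = c *\<^sub>C G0 y + d *\<^sub>C G0 z"
    proof (rule fin_seq_eqI)
      fix i show "seq_nth (G0 ?x) i = seq_nth (c *\<^sub>C G0 y + d *\<^sub>C G0 z) i"
        using qw by (simp add: G0_def seq_nth_fseq \<alpha>lin \<beta>lin yz algebra_simps)
    qed
    moreover have "G1 ?x = c *\<^sub>C G1 y + d *\<^sub>C G1 z"
    proof (rule fin_seq_eqI)
      fix i show "seq_nth (G1 ?x) i = seq_nth (c *\<^sub>C G1 y + d *\<^sub>C G1 z) i"
        using qw by (simp add: G1_def seq_nth_fseq \<alpha>lin \<beta>lin yz algebra_simps)
    qed
    moreover have "Gh ?x = c *\<^sub>C Gh y + d *\<^sub>C Gh z"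
      by (simp add: Gh_def \<alpha>lin yz scaleC_add_left sum.distrib cs.scale_sum_right scaleC_scaleC)
    ultimately show "G ?x = c *\<^sub>C G y + d *\<^sub>C G z" by (simp add: G_def scaleC_prod_def)
  qed
  have G0_mem: "G0 y \<in> seq_space w" and G1_mem: "G1 y \<in> seq_space q" for y
    by (simp_all add: G0_def G1_def seq_space_def seq_nth_fseq)
  have img: "G ` dom = seq_space w \<times> UNIV \<times> seq_space q"
  proof (intro set_eqI iffI)
    fix g assume "g \<in> G ` dom"
    then show "g \<in> seq_space w \<times> UNIV \<times> seq_space q" using G0_mem G1_mem by (auto simp: G_def)
  next
    fix g assume "g \<in> seq_space w \<times> (UNIV :: 'k set) \<times> seq_space q"
    then obtain x \<kappa> v where g: "g = (x, \<kappa>, v)" and x: "x \<in> seq_space w" and v: "v \<in> seq_space q" by blast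
    define A where "A i = (if i < q then s * (seq_nth x i + \<i> * seq_nth v i)
      else if i < w then seq_nth x i else cinner \<kappa> (cbasis (i - w)))" for i
    define C where "C j = s * (seq_nth x j - \<i> * seq_nth v j)" for j
    define y1 where "y1 = lincomb (w + ?N) A E"
    define y2 where "y2 = lincomb q (\<lambda>j. - C j) F"
    have yd: "y1 \<in> dom" "y2 \<in> dom" unfolding y1_def y2_def using E F by (auto intro!: dom_Tmax_lincomb)
    define y where "y = (\<lambda>t. 1 *\<^sub>C y1 t + 1 *\<^sub>C y2 t)"
    have y: "y \<in> dom" unfolding y_def by (rule dom_comb[OF yd])
    have \<alpha>y: "\<alpha> i y = A i" if i: "i < w + ?N" for i
    proof -
      have Ei: "E i \<in> dom" using E i by blast
      have "hform y1 (E i) = (\<Sum>l<w + ?N. A l * hform (E l) (E i))"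
        unfolding y1_def by (rule hform_lincomb_left[OF _ Ei]) (use E in blast)
      also have "\<dots> = (\<Sum>l<w + ?N. if l = i then A i else 0)"
        using oE i by (intro sum.cong) (auto simp: orthonormal_on_def)
      finally have 1: "hform y1 (E i) = A i" using i by simp
      have "hform y2 (E i) = (\<Sum>l<q. - C l * hform (F l) (E i))"
        unfolding y2_def by (rule hform_lincomb_left[OF _ Ei]) (use F in blast)
      also have "\<dots> = 0" by (rule sum.neutral) (use FE i in simp)
      finally have 2: "hform y2 (E i) = 0" .
      show ?thesis unfolding \<alpha>_def y_def using hform_comb[OF yd Ei, of 1 1] 1 2 by simp
    qed
    have \<beta>y: "\<beta> j y = C j" if j: "j < q" for j
    proof -
      have Fj: "F j \<in> dom" using F j by blast
      have EF: "hform (E l) (F j) = 0" if l: "l < w + ?N" for l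
      proof -
        have "E l \<in> dom" using E l by blast
        from H.form_commute[OF this Fj] show ?thesis using FE l j by simp
      qed
      have "hform y1 (F j) = (\<Sum>l<w + ?N. A l * hform (E l) (F j))"
        unfolding y1_def by (rule hform_lincomb_left[OF _ Fj]) (use E in blast)
      also have "\<dots> = 0" by (rule sum.neutral) (use EF in simp)
      finally have 1: "hform y1 (F j) = 0" .
      have "hform y2 (F j) = (\<Sum>l<q. - C l * hform (F l) (F j))"
        unfolding y2_def by (rule hform_lincomb_left[OF _ Fj]) (use F in blast)
      also have "\<dots> = (\<Sum>l<q. C l * (- hform (F l) (F j)))" by simp
      also have "\<dots> = (\<Sum>l<q. if l = j then C j else 0)"
      proof (rule sum.cong[OF refl])
        fix l assume "l \<in> {..<q}"
        then have "- hform (F l) (F j) = (if l = j then 1 else 0)" using oF j unfolding orthonormal_on_def by simp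
        then show "C l * (- hform (F l) (F j)) = (if l = j then C j else 0)" by simp
      qed
      finally have 2: "hform y2 (F j) = C j" using j by simp
      show ?thesis unfolding \<beta>_def y_def using hform_comb[OF yd Fj, of 1 1] 1 2 by simp
    qed
    have "G0 y = x"
    proof (rule fin_seq_eqI)
      fix i
      have "s * (A i + C i) = seq_nth x i" if "i < q"
      proof -
        have "s * (A i + C i) = (s * s) * (2 * seq_nth x i)" using that by (simp add: A_def C_def algebra_simps)
        then show ?thesis by (simp add: ss)
      qed
      then show "seq_nth (G0 y) i = seq_nth x i"
        using x qw by (auto simp: G0_def seq_nth_fseq \<alpha>y \<beta>y A_def seq_space_def)
    qed
    moreover have "G1 y = v"
    proof (rule fin_seq_eqI)
      fix i
      have "- \<i> * s * (A i - C i) = seq_nth v i" if "i < q"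
      proof -
        have "- \<i> * s * (A i - C i) = (s * s) * (2 * seq_nth v i)" using that by (simp add: A_def C_def algebra_simps)
        then show ?thesis by (simp add: ss)
      qed
      then show "seq_nth (G1 y) i = seq_nth v i"
        using v qw by (auto simp: G1_def seq_nth_fseq \<alpha>y \<beta>y seq_space_def simp del: mult_minus_left)
    qed
    moreover have "Gh y = \<kappa>"
    proof -
      have "Gh y = (\<Sum>i<?N. cinner \<kappa> (cbasis i) *\<^sub>C cbasis i)"
        unfolding Gh_def by (rule sum.cong) (use qw in \<open>simp_all add: \<alpha>y A_def\<close>)
      then show ?thesis by (simp add: cbasis_expansion)
    qed
    ultimately have "G y = g" by (simp add: G_def g)
    then show "g \<in> G ` dom" using y by blast
  qed
  let ?P = "orth_proj (orth_compl_in (seq_space w) (seq_space q))"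
  have identity: "form_b b y z = cinner (G0 y) (G1 z) - cinner (G1 y) (G0 z) + \<i> * cinner (?P (G0 y)) (?P (G0 z)) + \<i> * cinner (Gh y) (Gh z)"
    if y: "y \<in> dom" and z: "z \<in> dom" for y z
  proof -
    have P: "?P (G0 y) \<in> seq_space w" "seq_nth (?P (G0 y)) i = (if i < q \<or> w \<le> i then 0 else \<alpha> i y)" for y i
      unfolding orth_proj_seq_space[OF qw G0_mem]
      using qw by (auto simp: seq_space_def seq_nth_diff seq_nth_fseq G0_def)
    have split: "(\<Sum>i<n + m. f i) = (\<Sum>i<n. f i) + (\<Sum>i<m. f (n + i))" for n m and f :: "nat \<Rightarrow> complex"
      by (induction m) (simp_all add: add.assoc)
    have split_q: "(\<Sum>i<w. f i) = (\<Sum>i<q. f i) + (\<Sum>i<w. if i < q then 0 else f i)" for f :: "nat \<Rightarrow> complex"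
    proof -
      have "(\<Sum>i<q. f i) = (\<Sum>i<w. if i < q then f i else 0)"
        using qw by (intro sum.mono_neutral_cong_left) auto
      then show ?thesis by (simp add: sum.distrib[symmetric]) (intro sum.cong refl, simp)
    qed
    have c01: "cinner (G1 y) (G0 z) = (\<Sum>i<q. - \<i> * s * (\<alpha> i y - \<beta> i y) * cnj (s * (\<alpha> i z + \<beta> i z)))" for y z
      unfolding cinner_seq_space[OF G1_mem] using qw by (intro sum.cong) (auto simp: G1_def G0_def seq_nth_fseq)
    have c10: "cinner (G0 y) (G1 z) = (\<Sum>i<q. s * (\<alpha> i y + \<beta> i y) * cnj (- \<i> * s * (\<alpha> i z - \<beta> i z)))"
      unfolding cinner_commute[of "G0 y"] c01[of z y] cnj_sum by (simp add: mult.commute)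
    have "cinner (G0 y) (G1 z) - cinner (G1 y) (G0 z)
        = (\<Sum>i<q. (s * s) * (2 * \<i> * (\<alpha> i y * cnj (\<alpha> i z) - \<beta> i y * cnj (\<beta> i z))))"
      unfolding c10 c01 sum_subtractf[symmetric] by (rule sum.cong) (simp_all add: cs algebra_simps)
    also have "\<dots> = \<i> * ((\<Sum>i<q. \<alpha> i y * cnj (\<alpha> i z)) - (\<Sum>i<q. \<beta> i y * cnj (\<beta> i z)))"
      by (simp add: ss sum_distrib_left sum_subtractf[symmetric] right_diff_distrib)
    finally have 1: "cinner (G0 y) (G1 z) - cinner (G1 y) (G0 z)
        = \<i> * ((\<Sum>i<q. \<alpha> i y * cnj (\<alpha> i z)) - (\<Sum>i<q. \<beta> i y * cnj (\<beta> i z)))" .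
    have 2: "cinner (?P (G0 y)) (?P (G0 z)) = (\<Sum>i<w. if i < q then 0 else \<alpha> i y * cnj (\<alpha> i z))"
      unfolding cinner_seq_space[OF P(1)] by (rule sum.cong) (auto simp: P(2))
    have 3: "cinner (Gh y) (Gh z) = (\<Sum>i<?N. \<alpha> (w + i) y * cnj (\<alpha> (w + i) z))"
    proof -
      have "cinner (Gh y) (Gh z) = (\<Sum>i<?N. cnj (\<alpha> (w + i) z) * cinner (Gh y) (cbasis i))"
        unfolding Gh_def[of z] by (simp add: cinner_sum_right cinner_scaleC_right)
      also have "\<dots> = (\<Sum>i<?N. \<alpha> (w + i) y * cnj (\<alpha> (w + i) z))"
        unfolding Gh_def[of y] by (rule sum.cong) (simp_all add: orthonormal_sum_cinner[OF orthonormal_cbasis])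
      finally show ?thesis .
    qed
    have h: "hform y z = (\<Sum>i<q. \<alpha> i y * cnj (\<alpha> i z)) + (\<Sum>i<w. if i < q then 0 else \<alpha> i y * cnj (\<alpha> i z))
        + (\<Sum>i<?N. \<alpha> (w + i) y * cnj (\<alpha> (w + i) z)) - (\<Sum>i<q. \<beta> i y * cnj (\<beta> i z))"
      using nf y z split[where n = w and m = ?N and f = "\<lambda>i. \<alpha> i y * cnj (\<alpha> i z)"] split_q[of "\<lambda>i. \<alpha> i y * cnj (\<alpha> i z)"]
      by (simp add: \<alpha>_def \<beta>_def)
    show ?thesis unfolding form_b_hform h 1 2 3 by (simp add: algebra_simps)
  qed
  have "boundary_map_b a b I B \<Delta> (seq_space w) (seq_space q) G"
    unfolding boundary_map_b_def Let_def
    using lin img identity qw seq_space_subspace seq_space_fin_dim by (auto simp: G_def seq_space_def)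
  then show ?thesis by blast
qed

lemma clinear_map_lincomb:
  assumes G: "clinear_map_on dom G" and f: "\<And>i. i < n \<Longrightarrow> f i \<in> dom"
  shows "G (lincomb n c f) = (\<Sum>i<n. c i *\<^sub>C G (f i))"
  using f
proof (induction n)
  case 0
  have z: "(\<lambda>_. 0) \<in> dom" using dom_Tmax_lincomb[of 0 "\<lambda>_ _. 0" "\<lambda>_. 0"] by (simp add: lincomb_def[abs_def])
  have "G (\<lambda>t. 0 *\<^sub>C 0 + 0 *\<^sub>C 0) = 0 *\<^sub>C G (\<lambda>_. 0) + 0 *\<^sub>C G (\<lambda>_. 0)"
    using G[unfolded clinear_map_on_def, rule_format, OF z z, of 0 0] by simp
  then show ?case by (simp add: lincomb_def[abs_def])
next
  case (Suc n)
  have d: "lincomb n c f \<in> dom" "f n \<in> dom" using Suc.prems by (auto intro!: dom_Tmax_lincomb)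
  have "lincomb (Suc n) c f = (\<lambda>t. 1 *\<^sub>C lincomb n c f t + c n *\<^sub>C f n t)" by (simp add: lincomb_def fun_eq_iff)
  then have "G (lincomb (Suc n) c f) = 1 *\<^sub>C G (lincomb n c f) + c n *\<^sub>C G (f n)"
    using G[unfolded clinear_map_on_def, rule_format, OF d, of 1 "c n"] by simp
  then show ?case using Suc by simp
qed

lemma fst_scaleC [simp]: "fst (c *\<^sub>C x) = c *\<^sub>C fst x" and snd_scaleC [simp]: "snd (c *\<^sub>C x) = c *\<^sub>C snd x"
  by (simp_all add: scaleC_prod_def)

lemma independent_sum_nonzero:
  assumes "orthonormal n e" "i < n" "c i \<noteq> 0"
  shows "(\<Sum>i<n. c i *\<^sub>C e i) \<noteq> 0"
  using orthonormal_sum_cinner[OF assms(1,2), of c] assms(3) by auto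

lemma enat_eqI_positive_family:
  assumes \<nu>: "\<And>n. enat n \<le> \<nu> \<longleftrightarrow> positive_family \<sigma> n"
    and d: "positive_family \<sigma> d" "\<not> positive_family \<sigma> (Suc d)"
  shows "enat d = \<nu>"
proof (rule antisym)
  show "enat d \<le> \<nu>" using \<nu> d(1) by blast
  show "\<nu> \<le> enat d"
  proof (rule ccontr)
    assume "\<not> \<nu> \<le> enat d"
    then have "enat (Suc d) \<le> \<nu>" by (simp add: Suc_ile_eq)
    then show False using \<nu> d(2) by blast
  qed
qed

text \<open>With \<open>Q\<close> the projection onto \<open>V\<close>, the form is positive definite on the preimages of the vectors
  \<open>(w, \<kappa>, -i Q w)\<close> and negative definite on those of \<open>(v, 0, i v)\<close>, which yields the two lower bounds.
  The equations \<open>\<Gamma>\<^sub>0 + i \<Gamma>\<^sub>1 = 0\<close>, \<open>\<Gamma>\<^sub>K = 0\<close> (values in \<open>W\<close> and \<open>K\<close>) force the form to be nonpositive,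
  and \<open>\<Gamma>\<^sub>1 + i Q \<Gamma>\<^sub>0 = 0\<close> (values in \<open>V\<close>) force it to be nonnegative. A family longer than the number
  of these equations has a nontrivial combination that satisfies them and so cannot be definite.\<close>

lemma boundary_map_dimensions:
  fixes W V :: "'w::complex_inner set"
  assumes bm: "boundary_map_b a b I B \<Delta> W V G"
  shows "enat (cdim V) = nu_b_minus a b I B \<Delta>"
    and "enat (cdim W + cDIM TYPE('k)) = nu_b_plus a b I B \<Delta>"
    and "cdim W = cdim V \<longleftrightarrow> W = V"
    and "\<lbrakk>W = V; y \<in> dom; z \<in> dom\<rbrakk> \<Longrightarrow> form_b b y z = cinner (fst (G y)) (snd (snd (G z)))
      - cinner (snd (snd (G y))) (fst (G z)) + \<i> * cinner (fst (snd (G y))) (fst (snd (G z)))"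
proof -
  let ?N = "cDIM TYPE('k)"
  let ?P = "orth_proj (orth_compl_in W V)"
  define G0 where "G0 y = fst (G y)" for y
  define Gh where "Gh y = fst (snd (G y))" for y
  define G1 where "G1 y = snd (snd (G y))" for y
  have W: "csubspace W" "fin_dim W" and V: "csubspace V" "V \<subseteq> W" and lin: "clinear_map_on dom G"
    and img: "G ` dom = W \<times> UNIV \<times> V"
    and id: "\<forall>y\<in>dom. \<forall>z\<in>dom. form_b b y z = cinner (G0 y) (G1 z) - cinner (G1 y) (G0 z)
         + \<i> * cinner (?P (G0 y)) (?P (G0 z)) + \<i> * cinner (Gh y) (Gh z)"
    using bm unfolding boundary_map_b_def Let_def G0_def Gh_def G1_def by blast+
  have Vf: "fin_dim V" by (rule fin_dim_mono[OF W(2) V(2)])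
  have mem: "G0 y \<in> W" "G1 y \<in> V" if "y \<in> dom" for y
  proof -
    have "G y \<in> W \<times> UNIV \<times> V" using img that by blast
    then show "G0 y \<in> W" "G1 y \<in> V" by (auto simp: G0_def G1_def mem_Times_iff)
  qed
  have surj: "\<exists>y\<in>dom. G0 y = x \<and> Gh y = \<kappa> \<and> G1 y = v" if "x \<in> W" "v \<in> V" for x \<kappa> v
  proof -
    have "(x, \<kappa>, v) \<in> G ` dom" using img that by blast
    then obtain y where "y \<in> dom" "G y = (x, \<kappa>, v)" by (metis imageE)
    then show ?thesis by (intro bexI[of _ y]) (simp_all add: G0_def Gh_def G1_def)
  qed
  obtain Q where Q: "\<And>x. Q x \<in> V" "\<And>x m. m \<in> V \<Longrightarrow> cinner (x - Q x) m = 0"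
    "\<And>x y. Q (x + y) = Q x + Q y" "\<And>c x. Q (c *\<^sub>C x) = c *\<^sub>C Q x" "\<And>x. x \<in> V \<Longrightarrow> Q x = x"
  proof (rule fin_dim_projection[OF V(1) Vf])
    fix Q assume q: "\<And>x. Q x \<in> V" "\<And>x m. m \<in> V \<Longrightarrow> cinner (x - Q x) m = 0"
      "\<And>x y. Q (x + y) = Q x + Q y" "\<And>c x. Q (c *\<^sub>C x) = c *\<^sub>C Q x" "\<And>x. x \<in> V \<Longrightarrow> Q x = x"
    show thesis by (rule that[of Q]; (fact q | erule q | rule q))
  qed
  have Q0: "Q 0 = 0" using Q(4)[of 0 0] by simp
  have Qsum: "Q (\<Sum>i<n. f i) = (\<Sum>i<n. Q (f i))" for n :: nat and f
    by (induction n) (simp_all add: Q0 Q(3))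
  have P: "?P x = x - Q x" if x: "x \<in> W" for x
  proof (rule orth_proj_unique)
    have "Q x \<in> W" using Q(1) V(2) by blast
    then show "x - Q x \<in> orth_compl_in W V" using Q(2) cs.subspace_diff[OF W(1) x] by (simp add: orth_compl_in_def)
    show "csubspace (orth_compl_in W V)"
      using W(1) unfolding orth_compl_in_def cs.subspace_def by (auto simp: cinner_add_left cinner_scaleC_left)
    fix m assume "m \<in> orth_compl_in W V"
    then have "cinner m (Q x) = 0" using Q(1) by (simp add: orth_compl_in_def)
    then show "cinner (x - (x - Q x)) m = 0" using cinner_commute[of "Q x" m] by simp
  qed
  have quad: "Im (form_b b y y) = 2 * Im (cinner (G0 y) (G1 y)) + (norm (G0 y - Q (G0 y)))\<^sup>2 + (norm (Gh y))\<^sup>2"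
    if y: "y \<in> dom" for y
  proof -
    have "form_b b y y = cinner (G0 y) (G1 y) - cnj (cinner (G0 y) (G1 y))
        + \<i> * complex_of_real ((norm (G0 y - Q (G0 y)))\<^sup>2) + \<i> * complex_of_real ((norm (Gh y))\<^sup>2)"
      using id[rule_format, OF y y] unfolding P[OF mem(1)[OF y]] cinner_self cinner_commute[of "G1 y" "G0 y"] .
    then show ?thesis by (simp del: of_real_power)
  qed
  have Qx: "cinner x (Q x) = complex_of_real ((norm (Q x))\<^sup>2)" for x
    using Q(2)[OF Q(1)[of x], of x] unfolding cinner_diff_left cinner_self by simp
  have Glin: "G0 (lincomb n c f) = (\<Sum>i<n. c i *\<^sub>C G0 (f i))" "Gh (lincomb n c f) = (\<Sum>i<n. c i *\<^sub>C Gh (f i))"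
      "G1 (lincomb n c f) = (\<Sum>i<n. c i *\<^sub>C G1 (f i))" if fd: "\<forall>i<n. f i \<in> dom" for n c f
  proof -
    have "G (lincomb n c f) = (\<Sum>i<n. c i *\<^sub>C G (f i))" by (rule clinear_map_lincomb[OF lin fd[rule_format]])
    then show "G0 (lincomb n c f) = (\<Sum>i<n. c i *\<^sub>C G0 (f i))" "Gh (lincomb n c f) = (\<Sum>i<n. c i *\<^sub>C Gh (f i))"
      "G1 (lincomb n c f) = (\<Sum>i<n. c i *\<^sub>C G1 (f i))"
      unfolding G0_def Gh_def G1_def by (simp_all add: fst_sum snd_sum)
  qed
  obtain e where e: "\<forall>i<cdim V. e i \<in> V" "orthonormal (cdim V) e" "\<forall>x\<in>V. x = (\<Sum>i<cdim V. cinner x (e i) *\<^sub>C e i)"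
    using fin_dim_orthonormal_basis[OF V(1) Vf] by blast
  obtain e' where e': "\<forall>i<cdim W. e' i \<in> W" "orthonormal (cdim W) e'" "\<forall>x\<in>W. x = (\<Sum>i<cdim W. cinner x (e' i) *\<^sub>C e' i)"
    using fin_dim_orthonormal_basis[OF W] by blast
  show "enat (cdim V) = nu_b_minus a b I B \<Delta>"
  proof (rule enat_eqI_positive_family[OF nu_b_minus_ge_iff])
    have "\<forall>i. \<exists>y. i < cdim V \<longrightarrow> y \<in> dom \<and> G0 y = e i \<and> Gh y = 0 \<and> G1 y = \<i> *\<^sub>C e i"
    proof
      fix i show "\<exists>y. i < cdim V \<longrightarrow> y \<in> dom \<and> G0 y = e i \<and> Gh y = 0 \<and> G1 y = \<i> *\<^sub>C e i"
        using surj[of "e i" "\<i> *\<^sub>C e i" 0] e(1) V cs.subspace_scale[OF V(1)] by (cases "i < cdim V") auto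
    qed
    from choice[OF this] obtain f where f: "\<And>i. i < cdim V \<Longrightarrow> f i \<in> dom" "\<And>i. i < cdim V \<Longrightarrow> G0 (f i) = e i"
      "\<And>i. i < cdim V \<Longrightarrow> Gh (f i) = 0" "\<And>i. i < cdim V \<Longrightarrow> G1 (f i) = \<i> *\<^sub>C e i" by blast
    show "positive_family (-1) (cdim V)"
      unfolding positive_family_def
    proof (rule exI[of _ f], intro conjI allI impI f(1))
      fix c :: "nat \<Rightarrow> complex" assume c: "\<exists>i<cdim V. c i \<noteq> 0"
      let ?y = "lincomb (cdim V) c f" and ?v = "\<Sum>i<cdim V. c i *\<^sub>C e i"
      have fd0: "\<forall>i<cdim V. f i \<in> dom" using f(1) by blast
      have yd: "?y \<in> dom" by (rule dom_Tmax_lincomb) (rule f(1))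
      have v: "?v \<noteq> 0" using c independent_sum_nonzero[OF e(2)] by blast
      have vV: "?v \<in> V" using e(1) V(1) by (intro cs.subspace_sum cs.subspace_scale) auto
      have "G0 ?y = ?v" unfolding Glin(1)[OF fd0] by (rule sum.cong) (use f in auto)
      moreover have "G1 ?y = \<i> *\<^sub>C ?v" unfolding Glin(3)[OF fd0] cs.scale_sum_right
        by (rule sum.cong) (use f in \<open>auto simp: scaleC_scaleC mult.commute\<close>)
      moreover have "Gh ?y = 0" unfolding Glin(2)[OF fd0] by (rule sum.neutral) (use f in auto)
      ultimately have "Im (form_b b ?y ?y) = - 2 * (norm ?v)\<^sup>2"
        unfolding quad[OF yd] by (simp add: Q(5)[OF vV] cinner_scaleC_right cinner_self del: of_real_power)
      then show "0 < - 1 * Im (form_b b ?y ?y)" using v by simp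
    qed
    show "\<not> positive_family (-1) (Suc (cdim V))"
    proof
      assume "positive_family (-1) (Suc (cdim V))"
      then obtain f where f: "\<forall>i<Suc (cdim V). f i \<in> dom"
        "\<forall>c. (\<exists>i<Suc (cdim V). c i \<noteq> 0) \<longrightarrow> 0 < -1 * Im (form_b b (lincomb (Suc (cdim V)) c f) (lincomb (Suc (cdim V)) c f))"
        unfolding positive_family_def by blast
      have mem': "G1 (f i) + \<i> *\<^sub>C Q (G0 (f i)) \<in> V" if "i < Suc (cdim V)" for i
        using f(1) that mem(2) Q(1) V(1) by (intro cs.subspace_add cs.subspace_scale) auto
      have "\<exists>c. (\<exists>i<Suc (cdim V). c i \<noteq> 0) \<and> (\<forall>i\<ge>Suc (cdim V). c i = 0) \<and>
          (\<Sum>i<Suc (cdim V). c i *\<^sub>C (G1 (f i) + \<i> *\<^sub>C Q (G0 (f i)))) = 0 \<and> (\<forall>j<(0::nat). (\<Sum>i<Suc (cdim V). c i * 0) = 0)"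
        by (rule ex_nontrivial_combination[OF V(1) Vf]; (erule mem' | simp))
      then obtain c where c: "\<exists>i<Suc (cdim V). c i \<noteq> 0" "(\<Sum>i<Suc (cdim V). c i *\<^sub>C (G1 (f i) + \<i> *\<^sub>C Q (G0 (f i)))) = 0"
        by blast
      let ?y = "lincomb (Suc (cdim V)) c f"
      have fd: "\<And>i. i < Suc (cdim V) \<Longrightarrow> f i \<in> dom" using f(1) by blast
      have yd: "?y \<in> dom" by (rule dom_Tmax_lincomb) (rule fd)
      have "G1 ?y + \<i> *\<^sub>C Q (G0 ?y) = (\<Sum>i<Suc (cdim V). c i *\<^sub>C (G1 (f i) + \<i> *\<^sub>C Q (G0 (f i))))"
        unfolding Glin(1,3)[OF f(1)] Qsum Q(4) cs.scale_sum_right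
        by (simp add: scaleC_add_right sum.distrib scaleC_scaleC mult.commute del: sum.lessThan_Suc)
      with c(2) have "G1 ?y = - \<i> *\<^sub>C Q (G0 ?y)" by (simp add: add_eq_0_iff2 cs.scale_minus_left del: sum.lessThan_Suc)
      then have "Im (form_b b ?y ?y) = 2 * (norm (Q (G0 ?y)))\<^sup>2 + (norm (G0 ?y - Q (G0 ?y)))\<^sup>2 + (norm (Gh ?y))\<^sup>2"
        unfolding quad[OF yd] by (simp add: cinner_scaleC_right Qx cs.scale_minus_left del: of_real_power)
      then have "0 \<le> Im (form_b b ?y ?y)" by simp
      moreover have "0 < -1 * Im (form_b b ?y ?y)" by (rule f(2)[THEN spec, THEN mp, OF c(1)])
      ultimately show False by linarith
    qed
  qed
  show "enat (cdim W + ?N) = nu_b_plus a b I B \<Delta>"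
  proof (rule enat_eqI_positive_family[OF nu_b_plus_ge_iff])
    let ?n = "cdim W + ?N"
    define x where "x i = (if i < cdim W then e' i else 0)" for i
    define \<kappa> where "\<kappa> i = (if i < cdim W then 0 else cbasis (i - cdim W) :: 'k)" for i
    have xW: "x i \<in> W" for i using e'(1) cs.subspace_0[OF W(1)] by (simp add: x_def)
    have "\<forall>i. \<exists>y. y \<in> dom \<and> G0 y = x i \<and> Gh y = \<kappa> i \<and> G1 y = - \<i> *\<^sub>C Q (x i)"
    proof
      fix i
      have "- \<i> *\<^sub>C Q (x i) \<in> V" by (intro cs.subspace_scale V(1) Q(1))
      from surj[where x = "x i" and v = "- \<i> *\<^sub>C Q (x i)" and \<kappa> = "\<kappa> i", OF xW this] show "\<exists>y. y \<in> dom \<and> G0 y = x i \<and> Gh y = \<kappa> i \<and> G1 y = - \<i> *\<^sub>C Q (x i)" by blast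
    qed
    from choice[OF this] obtain f where f: "\<And>i. f i \<in> dom" "\<And>i. G0 (f i) = x i" "\<And>i. Gh (f i) = \<kappa> i" "\<And>i. G1 (f i) = - \<i> *\<^sub>C Q (x i)"
      by blast
    show "positive_family 1 ?n"
      unfolding positive_family_def
    proof (rule exI[of _ f], intro conjI allI impI f(1))
      fix c :: "nat \<Rightarrow> complex" assume c: "\<exists>i<?n. c i \<noteq> 0"
      let ?y = "lincomb ?n c f"
      have fd0: "\<forall>i<?n. f i \<in> dom" using f(1) by blast
      have yd: "?y \<in> dom" by (rule dom_Tmax_lincomb) (rule f(1))
      have sum_split: "(\<Sum>i<n + m. h i) = (\<Sum>i<n. h i) + (\<Sum>i<m. h (n + i))" for n m and h :: "nat \<Rightarrow> 'z::comm_monoid_add"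
        by (induction m) (simp_all add: add.assoc)
      have g0: "G0 ?y = (\<Sum>i<cdim W. c i *\<^sub>C e' i)" unfolding Glin(1)[OF fd0] f(2) sum_split by (simp add: x_def)
      have gh: "Gh ?y = (\<Sum>i<?N. c (cdim W + i) *\<^sub>C cbasis i)" unfolding Glin(2)[OF fd0] f(3) sum_split by (simp add: \<kappa>_def)
      have "G1 ?y = - \<i> *\<^sub>C Q (G0 ?y)"
        unfolding Glin(1,3)[OF fd0] f(2,4) Qsum Q(4) cs.scale_sum_right by (simp add: scaleC_scaleC mult.commute)
      then have form: "Im (form_b b ?y ?y) = 2 * (norm (Q (G0 ?y)))\<^sup>2 + (norm (G0 ?y - Q (G0 ?y)))\<^sup>2 + (norm (Gh ?y))\<^sup>2"
        unfolding quad[OF yd] by (simp add: cinner_scaleC_right Qx cs.scale_minus_left del: of_real_power)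
      obtain i where i: "i < ?n" "c i \<noteq> 0" using c by blast
      have "G0 ?y \<noteq> 0 \<or> Gh ?y \<noteq> 0"
      proof (cases "i < cdim W")
        case True
        then show ?thesis using independent_sum_nonzero[OF e'(2) True, of c] i(2) g0 by simp
      next
        case False
        then have lt: "i - cdim W < ?N" using i(1) by simp
        have "c (cdim W + (i - cdim W)) \<noteq> 0" using False i(2) by simp
        from independent_sum_nonzero[where c = "\<lambda>i. c (cdim W + i)", OF orthonormal_cbasis lt this]
        show ?thesis unfolding gh by blast
      qed
      then have nz: "Q (G0 ?y) \<noteq> 0 \<or> G0 ?y - Q (G0 ?y) \<noteq> 0 \<or> Gh ?y \<noteq> 0" by auto
      have pos: "0 < 1 * (2 * a + b + c)" if "0 < a \<or> 0 < b \<or> 0 < c" "0 \<le> a" "0 \<le> b" "0 \<le> c" for a b c :: real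
        using that unfolding mult_1_left by (elim disjE; linarith)
      from nz have sq: "0 < (norm (Q (G0 ?y)))\<^sup>2 \<or> 0 < (norm (G0 ?y - Q (G0 ?y)))\<^sup>2 \<or> 0 < (norm (Gh ?y))\<^sup>2" by simp
      show "0 < 1 * Im (form_b b ?y ?y)"
        unfolding form by (rule pos[OF sq]) simp_all
    qed
    show "\<not> positive_family 1 (Suc ?n)"
    proof
      assume "positive_family 1 (Suc ?n)"
      then obtain f where f: "\<forall>i<Suc ?n. f i \<in> dom"
        "\<forall>c. (\<exists>i<Suc ?n. c i \<noteq> 0) \<longrightarrow> 0 < 1 * Im (form_b b (lincomb (Suc ?n) c f) (lincomb (Suc ?n) c f))"
        unfolding positive_family_def by blast
      have mem': "G0 (f i) + \<i> *\<^sub>C G1 (f i) \<in> W" if "i < Suc ?n" for i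
        using f(1) that mem V(2) W(1) by (intro cs.subspace_add cs.subspace_scale) auto
      have "\<exists>c. (\<exists>i<Suc ?n. c i \<noteq> 0) \<and> (\<forall>i\<ge>Suc ?n. c i = 0) \<and> (\<Sum>i<Suc ?n. c i *\<^sub>C (G0 (f i) + \<i> *\<^sub>C G1 (f i))) = 0
          \<and> (\<forall>j<?N. (\<Sum>i<Suc ?n. c i * cinner (Gh (f i)) (cbasis j)) = 0)"
        by (rule ex_nontrivial_combination[OF W]; (erule mem' | simp))
      then obtain c where c: "\<exists>i<Suc ?n. c i \<noteq> 0" "(\<Sum>i<Suc ?n. c i *\<^sub>C (G0 (f i) + \<i> *\<^sub>C G1 (f i))) = 0"
        "\<forall>j<?N. (\<Sum>i<Suc ?n. c i * cinner (Gh (f i)) (cbasis j)) = 0" by blast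
      let ?y = "lincomb (Suc ?n) c f"
      have fd: "\<And>i. i < Suc ?n \<Longrightarrow> f i \<in> dom" using f(1) by blast
      have yd: "?y \<in> dom" by (rule dom_Tmax_lincomb) (rule fd)
      have "cinner (Gh ?y) (cbasis j) = 0" if "j < ?N" for j
        using c(3) that unfolding Glin(2)[OF f(1)] cinner_sum_left cinner_scaleC_left by blast
      then have "(\<Sum>j<?N. cinner (Gh ?y) (cbasis j) *\<^sub>C (cbasis j :: 'k)) = 0" by (intro sum.neutral) auto
      then have gh: "Gh ?y = 0" unfolding cbasis_expansion .
      have "G0 ?y + \<i> *\<^sub>C G1 ?y = (\<Sum>i<Suc ?n. c i *\<^sub>C (G0 (f i) + \<i> *\<^sub>C G1 (f i)))"
        unfolding Glin(1,3)[OF f(1)] cs.scale_sum_right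
        by (simp add: scaleC_add_right sum.distrib scaleC_scaleC mult.commute del: sum.lessThan_Suc)
      with c(2) have g0: "G0 ?y = - \<i> *\<^sub>C G1 ?y" by (simp add: add_eq_0_iff2 cs.scale_minus_left del: sum.lessThan_Suc)
      have qq: "Q (G0 ?y) = G0 ?y" unfolding g0 by (rule Q(5)) (intro cs.subspace_scale V(1) mem(2) yd)
      have "Im (form_b b ?y ?y) = 2 * Im (cinner (G0 ?y) (G1 ?y))"
        unfolding quad[OF yd] qq gh by simp
      also have "\<dots> = - 2 * (norm (G1 ?y))\<^sup>2" unfolding g0 cinner_scaleC_left cinner_self by (simp del: of_real_power)
      finally have "Im (form_b b ?y ?y) \<le> 0" by simp
      moreover have "0 < 1 * Im (form_b b ?y ?y)" by (rule f(2)[THEN spec, THEN mp, OF c(1)])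
      ultimately show False unfolding mult_1_left by linarith
    qed
  qed
  show "cdim W = cdim V \<longleftrightarrow> W = V"
  proof
    assume eq: "cdim W = cdim V"
    have "x \<in> V" if x: "x \<in> W" for x
    proof (rule ccontr)
      assume nx: "x \<notin> V"
      let ?z = "x - Q x"
      have z0: "?z \<noteq> 0" using Q(1)[of x] nx by auto
      have QW: "Q x \<in> W" using Q(1) V(2) by blast
      have zW: "?z \<in> W" by (rule cs.subspace_diff[OF W(1) x QW])
      have mem': "(if i < cdim V then e i else ?z) \<in> W" if "i < Suc (cdim V)" for i
        using e(1) V(2) zW by (cases "i < cdim V") auto
      have "\<exists>c. (\<exists>i<Suc (cdim V). c i \<noteq> 0) \<and> (\<forall>i\<ge>Suc (cdim V). c i = 0) \<and>
          (\<Sum>i<Suc (cdim V). c i *\<^sub>C (if i < cdim V then e i else ?z)) = 0 \<and> (\<forall>j<(0::nat). (\<Sum>i<Suc (cdim V). c i * 0) = 0)"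
        by (rule ex_nontrivial_combination[OF W]; (erule mem' | simp add: eq))
      then obtain c where c: "\<exists>i<Suc (cdim V). c i \<noteq> 0" "(\<Sum>i<Suc (cdim V). c i *\<^sub>C (if i < cdim V then e i else ?z)) = 0"
        by blast
      have sum0: "(\<Sum>i<cdim V. c i *\<^sub>C e i) + c (cdim V) *\<^sub>C ?z = 0" using c(2) by simp
      have orth: "cinner (\<Sum>i<cdim V. c i *\<^sub>C e i) ?z = 0"
      proof -
        have "(\<Sum>i<cdim V. c i *\<^sub>C e i) \<in> V" using e(1) V(1) by (intro cs.subspace_sum cs.subspace_scale) auto
        from Q(2)[OF this, of x] show ?thesis using cinner_commute[of "\<Sum>i<cdim V. c i *\<^sub>C e i" ?z] by simp
      qed
      have "cinner ((\<Sum>i<cdim V. c i *\<^sub>C e i) + c (cdim V) *\<^sub>C ?z) ?z = 0" unfolding sum0 by simp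
      then have "c (cdim V) * cinner ?z ?z = 0" unfolding cinner_add_left orth cinner_scaleC_left by simp
      then have cz: "c (cdim V) = 0" using z0 by simp
      then have "(\<Sum>i<cdim V. c i *\<^sub>C e i) = 0" using sum0 by simp
      then have "\<forall>i<cdim V. c i = 0" using independent_sum_nonzero[where c = c, OF e(2)] by blast
      with cz c(1) show False by (auto simp: less_Suc_eq)
    qed
    with V(2) show "W = V" by blast
  qed simp
  show "form_b b y z = cinner (fst (G y)) (snd (snd (G z)))
      - cinner (snd (snd (G y))) (fst (G z)) + \<i> * cinner (fst (snd (G y))) (fst (snd (G z)))"
    if WV: "W = V" and y: "y \<in> dom" and z: "z \<in> dom"
  proof -
    have "?P (G0 y) = 0" unfolding P[OF mem(1)[OF y]] using Q(5)[of "G0 y"] mem(1)[OF y] WV by simp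
    then show ?thesis using id[rule_format, OF y z] by (simp add: G0_def Gh_def G1_def)
  qed
qed

end

theorem lemma3p4:
  fixes a :: real and b :: ereal and I :: "real set"
    and B \<Delta> :: "real \<Rightarrow> ('h::fd_complex_hilbert, 'k::fd_complex_hilbert) opH"
    and mu_plus mu_minus :: complex
  assumes system: "definite_system a b I B \<Delta>"
    and half_planes: "Im mu_plus > 0" "Im mu_minus < 0"
    and deficiency_le: "deficiency a I B \<Delta> mu_minus \<le> deficiency a I B \<Delta> mu_plus"
  shows "(\<exists>(W :: fin_seq set) V G. boundary_map_b a b I B \<Delta> W V G) \<and>
    (\<forall>(W :: 'w::complex_inner set) V G. boundary_map_b a b I B \<Delta> W V G \<longrightarrow>
       enat (cdim V) = nu_b_minus a b I B \<Delta> \<and>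
       enat (cdim W + cdim (UNIV :: 'k set)) = nu_b_plus a b I B \<Delta> \<and>
       (deficiency a I B \<Delta> mu_plus = deficiency a I B \<Delta> mu_minus \<longleftrightarrow> W = V) \<and>
       (deficiency a I B \<Delta> mu_plus = deficiency a I B \<Delta> mu_minus \<longrightarrow>
         (\<forall>y\<in>dom_Tmax a I B \<Delta>. \<forall>z\<in>dom_Tmax a I B \<Delta>.
            G y \<in> V \<times> UNIV \<times> V \<and>
            form_b b y z = cinner (fst (G y)) (snd (snd (G z)))
              - cinner (snd (snd (G y))) (fst (G z))
              + \<i> * cinner (fst (snd (G y))) (fst (snd (G z))))))"
proof -
  interpret canonical_system a b I B \<Delta> by unfold_locales (rule system)
  note def = deficiency_formulas[OF half_planes]
  have fin1: "nu_b_plus a b I B \<Delta> \<noteq> \<infinity>"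
  proof
    assume "nu_b_plus a b I B \<Delta> = \<infinity>"
    then show False using deficiency_finite[of mu_plus] unfolding def(1) by simp
  qed
  have fin2: "nu_b_minus a b I B \<Delta> \<noteq> \<infinity>"
  proof
    assume "nu_b_minus a b I B \<Delta> = \<infinity>"
    then show False using deficiency_finite[of mu_minus] unfolding def(2) by simp
  qed
  obtain p where p: "nu_b_plus a b I B \<Delta> = enat p" using fin1 by auto
  obtain q where q: "nu_b_minus a b I B \<Delta> = enat q" using fin2 by auto
  have le: "q + cDIM TYPE('k) \<le> p" using deficiency_le unfolding def p q by simp
  show ?thesis
  proof (intro conjI allI impI)
    have "nu_b_plus a b I B \<Delta> = enat ((p - cDIM TYPE('k)) + cDIM TYPE('k))" using p le by simp
    then show "\<exists>(W :: fin_seq set) V G. boundary_map_b a b I B \<Delta> W V G"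
      by (rule boundary_map_exists[OF _ q]) (use le in simp)
    fix W V :: "'w set" and G
    assume bm: "boundary_map_b a b I B \<Delta> W V G"
    note dims = boundary_map_dimensions[OF bm]
    show "enat (cdim V) = nu_b_minus a b I B \<Delta>" "enat (cdim W + cDIM TYPE('k)) = nu_b_plus a b I B \<Delta>"
      by (rule dims)+
    have "deficiency a I B \<Delta> mu_plus = deficiency a I B \<Delta> mu_minus \<longleftrightarrow> cdim W = cdim V"
      unfolding def dims(1,2)[symmetric] by auto
    also have "\<dots> \<longleftrightarrow> W = V" by (rule dims(3))
    finally show eq: "deficiency a I B \<Delta> mu_plus = deficiency a I B \<Delta> mu_minus \<longleftrightarrow> W = V" .
    show "\<forall>y\<in>dom_Tmax a I B \<Delta>. \<forall>z\<in>dom_Tmax a I B \<Delta>.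
            G y \<in> V \<times> UNIV \<times> V \<and>
            form_b b y z = cinner (fst (G y)) (snd (snd (G z)))
              - cinner (snd (snd (G y))) (fst (G z))
              + \<i> * cinner (fst (snd (G y))) (fst (snd (G z)))"
      if "deficiency a I B \<Delta> mu_plus = deficiency a I B \<Delta> mu_minus"
    proof (intro ballI conjI)
      have WV: "W = V" using that eq by blast
      fix y z assume yz: "y \<in> dom" "z \<in> dom"
      have "G ` dom = W \<times> UNIV \<times> V" using bm unfolding boundary_map_b_def by (elim conjE)
      then show "G y \<in> V \<times> UNIV \<times> V" using yz WV by blast
      show "form_b b y z = cinner (fst (G y)) (snd (snd (G z)))
              - cinner (snd (snd (G y))) (fst (G z)) + \<i> * cinner (fst (snd (G y))) (fst (snd (G z)))"
        by (rule dims(4)[OF WV yz])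
    qed
  qed
qed

end
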